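(* Let $k$ be a commutative artinian ring and let $\mathcal{C}$ be an essentially small $k$-linear Hom-finite Krull--Schmidt exact category, with generalized Auslander--Reiten duality $\{\mathcal{C}_r,\mathcal{C}_l,\phi,\psi,\tau,\tau^-\}$. Let $\xi\colon X\xrightarrow{i}E\xrightarrow{d}Y$ be a conflation in $\mathcal{C}$, with covariant defect $\xi_*$ and contravariant defect $\xi^*$. (1) For any $K\in\mathcal{C}_r$ there exists an isomorphism of $k$-modules $\xi_*(\tau K)\cong D\,\xi^*(K)$, which is natural in both $\xi$ and $K$. (2) For any $K\in\mathcal{C}_l$ there exists an isomorphism of $k$-modules $\xi^*(\tau^-K)\cong D\,\xi_*(K)$, which is natural in both $\xi$ and $K$.
   Context: Setting. $k$ is a commutative artinian ring, $\check{k}$ is its minimal injective cogenerator, $\operatorname{mod}k$ is the category of finitely generated $k$-modules, and $D=\operatorname{Hom}_k(-,\check{k})$. An exact category is an additive category with a class of kernel-cokernel pairs (conflations) $X\xrightarrow{i}Y\xrightarrow{d}Z$ satisfying the usual (Quillen/Keller) axioms; $i$ is called an inflation and $d$ a deflation. $\operatorname{Ext}^1_{\mathcal{C}}(X,Y)$ is the $k$-module of equivalence classes of conflations $Y\to E\to X$. Stable categories. A morphism $f\colon X\to Y$ is projectively trivial if $\operatorname{Ext}^1_{\mathcal{C}}(f,Z)\colon\operatorname{Ext}^1_{\mathcal{C}}(Y,Z)\to\operatorname{Ext}^1_{\mathcal{C}}(X,Z)$ is zero for every $Z$, and injectively trivial if $\operatorname{Ext}^1_{\mathcal{C}}(Z,f)\colon\operatorname{Ext}^1_{\mathcal{C}}(Z,X)\to\operatorname{Ext}^1_{\mathcal{C}}(Z,Y)$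 is zero for every $Z$. These morphisms form ideals $\mathcal{P}$ and $\mathcal{I}$ of $\mathcal{C}$. Put $\underline{\mathcal{C}}=\mathcal{C}/\mathcal{P}$ and $\overline{\mathcal{C}}=\mathcal{C}/\mathcal{I}$, with morphism modules $\underline{\operatorname{Hom}}_{\mathcal{C}}(X,Y)=\operatorname{Hom}_{\mathcal{C}}(X,Y)/\mathcal{P}(X,Y)$ and $\overline{\operatorname{Hom}}_{\mathcal{C}}(X,Y)=\operatorname{Hom}_{\mathcal{C}}(X,Y)/\mathcal{I}(X,Y)$. The bifunctor $\operatorname{Ext}^1_{\mathcal{C}}(-,-)$ factors through $\underline{\mathcal{C}}$ in the first variable and through $\overline{\mathcal{C}}$ in the second. Generalized Auslander--Reiten duality. $\mathcal{C}_r$ is the full subcategory of those $X\in\mathcal{C}$ for which the contravariant functor $D\operatorname{Ext}^1_{\mathcal{C}}(X,-)$ on $\overline{\mathcal{C}}$ is representable, and $\mathcal{C}_l$ is the full subcategory of those $X\in\mathcal{C}$ for which the covariant functor $D\operatorname{Ext}^1_{\mathcal{C}}(-,X)$ on $\underline{\mathcal{C}}$ is representable. Write $\underline{\mathcal{C}_r}$ for the image of $\mathcal{C}_r$ in $\underline{\mathcal{C}}$ and $\overline{\mathcal{C}_l}$ for the image of $\mathcal{C}_l$ in $\overline{\mathcal{C}}$. It is known, and taken as given, that choosing representing objects yields mutually quasi-inverse equivalences $\tau\colon\underline{\mathcal{C}_r}\to\overline{\mathcal{C}_l}$ and $\tau^-\colon\overline{\mathcal{C}_l}\to\underline{\mathcal{C}_r}$,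 together with isomorphisms $\phi_{Y,X}\colon\overline{\operatorname{Hom}}_{\mathcal{C}}(X,\tau Y)\xrightarrow{\sim}D\operatorname{Ext}^1_{\mathcal{C}}(Y,X)$, natural in $X\in\mathcal{C}$ and $Y\in\mathcal{C}_r$, and $\psi_{X,Y}\colon\underline{\operatorname{Hom}}_{\mathcal{C}}(\tau^-X,Y)\xrightarrow{\sim}D\operatorname{Ext}^1_{\mathcal{C}}(Y,X)$, natural in $X\in\mathcal{C}_l$ and $Y\in\mathcal{C}$. Such data are fixed. Defects. For a conflation $\xi\colon X\xrightarrow{i}E\xrightarrow{d}Y$, the functors $\xi_*$ (covariant) and $\xi^*$ (contravariant) are defined by the exact sequences $$0\to\operatorname{Hom}_{\mathcal{C}}(Y,-)\to\operatorname{Hom}_{\mathcal{C}}(E,-)\to\operatorname{Hom}_{\mathcal{C}}(X,-)\to\xi_*\to0,$$ $$0\to\operatorname{Hom}_{\mathcal{C}}(-,X)\to\operatorname{Hom}_{\mathcal{C}}(-,E)\to\operatorname{Hom}_{\mathcal{C}}(-,Y)\to\xi^*\to0.$$ The functor $\xi_*$ vanishes on injectively trivial morphisms and $\xi^*$ vanishes on projectively trivial morphisms, so they induce functors to $\operatorname{mod}k$ on $\overline{\mathcal{C}}$ (covariant) and on $\underline{\mathcal{C}}$ (contravariant), respectively. Naturality in $\xi$ refers to morphisms of conflations; naturality in $K$ refers to morphisms in $\underline{\mathcal{C}_r}$ in (1) and in $\overline{\mathcal{C}_l}$ in (2). *)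

theory Defs
  imports "HOL-Algebra.Module" "HOL-Algebra.Ideal" "HOL-Algebra.AbelCoset"
begin

section \<open>Modules over a commutative artinian ring\<close>

locale artinian_ring = ring +
  assumes descending_chain:
    "\<lbrakk>\<And>n::nat. ideal (I n) R; \<And>n. I (Suc n) \<subseteq> I n\<rbrakk> \<Longrightarrow> \<exists>N. \<forall>n\<ge>N. I n = I N"

definition mod_hom ::
  "('k, 'r) ring_scheme \<Rightarrow> ('k, 'a, 'u) module_scheme \<Rightarrow> ('k, 'b, 'v) module_scheme \<Rightarrow> ('a \<Rightarrow> 'b) set"
  where "mod_hom R M N = {f. f \<in> carrier M \<rightarrow> carrier N \<and>
     (\<forall>x\<in>carrier M. \<forall>y\<in>carrier M. f (x \<oplus>\<^bsub>M\<^esub> y) = f x \<oplus>\<^bsub>N\<^esub> f y) \<and>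
     (\<forall>a\<in>carrier R. \<forall>x\<in>carrier M. f (a \<odot>\<^bsub>M\<^esub> x) = a \<odot>\<^bsub>N\<^esub> f x)}"

definition mod_iso ::
  "('k, 'r) ring_scheme \<Rightarrow> ('k, 'a, 'u) module_scheme \<Rightarrow> ('k, 'b, 'v) module_scheme \<Rightarrow> ('a \<Rightarrow> 'b) set"
  where "mod_iso R M N = {f \<in> mod_hom R M N. bij_betw f (carrier M) (carrier N)}"

definition fin_gen :: "('k, 'r) ring_scheme \<Rightarrow> ('k, 'a, 'u) module_scheme \<Rightarrow> bool"
  where "fin_gen R M \<longleftrightarrow>
    (\<exists>S. finite S \<and> S \<subseteq> carrier M \<and> (\<forall>N. submodule N R M \<and> S \<subseteq> N \<longrightarrow> N = carrier M))"

text \<open>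
  The multiplicative fields of a module record play no role; they are left \<^const>\<open>undefined\<close>
  below.  \<open>quot_map M N g\<close> is the map into \<open>M/N\<close> induced on cosets by \<open>g\<close>.
\<close>

definition quot_map :: "('k, 'b) module \<Rightarrow> 'b set \<Rightarrow> ('a \<Rightarrow> 'b) \<Rightarrow> 'a set \<Rightarrow> 'b set"
  where "quot_map M N g A = (\<Union>x\<in>A. N +>\<^bsub>M\<^esub> g x)"

definition quot_mod :: "('k, 'a) module \<Rightarrow> 'a set \<Rightarrow> ('k, 'a set) module"
  where "quot_mod M N =
    \<lparr>carrier = a_rcosets\<^bsub>M\<^esub> N, mult = undefined, one = undefined, zero = N,
     add = set_add M, smult = \<lambda>a. quot_map M N (\<lambda>x. a \<odot>\<^bsub>M\<^esub> x)\<rparr>"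

text \<open>
  HOL cannot quantify over all modules of all types.  The test modules below have elements of type
  \<open>(nat \<Rightarrow> 'k) set\<close>: every finitely generated \<open>R\<close>-module is isomorphic to a quotient of some free
  module of finite rank and hence has a copy of this type.  By Baer's criterion this is enough for
  injectivity; for injective \<open>J\<close> it is enough for cogeneration too, since a homomorphism that is
  nonzero at a given element extends from the cyclic submodule that the element generates.
\<close>

definition injective_module :: "('k, 'r) ring_scheme \<Rightarrow> ('k, 'j) module \<Rightarrow> bool"
  where "injective_module R J \<longleftrightarrow> module R J \<and>
    (\<forall>(B :: ('k, (nat \<Rightarrow> 'k) set) module) A.
       module R B \<and> submodule A R B \<longrightarrow>
       (\<forall>f \<in> mod_hom R (B\<lparr>carrier := A\<rparr>) J. \<exists>g \<in> mod_hom R B J. \<forall>x\<in>A. g x = f x))"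

definition cogenerator :: "('k, 'r) ring_scheme \<Rightarrow> ('k, 'j) module \<Rightarrow> bool"
  where "cogenerator R J \<longleftrightarrow> module R J \<and>
    (\<forall>B :: ('k, (nat \<Rightarrow> 'k) set) module. module R B \<longrightarrow>
       (\<forall>x \<in> carrier B. x \<noteq> \<zero>\<^bsub>B\<^esub> \<longrightarrow> (\<exists>f \<in> mod_hom R B J. f x \<noteq> \<zero>\<^bsub>J\<^esub>)))"

definition minimal_injective_cogenerator :: "('k, 'r) ring_scheme \<Rightarrow> ('k, 'j) module \<Rightarrow> bool"
  where "minimal_injective_cogenerator R J \<longleftrightarrow>
    injective_module R J \<and> cogenerator R J \<and>
    (\<forall>N. submodule N R J \<and> injective_module R (J\<lparr>carrier := N\<rparr>) \<and> cogenerator R (J\<lparr>carrier := N\<rparr>)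
         \<longrightarrow> N = carrier J)"

text \<open>\<open>D M = Hom\<^sub>R(M, J)\<close>; its elements are normalised to be undefined outside \<open>M\<close>.\<close>

definition dual :: "('k, 'r) ring_scheme \<Rightarrow> ('k, 'j) module \<Rightarrow> ('k, 'a) module \<Rightarrow> ('k, 'a \<Rightarrow> 'j) module"
  where "dual R J M =
    \<lparr>carrier = mod_hom R M J \<inter> extensional (carrier M), mult = undefined, one = undefined,
     zero = (\<lambda>x\<in>carrier M. \<zero>\<^bsub>J\<^esub>),
     add = (\<lambda>u v. \<lambda>x\<in>carrier M. u x \<oplus>\<^bsub>J\<^esub> v x),
     smult = (\<lambda>a u. \<lambda>x\<in>carrier M. a \<odot>\<^bsub>J\<^esub> u x)\<rparr>"

text \<open>\<open>dual_map M f : D N \<rightarrow> D M\<close> is precomposition with \<open>f : M \<rightarrow> N\<close>.\<close>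

definition dual_map :: "('k, 'a) module \<Rightarrow> ('a \<Rightarrow> 'b) \<Rightarrow> ('b \<Rightarrow> 'j) \<Rightarrow> ('a \<Rightarrow> 'j)"
  where "dual_map M f u = (\<lambda>x\<in>carrier M. u (f x))"


section \<open>Linear categories\<close>

text \<open>
  Morphism sets of different pairs of objects need not be disjoint, so composition is indexed by
  the objects: \<open>Cmp C X Y Z g f\<close> is the composite of \<open>f : X \<rightarrow> Y\<close> and \<open>g : Y \<rightarrow> Z\<close>.
\<close>

record ('o, 'm, 'k) kcat =
  Ob :: "'o set"
  Hom :: "'o \<Rightarrow> 'o \<Rightarrow> ('k, 'm) module"
  Idm :: "'o \<Rightarrow> 'm"
  Cmp :: "'o \<Rightarrow> 'o \<Rightarrow> 'o \<Rightarrow> 'm \<Rightarrow> 'm \<Rightarrow> 'm"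

abbreviation Mor :: "('o, 'm, 'k, 'z) kcat_scheme \<Rightarrow> 'o \<Rightarrow> 'o \<Rightarrow> 'm set"
  where "Mor C X Y \<equiv> carrier (Hom C X Y)"

locale linear_category = R?: cring R
  for R (structure) and C :: "('o, 'm, 'k, 'z) kcat_scheme" +
  assumes Hom_module: "\<lbrakk>X \<in> Ob C; Y \<in> Ob C\<rbrakk> \<Longrightarrow> module R (Hom C X Y)"
    and Idm_closed: "X \<in> Ob C \<Longrightarrow> Idm C X \<in> Mor C X X"
    and Cmp_closed: "\<lbrakk>X \<in> Ob C; Y \<in> Ob C; Z \<in> Ob C; f \<in> Mor C X Y; g \<in> Mor C Y Z\<rbrakk>
        \<Longrightarrow> Cmp C X Y Z g f \<in> Mor C X Z"
    and Cmp_Idm: "\<lbrakk>X \<in> Ob C; Y \<in> Ob C; f \<in> Mor C X Y\<rbrakk> \<Longrightarrow> Cmp C X X Y f (Idm C X) = f"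
    and Idm_Cmp: "\<lbrakk>X \<in> Ob C; Y \<in> Ob C; f \<in> Mor C X Y\<rbrakk> \<Longrightarrow> Cmp C X Y Y (Idm C Y) f = f"
    and Cmp_assoc: "\<lbrakk>W \<in> Ob C; X \<in> Ob C; Y \<in> Ob C; Z \<in> Ob C;
          f \<in> Mor C W X; g \<in> Mor C X Y; h \<in> Mor C Y Z\<rbrakk>
        \<Longrightarrow> Cmp C W X Z (Cmp C X Y Z h g) f = Cmp C W Y Z h (Cmp C W X Y g f)"
    and Cmp_linear_left: "\<lbrakk>X \<in> Ob C; Y \<in> Ob C; Z \<in> Ob C; f \<in> Mor C X Y\<rbrakk>
        \<Longrightarrow> (\<lambda>g. Cmp C X Y Z g f) \<in> mod_hom R (Hom C Y Z) (Hom C X Z)"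
    and Cmp_linear_right: "\<lbrakk>X \<in> Ob C; Y \<in> Ob C; Z \<in> Ob C; g \<in> Mor C Y Z\<rbrakk>
        \<Longrightarrow> (\<lambda>f. Cmp C X Y Z g f) \<in> mod_hom R (Hom C X Y) (Hom C X Z)"

definition is_iso :: "('o, 'm, 'k, 'z) kcat_scheme \<Rightarrow> 'o \<Rightarrow> 'o \<Rightarrow> 'm \<Rightarrow> bool"
  where "is_iso C X Y f \<longleftrightarrow> f \<in> Mor C X Y \<and>
    (\<exists>g \<in> Mor C Y X. Cmp C X Y X g f = Idm C X \<and> Cmp C Y X Y f g = Idm C Y)"

definition direct_sum ::
  "('o, 'm, 'k, 'z) kcat_scheme \<Rightarrow> 'o list \<Rightarrow> 'o \<Rightarrow> (nat \<Rightarrow> 'm) \<Rightarrow> (nat \<Rightarrow> 'm) \<Rightarrow> bool"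
  where "direct_sum C Xs S \<iota> \<pi> \<longleftrightarrow> set Xs \<subseteq> Ob C \<and> S \<in> Ob C \<and>
    (\<forall>j<length Xs. \<iota> j \<in> Mor C (Xs ! j) S \<and> \<pi> j \<in> Mor C S (Xs ! j)) \<and>
    (\<forall>i<length Xs. \<forall>j<length Xs. Cmp C (Xs ! j) S (Xs ! i) (\<pi> i) (\<iota> j) =
        (if i = j then Idm C (Xs ! j) else \<zero>\<^bsub>Hom C (Xs ! j) (Xs ! i)\<^esub>)) \<and>
    finsum (Hom C S S) (\<lambda>j. Cmp C S (Xs ! j) S (\<iota> j) (\<pi> j)) {..<length Xs} = Idm C S"

text \<open>The empty list yields a zero object.\<close>

locale additive_category = linear_category +
  assumes direct_sums: "set Xs \<subseteq> Ob C \<Longrightarrow> \<exists>S \<iota> \<pi>. direct_sum C Xs S \<iota> \<pi>"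

definition hom_finite :: "('k, 'r) ring_scheme \<Rightarrow> ('o, 'm, 'k, 'z) kcat_scheme \<Rightarrow> bool"
  where "hom_finite R C \<longleftrightarrow> (\<forall>X\<in>Ob C. \<forall>Y\<in>Ob C. fin_gen R (Hom C X Y))"

definition End_ring :: "('o, 'm, 'k, 'z) kcat_scheme \<Rightarrow> 'o \<Rightarrow> 'm ring"
  where "End_ring C X =
    \<lparr>carrier = Mor C X X, mult = Cmp C X X X, one = Idm C X,
     zero = \<zero>\<^bsub>Hom C X X\<^esub>, add = add (Hom C X X)\<rparr>"

text \<open>Not necessarily commutative local rings: nonzero, and the nonunits are closed under addition.\<close>

definition local_ring :: "('a, 'r) ring_scheme \<Rightarrow> bool"
  where "local_ring A \<longleftrightarrow> ring A \<and> \<one>\<^bsub>A\<^esub> \<noteq> \<zero>\<^bsub>A\<^esub> \<and>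
    (\<forall>a \<in> carrier A - Units A. \<forall>b \<in> carrier A - Units A. a \<oplus>\<^bsub>A\<^esub> b \<notin> Units A)"

definition krull_schmidt :: "('o, 'm, 'k, 'z) kcat_scheme \<Rightarrow> bool"
  where "krull_schmidt C \<longleftrightarrow> (\<forall>X\<in>Ob C. \<exists>Xs \<iota> \<pi>.
    direct_sum C Xs X \<iota> \<pi> \<and> (\<forall>Y\<in>set Xs. local_ring (End_ring C Y)))"


section \<open>Exact categories\<close>

record ('o, 'm) ses =
  lft :: 'o
  mid :: 'o
  rgt :: 'o
  infl :: 'm
  defl :: 'm

record ('o, 'm, 'k) excat = "('o, 'm, 'k) kcat" +
  Conf :: "('o, 'm) ses set"

definition ses_in :: "('o, 'm, 'k, 'z) kcat_scheme \<Rightarrow> ('o, 'm) ses \<Rightarrow> bool"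
  where "ses_in C \<xi> \<longleftrightarrow> lft \<xi> \<in> Ob C \<and> mid \<xi> \<in> Ob C \<and> rgt \<xi> \<in> Ob C \<and>
    infl \<xi> \<in> Mor C (lft \<xi>) (mid \<xi>) \<and> defl \<xi> \<in> Mor C (mid \<xi>) (rgt \<xi>)"

definition is_kernel :: "('o, 'm, 'k, 'z) kcat_scheme \<Rightarrow> 'o \<Rightarrow> 'o \<Rightarrow> 'o \<Rightarrow> 'm \<Rightarrow> 'm \<Rightarrow> bool"
  where "is_kernel C X E Y i d \<longleftrightarrow> Cmp C X E Y d i = \<zero>\<^bsub>Hom C X Y\<^esub> \<and>
    (\<forall>W\<in>Ob C. \<forall>f \<in> Mor C W E. Cmp C W E Y d f = \<zero>\<^bsub>Hom C W Y\<^esub> \<longrightarrow>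
       (\<exists>!g. g \<in> Mor C W X \<and> Cmp C W X E i g = f))"

definition is_cokernel :: "('o, 'm, 'k, 'z) kcat_scheme \<Rightarrow> 'o \<Rightarrow> 'o \<Rightarrow> 'o \<Rightarrow> 'm \<Rightarrow> 'm \<Rightarrow> bool"
  where "is_cokernel C X E Y i d \<longleftrightarrow> Cmp C X E Y d i = \<zero>\<^bsub>Hom C X Y\<^esub> \<and>
    (\<forall>W\<in>Ob C. \<forall>f \<in> Mor C E W. Cmp C X E W f i = \<zero>\<^bsub>Hom C X W\<^esub> \<longrightarrow>
       (\<exists>!g. g \<in> Mor C Y W \<and> Cmp C E Y W g d = f))"

definition ses_mor ::
  "('o, 'm, 'k, 'z) kcat_scheme \<Rightarrow> ('o, 'm) ses \<Rightarrow> ('o, 'm) ses \<Rightarrow> 'm \<Rightarrow> 'm \<Rightarrow> 'm \<Rightarrow> bool"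
  where "ses_mor C \<xi> \<xi>' a b c \<longleftrightarrow>
    a \<in> Mor C (lft \<xi>) (lft \<xi>') \<and> b \<in> Mor C (mid \<xi>) (mid \<xi>') \<and> c \<in> Mor C (rgt \<xi>) (rgt \<xi>') \<and>
    Cmp C (lft \<xi>) (mid \<xi>) (mid \<xi>') b (infl \<xi>) = Cmp C (lft \<xi>) (lft \<xi>') (mid \<xi>') (infl \<xi>') a \<and>
    Cmp C (mid \<xi>) (rgt \<xi>) (rgt \<xi>') c (defl \<xi>) = Cmp C (mid \<xi>) (mid \<xi>') (rgt \<xi>') (defl \<xi>') b"

text \<open>\<open>p : P \<rightarrow> A\<close>, \<open>q : P \<rightarrow> B\<close> is a pullback of \<open>f : A \<rightarrow> Z\<close>, \<open>g : B \<rightarrow> Z\<close>.\<close>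

definition is_pullback ::
  "('o, 'm, 'k, 'z) kcat_scheme \<Rightarrow> 'o \<Rightarrow> 'o \<Rightarrow> 'o \<Rightarrow> 'o \<Rightarrow> 'm \<Rightarrow> 'm \<Rightarrow> 'm \<Rightarrow> 'm \<Rightarrow> bool"
  where "is_pullback C P A B Z p q f g \<longleftrightarrow> P \<in> Ob C \<and> p \<in> Mor C P A \<and> q \<in> Mor C P B \<and>
    Cmp C P A Z f p = Cmp C P B Z g q \<and>
    (\<forall>W\<in>Ob C. \<forall>u \<in> Mor C W A. \<forall>v \<in> Mor C W B. Cmp C W A Z f u = Cmp C W B Z g v \<longrightarrow>
       (\<exists>!w. w \<in> Mor C W P \<and> Cmp C W P A p w = u \<and> Cmp C W P B q w = v))"

text \<open>\<open>p : A \<rightarrow> P\<close>, \<open>q : B \<rightarrow> P\<close> is a pushout of \<open>f : Z \<rightarrow> A\<close>, \<open>g : Z \<rightarrow> B\<close>.\<close>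

definition is_pushout ::
  "('o, 'm, 'k, 'z) kcat_scheme \<Rightarrow> 'o \<Rightarrow> 'o \<Rightarrow> 'o \<Rightarrow> 'o \<Rightarrow> 'm \<Rightarrow> 'm \<Rightarrow> 'm \<Rightarrow> 'm \<Rightarrow> bool"
  where "is_pushout C P A B Z p q f g \<longleftrightarrow> P \<in> Ob C \<and> p \<in> Mor C A P \<and> q \<in> Mor C B P \<and>
    Cmp C Z A P p f = Cmp C Z B P q g \<and>
    (\<forall>W\<in>Ob C. \<forall>u \<in> Mor C A W. \<forall>v \<in> Mor C B W. Cmp C Z A W u f = Cmp C Z B W v g \<longrightarrow>
       (\<exists>!w. w \<in> Mor C P W \<and> Cmp C A P W w p = u \<and> Cmp C B P W w q = v))"

definition inflation :: "('o, 'm, 'k, 'z) excat_scheme \<Rightarrow> 'o \<Rightarrow> 'o \<Rightarrow> 'm \<Rightarrow> bool"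
  where "inflation C X E i \<longleftrightarrow> (\<exists>\<xi>\<in>Conf C. lft \<xi> = X \<and> mid \<xi> = E \<and> infl \<xi> = i)"

definition deflation :: "('o, 'm, 'k, 'z) excat_scheme \<Rightarrow> 'o \<Rightarrow> 'o \<Rightarrow> 'm \<Rightarrow> bool"
  where "deflation C E Y d \<longleftrightarrow> (\<exists>\<xi>\<in>Conf C. mid \<xi> = E \<and> rgt \<xi> = Y \<and> defl \<xi> = d)"

locale exact_category = additive_category R C
  for R (structure) and C :: "('o, 'm, 'k, 'z) excat_scheme" +
  assumes conf_ses: "\<xi> \<in> Conf C \<Longrightarrow> ses_in C \<xi>"
    and conf_kernel: "\<xi> \<in> Conf C \<Longrightarrow> is_kernel C (lft \<xi>) (mid \<xi>) (rgt \<xi>) (infl \<xi>) (defl \<xi>)"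
    and conf_cokernel: "\<xi> \<in> Conf C \<Longrightarrow> is_cokernel C (lft \<xi>) (mid \<xi>) (rgt \<xi>) (infl \<xi>) (defl \<xi>)"
    and conf_iso: "\<lbrakk>\<xi> \<in> Conf C; ses_in C \<xi>'; ses_mor C \<xi> \<xi>' a b c;
          is_iso C (lft \<xi>) (lft \<xi>') a; is_iso C (mid \<xi>) (mid \<xi>') b; is_iso C (rgt \<xi>) (rgt \<xi>') c\<rbrakk>
        \<Longrightarrow> \<xi>' \<in> Conf C"
    and inflation_Idm: "X \<in> Ob C \<Longrightarrow> inflation C X X (Idm C X)"
    and deflation_Idm: "X \<in> Ob C \<Longrightarrow> deflation C X X (Idm C X)"
    and inflation_Cmp: "\<lbrakk>inflation C X Y i; inflation C Y Z j\<rbrakk> \<Longrightarrow> inflation C X Z (Cmp C X Y Z j i)"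
    and deflation_Cmp: "\<lbrakk>deflation C X Y d; deflation C Y Z e\<rbrakk> \<Longrightarrow> deflation C X Z (Cmp C X Y Z e d)"
    and inflation_pushout: "\<lbrakk>inflation C X E i; X' \<in> Ob C; f \<in> Mor C X X'\<rbrakk>
        \<Longrightarrow> \<exists>P p q. is_pushout C P E X' X p q i f \<and> inflation C X' P q"
    and deflation_pullback: "\<lbrakk>deflation C E Y d; Y' \<in> Ob C; f \<in> Mor C Y' Y\<rbrakk>
        \<Longrightarrow> \<exists>P p q. is_pullback C P E Y' Y p q d f \<and> deflation C P Y' q"


section \<open>Extension modules\<close>

definition ext_class :: "('o, 'm, 'k, 'z) excat_scheme \<Rightarrow> ('o, 'm) ses \<Rightarrow> ('o, 'm) ses set"
  where "ext_class C \<xi> = {\<eta> \<in> Conf C. lft \<eta> = lft \<xi> \<and> rgt \<eta> = rgt \<xi> \<and>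
    (\<exists>h. is_iso C (mid \<xi>) (mid \<eta>) h \<and>
         ses_mor C \<xi> \<eta> (Idm C (lft \<xi>)) h (Idm C (rgt \<xi>)))}"

text \<open>
  As in Mac Lane's \<^emph>\<open>Homology\<close>, the pullback of the class \<open>c\<close> of an extension of \<open>Y\<close> by \<open>Z\<close> along
  \<open>f : X \<rightarrow> Y\<close> consists of the conflations that admit a morphism \<open>(1, h, f)\<close> to a member of \<open>c\<close>;
  dually for the pushout of the class of an extension of \<open>X\<close> by \<open>Y\<close> along \<open>g : Y \<rightarrow> Y'\<close>.
  In an exact category such a morphism exhibits a pullback (pushout) square.
\<close>

definition Ext_pull ::
  "('o, 'm, 'k, 'z) excat_scheme \<Rightarrow> 'o \<Rightarrow> 'o \<Rightarrow> 'o \<Rightarrow> 'm \<Rightarrow> ('o, 'm) ses set \<Rightarrow> ('o, 'm) ses set"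
  where "Ext_pull C Z X Y f c = {\<eta> \<in> Conf C. lft \<eta> = Z \<and> rgt \<eta> = X \<and>
    (\<exists>\<xi>\<in>c. \<exists>h. ses_mor C \<eta> \<xi> (Idm C Z) h f)}"

definition Ext_push ::
  "('o, 'm, 'k, 'z) excat_scheme \<Rightarrow> 'o \<Rightarrow> 'o \<Rightarrow> 'o \<Rightarrow> 'm \<Rightarrow> ('o, 'm) ses set \<Rightarrow> ('o, 'm) ses set"
  where "Ext_push C X Y Y' g c = {\<eta> \<in> Conf C. lft \<eta> = Y' \<and> rgt \<eta> = X \<and>
    (\<exists>\<xi>\<in>c. \<exists>h. ses_mor C \<xi> \<eta> g h (Idm C X))}"

definition ses_sum ::
  "('o, 'm, 'k, 'z) kcat_scheme \<Rightarrow> ('o, 'm) ses \<Rightarrow> ('o, 'm) ses \<Rightarrow>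
   'o \<Rightarrow> (nat \<Rightarrow> 'm) \<Rightarrow> 'o \<Rightarrow> (nat \<Rightarrow> 'm) \<Rightarrow> (nat \<Rightarrow> 'm) \<Rightarrow> 'o \<Rightarrow> (nat \<Rightarrow> 'm) \<Rightarrow> ('o, 'm) ses"
  where "ses_sum C \<xi> \<xi>' A \<pi>A B \<iota>B \<pi>B P \<iota>P =
    \<lparr>lft = A, mid = B, rgt = P,
     infl = Cmp C A (mid \<xi>) B (\<iota>B 0) (Cmp C A (lft \<xi>) (mid \<xi>) (infl \<xi>) (\<pi>A 0))
       \<oplus>\<^bsub>Hom C A B\<^esub> Cmp C A (mid \<xi>') B (\<iota>B 1) (Cmp C A (lft \<xi>') (mid \<xi>') (infl \<xi>') (\<pi>A 1)),
     defl = Cmp C B (rgt \<xi>) P (\<iota>P 0) (Cmp C B (mid \<xi>) (rgt \<xi>) (defl \<xi>) (\<pi>B 0))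
       \<oplus>\<^bsub>Hom C B P\<^esub> Cmp C B (rgt \<xi>') P (\<iota>P 1) (Cmp C B (mid \<xi>') (rgt \<xi>') (defl \<xi>') (\<pi>B 1))\<rparr>"

text \<open>
  Baer sum \<open>\<nabla>(\<xi> \<oplus> \<xi>')\<Delta>\<close> of classes of extensions of \<open>X\<close> by \<open>Y\<close>, for any choice of the
  direct sums \<open>A = Y \<oplus> Y\<close>, \<open>B = mid \<xi> \<oplus> mid \<xi>'\<close>, \<open>P = X \<oplus> X\<close>; the codiagonal of \<open>Y\<close> is the sum
  of the two projections of \<open>A\<close>, the diagonal of \<open>X\<close> the sum of the two injections into \<open>P\<close>.
\<close>

definition Baer_sum ::
  "('o, 'm, 'k, 'z) excat_scheme \<Rightarrow> 'o \<Rightarrow> 'o \<Rightarrow> ('o, 'm) ses set \<Rightarrow> ('o, 'm) ses set \<Rightarrow> ('o, 'm) ses set"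
  where "Baer_sum C X Y c c' = {\<eta>. \<exists>\<xi>\<in>c. \<exists>\<xi>'\<in>c'. \<exists>A \<iota>A \<pi>A B \<iota>B \<pi>B P \<iota>P \<pi>P.
    direct_sum C [Y, Y] A \<iota>A \<pi>A \<and>
    direct_sum C [mid \<xi>, mid \<xi>'] B \<iota>B \<pi>B \<and>
    direct_sum C [X, X] P \<iota>P \<pi>P \<and>
    \<eta> \<in> Ext_push C X A Y (\<pi>A 0 \<oplus>\<^bsub>Hom C A Y\<^esub> \<pi>A 1)
          (Ext_pull C A X P (\<iota>P 0 \<oplus>\<^bsub>Hom C X P\<^esub> \<iota>P 1)
            (ext_class C (ses_sum C \<xi> \<xi>' A \<pi>A B \<iota>B \<pi>B P \<iota>P)))}"

text \<open>
  \<open>Ext C X Y\<close> consists of classes of conflations from \<open>Y\<close> to \<open>X\<close>; its zero is the class of the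
  split ones, and scalars act by pushout along multiples of the identity of \<open>Y\<close>.
\<close>

definition Ext :: "('o, 'm, 'k, 'z) excat_scheme \<Rightarrow> 'o \<Rightarrow> 'o \<Rightarrow> ('k, ('o, 'm) ses set) module"
  where "Ext C X Y =
    \<lparr>carrier = {ext_class C \<xi> | \<xi>. \<xi> \<in> Conf C \<and> lft \<xi> = Y \<and> rgt \<xi> = X},
     mult = undefined, one = undefined,
     zero = {\<eta> \<in> Conf C. lft \<eta> = Y \<and> rgt \<eta> = X \<and>
       (\<exists>s \<in> Mor C X (mid \<eta>). Cmp C X (mid \<eta>) X (defl \<eta>) s = Idm C X)},
     add = Baer_sum C X Y,
     smult = \<lambda>a. Ext_push C X Y Y (a \<odot>\<^bsub>Hom C Y Y\<^esub> Idm C Y)\<rparr>"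


section \<open>Stable categories\<close>

definition proj_trivial :: "('o, 'm, 'k, 'z) excat_scheme \<Rightarrow> 'o \<Rightarrow> 'o \<Rightarrow> 'm set"
  where "proj_trivial C X Y = {f \<in> Mor C X Y.
    \<forall>Z\<in>Ob C. \<forall>c \<in> carrier (Ext C Y Z). Ext_pull C Z X Y f c = \<zero>\<^bsub>Ext C X Z\<^esub>}"

definition inj_trivial :: "('o, 'm, 'k, 'z) excat_scheme \<Rightarrow> 'o \<Rightarrow> 'o \<Rightarrow> 'm set"
  where "inj_trivial C X Y = {f \<in> Mor C X Y.
    \<forall>Z\<in>Ob C. \<forall>c \<in> carrier (Ext C Z X). Ext_push C Z X Y f c = \<zero>\<^bsub>Ext C Z Y\<^esub>}"

definition quot_cat ::
  "('o, 'm, 'k, 'z) kcat_scheme \<Rightarrow> ('o \<Rightarrow> 'o \<Rightarrow> 'm set) \<Rightarrow> ('o, 'm set, 'k) kcat"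
  where "quot_cat C I =
    \<lparr>Ob = Ob C, Hom = \<lambda>X Y. quot_mod (Hom C X Y) (I X Y),
     Idm = \<lambda>X. I X X +>\<^bsub>Hom C X X\<^esub> Idm C X,
     Cmp = \<lambda>X Y Z G F. \<Union>g\<in>G. quot_map (Hom C X Z) (I X Z) (Cmp C X Y Z g) F\<rparr>"

definition lower_stable :: "('o, 'm, 'k, 'z) excat_scheme \<Rightarrow> ('o, 'm set, 'k) kcat"
  where "lower_stable C = quot_cat C (proj_trivial C)"

definition upper_stable :: "('o, 'm, 'k, 'z) excat_scheme \<Rightarrow> ('o, 'm set, 'k) kcat"
  where "upper_stable C = quot_cat C (inj_trivial C)"

definition full_subcat :: "('o, 'm, 'k) kcat \<Rightarrow> 'o set \<Rightarrow> ('o, 'm, 'k) kcat"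
  where "full_subcat C S = C\<lparr>Ob := S\<rparr>"


section \<open>Functors\<close>

record ('o, 'm, 'p, 'n) cfun =
  FOb :: "'o \<Rightarrow> 'p"
  FMor :: "'o \<Rightarrow> 'o \<Rightarrow> 'm \<Rightarrow> 'n"

definition is_cfun ::
  "('o, 'm, 'k, 'y) kcat_scheme \<Rightarrow> ('p, 'n, 'k, 'z) kcat_scheme \<Rightarrow> ('o, 'm, 'p, 'n) cfun \<Rightarrow> bool"
  where "is_cfun A B F \<longleftrightarrow>
    (\<forall>X\<in>Ob A. FOb F X \<in> Ob B \<and> FMor F X X (Idm A X) = Idm B (FOb F X)) \<and>
    (\<forall>X\<in>Ob A. \<forall>Y\<in>Ob A. \<forall>f \<in> Mor A X Y. FMor F X Y f \<in> Mor B (FOb F X) (FOb F Y)) \<and>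
    (\<forall>X\<in>Ob A. \<forall>Y\<in>Ob A. \<forall>Z\<in>Ob A. \<forall>f \<in> Mor A X Y. \<forall>g \<in> Mor A Y Z.
       FMor F X Z (Cmp A X Y Z g f) =
       Cmp B (FOb F X) (FOb F Y) (FOb F Z) (FMor F Y Z g) (FMor F X Y f))"

definition id_cfun :: "('o, 'm, 'o, 'm) cfun"
  where "id_cfun = \<lparr>FOb = \<lambda>X. X, FMor = \<lambda>X Y f. f\<rparr>"

definition comp_cfun ::
  "('p, 'n, 'q, 'l) cfun \<Rightarrow> ('o, 'm, 'p, 'n) cfun \<Rightarrow> ('o, 'm, 'q, 'l) cfun"
  where "comp_cfun G F =
    \<lparr>FOb = \<lambda>X. FOb G (FOb F X), FMor = \<lambda>X Y f. FMor G (FOb F X) (FOb F Y) (FMor F X Y f)\<rparr>"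

definition cfun_isomorphic ::
  "('o, 'm, 'k, 'y) kcat_scheme \<Rightarrow> ('p, 'n, 'k, 'z) kcat_scheme \<Rightarrow>
   ('o, 'm, 'p, 'n) cfun \<Rightarrow> ('o, 'm, 'p, 'n) cfun \<Rightarrow> bool"
  where "cfun_isomorphic A B F G \<longleftrightarrow> (\<exists>\<eta>.
    (\<forall>X\<in>Ob A. is_iso B (FOb F X) (FOb G X) (\<eta> X)) \<and>
    (\<forall>X\<in>Ob A. \<forall>Y\<in>Ob A. \<forall>f \<in> Mor A X Y.
       Cmp B (FOb F X) (FOb F Y) (FOb G Y) (\<eta> Y) (FMor F X Y f) =
       Cmp B (FOb F X) (FOb G X) (FOb G Y) (FMor G X Y f) (\<eta> X)))"

definition quasi_inverse ::
  "('o, 'm, 'k, 'y) kcat_scheme \<Rightarrow> ('p, 'n, 'k, 'z) kcat_scheme \<Rightarrow>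
   ('o, 'm, 'p, 'n) cfun \<Rightarrow> ('p, 'n, 'o, 'm) cfun \<Rightarrow> bool"
  where "quasi_inverse A B F G \<longleftrightarrow> is_cfun A B F \<and> is_cfun B A G \<and>
    cfun_isomorphic A A id_cfun (comp_cfun G F) \<and> cfun_isomorphic B B id_cfun (comp_cfun F G)"

text \<open>
  Module-valued functors.  For \<open>f : X \<rightarrow> Y\<close>, \<open>MMor F X Y f\<close> maps \<open>MOb F X\<close> to \<open>MOb F Y\<close> if \<open>F\<close>
  is covariant and \<open>MOb F Y\<close> to \<open>MOb F X\<close> if \<open>F\<close> is contravariant.
\<close>

record ('o, 'm, 'k, 'a) mfun =
  MOb :: "'o \<Rightarrow> ('k, 'a) module"
  MMor :: "'o \<Rightarrow> 'o \<Rightarrow> 'm \<Rightarrow> 'a \<Rightarrow> 'a"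

definition cov_natiso ::
  "('k, 'r) ring_scheme \<Rightarrow> ('o, 'm, 'k, 'z) kcat_scheme \<Rightarrow>
   ('o, 'm, 'k, 'a) mfun \<Rightarrow> ('o, 'm, 'k, 'b) mfun \<Rightarrow> ('o \<Rightarrow> 'a \<Rightarrow> 'b) \<Rightarrow> bool"
  where "cov_natiso R C F G \<theta> \<longleftrightarrow>
    (\<forall>X\<in>Ob C. \<theta> X \<in> mod_iso R (MOb F X) (MOb G X)) \<and>
    (\<forall>X\<in>Ob C. \<forall>Y\<in>Ob C. \<forall>f \<in> Mor C X Y. \<forall>x \<in> carrier (MOb F X).
       \<theta> Y (MMor F X Y f x) = MMor G X Y f (\<theta> X x))"

definition contra_natiso ::
  "('k, 'r) ring_scheme \<Rightarrow> ('o, 'm, 'k, 'z) kcat_scheme \<Rightarrow>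
   ('o, 'm, 'k, 'a) mfun \<Rightarrow> ('o, 'm, 'k, 'b) mfun \<Rightarrow> ('o \<Rightarrow> 'a \<Rightarrow> 'b) \<Rightarrow> bool"
  where "contra_natiso R C F G \<theta> \<longleftrightarrow>
    (\<forall>X\<in>Ob C. \<theta> X \<in> mod_iso R (MOb F X) (MOb G X)) \<and>
    (\<forall>X\<in>Ob C. \<forall>Y\<in>Ob C. \<forall>f \<in> Mor C X Y. \<forall>y \<in> carrier (MOb F Y).
       \<theta> X (MMor F X Y f y) = MMor G X Y f (\<theta> Y y))"

definition hom_cov :: "('o, 'm, 'k, 'z) kcat_scheme \<Rightarrow> 'o \<Rightarrow> ('o, 'm, 'k, 'm) mfun"
  where "hom_cov C T = \<lparr>MOb = \<lambda>X. Hom C T X, MMor = \<lambda>X Y f g. Cmp C T X Y f g\<rparr>"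

definition hom_contra :: "('o, 'm, 'k, 'z) kcat_scheme \<Rightarrow> 'o \<Rightarrow> ('o, 'm, 'k, 'm) mfun"
  where "hom_contra C T = \<lparr>MOb = \<lambda>X. Hom C X T, MMor = \<lambda>X Y f g. Cmp C X Y T g f\<rparr>"

definition ext_cov :: "('o, 'm, 'k, 'z) excat_scheme \<Rightarrow> 'o \<Rightarrow> ('o, 'm, 'k, ('o, 'm) ses set) mfun"
  where "ext_cov C X = \<lparr>MOb = \<lambda>Y. Ext C X Y, MMor = \<lambda>Y Y' g. Ext_push C X Y Y' g\<rparr>"

definition ext_contra :: "('o, 'm, 'k, 'z) excat_scheme \<Rightarrow> 'o \<Rightarrow> ('o, 'm, 'k, ('o, 'm) ses set) mfun"
  where "ext_contra C Z = \<lparr>MOb = \<lambda>X. Ext C X Z, MMor = \<lambda>X Y f. Ext_pull C Z X Y f\<rparr>"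

text \<open>\<open>D \<circ> F\<close> for covariant, respectively contravariant, \<open>F\<close>.\<close>

definition dual_cov ::
  "('k, 'r) ring_scheme \<Rightarrow> ('k, 'j) module \<Rightarrow> ('o, 'm, 'k, 'a) mfun \<Rightarrow> ('o, 'm, 'k, 'a \<Rightarrow> 'j) mfun"
  where "dual_cov R J F =
    \<lparr>MOb = \<lambda>X. dual R J (MOb F X), MMor = \<lambda>X Y f. dual_map (MOb F X) (MMor F X Y f)\<rparr>"

definition dual_contra ::
  "('k, 'r) ring_scheme \<Rightarrow> ('k, 'j) module \<Rightarrow> ('o, 'm, 'k, 'a) mfun \<Rightarrow> ('o, 'm, 'k, 'a \<Rightarrow> 'j) mfun"
  where "dual_contra R J F =
    \<lparr>MOb = \<lambda>X. dual R J (MOb F X), MMor = \<lambda>X Y f. dual_map (MOb F Y) (MMor F X Y f)\<rparr>"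

text \<open>
  The functor induced on a quotient category: a coset acts through any of its elements.  It is
  applied only to functors that vanish on the ideal, where the choice does not matter.
\<close>

definition induced :: "('o, 'm, 'k, 'a) mfun \<Rightarrow> ('o, 'm set, 'k, 'a) mfun"
  where "induced F = \<lparr>MOb = MOb F, MMor = \<lambda>X Y G. MMor F X Y (SOME g. g \<in> G)\<rparr>"


section \<open>Generalized Auslander--Reiten duality\<close>

definition Cr ::
  "('k, 'r) ring_scheme \<Rightarrow> ('k, 'j) module \<Rightarrow> ('o, 'm, 'k, 'z) excat_scheme \<Rightarrow> 'o set"
  where "Cr R J C = {X \<in> Ob C. \<exists>T \<in> Ob C. \<exists>\<theta>.
    contra_natiso R (upper_stable C)
      (hom_contra (upper_stable C) T) (induced (dual_cov R J (ext_cov C X))) \<theta>}"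

definition Cl ::
  "('k, 'r) ring_scheme \<Rightarrow> ('k, 'j) module \<Rightarrow> ('o, 'm, 'k, 'z) excat_scheme \<Rightarrow> 'o set"
  where "Cl R J C = {X \<in> Ob C. \<exists>T \<in> Ob C. \<exists>\<theta>.
    cov_natiso R (lower_stable C)
      (hom_cov (lower_stable C) T) (induced (dual_contra R J (ext_contra C X))) \<theta>}"

abbreviation lower_Cr ::
  "('k, 'r) ring_scheme \<Rightarrow> ('k, 'j) module \<Rightarrow> ('o, 'm, 'k, 'z) excat_scheme \<Rightarrow> ('o, 'm set, 'k) kcat"
  where "lower_Cr R J C \<equiv> full_subcat (lower_stable C) (Cr R J C)"

abbreviation upper_Cl ::
  "('k, 'r) ring_scheme \<Rightarrow> ('k, 'j) module \<Rightarrow> ('o, 'm, 'k, 'z) excat_scheme \<Rightarrow> ('o, 'm set, 'k) kcat"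
  where "upper_Cl R J C \<equiv> full_subcat (upper_stable C) (Cl R J C)"

text \<open>
  \<open>\<phi> Y X\<close> and \<open>\<psi> X Y\<close> are the components \<open>\<phi>\<^sub>Y\<^sub>,\<^sub>X\<close> and \<open>\<psi>\<^sub>X\<^sub>,\<^sub>Y\<close>; \<open>\<tau>'\<close> stands for \<open>\<tau>\<^sup>-\<close>.
\<close>

locale AR_duality =
  fixes R :: "('k, 'r) ring_scheme"
    and J :: "('k, 'j) module"
    and C :: "('o, 'm, 'k, 'z) excat_scheme"
    and \<phi> \<psi> :: "'o \<Rightarrow> 'o \<Rightarrow> 'm set \<Rightarrow> ('o, 'm) ses set \<Rightarrow> 'j"
    and \<tau> \<tau>' :: "('o, 'm set, 'o, 'm set) cfun"
  assumes equivalence: "quasi_inverse (lower_Cr R J C) (upper_Cl R J C) \<tau> \<tau>'"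
    and \<phi>_natiso: "Y \<in> Cr R J C \<Longrightarrow>
      contra_natiso R (upper_stable C)
        (hom_contra (upper_stable C) (FOb \<tau> Y)) (induced (dual_cov R J (ext_cov C Y))) (\<phi> Y)"
    and \<phi>_natural: "\<lbrakk>X \<in> Ob C; Y \<in> Cr R J C; Y' \<in> Cr R J C;
        g \<in> Mor (lower_stable C) Y Y'; h \<in> Mor (upper_stable C) X (FOb \<tau> Y)\<rbrakk> \<Longrightarrow>
      \<phi> Y' X (Cmp (upper_stable C) X (FOb \<tau> Y) (FOb \<tau> Y') (FMor \<tau> Y Y' g) h) =
      MMor (induced (dual_contra R J (ext_contra C X))) Y Y' g (\<phi> Y X h)"
    and \<psi>_natiso: "X \<in> Cl R J C \<Longrightarrow>
      cov_natiso R (lower_stable C)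
        (hom_cov (lower_stable C) (FOb \<tau>' X)) (induced (dual_contra R J (ext_contra C X))) (\<psi> X)"
    and \<psi>_natural: "\<lbrakk>Y \<in> Ob C; X \<in> Cl R J C; X' \<in> Cl R J C;
        g \<in> Mor (upper_stable C) X X'; h \<in> Mor (lower_stable C) (FOb \<tau>' X') Y\<rbrakk> \<Longrightarrow>
      \<psi> X Y (Cmp (lower_stable C) (FOb \<tau>' X) (FOb \<tau>' X') Y h (FMor \<tau>' X X' g)) =
      MMor (induced (dual_cov R J (ext_cov C Y))) X X' g (\<psi> X' Y h)"


section \<open>Defects\<close>

text \<open>
  \<open>cov_im C \<xi> Z\<close> is the image of \<open>Hom(E,Z) \<rightarrow> Hom(X,Z)\<close> and \<open>contra_im C \<xi> Z\<close> the image of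
  \<open>Hom(Z,E) \<rightarrow> Hom(Z,Y)\<close> for \<open>\<xi> : X \<rightarrow> E \<rightarrow> Y\<close>; the defects are the cokernels of these maps.
\<close>

definition cov_im :: "('o, 'm, 'k, 'z) kcat_scheme \<Rightarrow> ('o, 'm) ses \<Rightarrow> 'o \<Rightarrow> 'm set"
  where "cov_im C \<xi> Z = (\<lambda>g. Cmp C (lft \<xi>) (mid \<xi>) Z g (infl \<xi>)) ` Mor C (mid \<xi>) Z"

definition contra_im :: "('o, 'm, 'k, 'z) kcat_scheme \<Rightarrow> ('o, 'm) ses \<Rightarrow> 'o \<Rightarrow> 'm set"
  where "contra_im C \<xi> Z = (\<lambda>g. Cmp C Z (mid \<xi>) (rgt \<xi>) (defl \<xi>) g) ` Mor C Z (mid \<xi>)"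

definition cov_defect :: "('o, 'm, 'k, 'z) kcat_scheme \<Rightarrow> ('o, 'm) ses \<Rightarrow> ('o, 'm, 'k, 'm set) mfun"
  where "cov_defect C \<xi> =
    \<lparr>MOb = \<lambda>Z. quot_mod (Hom C (lft \<xi>) Z) (cov_im C \<xi> Z),
     MMor = \<lambda>Z Z' f. quot_map (Hom C (lft \<xi>) Z') (cov_im C \<xi> Z') (\<lambda>x. Cmp C (lft \<xi>) Z Z' f x)\<rparr>"

definition contra_defect :: "('o, 'm, 'k, 'z) kcat_scheme \<Rightarrow> ('o, 'm) ses \<Rightarrow> ('o, 'm, 'k, 'm set) mfun"
  where "contra_defect C \<xi> =
    \<lparr>MOb = \<lambda>Z. quot_mod (Hom C Z (rgt \<xi>)) (contra_im C \<xi> Z),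
     MMor = \<lambda>Z Z' f. quot_map (Hom C Z (rgt \<xi>)) (contra_im C \<xi> Z) (\<lambda>x. Cmp C Z Z' (rgt \<xi>) x f)\<rparr>"

text \<open>
  A morphism of conflations \<open>(a, b, c) : \<xi> \<rightarrow> \<xi>'\<close> induces \<open>\<xi>'\<^sub>* \<rightarrow> \<xi>\<^sub>*\<close> through \<open>a\<close> and
  \<open>\<xi>\<^sup>* \<rightarrow> \<xi>'\<^sup>*\<close> through \<open>c\<close>.
\<close>

definition cov_defect_map ::
  "('o, 'm, 'k, 'z) kcat_scheme \<Rightarrow> ('o, 'm) ses \<Rightarrow> ('o, 'm) ses \<Rightarrow> 'm \<Rightarrow> 'o \<Rightarrow> 'm set \<Rightarrow> 'm set"
  where "cov_defect_map C \<xi> \<xi>' a Z =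
    quot_map (Hom C (lft \<xi>) Z) (cov_im C \<xi> Z) (\<lambda>x. Cmp C (lft \<xi>) (lft \<xi>') Z x a)"

definition contra_defect_map ::
  "('o, 'm, 'k, 'z) kcat_scheme \<Rightarrow> ('o, 'm) ses \<Rightarrow> ('o, 'm) ses \<Rightarrow> 'm \<Rightarrow> 'o \<Rightarrow> 'm set \<Rightarrow> 'm set"
  where "contra_defect_map C \<xi> \<xi>' c Z =
    quot_map (Hom C Z (rgt \<xi>')) (contra_im C \<xi>' Z) (\<lambda>x. Cmp C Z (rgt \<xi>) (rgt \<xi>') c x)"

end

theory Submission
  imports Defs
begin

text \<open>
  For \<open>\<xi> : X \<rightarrow> E \<rightarrow> Y\<close> the isomorphism \<open>\<xi>\<^sub>*(\<tau>K) \<rightarrow> D \<xi>\<^sup>*(K)\<close> is the pairing that sends the classes of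
  \<open>f : X \<rightarrow> \<tau>K\<close> and \<open>g : K \<rightarrow> Y\<close> to \<open>\<phi>\<^sub>K\<^sub>,\<^sub>X(f)\<close> evaluated at the pullback \<open>g\<^sup>*\<xi> \<in> Ext(K, X)\<close>.
  The connecting map \<open>g \<mapsto> g\<^sup>*\<xi>\<close> embeds \<open>\<xi>\<^sup>*(K)\<close> into \<open>Ext(K, X)\<close> as the kernel of
  \<open>Ext(K, X) \<rightarrow> Ext(K, E)\<close>; exactness of \<open>D\<close> and the naturality of \<open>\<phi>\<close> identify \<open>D \<xi>\<^sup>*(K)\<close> with the
  cokernel of the map from stable homomorphisms \<open>E \<rightarrow> \<tau>K\<close> to stable homomorphisms \<open>X \<rightarrow> \<tau>K\<close>.  This
  cokernel is \<open>\<xi>\<^sub>*(\<tau>K)\<close>, since injectively trivial morphisms factor through every inflation.  The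
  second isomorphism is dual, with \<open>f\<^sub>*\<xi> \<in> Ext(Y, K)\<close>.

  That \<open>Ext\<close> is a module is reduced to \<open>Hom\<close>: finitely many extensions of objects by a fixed \<open>Y\<close> are
  pullbacks of a single conflation \<open>Y \<rightarrow> E \<rightarrow> Z\<close>, and the Baer sum of \<open>g\<^sup>*\<zeta>\<close> and \<open>g'\<^sup>*\<zeta>\<close> is \<open>(g + g')\<^sup>*\<zeta>\<close>.
\<close>

text \<open>The given injectivity of \<open>J\<close> speaks only about test modules of one fixed
  element type, whereas \<open>D\<close> is applied to defects and extension modules of other types;
  Baer's criterion, with the regular module copied into the test type, bridges this gap. The duality
  of cokernels is then proved once for abstract modules, so that both parts of the theorem are
  instances of it. Stable Hom modules are avoided in that argument: \<open>\<phi>\<close> and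
  \<open>\<psi>\<close> are lifted to ordinary morphisms, which creates a kernel, the trivial
  morphisms, and the cokernel absorbs it. Facts about single conflations are dualised through the
  opposite exact category. For the extension modules both variances are treated directly, because
  \<open>Ext\<close> and \<open>Baer_sum\<close> consist of conflations of \<open>C\<close> and the
  Baer sum pulls back before it pushes out, a form that does not carry over literally to the
  opposite category.\<close>

lemma mod_homI:
  assumes "\<And>x. x \<in> carrier M \<Longrightarrow> f x \<in> carrier N"
    and "\<And>x y. \<lbrakk>x \<in> carrier M; y \<in> carrier M\<rbrakk> \<Longrightarrow> f (x \<oplus>\<^bsub>M\<^esub> y) = f x \<oplus>\<^bsub>N\<^esub> f y"
    and "\<And>a x. \<lbrakk>a \<in> carrier R; x \<in> carrier M\<rbrakk> \<Longrightarrow> f (a \<odot>\<^bsub>M\<^esub> x) = a \<odot>\<^bsub>N\<^esub> f x"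
  shows "f \<in> mod_hom R M N"
  using assms by (simp add: mod_hom_def)

lemma mod_hom_closed: "\<lbrakk>f \<in> mod_hom R M N; x \<in> carrier M\<rbrakk> \<Longrightarrow> f x \<in> carrier N"
  by (auto simp: mod_hom_def)

lemma mod_hom_add:
  "\<lbrakk>f \<in> mod_hom R M N; x \<in> carrier M; y \<in> carrier M\<rbrakk> \<Longrightarrow> f (x \<oplus>\<^bsub>M\<^esub> y) = f x \<oplus>\<^bsub>N\<^esub> f y"
  by (auto simp: mod_hom_def)

lemma mod_hom_smult:
  "\<lbrakk>f \<in> mod_hom R M N; a \<in> carrier R; x \<in> carrier M\<rbrakk> \<Longrightarrow> f (a \<odot>\<^bsub>M\<^esub> x) = a \<odot>\<^bsub>N\<^esub> f x"
  by (auto simp: mod_hom_def)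

text \<open>\<open>mod_hom\<close> lists only sums and scalar multiples; zero is recovered as a
  multiple by the scalar zero, and negatives below as multiples by minus one.\<close>

lemma mod_hom_zero:
  assumes "module R M" "module R N" "f \<in> mod_hom R M N"
  shows "f \<zero>\<^bsub>M\<^esub> = \<zero>\<^bsub>N\<^esub>"
proof -
  interpret M: module R M by fact
  interpret N: module R N by fact
  have "f (\<zero>\<^bsub>R\<^esub> \<odot>\<^bsub>M\<^esub> \<zero>\<^bsub>M\<^esub>) = \<zero>\<^bsub>R\<^esub> \<odot>\<^bsub>N\<^esub> f \<zero>\<^bsub>M\<^esub>"
    by (rule mod_hom_smult[OF assms(3)]) auto
  then show ?thesis using mod_hom_closed[OF assms(3) M.M.zero_closed] by simp
qed

lemma (in abelian_group) minus_eq_zero_iff: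
  assumes "x \<in> carrier G" "y \<in> carrier G"
  shows "x \<ominus> y = \<zero> \<longleftrightarrow> x = y"
proof
  assume "x \<ominus> y = \<zero>"
  then have "(x \<ominus> y) \<oplus> y = y" using assms by simp
  then show "x = y" using assms by (simp add: a_minus_def a_assoc l_neg)
qed (use assms in \<open>simp add: a_minus_def r_neg\<close>)

lemma (in module) a_inv_smult: "x \<in> carrier M \<Longrightarrow> \<ominus>\<^bsub>M\<^esub> x = (\<ominus> \<one>) \<odot>\<^bsub>M\<^esub> x"
  by (simp add: smult_l_minus)

lemma mod_hom_a_inv:
  assumes "module R M" "module R N" "f \<in> mod_hom R M N" "x \<in> carrier M"
  shows "f (\<ominus>\<^bsub>M\<^esub> x) = \<ominus>\<^bsub>N\<^esub> f x"
proof -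
  interpret M: module R M by fact
  interpret N: module R N by fact
  show ?thesis
    using mod_hom_smult[OF assms(3) _ assms(4), of "\<ominus>\<^bsub>R\<^esub> \<one>\<^bsub>R\<^esub>"] mod_hom_closed[OF assms(3,4)] assms(4)
    by (simp add: M.a_inv_smult N.a_inv_smult)
qed

lemma mod_hom_minus:
  assumes "module R M" "module R N" "f \<in> mod_hom R M N" "x \<in> carrier M" "y \<in> carrier M"
  shows "f (x \<ominus>\<^bsub>M\<^esub> y) = f x \<ominus>\<^bsub>N\<^esub> f y"
proof -
  interpret M: module R M by fact
  show ?thesis using assms by (simp add: a_minus_def mod_hom_add mod_hom_a_inv)
qed

lemma mod_hom_image_submodule:
  assumes "module R M" "module R N" "f \<in> mod_hom R M N"
  shows "submodule (f ` carrier M) R N"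
proof -
  interpret M: module R M by fact
  interpret N: module R N by fact
  show ?thesis
  proof (rule N.submoduleI)
    show "f ` carrier M \<subseteq> carrier N" using mod_hom_closed[OF assms(3)] by auto
    show "\<zero>\<^bsub>N\<^esub> \<in> f ` carrier M" using mod_hom_zero[OF assms] M.M.zero_closed by (metis imageI)
    show "\<ominus>\<^bsub>N\<^esub> a \<in> f ` carrier M" if "a \<in> f ` carrier M" for a
      using that mod_hom_a_inv[OF assms] M.M.a_inv_closed by (elim imageE) (metis image_eqI)
    show "a \<oplus>\<^bsub>N\<^esub> b \<in> f ` carrier M" if "a \<in> f ` carrier M" "b \<in> f ` carrier M" for a b
      using that mod_hom_add[OF assms(3)] M.M.add.m_closed by (elim imageE) (metis image_eqI)
    show "a \<odot>\<^bsub>N\<^esub> b \<in> f ` carrier M" if "a \<in> carrier R" "b \<in> f ` carrier M" for a b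
      using that mod_hom_smult[OF assms(3)] M.smult_closed by (elim imageE) (metis image_eqI)
  qed
qed

text \<open>Trivial morphisms are cut out by one condition per conflation and so form such an
  intersection; the carrier appears explicitly because \<open>P\<close> may hold for no
  index.\<close>

lemma submodule_Inter:
  assumes M: "module R M" and N: "\<And>i. P i \<Longrightarrow> submodule (N i) R M"
  shows "submodule {x \<in> carrier M. \<forall>i. P i \<longrightarrow> x \<in> N i} R M"
proof -
  interpret M: module R M by (rule M)
  have z: "\<zero>\<^bsub>M\<^esub> \<in> N i" if "P i" for i using N[OF that] by (simp add: submodule_def subgroup_def)
  show ?thesis
    by (rule M.submoduleI) (use z M.submoduleE(3-5)[OF N] in auto)
qed

section \<open>Quotient modules\<close>

context
  fixes R :: "('k, 'r) ring_scheme" and M :: "('k, 'a) module" and N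
  assumes M: "module R M" and N: "submodule N R M"
begin

lemma abelian_subgroup_of_submodule: "abelian_subgroup N M"
proof (rule abelian_subgroupI3)
  have "subgroup N (add_monoid M)" using N by (simp add: submodule_def)
  then show "additive_subgroup N M" by (rule additive_subgroupI)
  show "abelian_group M" using M by (simp add: module_def)
qed

lemma rcos_self: "x \<in> carrier M \<Longrightarrow> x \<in> N +>\<^bsub>M\<^esub> x"
  by (rule abelian_subgroup.a_rcos_self[OF abelian_subgroup_of_submodule])

lemma rcos_memD:
  assumes "x \<in> carrier M" "y \<in> N +>\<^bsub>M\<^esub> x"
  shows "y \<in> carrier M" "N +>\<^bsub>M\<^esub> y = N +>\<^bsub>M\<^esub> x"
  using abelian_subgroup.a_elemrcos_carrier[OF abelian_subgroup_of_submodule assms]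
    abelian_subgroup.a_repr_independence'[OF abelian_subgroup_of_submodule assms(2,1)] by auto

lemma rcos_eq_iff:
  assumes "x \<in> carrier M" "y \<in> carrier M"
  shows "N +>\<^bsub>M\<^esub> x = N +>\<^bsub>M\<^esub> y \<longleftrightarrow> x \<ominus>\<^bsub>M\<^esub> y \<in> N"
  using abelian_subgroup.a_rcos_module[OF abelian_subgroup_of_submodule assms(2,1)]
    rcos_memD[OF assms(2), of x] rcos_self[OF assms(1)]
  by (auto simp: a_minus_def)

text \<open>\<open>induced\<close> and \<open>coset_pairing\<close> read a coset through Hilbert
  choice, so the chosen element has to represent the coset that it was taken from.\<close>

lemma some_rcos:
  assumes "x \<in> carrier M"
  shows "(SOME y. y \<in> N +>\<^bsub>M\<^esub> x) \<in> carrier M" "N +>\<^bsub>M\<^esub> (SOME y. y \<in> N +>\<^bsub>M\<^esub> x) = N +>\<^bsub>M\<^esub> x"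
  using someI[of "\<lambda>y. y \<in> N +>\<^bsub>M\<^esub> x", OF rcos_self[OF assms]] rcos_memD[OF assms] by blast+

lemma quot_carrier: "carrier (quot_mod M N) = {N +>\<^bsub>M\<^esub> x | x. x \<in> carrier M}"
  by (auto simp: quot_mod_def A_RCOSETS_def')

lemma quot_add:
  assumes "x \<in> carrier M" "y \<in> carrier M"
  shows "(N +>\<^bsub>M\<^esub> x) \<oplus>\<^bsub>quot_mod M N\<^esub> (N +>\<^bsub>M\<^esub> y) = N +>\<^bsub>M\<^esub> (x \<oplus>\<^bsub>M\<^esub> y)"
  using assms by (simp add: quot_mod_def abelian_subgroup.a_rcos_sum[OF abelian_subgroup_of_submodule])

end

text \<open>Two elements of \<open>S +> x\<close> differ by an element of \<open>S\<close>, which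
  \<open>g\<close> sends into \<open>N\<close>; hence all cosets in the union that defines
  \<open>quot_map\<close> coincide.\<close>

lemma quot_map_rcos:
  fixes R :: "('k, 'r) ring_scheme" and M :: "('k, 'b) module" and A :: "('k, 'a) module"
  assumes M: "module R M" "submodule N R M" and A: "module R A" "submodule S R A"
    and g: "g \<in> mod_hom R A M" "\<And>s. s \<in> S \<Longrightarrow> g s \<in> N" and x: "x \<in> carrier A"
  shows "quot_map M N g (S +>\<^bsub>A\<^esub> x) = N +>\<^bsub>M\<^esub> g x"
proof -
  have "N +>\<^bsub>M\<^esub> g y = N +>\<^bsub>M\<^esub> g x" if "y \<in> S +>\<^bsub>A\<^esub> x" for y
  proof -
    have y: "y \<in> carrier A" "S +>\<^bsub>A\<^esub> y = S +>\<^bsub>A\<^esub> x" using rcos_memD[OF A(1) A(2) x that] by blast+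
    then have "y \<ominus>\<^bsub>A\<^esub> x \<in> S" using rcos_eq_iff[OF A] x by blast
    then have "g y \<ominus>\<^bsub>M\<^esub> g x \<in> N" using g mod_hom_minus[OF A(1) M(1) g(1) y(1) x] by force
    then show ?thesis using rcos_eq_iff[OF M mod_hom_closed[OF g(1) y(1)] mod_hom_closed[OF g(1) x]] by simp
  qed
  then show ?thesis unfolding quot_map_def by (intro UN_constant_eq[OF rcos_self[OF A x]] ballI)
qed

lemma quot_smult:
  fixes R :: "('k, 'r) ring_scheme" and M :: "('k, 'a) module"
  assumes M: "module R M" and N: "submodule N R M" and "a \<in> carrier R" "x \<in> carrier M"
  shows "a \<odot>\<^bsub>quot_mod M N\<^esub> (N +>\<^bsub>M\<^esub> x) = N +>\<^bsub>M\<^esub> (a \<odot>\<^bsub>M\<^esub> x)"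
proof -
  interpret module R M by (rule M)
  have "(\<lambda>x. a \<odot>\<^bsub>M\<^esub> x) \<in> mod_hom R M M"
    using assms(3) by (intro mod_homI) (auto simp: smult_r_distr smult_assoc1[symmetric] R.m_comm)
  then show ?thesis
    using quot_map_rcos[OF M N M N _ submodule.smult_closed[OF N assms(3)] assms(4)]
    by (simp add: quot_mod_def)
qed

section \<open>Baer's criterion\<close>

text \<open>A copy of the regular module whose elements have the type that \<^const>\<open>injective_module\<close> tests.\<close>

definition ring_test_module :: "('k, 'r) ring_scheme \<Rightarrow> ('k, (nat \<Rightarrow> 'k) set) module"
  where "ring_test_module R =
    \<lparr>carrier = (\<lambda>r. {\<lambda>_. r}) ` carrier R, mult = undefined, one = undefined, zero = {\<lambda>_. \<zero>\<^bsub>R\<^esub>},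
     add = (\<lambda>X Y. {\<lambda>_. (THE r. X = {\<lambda>_. r}) \<oplus>\<^bsub>R\<^esub> (THE r. Y = {\<lambda>_. r})}),
     smult = (\<lambda>a X. {\<lambda>_. a \<otimes>\<^bsub>R\<^esub> (THE r. X = {\<lambda>_. r})})\<rparr>"

text \<open>Lets the description operator in the operations of \<open>ring_test_module\<close>
  evaluate to the scalar that a singleton encodes.\<close>

lemma the_const_singleton: "(THE r. {\<lambda>_::nat. s} = {\<lambda>_. r}) = s"
  by (rule the_equality) (auto dest: fun_cong)

lemma ring_test_module_simps:
  "carrier (ring_test_module R) = (\<lambda>r. {\<lambda>_. r}) ` carrier R"
  "\<zero>\<^bsub>ring_test_module R\<^esub> = {\<lambda>_. \<zero>\<^bsub>R\<^esub>}"
  "{\<lambda>_. r} \<oplus>\<^bsub>ring_test_module R\<^esub> {\<lambda>_. s} = {\<lambda>_. r \<oplus>\<^bsub>R\<^esub> s}"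
  "a \<odot>\<^bsub>ring_test_module R\<^esub> {\<lambda>_. r} = {\<lambda>_. a \<otimes>\<^bsub>R\<^esub> r}"
  unfolding ring_test_module_def by (simp_all only: module.simps ring.simps partial_object.simps the_const_singleton)

lemma (in cring) ring_test_module: "module R (ring_test_module R)"
proof (rule moduleI)
  show "cring R" ..
  show "abelian_group (ring_test_module R)"
    by (rule abelian_groupI) (auto simp: ring_test_module_simps a_ac r_neg intro!: bexI[where x = "\<ominus> _"])
qed (auto simp: ring_test_module_simps l_distr r_distr m_assoc)

lemma injective_module_module: "injective_module R J \<Longrightarrow> module R J"
  by (simp add: injective_module_def)

text \<open>Injectivity extends \<open>h\<close> from the ideal to the regular module, and a
  homomorphism out of the regular module is multiplication by its value \<open>y\<close> at
  one.\<close>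

lemma extend_from_ideal:
  assumes J: "injective_module R J"
    and I: "I \<subseteq> carrier R" "\<zero>\<^bsub>R\<^esub> \<in> I" "\<And>r s. \<lbrakk>r \<in> I; s \<in> I\<rbrakk> \<Longrightarrow> r \<oplus>\<^bsub>R\<^esub> s \<in> I"
      "\<And>a r. \<lbrakk>a \<in> carrier R; r \<in> I\<rbrakk> \<Longrightarrow> a \<otimes>\<^bsub>R\<^esub> r \<in> I"
    and h: "\<And>r. r \<in> I \<Longrightarrow> h r \<in> carrier J"
      "\<And>r s. \<lbrakk>r \<in> I; s \<in> I\<rbrakk> \<Longrightarrow> h (r \<oplus>\<^bsub>R\<^esub> s) = h r \<oplus>\<^bsub>J\<^esub> h s"
      "\<And>a r. \<lbrakk>a \<in> carrier R; r \<in> I\<rbrakk> \<Longrightarrow> h (a \<otimes>\<^bsub>R\<^esub> r) = a \<odot>\<^bsub>J\<^esub> h r"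
  shows "\<exists>y \<in> carrier J. \<forall>r \<in> I. h r = r \<odot>\<^bsub>J\<^esub> y"
proof -
  interpret J: module R J by (rule injective_module_module[OF J])
  let ?T = "ring_test_module R" and ?A = "(\<lambda>r. {\<lambda>_::nat. r}) ` I"
  note T = J.R.ring_test_module
  interpret T: module R ?T by (rule T)
  have A: "submodule ?A R ?T"
  proof (rule T.submoduleI)
    show sub: "?A \<subseteq> carrier ?T" and "\<zero>\<^bsub>?T\<^esub> \<in> ?A" using I by (auto simp: ring_test_module_simps)
    show sm: "a \<odot>\<^bsub>?T\<^esub> X \<in> ?A" if "a \<in> carrier R" "X \<in> ?A" for a X
      using that I by (auto simp: ring_test_module_simps)
    show "\<ominus>\<^bsub>?T\<^esub> X \<in> ?A" if "X \<in> ?A" for X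
      using that sub sm[of "\<ominus>\<^bsub>R\<^esub> \<one>\<^bsub>R\<^esub>" X] T.a_inv_smult[of X] by (simp add: subset_iff)
    show "X \<oplus>\<^bsub>?T\<^esub> Y \<in> ?A" if "X \<in> ?A" "Y \<in> ?A" for X Y
      using that I(3) by (elim imageE) (simp add: ring_test_module_simps)
  qed
  define f where "f X = h (THE r. X = {\<lambda>_::nat. r})" for X
  have f: "f {\<lambda>_. r} = h r" for r unfolding f_def by (simp only: the_const_singleton)
  have upd: "X \<oplus>\<^bsub>?T\<lparr>carrier := ?A\<rparr>\<^esub> Y = X \<oplus>\<^bsub>?T\<^esub> Y" "a \<odot>\<^bsub>?T\<lparr>carrier := ?A\<rparr>\<^esub> X = a \<odot>\<^bsub>?T\<^esub> X" for X Y a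
    by simp_all
  have fhom: "f \<in> mod_hom R (?T\<lparr>carrier := ?A\<rparr>) J"
  proof (rule mod_homI)
    fix X assume "X \<in> carrier (?T\<lparr>carrier := ?A\<rparr>)"
    then obtain r where r: "r \<in> I" "X = {\<lambda>_. r}" by auto
    show "f X \<in> carrier J" unfolding r(2) f by (rule h(1)[OF r(1)])
  next
    fix X Y assume "X \<in> carrier (?T\<lparr>carrier := ?A\<rparr>)" "Y \<in> carrier (?T\<lparr>carrier := ?A\<rparr>)"
    then obtain r s where rs: "r \<in> I" "s \<in> I" "X = {\<lambda>_. r}" "Y = {\<lambda>_. s}" by auto
    have "X \<oplus>\<^bsub>?T\<lparr>carrier := ?A\<rparr>\<^esub> Y = {\<lambda>_. r \<oplus>\<^bsub>R\<^esub> s}"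
      unfolding rs by (simp only: upd ring_test_module_simps)
    then show "f (X \<oplus>\<^bsub>?T\<lparr>carrier := ?A\<rparr>\<^esub> Y) = f X \<oplus>\<^bsub>J\<^esub> f Y"
      unfolding rs by (simp only: f h(2)[OF rs(1,2)])
  next
    fix a X assume a: "a \<in> carrier R" and "X \<in> carrier (?T\<lparr>carrier := ?A\<rparr>)"
    then obtain r where r: "r \<in> I" "X = {\<lambda>_. r}" by auto
    have "a \<odot>\<^bsub>?T\<lparr>carrier := ?A\<rparr>\<^esub> X = {\<lambda>_. a \<otimes>\<^bsub>R\<^esub> r}"
      unfolding r by (simp only: upd ring_test_module_simps)
    then show "f (a \<odot>\<^bsub>?T\<lparr>carrier := ?A\<rparr>\<^esub> X) = a \<odot>\<^bsub>J\<^esub> f X"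
      unfolding r by (simp only: f h(3)[OF a r(1)])
  qed
  obtain g where g: "g \<in> mod_hom R ?T J" "\<forall>X\<in>?A. g X = f X"
    using conjunct2[OF J[unfolded injective_module_def], rule_format, OF conjI[OF T A] fhom] by blast
  have one: "{\<lambda>_. \<one>\<^bsub>R\<^esub>} \<in> carrier ?T" by (simp add: ring_test_module_simps)
  show ?thesis
  proof (intro bexI ballI)
    show "g {\<lambda>_. \<one>\<^bsub>R\<^esub>} \<in> carrier J" using mod_hom_closed[OF g(1) one] .
    show "h r = r \<odot>\<^bsub>J\<^esub> g {\<lambda>_. \<one>\<^bsub>R\<^esub>}" if "r \<in> I" for r
    proof -
      have "r \<in> carrier R" using that I by auto
      then have "g {\<lambda>_. r} = r \<odot>\<^bsub>J\<^esub> g {\<lambda>_. \<one>\<^bsub>R\<^esub>}"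
        using mod_hom_smult[OF g(1) _ one, of r] by (simp add: ring_test_module_simps)
      then show ?thesis using g(2) that f by auto
    qed
  qed
qed

text \<open>Baer's criterion: unlike in \<open>injective_module\<close>, the element type of
  \<open>B\<close> is arbitrary. Zorn's lemma gives a maximal partial extension, and
  \<open>extend_from_ideal\<close> enlarges any partial extension by a missing element.\<close>

lemma injective_module_extend:
  fixes B :: "('k, 'b) module"
  assumes J: "injective_module R J" and B: "module R B" and A: "submodule A R B"
    and f: "f \<in> mod_hom R (B\<lparr>carrier := A\<rparr>) J"
  shows "\<exists>g \<in> mod_hom R B J. \<forall>x\<in>A. g x = f x"
proof -
  note modJ = injective_module_module[OF J]
  interpret J: module R J by (rule modJ)
  interpret B: module R B by (rule B)
  have Asub: "A \<subseteq> carrier B" using B.submoduleE[OF A] by simp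
  \<comment> \<open>Partial extensions of \<open>f\<close> are encoded as their graphs. Extending
    then means inclusion, and the union of a chain is the obvious upper bound.\<close>
  define P where "P G \<longleftrightarrow>
      (\<forall>x y. (x, y) \<in> G \<longrightarrow> x \<in> carrier B \<and> y \<in> carrier J) \<and>
      (\<forall>x y y'. (x, y) \<in> G \<longrightarrow> (x, y') \<in> G \<longrightarrow> y = y') \<and>
      (\<forall>x y x' y'. (x, y) \<in> G \<longrightarrow> (x', y') \<in> G \<longrightarrow> (x \<oplus>\<^bsub>B\<^esub> x', y \<oplus>\<^bsub>J\<^esub> y') \<in> G) \<and>
      (\<forall>a x y. a \<in> carrier R \<longrightarrow> (x, y) \<in> G \<longrightarrow> (a \<odot>\<^bsub>B\<^esub> x, a \<odot>\<^bsub>J\<^esub> y) \<in> G) \<and>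
      (\<forall>x\<in>A. (x, f x) \<in> G)" for G :: "('b \<times> 'c) set"
  have P1: "x \<in> carrier B" "y \<in> carrier J" if "P G" "(x, y) \<in> G" for G x y
    using conjunct1[OF that(1)[unfolded P_def]] that(2) by blast+
  have P2: "y = y'" if "P G" "(x, y) \<in> G" "(x, y') \<in> G" for G x y y'
    using conjunct1[OF conjunct2[OF that(1)[unfolded P_def]]] that(2,3) by blast
  have P3: "(x \<oplus>\<^bsub>B\<^esub> x', y \<oplus>\<^bsub>J\<^esub> y') \<in> G" if "P G" "(x, y) \<in> G" "(x', y') \<in> G" for G x y x' y'
    using conjunct1[OF conjunct2[OF conjunct2[OF that(1)[unfolded P_def]]]] that(2,3) by blast
  have P4: "(a \<odot>\<^bsub>B\<^esub> x, a \<odot>\<^bsub>J\<^esub> y) \<in> G" if "P G" "a \<in> carrier R" "(x, y) \<in> G" for G a x y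
    using conjunct1[OF conjunct2[OF conjunct2[OF conjunct2[OF that(1)[unfolded P_def]]]]] that(2,3) by blast
  have P5: "(x, f x) \<in> G" if "P G" "x \<in> A" for G x
    using conjunct2[OF conjunct2[OF conjunct2[OF conjunct2[OF that(1)[unfolded P_def]]]]] that(2) by blast
  let ?G0 = "(\<lambda>x. (x, f x)) ` A"
  have P0: "P ?G0"
    unfolding P_def
    using Asub B.submoduleE(4,5)[OF A] mod_hom_closed[OF f] mod_hom_add[OF f] mod_hom_smult[OF f] by auto
  have "\<exists>M\<in>Collect P. \<forall>X\<in>Collect P. M \<subseteq> X \<longrightarrow> X = M"
  proof (rule subset_Zorn_nonempty)
    show "Collect P \<noteq> {}" using P0 by blast
    fix \<C> assume ne: "\<C> \<noteq> {}" and ch: "subset.chain (Collect P) \<C>"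
    have C: "P G" if "G \<in> \<C>" for G using that ch by (auto simp: subset_chain_def)
    \<comment> \<open>Every closure condition in \<open>P\<close> involves at most two pairs, so it
      is enough that any two pairs lie in a common member of the chain.\<close>
    have dir: "\<exists>G\<in>\<C>. p \<in> G \<and> q \<in> G" if "p \<in> \<Union>\<C>" "q \<in> \<Union>\<C>" for p q
    proof -
      obtain G H where GH: "G \<in> \<C>" "p \<in> G" "H \<in> \<C>" "q \<in> H" using \<open>p \<in> \<Union>\<C>\<close> \<open>q \<in> \<Union>\<C>\<close> by blast
      then have "G \<subseteq> H \<or> H \<subseteq> G" using ch unfolding subset_chain_def by blast
      then show ?thesis using GH by blast
    qed
    obtain G where G: "G \<in> \<C>" using ne by blast
    have "P (\<Union>\<C>)"
      unfolding P_def
    proof (intro conjI allI impI ballI)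
      fix x y assume "(x, y) \<in> \<Union>\<C>"
      then obtain H where "H \<in> \<C>" "(x, y) \<in> H" by blast
      then show "x \<in> carrier B" "y \<in> carrier J" using P1[OF C] by blast+
    next
      fix x y y' assume "(x, y) \<in> \<Union>\<C>" "(x, y') \<in> \<Union>\<C>"
      then obtain H where "H \<in> \<C>" "(x, y) \<in> H" "(x, y') \<in> H" using dir by meson
      then show "y = y'" using P2[OF C] by blast
    next
      fix x y x' y' assume "(x, y) \<in> \<Union>\<C>" "(x', y') \<in> \<Union>\<C>"
      then obtain H where "H \<in> \<C>" "(x, y) \<in> H" "(x', y') \<in> H" using dir by meson
      then show "(x \<oplus>\<^bsub>B\<^esub> x', y \<oplus>\<^bsub>J\<^esub> y') \<in> \<Union>\<C>" using P3[OF C] by blast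
    next
      fix a x y assume "a \<in> carrier R" "(x, y) \<in> \<Union>\<C>"
      then obtain H where "H \<in> \<C>" "(x, y) \<in> H" by blast
      then show "(a \<odot>\<^bsub>B\<^esub> x, a \<odot>\<^bsub>J\<^esub> y) \<in> \<Union>\<C>" using P4[OF C] \<open>a \<in> carrier R\<close> by blast
    next
      fix x assume "x \<in> A" then show "(x, f x) \<in> \<Union>\<C>" using G P5[OF C[OF G]] by blast
    qed
    then show "\<Union>\<C> \<in> Collect P" by simp
  qed
  then obtain G where G: "P G" and max: "\<And>X. P X \<Longrightarrow> G \<subseteq> X \<Longrightarrow> X = G" by blast
  note G1 = P1[OF G] and G2 = P2[OF G] and G3 = P3[OF G] and G4 = P4[OF G] and G5 = P5[OF G]
  have "\<zero>\<^bsub>B\<^esub> \<in> A" using A by (simp add: submodule_def subgroup_def)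
  then have G0: "(\<zero>\<^bsub>B\<^esub>, \<zero>\<^bsub>J\<^esub>) \<in> G"
    using G4[OF J.R.zero_closed G5] G1(2)[OF G5] by fastforce
  have G6: "(x \<ominus>\<^bsub>B\<^esub> x', y \<ominus>\<^bsub>J\<^esub> y') \<in> G" if "(x, y) \<in> G" "(x', y') \<in> G" for x y x' y'
    using G3[OF that(1) G4[OF _ that(2), of "\<ominus>\<^bsub>R\<^esub> \<one>\<^bsub>R\<^esub>"]] G1[OF that(2)]
    by (simp add: a_minus_def B.a_inv_smult J.a_inv_smult)
  have total: "\<exists>y. (b, y) \<in> G" if b: "b \<in> carrier B" for b
  proof -
    \<comment> \<open>\<open>I\<close> is the ideal of scalars that carry \<open>b\<close> into the
      domain of \<open>G\<close>, and \<open>h r\<close> is the value already prescribed at the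
      multiple of \<open>b\<close> by \<open>r\<close>. An element \<open>y0\<close> with
      \<open>h r = r y0\<close> on \<open>I\<close> is an admissible value at
      \<open>b\<close>.\<close>
    define I where "I = {r \<in> carrier R. \<exists>y. (r \<odot>\<^bsub>B\<^esub> b, y) \<in> G}"
    define h where "h r = (THE y. (r \<odot>\<^bsub>B\<^esub> b, y) \<in> G)" for r
    have h: "h r = y" if "(r \<odot>\<^bsub>B\<^esub> b, y) \<in> G" for r y
      unfolding h_def using that G2 by blast
    have I: "r \<in> I \<longleftrightarrow> r \<in> carrier R \<and> (r \<odot>\<^bsub>B\<^esub> b, h r) \<in> G" for r
      unfolding I_def using h by blast
    have "\<exists>y \<in> carrier J. \<forall>r \<in> I. h r = r \<odot>\<^bsub>J\<^esub> y"
    proof (rule extend_from_ideal[OF J, of I h])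
      show "I \<subseteq> carrier R" by (auto simp: I)
      show "\<zero>\<^bsub>R\<^esub> \<in> I" unfolding I_def using G0 b by auto
      have add: "((r \<oplus>\<^bsub>R\<^esub> s) \<odot>\<^bsub>B\<^esub> b, h r \<oplus>\<^bsub>J\<^esub> h s) \<in> G" if "r \<in> I" "s \<in> I" for r s
        using that G3[of "r \<odot>\<^bsub>B\<^esub> b" "h r" "s \<odot>\<^bsub>B\<^esub> b" "h s"] b by (auto simp: I B.smult_l_distr)
      have sm: "((a \<otimes>\<^bsub>R\<^esub> r) \<odot>\<^bsub>B\<^esub> b, a \<odot>\<^bsub>J\<^esub> h r) \<in> G" if "a \<in> carrier R" "r \<in> I" for a r
        using that G4[of a "r \<odot>\<^bsub>B\<^esub> b" "h r"] b by (auto simp: I B.smult_assoc1)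
      show "r \<oplus>\<^bsub>R\<^esub> s \<in> I" "h (r \<oplus>\<^bsub>R\<^esub> s) = h r \<oplus>\<^bsub>J\<^esub> h s" if "r \<in> I" "s \<in> I" for r s
        using add[OF that] that h by (auto simp: I_def)
      show "a \<otimes>\<^bsub>R\<^esub> r \<in> I" "h (a \<otimes>\<^bsub>R\<^esub> r) = a \<odot>\<^bsub>J\<^esub> h r" if "a \<in> carrier R" "r \<in> I" for a r
        using sm[OF that] that h by (auto simp: I_def)
      show "h r \<in> carrier J" if "r \<in> I" for r using that G1(2) I by blast
    qed
    then obtain y0 where y0: "y0 \<in> carrier J" "\<And>r. r \<in> I \<Longrightarrow> h r = r \<odot>\<^bsub>J\<^esub> y0" by blast
    define G' where "G' = {(x \<oplus>\<^bsub>B\<^esub> r \<odot>\<^bsub>B\<^esub> b, y \<oplus>\<^bsub>J\<^esub> r \<odot>\<^bsub>J\<^esub> y0) | x y r. (x, y) \<in> G \<and> r \<in> carrier R}"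
    have G': "(x \<oplus>\<^bsub>B\<^esub> r \<odot>\<^bsub>B\<^esub> b, y \<oplus>\<^bsub>J\<^esub> r \<odot>\<^bsub>J\<^esub> y0) \<in> G'" if "(x, y) \<in> G" "r \<in> carrier R" for x y r
      using that unfolding G'_def by blast
    have GG': "G \<subseteq> G'"
    proof
      fix p assume "p \<in> G"
      moreover obtain x y where "p = (x, y)" by fastforce
      ultimately show "p \<in> G'"
        using G'[of x y "\<zero>\<^bsub>R\<^esub>"] G1[of x y] b y0(1) by auto
    qed
    have "P G'"
      unfolding P_def
    proof (intro conjI allI impI ballI)
      fix p q assume "(p, q) \<in> G'"
      then show "p \<in> carrier B" "q \<in> carrier J" using G1 b y0(1) unfolding G'_def by auto
    next
      \<comment> \<open>Two representations of \<open>p\<close> differ by the multiple of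
        \<open>b\<close> by \<open>r - r'\<close>, which lies in the domain of \<open>G\<close>.
        There \<open>G\<close> agrees with multiplication of \<open>y0\<close>, so the second
        components agree as well.\<close>
      fix p q q' assume "(p, q) \<in> G'" "(p, q') \<in> G'"
      then obtain x y r x' y' r' where *: "(x, y) \<in> G" "r \<in> carrier R" "p = x \<oplus>\<^bsub>B\<^esub> r \<odot>\<^bsub>B\<^esub> b" "q = y \<oplus>\<^bsub>J\<^esub> r \<odot>\<^bsub>J\<^esub> y0"
        "(x', y') \<in> G" "r' \<in> carrier R" "p = x' \<oplus>\<^bsub>B\<^esub> r' \<odot>\<^bsub>B\<^esub> b" "q' = y' \<oplus>\<^bsub>J\<^esub> r' \<odot>\<^bsub>J\<^esub> y0"
        unfolding G'_def by blast
      note c = G1[OF *(1)] G1[OF *(5)] *(2,6) b y0(1)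
      have "(r \<ominus>\<^bsub>R\<^esub> r') \<odot>\<^bsub>B\<^esub> b = x' \<ominus>\<^bsub>B\<^esub> x"
      proof -
        have "r \<odot>\<^bsub>B\<^esub> b = (x \<oplus>\<^bsub>B\<^esub> r \<odot>\<^bsub>B\<^esub> b) \<ominus>\<^bsub>B\<^esub> x" using c by (simp add: a_minus_def B.M.a_ac B.M.r_neg B.M.r_neg1 B.M.r_neg2)
        also have "\<dots> = x' \<oplus>\<^bsub>B\<^esub> r' \<odot>\<^bsub>B\<^esub> b \<ominus>\<^bsub>B\<^esub> x" using *(3,7) by simp
        finally show ?thesis using c
          by (simp add: a_minus_def B.smult_l_distr B.smult_l_minus B.M.a_ac B.M.r_neg B.M.r_neg1 B.M.r_neg2)
      qed
      then have D: "((r \<ominus>\<^bsub>R\<^esub> r') \<odot>\<^bsub>B\<^esub> b, y' \<ominus>\<^bsub>J\<^esub> y) \<in> G" using G6[OF *(5,1)] by simp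
      moreover have "r \<ominus>\<^bsub>R\<^esub> r' \<in> carrier R" using c by simp
      ultimately have "r \<ominus>\<^bsub>R\<^esub> r' \<in> I" unfolding I_def by blast
      then have "(r \<ominus>\<^bsub>R\<^esub> r') \<odot>\<^bsub>J\<^esub> y0 = y' \<ominus>\<^bsub>J\<^esub> y"
        using y0(2) h[OF D] by simp
      then have "(r \<odot>\<^bsub>J\<^esub> y0 \<ominus>\<^bsub>J\<^esub> r' \<odot>\<^bsub>J\<^esub> y0) \<oplus>\<^bsub>J\<^esub> (y \<oplus>\<^bsub>J\<^esub> r' \<odot>\<^bsub>J\<^esub> y0) = (y' \<ominus>\<^bsub>J\<^esub> y) \<oplus>\<^bsub>J\<^esub> (y \<oplus>\<^bsub>J\<^esub> r' \<odot>\<^bsub>J\<^esub> y0)"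
        using c by (simp add: a_minus_def J.smult_l_distr J.smult_l_minus)
      then show "q = q'" unfolding *(4,8)
        using c by (simp add: a_minus_def J.M.a_ac J.M.r_neg J.M.r_neg1 J.M.r_neg2)
    next
      fix p q p' q' assume "(p, q) \<in> G'" "(p', q') \<in> G'"
      then obtain x y r x' y' r' where *: "(x, y) \<in> G" "r \<in> carrier R" "p = x \<oplus>\<^bsub>B\<^esub> r \<odot>\<^bsub>B\<^esub> b" "q = y \<oplus>\<^bsub>J\<^esub> r \<odot>\<^bsub>J\<^esub> y0"
        "(x', y') \<in> G" "r' \<in> carrier R" "p' = x' \<oplus>\<^bsub>B\<^esub> r' \<odot>\<^bsub>B\<^esub> b" "q' = y' \<oplus>\<^bsub>J\<^esub> r' \<odot>\<^bsub>J\<^esub> y0"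
        unfolding G'_def by blast
      show "(p \<oplus>\<^bsub>B\<^esub> p', q \<oplus>\<^bsub>J\<^esub> q') \<in> G'"
        using G'[OF G3[OF *(1,5)], of "r \<oplus>\<^bsub>R\<^esub> r'"] G1[OF *(1)] G1[OF *(5)] *(2,6) b y0(1)
        by (simp add: *(3,4,7,8) B.smult_l_distr J.smult_l_distr B.M.a_ac J.M.a_ac)
    next
      fix a p q assume a: "a \<in> carrier R" and "(p, q) \<in> G'"
      then obtain x y r where *: "(x, y) \<in> G" "r \<in> carrier R" "p = x \<oplus>\<^bsub>B\<^esub> r \<odot>\<^bsub>B\<^esub> b" "q = y \<oplus>\<^bsub>J\<^esub> r \<odot>\<^bsub>J\<^esub> y0"
        unfolding G'_def by blast
      show "(a \<odot>\<^bsub>B\<^esub> p, a \<odot>\<^bsub>J\<^esub> q) \<in> G'"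
        using G'[OF G4[OF a *(1)], of "a \<otimes>\<^bsub>R\<^esub> r"] G1[OF *(1)] a *(2) b y0(1)
        by (simp add: *(3,4) B.smult_r_distr J.smult_r_distr B.smult_assoc1 J.smult_assoc1)
    next
      fix x assume "x \<in> A" then show "(x, f x) \<in> G'" using G5 GG' by blast
    qed
    \<comment> \<open>By maximality nothing was added, although \<open>G'\<close> contains the pair
      obtained from zero in \<open>G\<close> and \<open>r = \<one>\<close>, that is,
      \<open>b\<close> together with \<open>y0\<close>.\<close>
    then have "G' = G" using max GG' by blast
    then show ?thesis using G'[OF G0 J.R.one_closed] b by auto
  qed
  define g where "g x = (THE y. (x, y) \<in> G)" for x
  have g: "g x = y" if "(x, y) \<in> G" for x y unfolding g_def using that G2 by blast
  then have gG: "(x, g x) \<in> G" if "x \<in> carrier B" for x using total[OF that] by blast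
  have "g \<in> mod_hom R B J"
  proof (rule mod_homI)
    show "g x \<in> carrier J" if "x \<in> carrier B" for x using G1(2)[OF gG[OF that]] .
    show "g (x \<oplus>\<^bsub>B\<^esub> y) = g x \<oplus>\<^bsub>J\<^esub> g y" if "x \<in> carrier B" "y \<in> carrier B" for x y
      by (rule g[OF G3[OF gG[OF that(1)] gG[OF that(2)]]])
    show "g (a \<odot>\<^bsub>B\<^esub> x) = a \<odot>\<^bsub>J\<^esub> g x" if "a \<in> carrier R" "x \<in> carrier B" for a x
      by (rule g[OF G4[OF that(1) gG[OF that(2)]]])
  qed
  moreover have "\<forall>x\<in>A. g x = f x" using g[OF G5] by blast
  ultimately show ?thesis by blast
qed

text \<open>Since \<open>t\<close> vanishes on the kernel of \<open>f\<close>, it descends to the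
  image of \<open>f\<close>, a submodule of \<open>Q\<close> from which injectivity extends it. This
  is the only form in which exactness of \<open>D\<close> enters.\<close>

lemma injective_module_extend_along:
  fixes P :: "('k, 'a) module" and Q :: "('k, 'b) module"
  assumes J: "injective_module R J" and P: "module R P" and Q: "module R Q"
    and f: "f \<in> mod_hom R P Q" and t: "t \<in> mod_hom R P J"
    and ker: "\<And>p. \<lbrakk>p \<in> carrier P; f p = \<zero>\<^bsub>Q\<^esub>\<rbrakk> \<Longrightarrow> t p = \<zero>\<^bsub>J\<^esub>"
  shows "\<exists>w \<in> mod_hom R Q J. \<forall>p \<in> carrier P. w (f p) = t p"
proof -
  note modJ = injective_module_module[OF J]
  interpret J: module R J by (rule modJ)
  interpret P: module R P by (rule P)
  interpret Q: module R Q by (rule Q)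
  let ?A = "f ` carrier P"
  \<comment> \<open>The descended functional, evaluated through an arbitrary preimage; the kernel
    condition makes the choice immaterial.\<close>
  define u where "u y = t (SOME p. p \<in> carrier P \<and> f p = y)" for y
  have u: "u (f p) = t p" if p: "p \<in> carrier P" for p
  proof -
    define q where "q = (SOME q. q \<in> carrier P \<and> f q = f p)"
    have "q \<in> carrier P \<and> f q = f p" unfolding q_def by (rule someI_ex) (use p in blast)
    then have q: "q \<in> carrier P" "f q = f p" by blast+
    have "f (q \<ominus>\<^bsub>P\<^esub> p) = \<zero>\<^bsub>Q\<^esub>"
      using mod_hom_minus[OF P Q f q(1) p] q(2) mod_hom_closed[OF f p] by (simp add: Q.M.minus_eq_zero_iff)
    then have "t (q \<ominus>\<^bsub>P\<^esub> p) = \<zero>\<^bsub>J\<^esub>" using ker q(1) p by simp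
    then have "t q \<ominus>\<^bsub>J\<^esub> t p = \<zero>\<^bsub>J\<^esub>" using mod_hom_minus[OF P modJ t q(1) p] by simp
    then have "t q = t p" using mod_hom_closed[OF t p] mod_hom_closed[OF t q(1)] by (simp add: J.M.minus_eq_zero_iff)
    then show ?thesis by (simp add: u_def q_def)
  qed
  have "u \<in> mod_hom R (Q\<lparr>carrier := ?A\<rparr>) J"
  proof (rule mod_homI)
    show "u y \<in> carrier J" if "y \<in> carrier (Q\<lparr>carrier := ?A\<rparr>)" for y
      using that u mod_hom_closed[OF t] by auto
  next
    fix y z assume "y \<in> carrier (Q\<lparr>carrier := ?A\<rparr>)" "z \<in> carrier (Q\<lparr>carrier := ?A\<rparr>)"
    then obtain p q where pq: "p \<in> carrier P" "q \<in> carrier P" "y = f p" "z = f q" by auto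
    then show "u (y \<oplus>\<^bsub>Q\<lparr>carrier := ?A\<rparr>\<^esub> z) = u y \<oplus>\<^bsub>J\<^esub> u z"
      using u[of "p \<oplus>\<^bsub>P\<^esub> q"] mod_hom_add[OF f pq(1,2)] mod_hom_add[OF t pq(1,2)] u[OF pq(1)] u[OF pq(2)] by simp
  next
    fix a y assume a: "a \<in> carrier R" and "y \<in> carrier (Q\<lparr>carrier := ?A\<rparr>)"
    then obtain p where p: "p \<in> carrier P" "y = f p" by auto
    then show "u (a \<odot>\<^bsub>Q\<lparr>carrier := ?A\<rparr>\<^esub> y) = a \<odot>\<^bsub>J\<^esub> u y"
      using u[of "a \<odot>\<^bsub>P\<^esub> p"] mod_hom_smult[OF f a p(1)] mod_hom_smult[OF t a p(1)] u[OF p(1)] a by simp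
  qed
  from injective_module_extend[OF J Q mod_hom_image_submodule[OF P Q f] this] u show ?thesis by auto
qed

section \<open>Duality between cokernels\<close>

lemma dual_carrier: "u \<in> carrier (dual R J M) \<longleftrightarrow> u \<in> mod_hom R M J \<and> u \<in> extensional (carrier M)"
  by (simp add: dual_def)

lemma dual_add: "m \<in> carrier M \<Longrightarrow> (u \<oplus>\<^bsub>dual R J M\<^esub> v) m = u m \<oplus>\<^bsub>J\<^esub> v m"
  by (simp add: dual_def)

lemma dual_smult: "m \<in> carrier M \<Longrightarrow> (a \<odot>\<^bsub>dual R J M\<^esub> u) m = a \<odot>\<^bsub>J\<^esub> u m"
  by (simp add: dual_def)

lemma dual_hom_add:
  "\<lbrakk>\<Phi> \<in> mod_hom R A (dual R J M); a \<in> carrier A; b \<in> carrier A; m \<in> carrier M\<rbrakk>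
    \<Longrightarrow> \<Phi> (a \<oplus>\<^bsub>A\<^esub> b) m = \<Phi> a m \<oplus>\<^bsub>J\<^esub> \<Phi> b m"
  by (simp add: mod_hom_add dual_add)

lemma dual_hom_closed:
  "\<lbrakk>\<Phi> \<in> mod_hom R A (dual R J M); a \<in> carrier A\<rbrakk> \<Longrightarrow> \<Phi> a \<in> mod_hom R M J"
  using mod_hom_closed[of \<Phi> R A "dual R J M"] by (simp add: dual_carrier)

lemma dual_hom_smult:
  "\<lbrakk>\<Phi> \<in> mod_hom R A (dual R J M); r \<in> carrier R; a \<in> carrier A; m \<in> carrier M\<rbrakk>
    \<Longrightarrow> \<Phi> (r \<odot>\<^bsub>A\<^esub> a) m = r \<odot>\<^bsub>J\<^esub> \<Phi> a m"
  by (simp add: mod_hom_smult dual_smult)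

lemma dual_hom_minus:
  assumes "module R A" "module R J" "module R M" "\<Phi> \<in> mod_hom R A (dual R J M)"
    "a \<in> carrier A" "b \<in> carrier A" "m \<in> carrier M"
  shows "\<Phi> (a \<ominus>\<^bsub>A\<^esub> b) m = \<Phi> a m \<ominus>\<^bsub>J\<^esub> \<Phi> b m"
proof -
  interpret A: module R A by fact
  interpret J: module R J by fact
  have "\<Phi> b m \<in> carrier J" using mod_hom_closed[OF dual_hom_closed[OF assms(4,6)] assms(7)] .
  then show ?thesis using assms
    by (simp add: a_minus_def dual_hom_add[OF assms(4)] A.a_inv_smult J.a_inv_smult dual_hom_smult[OF assms(4)])
qed

text \<open>The outer argument is a class modulo the image of \<open>\<alpha>\<close>, the inner one
  a class in \<open>Q\<close>; both are evaluated through chosen representatives. The inner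
  abstraction is restricted to the carrier because elements of a dual are normalised to be undefined
  outside it.\<close>

definition coset_pairing :: "('k, 'c set) module \<Rightarrow> ('a \<Rightarrow> 'm \<Rightarrow> 'j) \<Rightarrow> ('c \<Rightarrow> 'm) \<Rightarrow> 'a set \<Rightarrow> 'c set \<Rightarrow> 'j"
  where "coset_pairing Q \<Phi> \<delta> = (\<lambda>X. \<lambda>Y\<in>carrier Q. \<Phi> (SOME a. a \<in> X) (\<delta> (SOME g. g \<in> Y)))"

text \<open>The abstract situation: the sequence \<open>H\<close>, \<open>G\<close>,
  \<open>M\<close>, \<open>M'\<close> is exact at \<open>G\<close> and at \<open>M\<close>, and
  \<open>\<Phi>\<close>, \<open>\<Psi>\<close> present the duals of \<open>M\<close>,
  \<open>M'\<close> as images of \<open>A\<close>, \<open>B\<close>, compatibly with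
  \<open>\<alpha>\<close> and the dual of \<open>\<mu>\<close>. The kernel of \<open>\<Phi>\<close>
  need only lie in the image of \<open>\<alpha>\<close>, which leaves room for lifts of maps defined
  on stable Hom modules.\<close>

context
  fixes R :: "('k, 'r) ring_scheme" and J :: "('k, 'j) module"
    and A :: "('k, 'a) module" and B :: "('k, 'b) module"
    and G :: "('k, 'c) module" and H :: "('k, 'd) module"
    and M :: "('k, 'm) module" and M' :: "('k, 'n) module"
    and \<alpha> \<gamma> \<delta> \<mu> \<Phi> \<Psi>
  assumes J: "injective_module R J"
    and mods: "module R A" "module R B" "module R G" "module R H" "module R M" "module R M'"
    and \<alpha>: "\<alpha> \<in> mod_hom R B A" and \<gamma>: "\<gamma> \<in> mod_hom R H G"
    and \<delta>: "\<delta> \<in> mod_hom R G M" and \<mu>: "\<mu> \<in> mod_hom R M M'"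
    and ker_\<delta>: "\<And>g. g \<in> carrier G \<Longrightarrow> \<delta> g = \<zero>\<^bsub>M\<^esub> \<longleftrightarrow> g \<in> \<gamma> ` carrier H"
    and ker_\<mu>: "\<And>m. m \<in> carrier M \<Longrightarrow> \<mu> m = \<zero>\<^bsub>M'\<^esub> \<longleftrightarrow> m \<in> \<delta> ` carrier G"
    and \<Phi>: "\<Phi> \<in> mod_hom R A (dual R J M)" and \<Phi>_surj: "\<Phi> ` carrier A = carrier (dual R J M)"
    and ker_\<Phi>: "\<And>a. \<lbrakk>a \<in> carrier A; \<And>m. m \<in> carrier M \<Longrightarrow> \<Phi> a m = \<zero>\<^bsub>J\<^esub>\<rbrakk> \<Longrightarrow> a \<in> \<alpha> ` carrier B"
    and \<Psi>: "\<Psi> ` carrier B = carrier (dual R J M')"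
    and \<Phi>_\<alpha>: "\<And>b m. \<lbrakk>b \<in> carrier B; m \<in> carrier M\<rbrakk> \<Longrightarrow> \<Phi> (\<alpha> b) m = \<Psi> b (\<mu> m)"
begin

abbreviation (input) "pairing \<equiv> coset_pairing (quot_mod G (\<gamma> ` carrier H)) \<Phi> \<delta>"

lemma coset_pairing_submodules: "submodule (\<alpha> ` carrier B) R A" "submodule (\<gamma> ` carrier H) R G"
  using mod_hom_image_submodule mods \<alpha> \<gamma> by blast+

text \<open>Both choices are harmless: \<open>\<delta>\<close> kills the image of
  \<open>\<gamma>\<close>, and changing \<open>a\<close> by \<open>\<alpha> b\<close> changes the
  value by \<open>\<Psi> b (\<mu> (\<delta> g))\<close>, which is zero because \<open>\<mu>\<close>
  kills the image of \<open>\<delta>\<close>.\<close>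

lemma coset_pairing_apply:
  assumes a: "a \<in> carrier A" and g: "g \<in> carrier G"
  shows "pairing (\<alpha> ` carrier B +>\<^bsub>A\<^esub> a) (\<gamma> ` carrier H +>\<^bsub>G\<^esub> g) = \<Phi> a (\<delta> g)"
proof -
  interpret J: module R J by (rule injective_module_module[OF J])
  interpret A: module R A by (rule mods)
  define a' where "a' = (SOME x. x \<in> \<alpha> ` carrier B +>\<^bsub>A\<^esub> a)"
  define g' where "g' = (SOME x. x \<in> \<gamma> ` carrier H +>\<^bsub>G\<^esub> g)"
  have a': "a' \<in> carrier A" "a' \<ominus>\<^bsub>A\<^esub> a \<in> \<alpha> ` carrier B"
    using some_rcos[OF mods(1) coset_pairing_submodules(1) a] rcos_eq_iff[OF mods(1) coset_pairing_submodules(1) _ a] unfolding a'_def by auto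
  have g': "g' \<in> carrier G" "g' \<ominus>\<^bsub>G\<^esub> g \<in> \<gamma> ` carrier H"
    using some_rcos[OF mods(3) coset_pairing_submodules(2) g] rcos_eq_iff[OF mods(3) coset_pairing_submodules(2) _ g] unfolding g'_def by auto
  interpret G: module R G by (rule mods)
  interpret M: module R M by (rule mods)
  have "\<delta> (g' \<ominus>\<^bsub>G\<^esub> g) = \<zero>\<^bsub>M\<^esub>" using ker_\<delta>[of "g' \<ominus>\<^bsub>G\<^esub> g"] g' g by simp
  then have "\<delta> g' \<ominus>\<^bsub>M\<^esub> \<delta> g = \<zero>\<^bsub>M\<^esub>" using mod_hom_minus[OF mods(3,5) \<delta> g'(1) g] by simp
  then have gg: "\<delta> g' = \<delta> g" using mod_hom_closed[OF \<delta> g] mod_hom_closed[OF \<delta> g'(1)] by (simp add: M.M.minus_eq_zero_iff)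
  have dg: "\<delta> g \<in> carrier M" by (rule mod_hom_closed[OF \<delta> g])
  obtain b where b: "b \<in> carrier B" "a' \<ominus>\<^bsub>A\<^esub> a = \<alpha> b" using a'(2) by blast
  have "\<Psi> b \<in> carrier (dual R J M')" using \<Psi> b(1) by blast
  then have \<Psi>b: "\<Psi> b \<in> mod_hom R M' J" by (simp add: dual_carrier)
  have "\<mu> (\<delta> g) = \<zero>\<^bsub>M'\<^esub>" using ker_\<mu>[OF dg] g by blast
  then have "\<Phi> (\<alpha> b) (\<delta> g) = \<zero>\<^bsub>J\<^esub>" using \<Phi>_\<alpha>[OF b(1) dg] mod_hom_zero[OF mods(6) injective_module_module[OF J] \<Psi>b] by simp
  then have "\<Phi> a' (\<delta> g) \<ominus>\<^bsub>J\<^esub> \<Phi> a (\<delta> g) = \<zero>\<^bsub>J\<^esub>"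
    using dual_hom_minus[OF mods(1) injective_module_module[OF J] mods(5) \<Phi> a'(1) a dg] b(2) by simp
  moreover have "\<Phi> a' (\<delta> g) \<in> carrier J" "\<Phi> a (\<delta> g) \<in> carrier J"
    using mod_hom_closed[OF dual_hom_closed[OF \<Phi>] dg] a a'(1) by blast+
  ultimately have "\<Phi> a' (\<delta> g) = \<Phi> a (\<delta> g)" by (simp add: J.M.minus_eq_zero_iff)
  then show ?thesis using g gg unfolding coset_pairing_def a'_def g'_def
    by (auto simp: quot_carrier[OF mods(3) coset_pairing_submodules(2)])
qed

text \<open>Injectivity rests on exactness at \<open>M\<close>, surjectivity on exactness at
  \<open>G\<close>; in each case a functional is extended along the next map of the
  sequence.\<close>

lemma coset_pairing_iso:
  "pairing \<in> mod_iso R (quot_mod A (\<alpha> ` carrier B)) (dual R J (quot_mod G (\<gamma> ` carrier H)))"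
proof -
  interpret J: module R J by (rule injective_module_module[OF J])
  interpret A: module R A by (rule mods)
  interpret G: module R G by (rule mods)
  let ?N = "\<alpha> ` carrier B" and ?N' = "\<gamma> ` carrier H"
  let ?Q = "quot_mod A ?N" and ?Q' = "quot_mod G ?N'"
  note QC = quot_carrier[OF mods(1) coset_pairing_submodules(1)] quot_carrier[OF mods(3) coset_pairing_submodules(2)]
  note QA = quot_add[OF mods(1) coset_pairing_submodules(1)] quot_add[OF mods(3) coset_pairing_submodules(2)]
  note QS = quot_smult[OF mods(1) coset_pairing_submodules(1)] quot_smult[OF mods(3) coset_pairing_submodules(2)]
  note app = coset_pairing_apply
  have ext: "pairing X \<in> extensional (carrier ?Q')" for X by (simp add: coset_pairing_def)
  have \<Phi>J: "\<Phi> a (\<delta> g) \<in> carrier J" if "a \<in> carrier A" "g \<in> carrier G" for a g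
    using mod_hom_closed[OF dual_hom_closed[OF \<Phi> that(1)] mod_hom_closed[OF \<delta> that(2)]] .
  have closed: "pairing (?N +>\<^bsub>A\<^esub> a) \<in> carrier (dual R J ?Q')" if a: "a \<in> carrier A" for a
  proof -
    note \<Phi>a = dual_hom_closed[OF \<Phi> a]
    have "pairing (?N +>\<^bsub>A\<^esub> a) \<in> mod_hom R ?Q' J"
    proof (rule mod_homI)
      show "pairing (?N +>\<^bsub>A\<^esub> a) X \<in> carrier J" if "X \<in> carrier ?Q'" for X
        using that a by (auto simp: QC app \<Phi>J)
    next
      fix X Y assume "X \<in> carrier ?Q'" "Y \<in> carrier ?Q'"
      then obtain g h where gh: "g \<in> carrier G" "h \<in> carrier G" "X = ?N' +>\<^bsub>G\<^esub> g" "Y = ?N' +>\<^bsub>G\<^esub> h" by (auto simp: QC)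
      then show "pairing (?N +>\<^bsub>A\<^esub> a) (X \<oplus>\<^bsub>?Q'\<^esub> Y) = pairing (?N +>\<^bsub>A\<^esub> a) X \<oplus>\<^bsub>J\<^esub> pairing (?N +>\<^bsub>A\<^esub> a) Y"
        using a by (simp add: QA app mod_hom_add[OF \<delta>] mod_hom_add[OF \<Phi>a] mod_hom_closed[OF \<delta>])
    next
      fix r X assume r: "r \<in> carrier R" and "X \<in> carrier ?Q'"
      then obtain g where g: "g \<in> carrier G" "X = ?N' +>\<^bsub>G\<^esub> g" by (auto simp: QC)
      then show "pairing (?N +>\<^bsub>A\<^esub> a) (r \<odot>\<^bsub>?Q'\<^esub> X) = r \<odot>\<^bsub>J\<^esub> pairing (?N +>\<^bsub>A\<^esub> a) X"
        using a r by (simp add: QS app mod_hom_smult[OF \<delta>] mod_hom_smult[OF \<Phi>a] mod_hom_closed[OF \<delta>])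
    qed
    then show ?thesis using ext by (simp add: dual_carrier)
  qed
  have eqI: "u = v" if "u \<in> extensional (carrier ?Q')" "v \<in> extensional (carrier ?Q')"
      "\<And>g. g \<in> carrier G \<Longrightarrow> u (?N' +>\<^bsub>G\<^esub> g) = v (?N' +>\<^bsub>G\<^esub> g)" for u v
    using that by (intro extensionalityI[OF that(1,2)]) (auto simp: QC)
  have dext: "u \<oplus>\<^bsub>dual R J ?Q'\<^esub> v \<in> extensional (carrier ?Q')" "r \<odot>\<^bsub>dual R J ?Q'\<^esub> u \<in> extensional (carrier ?Q')" for u v r
    by (simp_all add: dual_def)
  have "pairing \<in> mod_hom R ?Q (dual R J ?Q')"
  proof (rule mod_homI)
    show "pairing X \<in> carrier (dual R J ?Q')" if "X \<in> carrier ?Q" for X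
      using that closed by (auto simp: QC)
  next
    fix X Y assume "X \<in> carrier ?Q" "Y \<in> carrier ?Q"
    then obtain a b where ab: "a \<in> carrier A" "b \<in> carrier A" "X = ?N +>\<^bsub>A\<^esub> a" "Y = ?N +>\<^bsub>A\<^esub> b" by (auto simp: QC)
    show "pairing (X \<oplus>\<^bsub>?Q\<^esub> Y) = pairing X \<oplus>\<^bsub>dual R J ?Q'\<^esub> pairing Y"
    proof (rule eqI[OF ext dext(1)])
      fix g assume g: "g \<in> carrier G"
      then have "?N' +>\<^bsub>G\<^esub> g \<in> carrier ?Q'" by (auto simp: QC)
      then show "pairing (X \<oplus>\<^bsub>?Q\<^esub> Y) (?N' +>\<^bsub>G\<^esub> g) = (pairing X \<oplus>\<^bsub>dual R J ?Q'\<^esub> pairing Y) (?N' +>\<^bsub>G\<^esub> g)"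
        using ab g by (simp add: QA app dual_add dual_hom_add[OF \<Phi>] mod_hom_closed[OF \<delta>])
    qed
  next
    fix r X assume r: "r \<in> carrier R" and "X \<in> carrier ?Q"
    then obtain a where a: "a \<in> carrier A" "X = ?N +>\<^bsub>A\<^esub> a" by (auto simp: QC)
    show "pairing (r \<odot>\<^bsub>?Q\<^esub> X) = r \<odot>\<^bsub>dual R J ?Q'\<^esub> pairing X"
    proof (rule eqI[OF ext dext(2)])
      fix g assume g: "g \<in> carrier G"
      then have "?N' +>\<^bsub>G\<^esub> g \<in> carrier ?Q'" by (auto simp: QC)
      then show "pairing (r \<odot>\<^bsub>?Q\<^esub> X) (?N' +>\<^bsub>G\<^esub> g) = (r \<odot>\<^bsub>dual R J ?Q'\<^esub> pairing X) (?N' +>\<^bsub>G\<^esub> g)"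
        using a g r by (simp add: QS app dual_smult dual_hom_smult[OF \<Phi>] mod_hom_closed[OF \<delta>])
    qed
  qed
  moreover have "inj_on pairing (carrier ?Q)"
  proof (rule inj_onI)
    fix X Y assume "X \<in> carrier ?Q" "Y \<in> carrier ?Q" and eq: "pairing X = pairing Y"
    then obtain a b where ab: "a \<in> carrier A" "b \<in> carrier A" "X = ?N +>\<^bsub>A\<^esub> a" "Y = ?N +>\<^bsub>A\<^esub> b" by (auto simp: QC)
    let ?c = "a \<ominus>\<^bsub>A\<^esub> b"
    have c: "?c \<in> carrier A" using ab by simp
    have "\<Phi> ?c (\<delta> g) = \<zero>\<^bsub>J\<^esub>" if g: "g \<in> carrier G" for g
    proof -
      have "\<Phi> a (\<delta> g) = \<Phi> b (\<delta> g)" using app[OF ab(1) g] app[OF ab(2) g] eq ab(3,4) by simp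
      then show ?thesis
        using dual_hom_minus[OF mods(1) injective_module_module[OF J] mods(5) \<Phi> ab(1,2) mod_hom_closed[OF \<delta> g]] \<Phi>J[OF ab(2) g] by (simp add: J.M.minus_eq_zero_iff)
    qed
    \<comment> \<open>The functional \<open>\<Phi> ?c\<close> vanishes on the image of
      \<open>\<delta>\<close>, which is the kernel of \<open>\<mu>\<close>, so it extends along
      \<open>\<mu>\<close> to \<open>M'\<close>. The extension is some \<open>\<Psi> e\<close>, and
      then \<open>\<Phi>\<close> kills the difference of \<open>?c\<close> and
      \<open>\<alpha> e\<close>.\<close>
    then have "\<exists>w \<in> mod_hom R M' J. \<forall>m \<in> carrier M. w (\<mu> m) = \<Phi> ?c m"
      using ker_\<mu> by (intro injective_module_extend_along[OF J mods(5,6) \<mu> dual_hom_closed[OF \<Phi> c]]) auto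
    then obtain w where w: "w \<in> mod_hom R M' J" "\<And>m. m \<in> carrier M \<Longrightarrow> w (\<mu> m) = \<Phi> ?c m" by blast
    have "restrict w (carrier M') \<in> carrier (dual R J M')"
    proof -
      interpret M': module R M' by (rule mods)
      have "restrict w (carrier M') \<in> mod_hom R M' J"
        using w(1) by (intro mod_homI) (simp_all add: mod_hom_add mod_hom_smult mod_hom_closed)
      then show ?thesis by (simp add: dual_carrier)
    qed
    then obtain e where e: "e \<in> carrier B" "\<Psi> e = restrict w (carrier M')" using \<Psi> by (metis imageE)
    have "?c \<ominus>\<^bsub>A\<^esub> \<alpha> e \<in> ?N"
    proof (rule ker_\<Phi>)
      have ae: "\<alpha> e \<in> carrier A" by (rule mod_hom_closed[OF \<alpha> e(1)])
      show "?c \<ominus>\<^bsub>A\<^esub> \<alpha> e \<in> carrier A" using c ae by simp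
      fix m assume m: "m \<in> carrier M"
      have "\<Phi> (\<alpha> e) m = \<Phi> ?c m" using \<Phi>_\<alpha>[OF e(1) m] e(2) w(2)[OF m] mod_hom_closed[OF \<mu> m] by simp
      then show "\<Phi> (?c \<ominus>\<^bsub>A\<^esub> \<alpha> e) m = \<zero>\<^bsub>J\<^esub>"
        using dual_hom_minus[OF mods(1) injective_module_module[OF J] mods(5) \<Phi> c ae m] mod_hom_closed[OF dual_hom_closed[OF \<Phi> c] m] by (simp add: J.M.minus_eq_zero_iff)
    qed
    moreover have "\<alpha> e \<in> ?N" using e by blast
    ultimately have "(?c \<ominus>\<^bsub>A\<^esub> \<alpha> e) \<oplus>\<^bsub>A\<^esub> \<alpha> e \<in> ?N" using A.submoduleE(5)[OF coset_pairing_submodules(1)] by blast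
    then have "?c \<in> ?N"
      using c mod_hom_closed[OF \<alpha> e(1)] by (simp add: a_minus_def A.M.a_assoc A.M.l_neg)
    then show "X = Y" using rcos_eq_iff[OF mods(1) coset_pairing_submodules(1) ab(1,2)] ab(3,4) by simp
  qed
  moreover have "\<exists>X \<in> carrier ?Q. pairing X = v" if v: "v \<in> carrier (dual R J ?Q')" for v
  proof -
    have vh: "v \<in> mod_hom R ?Q' J" and ve: "v \<in> extensional (carrier ?Q')" using v by (simp_all add: dual_carrier)
    let ?t = "\<lambda>g. v (?N' +>\<^bsub>G\<^esub> g)"
    have cos: "?N' +>\<^bsub>G\<^esub> g \<in> carrier ?Q'" if "g \<in> carrier G" for g using that by (auto simp: QC)
    have t: "?t \<in> mod_hom R G J"
      by (rule mod_homI)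
        (simp_all add: cos mod_hom_closed[OF vh] flip: QA QS mod_hom_add[OF vh] mod_hom_smult[OF vh])
    \<comment> \<open>Pulled back to \<open>G\<close>, the functional \<open>v\<close> kills the
      image of \<open>\<gamma>\<close>, which is the kernel of \<open>\<delta>\<close>. It therefore
      extends along \<open>\<delta>\<close> to a functional on \<open>M\<close>, and
      \<open>\<Phi>\<close> hits that one.\<close>
    have "\<exists>w \<in> mod_hom R M J. \<forall>g \<in> carrier G. w (\<delta> g) = ?t g"
    proof (rule injective_module_extend_along[OF J mods(3,5) \<delta> t])
      fix g assume g: "g \<in> carrier G" "\<delta> g = \<zero>\<^bsub>M\<^esub>"
      have z: "\<ominus>\<^bsub>G\<^esub> \<zero>\<^bsub>G\<^esub> = \<zero>\<^bsub>G\<^esub>" by (rule G.M.minus_equality) simp_all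
      from g have "g \<ominus>\<^bsub>G\<^esub> \<zero>\<^bsub>G\<^esub> \<in> ?N'" using ker_\<delta>[OF g(1)] unfolding a_minus_def z by simp
      then have "?N' +>\<^bsub>G\<^esub> g = ?N' +>\<^bsub>G\<^esub> \<zero>\<^bsub>G\<^esub>" using rcos_eq_iff[OF mods(3) coset_pairing_submodules(2) g(1)] by simp
      then show "?t g = \<zero>\<^bsub>J\<^esub>" using mod_hom_zero[OF mods(3) injective_module_module[OF J] t] by simp
    qed
    then obtain w where w: "w \<in> mod_hom R M J" "\<And>g. g \<in> carrier G \<Longrightarrow> w (\<delta> g) = ?t g" by blast
    have "restrict w (carrier M) \<in> carrier (dual R J M)"
    proof -
      interpret M: module R M by (rule mods)
      have "restrict w (carrier M) \<in> mod_hom R M J"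
        using w(1) by (intro mod_homI) (simp_all add: mod_hom_add mod_hom_smult mod_hom_closed)
      then show ?thesis by (simp add: dual_carrier)
    qed
    then obtain a where a: "a \<in> carrier A" "\<Phi> a = restrict w (carrier M)" using \<Phi>_surj by (metis imageE)
    have "pairing (?N +>\<^bsub>A\<^esub> a) = v"
      by (rule eqI[OF ext ve]) (simp add: app[OF a(1)] a(2) w(2) mod_hom_closed[OF \<delta>])
    then show ?thesis using a(1) by (auto simp: QC)
  qed
  ultimately show ?thesis
    unfolding mod_iso_def bij_betw_def using mod_hom_closed[of pairing R ?Q "dual R J ?Q'"] by blast
qed

end

text \<open>Lets later arguments handle actual morphisms instead of stable classes: composed with
  the projection, \<open>\<phi>\<close> is still onto, and what it kills lies in
  \<open>N\<close>.\<close>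

lemma mod_iso_quot_lift:
  fixes R :: "('k, 'r) ring_scheme" and M :: "('k, 'a) module" and E :: "('k, 'e) module" and J :: "('k, 'j) module"
  assumes M: "module R M" and N: "submodule N R M" and J: "module R J" and E: "module R E"
    and \<phi>: "\<phi> \<in> mod_iso R (quot_mod M N) (dual R J E)"
  shows "(\<lambda>f. \<phi> (N +>\<^bsub>M\<^esub> f)) \<in> mod_hom R M (dual R J E)"
    and "(\<lambda>f. \<phi> (N +>\<^bsub>M\<^esub> f)) ` carrier M = carrier (dual R J E)"
    and "\<lbrakk>f \<in> carrier M; \<And>m. m \<in> carrier E \<Longrightarrow> \<phi> (N +>\<^bsub>M\<^esub> f) m = \<zero>\<^bsub>J\<^esub>\<rbrakk> \<Longrightarrow> f \<in> N"
proof -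
  interpret M: module R M by (rule M)
  note Q = quot_carrier[OF M N]
  have h: "\<phi> \<in> mod_hom R (quot_mod M N) (dual R J E)" and b: "bij_betw \<phi> (carrier (quot_mod M N)) (carrier (dual R J E))"
    using \<phi> by (simp_all add: mod_iso_def)
  have cl: "N +>\<^bsub>M\<^esub> f \<in> carrier (quot_mod M N)" if "f \<in> carrier M" for f using that by (auto simp: Q)
  show hom: "(\<lambda>f. \<phi> (N +>\<^bsub>M\<^esub> f)) \<in> mod_hom R M (dual R J E)"
  proof (rule mod_homI)
    show "\<phi> (N +>\<^bsub>M\<^esub> f) \<in> carrier (dual R J E)" if "f \<in> carrier M" for f by (rule mod_hom_closed[OF h cl[OF that]])
    show "\<phi> (N +>\<^bsub>M\<^esub> (f \<oplus>\<^bsub>M\<^esub> g)) = \<phi> (N +>\<^bsub>M\<^esub> f) \<oplus>\<^bsub>dual R J E\<^esub> \<phi> (N +>\<^bsub>M\<^esub> g)" if "f \<in> carrier M" "g \<in> carrier M" for f g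
      unfolding quot_add[OF M N that, symmetric] by (rule mod_hom_add[OF h cl[OF that(1)] cl[OF that(2)]])
    show "\<phi> (N +>\<^bsub>M\<^esub> (a \<odot>\<^bsub>M\<^esub> f)) = a \<odot>\<^bsub>dual R J E\<^esub> \<phi> (N +>\<^bsub>M\<^esub> f)" if "a \<in> carrier R" "f \<in> carrier M" for a f
      unfolding quot_smult[OF M N that, symmetric] by (rule mod_hom_smult[OF h that(1) cl[OF that(2)]])
  qed
  have "carrier (quot_mod M N) = (\<lambda>f. N +>\<^bsub>M\<^esub> f) ` carrier M" by (auto simp: Q)
  then show "(\<lambda>f. \<phi> (N +>\<^bsub>M\<^esub> f)) ` carrier M = carrier (dual R J E)"
    using bij_betw_imp_surj_on[OF b] by (simp add: image_image)
  assume f: "f \<in> carrier M" and z: "\<And>m. m \<in> carrier E \<Longrightarrow> \<phi> (N +>\<^bsub>M\<^esub> f) m = \<zero>\<^bsub>J\<^esub>"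
  \<comment> \<open>Functionals are compared pointwise: the class of zero takes the value zero
    everywhere, being its own multiple by the scalar zero.\<close>
  have z0: "\<phi> (N +>\<^bsub>M\<^esub> \<zero>\<^bsub>M\<^esub>) m = \<zero>\<^bsub>J\<^esub>" if m: "m \<in> carrier E" for m
  proof -
    interpret J: module R J by (rule J)
    have c: "\<phi> (N +>\<^bsub>M\<^esub> \<zero>\<^bsub>M\<^esub>) m \<in> carrier J" using mod_hom_closed[OF dual_hom_closed[OF hom M.M.zero_closed] m] .
    have "\<phi> (N +>\<^bsub>M\<^esub> (\<zero>\<^bsub>R\<^esub> \<odot>\<^bsub>M\<^esub> \<zero>\<^bsub>M\<^esub>)) m = \<zero>\<^bsub>R\<^esub> \<odot>\<^bsub>J\<^esub> \<phi> (N +>\<^bsub>M\<^esub> \<zero>\<^bsub>M\<^esub>) m"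
      by (rule dual_hom_smult[OF hom M.R.zero_closed M.M.zero_closed m])
    then show ?thesis using c by simp
  qed
  have "\<phi> (N +>\<^bsub>M\<^esub> f) = \<phi> (N +>\<^bsub>M\<^esub> \<zero>\<^bsub>M\<^esub>)"
  proof (rule extensionalityI[of _ "carrier E"])
    show "\<phi> (N +>\<^bsub>M\<^esub> f) \<in> extensional (carrier E)" "\<phi> (N +>\<^bsub>M\<^esub> \<zero>\<^bsub>M\<^esub>) \<in> extensional (carrier E)"
      using mod_hom_closed[OF h cl[OF f]] mod_hom_closed[OF h cl[OF M.M.zero_closed]] by (simp_all add: dual_carrier)
  qed (use z z0 in simp)
  then have "N +>\<^bsub>M\<^esub> f = N +>\<^bsub>M\<^esub> \<zero>\<^bsub>M\<^esub>"
    using inj_onD[OF bij_betw_imp_inj_on[OF b]] cl[OF f] cl[OF M.M.zero_closed] by blast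
  then have "f \<ominus>\<^bsub>M\<^esub> \<zero>\<^bsub>M\<^esub> \<in> N" using rcos_eq_iff[OF M N f M.M.zero_closed] by simp
  moreover have "\<ominus>\<^bsub>M\<^esub> \<zero>\<^bsub>M\<^esub> = \<zero>\<^bsub>M\<^esub>" by (rule M.M.minus_equality) simp_all
  ultimately show "f \<in> N" using f unfolding a_minus_def by simp
qed

section \<open>Linear categories\<close>

context linear_category
begin

lemma zero_Mor: "\<lbrakk>X \<in> Ob C; Y \<in> Ob C\<rbrakk> \<Longrightarrow> \<zero>\<^bsub>Hom C X Y\<^esub> \<in> Mor C X Y"
  using Hom_module[of X Y] by (meson abelian_group.axioms(1) abelian_monoid.zero_closed module.axioms(2))

lemma Hom_abelian_group: "\<lbrakk>X \<in> Ob C; Y \<in> Ob C\<rbrakk> \<Longrightarrow> abelian_group (Hom C X Y)"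
  using Hom_module[of X Y] by (simp add: module_def)

context
  fixes X Y assumes XY: "X \<in> Ob C" "Y \<in> Ob C"
begin

interpretation H: abelian_group "Hom C X Y" by (rule Hom_abelian_group[OF XY])

lemma Mor_closed:
  "\<lbrakk>f \<in> Mor C X Y; g \<in> Mor C X Y\<rbrakk> \<Longrightarrow> f \<oplus>\<^bsub>Hom C X Y\<^esub> g \<in> Mor C X Y"
  "\<lbrakk>f \<in> Mor C X Y; g \<in> Mor C X Y\<rbrakk> \<Longrightarrow> f \<ominus>\<^bsub>Hom C X Y\<^esub> g \<in> Mor C X Y"
  "f \<in> Mor C X Y \<Longrightarrow> \<ominus>\<^bsub>Hom C X Y\<^esub> f \<in> Mor C X Y"
  "\<lbrakk>a \<in> carrier R; f \<in> Mor C X Y\<rbrakk> \<Longrightarrow> a \<odot>\<^bsub>Hom C X Y\<^esub> f \<in> Mor C X Y"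
  using module.smult_closed[OF Hom_module[OF XY]] by auto

lemma Mor_add:
  "f \<in> Mor C X Y \<Longrightarrow> f \<oplus>\<^bsub>Hom C X Y\<^esub> \<zero>\<^bsub>Hom C X Y\<^esub> = f"
  "f \<in> Mor C X Y \<Longrightarrow> \<zero>\<^bsub>Hom C X Y\<^esub> \<oplus>\<^bsub>Hom C X Y\<^esub> f = f"
  "f \<in> Mor C X Y \<Longrightarrow> f \<oplus>\<^bsub>Hom C X Y\<^esub> \<ominus>\<^bsub>Hom C X Y\<^esub> f = \<zero>\<^bsub>Hom C X Y\<^esub>"
  "f \<in> Mor C X Y \<Longrightarrow> f \<ominus>\<^bsub>Hom C X Y\<^esub> f = \<zero>\<^bsub>Hom C X Y\<^esub>"
  "f \<in> Mor C X Y \<Longrightarrow> f \<ominus>\<^bsub>Hom C X Y\<^esub> \<zero>\<^bsub>Hom C X Y\<^esub> = f"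
  "f \<in> Mor C X Y \<Longrightarrow> \<zero>\<^bsub>Hom C X Y\<^esub> \<ominus>\<^bsub>Hom C X Y\<^esub> f = \<ominus>\<^bsub>Hom C X Y\<^esub> f"
  "\<lbrakk>f \<in> Mor C X Y; g \<in> Mor C X Y\<rbrakk> \<Longrightarrow> f \<ominus>\<^bsub>Hom C X Y\<^esub> g \<oplus>\<^bsub>Hom C X Y\<^esub> g = f"
  using H.add.inv_one by (auto simp: a_minus_def H.r_neg H.l_neg H.a_ac H.r_neg1 H.r_neg2)

lemma Mor_minus_eq_zero:
  "\<lbrakk>f \<in> Mor C X Y; g \<in> Mor C X Y\<rbrakk> \<Longrightarrow> f \<ominus>\<^bsub>Hom C X Y\<^esub> g = \<zero>\<^bsub>Hom C X Y\<^esub> \<longleftrightarrow> f = g"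
  by (rule H.minus_eq_zero_iff)

end

context
  fixes X Y Z assumes XYZ: "X \<in> Ob C" "Y \<in> Ob C" "Z \<in> Ob C"
begin

lemma Cmp_left:
  assumes "f \<in> Mor C X Y"
  shows "\<lbrakk>g \<in> Mor C Y Z; h \<in> Mor C Y Z\<rbrakk> \<Longrightarrow>
      Cmp C X Y Z (g \<oplus>\<^bsub>Hom C Y Z\<^esub> h) f = Cmp C X Y Z g f \<oplus>\<^bsub>Hom C X Z\<^esub> Cmp C X Y Z h f"
    and "\<lbrakk>g \<in> Mor C Y Z; h \<in> Mor C Y Z\<rbrakk> \<Longrightarrow>
      Cmp C X Y Z (g \<ominus>\<^bsub>Hom C Y Z\<^esub> h) f = Cmp C X Y Z g f \<ominus>\<^bsub>Hom C X Z\<^esub> Cmp C X Y Z h f"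
    and "g \<in> Mor C Y Z \<Longrightarrow> Cmp C X Y Z (\<ominus>\<^bsub>Hom C Y Z\<^esub> g) f = \<ominus>\<^bsub>Hom C X Z\<^esub> Cmp C X Y Z g f"
    and "Cmp C X Y Z \<zero>\<^bsub>Hom C Y Z\<^esub> f = \<zero>\<^bsub>Hom C X Z\<^esub>"
    and "\<lbrakk>a \<in> carrier R; g \<in> Mor C Y Z\<rbrakk> \<Longrightarrow> Cmp C X Y Z (a \<odot>\<^bsub>Hom C Y Z\<^esub> g) f = a \<odot>\<^bsub>Hom C X Z\<^esub> Cmp C X Y Z g f"
proof -
  note M = Hom_module[OF XYZ(2,3)] Hom_module[OF XYZ(1,3)]
  note l = Cmp_linear_left[OF XYZ assms]
  show "\<lbrakk>g \<in> Mor C Y Z; h \<in> Mor C Y Z\<rbrakk> \<Longrightarrow>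
      Cmp C X Y Z (g \<oplus>\<^bsub>Hom C Y Z\<^esub> h) f = Cmp C X Y Z g f \<oplus>\<^bsub>Hom C X Z\<^esub> Cmp C X Y Z h f"
    by (rule mod_hom_add[OF l])
  show "\<lbrakk>g \<in> Mor C Y Z; h \<in> Mor C Y Z\<rbrakk> \<Longrightarrow>
      Cmp C X Y Z (g \<ominus>\<^bsub>Hom C Y Z\<^esub> h) f = Cmp C X Y Z g f \<ominus>\<^bsub>Hom C X Z\<^esub> Cmp C X Y Z h f"
    by (rule mod_hom_minus[OF M l])
  show "g \<in> Mor C Y Z \<Longrightarrow> Cmp C X Y Z (\<ominus>\<^bsub>Hom C Y Z\<^esub> g) f = \<ominus>\<^bsub>Hom C X Z\<^esub> Cmp C X Y Z g f"
    by (rule mod_hom_a_inv[OF M l])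
  show "Cmp C X Y Z \<zero>\<^bsub>Hom C Y Z\<^esub> f = \<zero>\<^bsub>Hom C X Z\<^esub>"
    by (rule mod_hom_zero[OF M l])
  show "\<lbrakk>a \<in> carrier R; g \<in> Mor C Y Z\<rbrakk> \<Longrightarrow> Cmp C X Y Z (a \<odot>\<^bsub>Hom C Y Z\<^esub> g) f = a \<odot>\<^bsub>Hom C X Z\<^esub> Cmp C X Y Z g f"
    by (rule mod_hom_smult[OF l])
qed

lemma Cmp_right:
  assumes "g \<in> Mor C Y Z"
  shows "\<lbrakk>f \<in> Mor C X Y; h \<in> Mor C X Y\<rbrakk> \<Longrightarrow>
      Cmp C X Y Z g (f \<oplus>\<^bsub>Hom C X Y\<^esub> h) = Cmp C X Y Z g f \<oplus>\<^bsub>Hom C X Z\<^esub> Cmp C X Y Z g h"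
    and "\<lbrakk>f \<in> Mor C X Y; h \<in> Mor C X Y\<rbrakk> \<Longrightarrow>
      Cmp C X Y Z g (f \<ominus>\<^bsub>Hom C X Y\<^esub> h) = Cmp C X Y Z g f \<ominus>\<^bsub>Hom C X Z\<^esub> Cmp C X Y Z g h"
    and "f \<in> Mor C X Y \<Longrightarrow> Cmp C X Y Z g (\<ominus>\<^bsub>Hom C X Y\<^esub> f) = \<ominus>\<^bsub>Hom C X Z\<^esub> Cmp C X Y Z g f"
    and "Cmp C X Y Z g \<zero>\<^bsub>Hom C X Y\<^esub> = \<zero>\<^bsub>Hom C X Z\<^esub>"
    and "\<lbrakk>a \<in> carrier R; f \<in> Mor C X Y\<rbrakk> \<Longrightarrow> Cmp C X Y Z g (a \<odot>\<^bsub>Hom C X Y\<^esub> f) = a \<odot>\<^bsub>Hom C X Z\<^esub> Cmp C X Y Z g f"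
proof -
  note M = Hom_module[OF XYZ(1,2)] Hom_module[OF XYZ(1,3)]
  note l = Cmp_linear_right[OF XYZ assms]
  show "\<lbrakk>f \<in> Mor C X Y; h \<in> Mor C X Y\<rbrakk> \<Longrightarrow>
      Cmp C X Y Z g (f \<oplus>\<^bsub>Hom C X Y\<^esub> h) = Cmp C X Y Z g f \<oplus>\<^bsub>Hom C X Z\<^esub> Cmp C X Y Z g h"
    by (rule mod_hom_add[OF l])
  show "\<lbrakk>f \<in> Mor C X Y; h \<in> Mor C X Y\<rbrakk> \<Longrightarrow>
      Cmp C X Y Z g (f \<ominus>\<^bsub>Hom C X Y\<^esub> h) = Cmp C X Y Z g f \<ominus>\<^bsub>Hom C X Z\<^esub> Cmp C X Y Z g h"
    by (rule mod_hom_minus[OF M l])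
  show "f \<in> Mor C X Y \<Longrightarrow> Cmp C X Y Z g (\<ominus>\<^bsub>Hom C X Y\<^esub> f) = \<ominus>\<^bsub>Hom C X Z\<^esub> Cmp C X Y Z g f"
    by (rule mod_hom_a_inv[OF M l])
  show "Cmp C X Y Z g \<zero>\<^bsub>Hom C X Y\<^esub> = \<zero>\<^bsub>Hom C X Z\<^esub>"
    by (rule mod_hom_zero[OF M l])
  show "\<lbrakk>a \<in> carrier R; f \<in> Mor C X Y\<rbrakk> \<Longrightarrow> Cmp C X Y Z g (a \<odot>\<^bsub>Hom C X Y\<^esub> f) = a \<odot>\<^bsub>Hom C X Z\<^esub> Cmp C X Y Z g f"
    by (rule mod_hom_smult[OF l])
qed

end

text \<open>\<open>Cmp_assoc\<close> as a rewrite rule nests composites to the right and thereby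
  hides the left-hand side of a known equation \<open>h g = k\<close> inside \<open>h (g f)\<close>;
  this variant applies the equation there.\<close>

lemma Cmp_reassoc:
  assumes "Cmp C X Y Z h g = k"
    and "W \<in> Ob C" "X \<in> Ob C" "Y \<in> Ob C" "Z \<in> Ob C" "g \<in> Mor C X Y" "h \<in> Mor C Y Z" "f \<in> Mor C W X"
  shows "Cmp C W Y Z h (Cmp C W X Y g f) = Cmp C W X Z k f"
  using assms Cmp_assoc[of W X Y Z f g h] by simp

lemmas cat_simps = zero_Mor Mor_closed Mor_add Cmp_left Cmp_right Cmp_closed Idm_closed Cmp_Idm Idm_Cmp Cmp_assoc

section \<open>Kernels, cokernels and morphisms of short sequences\<close>

lemma kernel_factor:
  assumes "is_kernel C X E Y i d" "W \<in> Ob C" "f \<in> Mor C W E" "Cmp C W E Y d f = \<zero>\<^bsub>Hom C W Y\<^esub>"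
  obtains g where "g \<in> Mor C W X" "Cmp C W X E i g = f"
  using assms unfolding is_kernel_def by blast

text \<open>Both morphisms factor one and the same composite through the kernel, and such a
  factorisation is unique.\<close>

lemma kernel_mono:
  assumes k: "is_kernel C X E Y i d" and obs: "W \<in> Ob C" "X \<in> Ob C" "E \<in> Ob C" "Y \<in> Ob C"
    and mor: "i \<in> Mor C X E" "d \<in> Mor C E Y" "f \<in> Mor C W X" "g \<in> Mor C W X" and eq: "Cmp C W X E i f = Cmp C W X E i g"
  shows "f = g"
proof -
  have di: "Cmp C X E Y d i = \<zero>\<^bsub>Hom C X Y\<^esub>" using k by (simp add: is_kernel_def)
  have "Cmp C W E Y d (Cmp C W X E i g) = \<zero>\<^bsub>Hom C W Y\<^esub>"
    using Cmp_reassoc[OF di, of W g] obs mor by (simp add: cat_simps)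
  moreover have "Cmp C W X E i g \<in> Mor C W E" using obs mor by (simp add: cat_simps)
  ultimately have "\<exists>!h. h \<in> Mor C W X \<and> Cmp C W X E i h = Cmp C W X E i g"
    using k obs unfolding is_kernel_def by blast
  then show ?thesis using mor eq by blast
qed

lemma cokernel_factor:
  assumes "is_cokernel C X E Y i d" "W \<in> Ob C" "f \<in> Mor C E W" "Cmp C X E W f i = \<zero>\<^bsub>Hom C X W\<^esub>"
  obtains g where "g \<in> Mor C Y W" "Cmp C E Y W g d = f"
  using assms unfolding is_cokernel_def by blast

lemma cokernel_epi:
  assumes k: "is_cokernel C X E Y i d" and obs: "W \<in> Ob C" "X \<in> Ob C" "E \<in> Ob C" "Y \<in> Ob C"
    and mor: "i \<in> Mor C X E" "d \<in> Mor C E Y" "f \<in> Mor C Y W" "g \<in> Mor C Y W" and eq: "Cmp C E Y W f d = Cmp C E Y W g d"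
  shows "f = g"
proof -
  have di: "Cmp C X E Y d i = \<zero>\<^bsub>Hom C X Y\<^esub>" using k by (simp add: is_cokernel_def)
  have "Cmp C X E W (Cmp C E Y W g d) i = \<zero>\<^bsub>Hom C X W\<^esub>"
    using di obs mor by (simp add: cat_simps)
  moreover have "Cmp C E Y W g d \<in> Mor C E W" using obs mor by (simp add: cat_simps)
  ultimately have "\<exists>!h. h \<in> Mor C Y W \<and> Cmp C E Y W h d = Cmp C E Y W g d"
    using k obs unfolding is_cokernel_def by blast
  then show ?thesis using mor eq by blast
qed

lemma ses_mor_comp:
  assumes "ses_mor C \<xi> \<xi>' a b c" "ses_mor C \<xi>' \<xi>'' a' b' c'" "ses_in C \<xi>" "ses_in C \<xi>'" "ses_in C \<xi>''"
  shows "ses_mor C \<xi> \<xi>'' (Cmp C (lft \<xi>) (lft \<xi>') (lft \<xi>'') a' a) (Cmp C (mid \<xi>) (mid \<xi>') (mid \<xi>'') b' b)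
    (Cmp C (rgt \<xi>) (rgt \<xi>') (rgt \<xi>'') c' c)"
proof -
  note [simp] = cat_simps
  have [simp]: "lft \<xi> \<in> Ob C" "mid \<xi> \<in> Ob C" "rgt \<xi> \<in> Ob C" "lft \<xi>' \<in> Ob C" "mid \<xi>' \<in> Ob C" "rgt \<xi>' \<in> Ob C"
    "lft \<xi>'' \<in> Ob C" "mid \<xi>'' \<in> Ob C" "rgt \<xi>'' \<in> Ob C"
    "infl \<xi> \<in> Mor C (lft \<xi>) (mid \<xi>)" "defl \<xi> \<in> Mor C (mid \<xi>) (rgt \<xi>)"
    "infl \<xi>' \<in> Mor C (lft \<xi>') (mid \<xi>')" "defl \<xi>' \<in> Mor C (mid \<xi>') (rgt \<xi>')"
    "infl \<xi>'' \<in> Mor C (lft \<xi>'') (mid \<xi>'')" "defl \<xi>'' \<in> Mor C (mid \<xi>'') (rgt \<xi>'')"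
    using assms(3-5) by (auto simp: ses_in_def)
  have [simp]: "a \<in> Mor C (lft \<xi>) (lft \<xi>')" "b \<in> Mor C (mid \<xi>) (mid \<xi>')" "c \<in> Mor C (rgt \<xi>) (rgt \<xi>')"
    "a' \<in> Mor C (lft \<xi>') (lft \<xi>'')" "b' \<in> Mor C (mid \<xi>') (mid \<xi>'')" "c' \<in> Mor C (rgt \<xi>') (rgt \<xi>'')"
    using assms(1,2) by (auto simp: ses_mor_def)
  have e: "Cmp C (lft \<xi>) (mid \<xi>) (mid \<xi>') b (infl \<xi>) = Cmp C (lft \<xi>) (lft \<xi>') (mid \<xi>') (infl \<xi>') a"
    "Cmp C (mid \<xi>) (mid \<xi>') (rgt \<xi>') (defl \<xi>') b = Cmp C (mid \<xi>) (rgt \<xi>) (rgt \<xi>') c (defl \<xi>)"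
    "Cmp C (lft \<xi>') (mid \<xi>') (mid \<xi>'') b' (infl \<xi>') = Cmp C (lft \<xi>') (lft \<xi>'') (mid \<xi>'') (infl \<xi>'') a'"
    "Cmp C (mid \<xi>') (mid \<xi>'') (rgt \<xi>'') (defl \<xi>'') b' = Cmp C (mid \<xi>') (rgt \<xi>') (rgt \<xi>'') c' (defl \<xi>')"
    using assms(1,2) by (simp_all add: ses_mor_def)
  show ?thesis
    unfolding ses_mor_def by (simp add: e Cmp_reassoc[OF e(3)] Cmp_reassoc[OF e(4)])
qed

lemma ses_mor_Idm:
  assumes "ses_in C \<xi>"
  shows "ses_mor C \<xi> \<xi> (Idm C (lft \<xi>)) (Idm C (mid \<xi>)) (Idm C (rgt \<xi>))"
  using assms by (simp add: ses_mor_def ses_in_def cat_simps)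

section \<open>Ideals of morphisms and composition in the quotient category\<close>

definition hom_ideal :: "('o \<Rightarrow> 'o \<Rightarrow> 'm set) \<Rightarrow> bool"
  where "hom_ideal I \<longleftrightarrow>
    (\<forall>X\<in>Ob C. \<forall>Y\<in>Ob C. submodule (I X Y) R (Hom C X Y)) \<and>
    (\<forall>X\<in>Ob C. \<forall>Y\<in>Ob C. \<forall>Z\<in>Ob C. \<forall>f\<in>Mor C X Y. \<forall>t\<in>I Y Z. Cmp C X Y Z t f \<in> I X Z) \<and>
    (\<forall>X\<in>Ob C. \<forall>Y\<in>Ob C. \<forall>Z\<in>Ob C. \<forall>t\<in>I X Y. \<forall>g\<in>Mor C Y Z. Cmp C X Y Z g t \<in> I X Z)"

lemma hom_ideal_submodule: "\<lbrakk>hom_ideal I; X \<in> Ob C; Y \<in> Ob C\<rbrakk> \<Longrightarrow> submodule (I X Y) R (Hom C X Y)"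
  by (simp add: hom_ideal_def)

text \<open>A composite in \<open>quot_cat\<close> is a union over all representatives of both
  classes; closure of the ideal under composition on either side makes all members of the union the
  same coset.\<close>

lemma quot_Cmp:
  assumes I: "hom_ideal I" and ob: "X \<in> Ob C" "Y \<in> Ob C" "Z \<in> Ob C" and f: "f \<in> Mor C X Y" and g: "g \<in> Mor C Y Z"
  shows "Cmp (quot_cat C I) X Y Z (I Y Z +>\<^bsub>Hom C Y Z\<^esub> g) (I X Y +>\<^bsub>Hom C X Y\<^esub> f) = I X Z +>\<^bsub>Hom C X Z\<^esub> Cmp C X Y Z g f"
proof -
  note sub = hom_ideal_submodule[OF I]
  note M = Hom_module
  have "quot_map (Hom C X Z) (I X Z) (Cmp C X Y Z g') (I X Y +>\<^bsub>Hom C X Y\<^esub> f) = I X Z +>\<^bsub>Hom C X Z\<^esub> Cmp C X Y Z g f"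
    if "g' \<in> I Y Z +>\<^bsub>Hom C Y Z\<^esub> g" for g'
  proof -
    have g': "g' \<in> Mor C Y Z" "I Y Z +>\<^bsub>Hom C Y Z\<^esub> g' = I Y Z +>\<^bsub>Hom C Y Z\<^esub> g"
      using rcos_memD[OF M[OF ob(2,3)] sub[OF ob(2,3)] g that] by auto
    have "g' \<ominus>\<^bsub>Hom C Y Z\<^esub> g \<in> I Y Z" using rcos_eq_iff[OF M[OF ob(2,3)] sub[OF ob(2,3)] g'(1) g] g'(2) by simp
    then have "Cmp C X Y Z (g' \<ominus>\<^bsub>Hom C Y Z\<^esub> g) f \<in> I X Z" using I ob f unfolding hom_ideal_def by blast
    then have "Cmp C X Y Z g' f \<ominus>\<^bsub>Hom C X Z\<^esub> Cmp C X Y Z g f \<in> I X Z" using ob f g g' by (simp add: cat_simps)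
    then have "I X Z +>\<^bsub>Hom C X Z\<^esub> Cmp C X Y Z g' f = I X Z +>\<^bsub>Hom C X Z\<^esub> Cmp C X Y Z g f"
      using rcos_eq_iff[OF M[OF ob(1,3)] sub[OF ob(1,3)]] Cmp_closed[OF ob f g] Cmp_closed[OF ob f g'(1)] by simp
    moreover have "quot_map (Hom C X Z) (I X Z) (Cmp C X Y Z g') (I X Y +>\<^bsub>Hom C X Y\<^esub> f) = I X Z +>\<^bsub>Hom C X Z\<^esub> Cmp C X Y Z g' f"
    proof (rule quot_map_rcos[OF M[OF ob(1,3)] sub[OF ob(1,3)] M[OF ob(1,2)] sub[OF ob(1,2)] Cmp_linear_right[OF ob g'(1)] _ f])
      show "Cmp C X Y Z g' s \<in> I X Z" if "s \<in> I X Y" for s using I ob g'(1) that unfolding hom_ideal_def by blast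
    qed
    ultimately show ?thesis by simp
  qed
  then show ?thesis
    unfolding quot_cat_def kcat.simps by (intro UN_constant_eq[OF rcos_self[OF M[OF ob(2,3)] sub[OF ob(2,3)] g]] ballI)
qed

end

section \<open>The opposite exact category\<close>

definition op_ses :: "('o, 'm) ses \<Rightarrow> ('o, 'm) ses"
  where "op_ses \<xi> = \<lparr>lft = rgt \<xi>, mid = mid \<xi>, rgt = lft \<xi>, infl = defl \<xi>, defl = infl \<xi>\<rparr>"

text \<open>Interpreting \<open>exact_category\<close> in this category yields the dual of a result
  on conflations; as \<open>op_ses\<close> is an involution, the dual translates back to
  \<open>C\<close> by simplification.\<close>

definition op_cat :: "('o, 'm, 'k, 'z) excat_scheme \<Rightarrow> ('o, 'm, 'k) excat"
  where "op_cat C = \<lparr>Ob = Ob C, Hom = \<lambda>X Y. Hom C Y X, Idm = Idm C, Cmp = \<lambda>X Y Z g f. Cmp C Z Y X f g,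
    Conf = op_ses ` Conf C\<rparr>"

lemma op_ses_simps [simp]:
  "lft (op_ses \<xi>) = rgt \<xi>" "mid (op_ses \<xi>) = mid \<xi>" "rgt (op_ses \<xi>) = lft \<xi>"
  "infl (op_ses \<xi>) = defl \<xi>" "defl (op_ses \<xi>) = infl \<xi>" "op_ses (op_ses \<xi>) = \<xi>"
  by (simp_all add: op_ses_def)

lemma op_ses_image [simp]: "op_ses \<xi> \<in> op_ses ` S \<longleftrightarrow> \<xi> \<in> S"
  by (metis image_iff op_ses_simps(6))

lemma op_cat_simps [simp]:
  "Ob (op_cat C) = Ob C" "Hom (op_cat C) X Y = Hom C Y X" "Idm (op_cat C) = Idm C"
  "Cmp (op_cat C) X Y Z g f = Cmp C Z Y X f g" "Conf (op_cat C) = op_ses ` Conf C"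
  by (simp_all add: op_cat_def)

lemma op_is_iso: "is_iso (op_cat C) X Y f \<longleftrightarrow> is_iso C Y X f"
  by (auto simp: is_iso_def)

lemma op_direct_sum: "direct_sum C Xs S \<iota> \<pi> \<Longrightarrow> direct_sum (op_cat C) Xs S \<pi> \<iota>"
  unfolding direct_sum_def by (simp add: eq_commute)

lemma op_ses_in: "ses_in (op_cat C) (op_ses \<xi>) \<longleftrightarrow> ses_in C \<xi>"
  by (auto simp: ses_in_def)

lemma op_is_kernel: "is_kernel (op_cat C) Y E X d i \<longleftrightarrow> is_cokernel C X E Y i d"
  by (simp add: is_kernel_def is_cokernel_def)

lemma op_is_cokernel: "is_cokernel (op_cat C) Y E X d i \<longleftrightarrow> is_kernel C X E Y i d"
  by (simp add: is_kernel_def is_cokernel_def)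

lemma op_ses_mor: "ses_mor (op_cat C) (op_ses \<xi>) (op_ses \<xi>') c b a \<longleftrightarrow> ses_mor C \<xi>' \<xi> a b c"
  by (auto simp: ses_mor_def)

lemma op_inflation: "inflation (op_cat C) X E i \<longleftrightarrow> deflation C E X i"
  by (force simp: inflation_def deflation_def)

lemma op_deflation: "deflation (op_cat C) E Y d \<longleftrightarrow> inflation C Y E d"
  by (force simp: inflation_def deflation_def)

lemma op_is_pushout: "is_pushout (op_cat C) P A B Z p q f g \<longleftrightarrow> is_pullback C P A B Z p q f g"
  by (simp add: is_pushout_def is_pullback_def)

lemma op_is_pullback: "is_pullback (op_cat C) P A B Z p q f g \<longleftrightarrow> is_pushout C P A B Z p q f g"
  by (simp add: is_pushout_def is_pullback_def)

text \<open>Reversing arrows turns an isomorphism of sequences around, so closure of conflations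
  under isomorphism in the opposite category calls for the inverse triple.\<close>

lemma (in linear_category) ses_mor_inverse:
  assumes m: "ses_mor C \<xi> \<xi>' a b c" and "ses_in C \<xi>" "ses_in C \<xi>'"
    and iso: "Cmp C (lft \<xi>) (lft \<xi>') (lft \<xi>) a' a = Idm C (lft \<xi>)" "Cmp C (lft \<xi>') (lft \<xi>) (lft \<xi>') a a' = Idm C (lft \<xi>')"
      "Cmp C (mid \<xi>) (mid \<xi>') (mid \<xi>) b' b = Idm C (mid \<xi>)" "Cmp C (mid \<xi>') (mid \<xi>) (mid \<xi>') b b' = Idm C (mid \<xi>')"
      "Cmp C (rgt \<xi>) (rgt \<xi>') (rgt \<xi>) c' c = Idm C (rgt \<xi>)" "Cmp C (rgt \<xi>') (rgt \<xi>) (rgt \<xi>') c c' = Idm C (rgt \<xi>')"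
    and [simp]: "a' \<in> Mor C (lft \<xi>') (lft \<xi>)" "b' \<in> Mor C (mid \<xi>') (mid \<xi>)" "c' \<in> Mor C (rgt \<xi>') (rgt \<xi>)"
  shows "ses_mor C \<xi>' \<xi> a' b' c'"
proof -
  note [simp] = cat_simps
  have [simp]: "lft \<xi> \<in> Ob C" "mid \<xi> \<in> Ob C" "rgt \<xi> \<in> Ob C" "lft \<xi>' \<in> Ob C" "mid \<xi>' \<in> Ob C" "rgt \<xi>' \<in> Ob C"
    "infl \<xi> \<in> Mor C (lft \<xi>) (mid \<xi>)" "defl \<xi> \<in> Mor C (mid \<xi>) (rgt \<xi>)"
    "infl \<xi>' \<in> Mor C (lft \<xi>') (mid \<xi>')" "defl \<xi>' \<in> Mor C (mid \<xi>') (rgt \<xi>')"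
    using assms(2,3) by (auto simp: ses_in_def)
  have [simp]: "a \<in> Mor C (lft \<xi>) (lft \<xi>')" "b \<in> Mor C (mid \<xi>) (mid \<xi>')" "c \<in> Mor C (rgt \<xi>) (rgt \<xi>')"
    using m by (auto simp: ses_mor_def)
  have e: "Cmp C (lft \<xi>) (mid \<xi>) (mid \<xi>') b (infl \<xi>) = Cmp C (lft \<xi>) (lft \<xi>') (mid \<xi>') (infl \<xi>') a"
    "Cmp C (mid \<xi>) (mid \<xi>') (rgt \<xi>') (defl \<xi>') b = Cmp C (mid \<xi>) (rgt \<xi>) (rgt \<xi>') c (defl \<xi>)"
    using m by (simp_all add: ses_mor_def)
  have "Cmp C (lft \<xi>') (mid \<xi>') (mid \<xi>) b' (infl \<xi>') =
      Cmp C (lft \<xi>') (mid \<xi>') (mid \<xi>) b' (Cmp C (lft \<xi>') (lft \<xi>') (mid \<xi>') (infl \<xi>') (Cmp C (lft \<xi>') (lft \<xi>) (lft \<xi>') a a'))"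
    by (simp add: iso)
  also have "\<dots> = Cmp C (lft \<xi>') (mid \<xi>') (mid \<xi>) b' (Cmp C (lft \<xi>') (lft \<xi>) (mid \<xi>') (Cmp C (lft \<xi>) (mid \<xi>) (mid \<xi>') b (infl \<xi>)) a')"
    unfolding e by simp
  also have "\<dots> = Cmp C (lft \<xi>') (lft \<xi>) (mid \<xi>) (infl \<xi>) a'"
    by (simp add: Cmp_reassoc[OF iso(3)])
  finally have 1: "Cmp C (lft \<xi>') (mid \<xi>') (mid \<xi>) b' (infl \<xi>') = Cmp C (lft \<xi>') (lft \<xi>) (mid \<xi>) (infl \<xi>) a'" .
  have "Cmp C (mid \<xi>') (rgt \<xi>') (rgt \<xi>) c' (defl \<xi>') =
      Cmp C (mid \<xi>') (rgt \<xi>') (rgt \<xi>) c' (Cmp C (mid \<xi>') (mid \<xi>') (rgt \<xi>') (defl \<xi>') (Cmp C (mid \<xi>') (mid \<xi>) (mid \<xi>') b b'))"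
    by (simp add: iso)
  also have "\<dots> = Cmp C (mid \<xi>') (rgt \<xi>') (rgt \<xi>) c' (Cmp C (mid \<xi>') (mid \<xi>) (rgt \<xi>') (Cmp C (mid \<xi>) (mid \<xi>') (rgt \<xi>') (defl \<xi>') b) b')"
    by simp
  also have "\<dots> = Cmp C (mid \<xi>') (mid \<xi>) (rgt \<xi>) (defl \<xi>) b'"
    unfolding e by (simp add: Cmp_reassoc[OF iso(5)])
  finally show ?thesis using 1 by (simp add: ses_mor_def)
qed

lemma (in linear_category) is_iso_inverse:
  assumes "is_iso C X Y f"
  obtains g where "g \<in> Mor C Y X" "Cmp C X Y X g f = Idm C X" "Cmp C Y X Y f g = Idm C Y" "is_iso C Y X g"
  using assms unfolding is_iso_def by blast

lemma (in exact_category) op_exact_category: "exact_category R (op_cat C)"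
proof (intro exact_category.intro additive_category.intro linear_category.intro)
  show "cring R" ..
  show "linear_category_axioms R (op_cat C)"
    by (rule linear_category_axioms.intro)
      (simp_all add: Hom_module Idm_closed Cmp_closed Cmp_Idm Idm_Cmp Cmp_assoc Cmp_linear_left Cmp_linear_right)
  show "additive_category_axioms (op_cat C)"
  proof (rule additive_category_axioms.intro)
    fix Xs assume "set Xs \<subseteq> Ob (op_cat C)"
    then have "set Xs \<subseteq> Ob C" by simp
    from direct_sums[OF this] obtain S \<iota> \<pi> where "direct_sum C Xs S \<iota> \<pi>" by blast
    from op_direct_sum[OF this] show "\<exists>S \<iota> \<pi>. direct_sum (op_cat C) Xs S \<iota> \<pi>" by (intro exI)
  qed
  show "exact_category_axioms (op_cat C)"
  proof (rule exact_category_axioms.intro)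
    fix \<eta> assume "\<eta> \<in> Conf (op_cat C)"
    then obtain \<xi> where \<xi>: "\<xi> \<in> Conf C" "\<eta> = op_ses \<xi>" by auto
    show "ses_in (op_cat C) \<eta>" using conf_ses \<xi> by (simp add: op_ses_in)
    show "is_kernel (op_cat C) (lft \<eta>) (mid \<eta>) (rgt \<eta>) (infl \<eta>) (defl \<eta>)"
      using conf_cokernel \<xi> by (simp add: op_is_kernel)
    show "is_cokernel (op_cat C) (lft \<eta>) (mid \<eta>) (rgt \<eta>) (infl \<eta>) (defl \<eta>)"
      using conf_kernel \<xi> by (simp add: op_is_cokernel)
    fix \<eta>' a b c
    assume "ses_in (op_cat C) \<eta>'" "ses_mor (op_cat C) \<eta> \<eta>' a b c"
      and i: "is_iso (op_cat C) (lft \<eta>) (lft \<eta>') a" "is_iso (op_cat C) (mid \<eta>) (mid \<eta>') b" "is_iso (op_cat C) (rgt \<eta>) (rgt \<eta>') c"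
    moreover obtain \<xi>' where \<xi>': "\<eta>' = op_ses \<xi>'" using op_ses_simps(6) by metis
    ultimately have m: "ses_mor C \<xi>' \<xi> c b a" and s: "ses_in C \<xi>'" using \<xi> by (simp_all add: op_ses_mor op_ses_in)
    obtain a' where a': "a' \<in> Mor C (rgt \<xi>) (rgt \<xi>')" "Cmp C (rgt \<xi>') (rgt \<xi>) (rgt \<xi>') a' a = Idm C (rgt \<xi>')"
        "Cmp C (rgt \<xi>) (rgt \<xi>') (rgt \<xi>) a a' = Idm C (rgt \<xi>)" "is_iso C (rgt \<xi>) (rgt \<xi>') a'"
      using is_iso_inverse i(1) \<xi> \<xi>' by (metis op_is_iso op_ses_simps(1))
    obtain b' where b': "b' \<in> Mor C (mid \<xi>) (mid \<xi>')" "Cmp C (mid \<xi>') (mid \<xi>) (mid \<xi>') b' b = Idm C (mid \<xi>')"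
        "Cmp C (mid \<xi>) (mid \<xi>') (mid \<xi>) b b' = Idm C (mid \<xi>)" "is_iso C (mid \<xi>) (mid \<xi>') b'"
      using is_iso_inverse i(2) \<xi> \<xi>' by (metis op_is_iso op_ses_simps(2))
    obtain c' where c': "c' \<in> Mor C (lft \<xi>) (lft \<xi>')" "Cmp C (lft \<xi>') (lft \<xi>) (lft \<xi>') c' c = Idm C (lft \<xi>')"
        "Cmp C (lft \<xi>) (lft \<xi>') (lft \<xi>) c c' = Idm C (lft \<xi>)" "is_iso C (lft \<xi>) (lft \<xi>') c'"
      using is_iso_inverse i(3) \<xi> \<xi>' by (metis op_is_iso op_ses_simps(3))
    have "ses_mor C \<xi> \<xi>' c' b' a'"
      by (rule ses_mor_inverse[OF m s conf_ses[OF \<xi>(1)] c'(2,3) b'(2,3) a'(2,3) c'(1) b'(1) a'(1)])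
    then have "\<xi>' \<in> Conf C" using conf_iso[OF \<xi>(1) s] a' b' c' by blast
    then show "\<eta>' \<in> Conf (op_cat C)" using \<xi>' by simp
  next
    fix X E i X' f assume "inflation (op_cat C) X E i" "X' \<in> Ob (op_cat C)" "f \<in> Mor (op_cat C) X X'"
    then show "\<exists>P p q. is_pushout (op_cat C) P E X' X p q i f \<and> inflation (op_cat C) X' P q"
      using deflation_pullback by (simp add: op_inflation op_is_pushout)
  next
    fix E Y d Y' f assume "deflation (op_cat C) E Y d" "Y' \<in> Ob (op_cat C)" "f \<in> Mor (op_cat C) Y' Y"
    then show "\<exists>P p q. is_pullback (op_cat C) P E Y' Y p q d f \<and> deflation (op_cat C) P Y' q"
      using inflation_pushout by (simp add: op_deflation op_is_pullback)
  qed (simp_all add: op_inflation op_deflation inflation_Idm deflation_Idm inflation_Cmp deflation_Cmp)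
qed

section \<open>Pushouts and pullbacks of conflations and the five lemma\<close>

context exact_category
begin

lemma deflation_kernel:
  assumes "deflation C E Y d"
  obtains X i where "X \<in> Ob C" "i \<in> Mor C X E" "is_kernel C X E Y i d" "is_cokernel C X E Y i d"
    "\<lparr>lft = X, mid = E, rgt = Y, infl = i, defl = d\<rparr> \<in> Conf C" "E \<in> Ob C" "Y \<in> Ob C" "d \<in> Mor C E Y"
proof -
  obtain \<xi> where \<xi>: "\<xi> \<in> Conf C" "mid \<xi> = E" "rgt \<xi> = Y" "defl \<xi> = d"
    using assms by (auto simp: deflation_def)
  then have eq: "\<lparr>lft = lft \<xi>, mid = E, rgt = Y, infl = infl \<xi>, defl = d\<rparr> = \<xi>" by auto
  show thesis
    using that[of "lft \<xi>" "infl \<xi>"] conf_ses[OF \<xi>(1)] conf_kernel[OF \<xi>(1)] conf_cokernel[OF \<xi>(1)] \<xi>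
    unfolding eq by (simp add: ses_in_def)
qed

text \<open>
  The pushout property is checked after pulling back \<open>d\<close> along \<open>d'\<close>: on the pullback \<open>P\<close> the
  difference \<open>q - h p\<close> factors as \<open>i' r\<close>, and \<open>k p + b r\<close> descends along the deflation \<open>q : P \<rightarrow> E'\<close>.
\<close>

lemma pushout_factor:
  assumes defl: "deflation C E Z d" and ker: "is_kernel C A E Z i d" and ker': "is_kernel C A' E' Z i' d'"
    and [simp]: "A \<in> Ob C" "E \<in> Ob C" "Z \<in> Ob C" "A' \<in> Ob C" "E' \<in> Ob C" "F \<in> Ob C"
      "i \<in> Mor C A E" "d \<in> Mor C E Z" "i' \<in> Mor C A' E'" "d' \<in> Mor C E' Z"
      "a \<in> Mor C A A'" "h \<in> Mor C E E'" "k \<in> Mor C E F" "b \<in> Mor C A' F"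
    and hi: "Cmp C A E E' h i = Cmp C A A' E' i' a" and dh: "Cmp C E E' Z d' h = d"
    and ki: "Cmp C A E F k i = Cmp C A A' F b a"
  shows "\<exists>k' \<in> Mor C E' F. Cmp C E E' F k' h = k \<and> Cmp C A' E' F k' i' = b"
proof -
  note [simp] = cat_simps
  have di': "Cmp C A' E' Z d' i' = \<zero>\<^bsub>Hom C A' Z\<^esub>" using ker' by (simp add: is_kernel_def)
  obtain P p q where pb: "is_pullback C P E E' Z p q d d'" and q: "deflation C P E' q"
    using deflation_pullback[OF defl \<open>E' \<in> Ob C\<close> \<open>d' \<in> Mor C E' Z\<close>] by blast
  have [simp]: "P \<in> Ob C" "p \<in> Mor C P E" "q \<in> Mor C P E'" and dpq: "Cmp C P E Z d p = Cmp C P E' Z d' q"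
    using pb by (auto simp: is_pullback_def)
  obtain L j where [simp]: "L \<in> Ob C" "j \<in> Mor C L P" and kerq: "is_kernel C L P E' j q" and cok: "is_cokernel C L P E' j q"
    using deflation_kernel[OF q] by metis
  have qj: "Cmp C L P E' q j = \<zero>\<^bsub>Hom C L E'\<^esub>" using kerq by (simp add: is_kernel_def)
  let ?x = "q \<ominus>\<^bsub>Hom C P E'\<^esub> Cmp C P E E' h p"
  have "Cmp C P E' Z d' ?x = \<zero>\<^bsub>Hom C P Z\<^esub>" by (simp add: Cmp_reassoc[OF dh] dpq)
  then obtain r where [simp]: "r \<in> Mor C P A'" and r: "Cmp C P A' E' i' r = ?x"
    using kernel_factor[OF ker', of P ?x] by (metis \<open>P \<in> Ob C\<close> \<open>p \<in> Mor C P E\<close> \<open>q \<in> Mor C P E'\<close> \<open>E \<in> Ob C\<close> \<open>E' \<in> Ob C\<close> \<open>h \<in> Mor C E E'\<close> Cmp_closed Mor_closed(2))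
  let ?t = "Cmp C P E F k p \<oplus>\<^bsub>Hom C P F\<^esub> Cmp C P A' F b r"
  \<comment> \<open>Vanishing on the kernel \<open>j\<close> of \<open>q\<close>: there
    \<open>p j = i v\<close>, which forces \<open>r j = - a v\<close>, and the two summands of
    \<open>?t\<close> cancel by \<open>ki\<close>.\<close>
  have "Cmp C L E Z d (Cmp C L P E p j) = \<zero>\<^bsub>Hom C L Z\<^esub>"
    by (simp add: Cmp_reassoc[OF dpq] qj)
  then obtain v where [simp]: "v \<in> Mor C L A" and v: "Cmp C L A E i v = Cmp C L P E p j"
    using kernel_factor[OF ker, of L "Cmp C L P E p j"] by (metis Cmp_closed \<open>L \<in> Ob C\<close> \<open>P \<in> Ob C\<close> \<open>E \<in> Ob C\<close> \<open>j \<in> Mor C L P\<close> \<open>p \<in> Mor C P E\<close>)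
  have "Cmp C L A' E' i' (Cmp C L P A' r j) = Cmp C L A' E' i' (\<ominus>\<^bsub>Hom C L A'\<^esub> Cmp C L A A' a v)"
    by (simp add: Cmp_reassoc[OF r] qj v[symmetric] Cmp_reassoc[OF hi])
  then have rj: "Cmp C L P A' r j = \<ominus>\<^bsub>Hom C L A'\<^esub> Cmp C L A A' a v"
    by - (rule kernel_mono[OF ker', where W = "L"], simp_all)
  have "Cmp C L P F ?t j = \<zero>\<^bsub>Hom C L F\<^esub>"
    by (simp add: rj v[symmetric] Cmp_reassoc[OF ki])
  moreover have "?t \<in> Mor C P F" by simp
  ultimately obtain k' where [simp]: "k' \<in> Mor C E' F" and k': "Cmp C P E' F k' q = ?t"
    using cokernel_factor[OF cok \<open>F \<in> Ob C\<close>] by blast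
  have ex: "\<exists>w. w \<in> Mor C W P \<and> Cmp C W P E p w = u \<and> Cmp C W P E' q w = v"
    if "W \<in> Ob C" "u \<in> Mor C W E" "v \<in> Mor C W E'" "Cmp C W E Z d u = Cmp C W E' Z d' v" for W u v
    using pb that unfolding is_pullback_def by blast
  \<comment> \<open>Two test morphisms into the pullback recover the required equations. The one
    with components the identity and \<open>h\<close> has \<open>r w = 0\<close> and gives
    \<open>k' h = k\<close>; the one with components zero and \<open>i'\<close> has
    \<open>r z = 1\<close> and gives \<open>k' i' = b\<close>.\<close>
  obtain w where [simp]: "w \<in> Mor C E P" and w: "Cmp C E P E p w = Idm C E" "Cmp C E P E' q w = h"
    using ex[of E "Idm C E" h] by (auto simp: dh)
  have "Cmp C E A' E' i' (Cmp C E P A' r w) = Cmp C E A' E' i' \<zero>\<^bsub>Hom C E A'\<^esub>"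
    by (simp add: Cmp_reassoc[OF r] w)
  then have rw: "Cmp C E P A' r w = \<zero>\<^bsub>Hom C E A'\<^esub>"
    by - (rule kernel_mono[OF ker', where W = "E"], simp_all)
  have 1: "Cmp C E E' F k' h = k"
    using Cmp_reassoc[OF k', of E w] by (simp add: w rw)
  obtain z where [simp]: "z \<in> Mor C A' P" and z: "Cmp C A' P E p z = \<zero>\<^bsub>Hom C A' E\<^esub>" "Cmp C A' P E' q z = i'"
    using ex[of A' "\<zero>\<^bsub>Hom C A' E\<^esub>" i'] by (auto simp: di')
  have "Cmp C A' A' E' i' (Cmp C A' P A' r z) = Cmp C A' A' E' i' (Idm C A')"
    by (simp add: Cmp_reassoc[OF r] z)
  then have rz: "Cmp C A' P A' r z = Idm C A'"
    by - (rule kernel_mono[OF ker', where W = "A'"], simp_all)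
  have 2: "Cmp C A' E' F k' i' = b"
    using Cmp_reassoc[OF k', of A' z] by (simp add: z rz)
  show ?thesis using 1 2 by (intro bexI[of _ k']) auto
qed

lemma pullback_factor:
  assumes infl: "inflation C Z E i" and cok: "is_cokernel C Z E A i d" and cok': "is_cokernel C Z E' A' i' d'"
    and mem: "A \<in> Ob C" "E \<in> Ob C" "Z \<in> Ob C" "A' \<in> Ob C" "E' \<in> Ob C" "F \<in> Ob C"
      "i \<in> Mor C Z E" "d \<in> Mor C E A" "i' \<in> Mor C Z E'" "d' \<in> Mor C E' A'"
      "a \<in> Mor C A' A" "h \<in> Mor C E' E" "k \<in> Mor C F E" "b \<in> Mor C F A'"
    and eq: "Cmp C E' E A d h = Cmp C E' A' A a d'" "Cmp C Z E' E h i' = i" "Cmp C F E A d k = Cmp C F A' A a b"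
  shows "\<exists>k' \<in> Mor C F E'. Cmp C F E' E h k' = k \<and> Cmp C F E' A' d' k' = b"
proof -
  interpret op: exact_category R "op_cat C" by (rule op_exact_category)
  show ?thesis
    using op.pushout_factor[of E Z i A d A' E' d' i' F a h k b] infl cok cok' mem eq
    by (simp add: op_is_kernel op_deflation)
qed

text \<open>The difference \<open>u - v\<close> kills \<open>i'\<close> and hence factors as
  \<open>w' d'\<close>. Then \<open>w' d = (u - v) h = 0\<close>, and \<open>d\<close> is
  epic.\<close>

lemma pushout_joint_epi:
  assumes cok: "is_cokernel C A E Z i d" and cok': "is_cokernel C A' E' Z i' d'"
    and [simp]: "A \<in> Ob C" "E \<in> Ob C" "Z \<in> Ob C" "A' \<in> Ob C" "E' \<in> Ob C" "F \<in> Ob C"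
      "i \<in> Mor C A E" "d \<in> Mor C E Z" "i' \<in> Mor C A' E'" "d' \<in> Mor C E' Z"
      "h \<in> Mor C E E'" "u \<in> Mor C E' F" "v \<in> Mor C E' F"
    and dh: "Cmp C E E' Z d' h = d"
    and uv: "Cmp C E E' F u h = Cmp C E E' F v h" "Cmp C A' E' F u i' = Cmp C A' E' F v i'"
  shows "u = v"
proof -
  note [simp] = cat_simps
  let ?w = "u \<ominus>\<^bsub>Hom C E' F\<^esub> v"
  have "Cmp C A' E' F ?w i' = \<zero>\<^bsub>Hom C A' F\<^esub>" by (simp add: uv)
  then obtain w' where [simp]: "w' \<in> Mor C Z F" and w': "Cmp C E' Z F w' d' = ?w"
    using cokernel_factor[OF cok' \<open>F \<in> Ob C\<close>, of ?w] by (auto simp: Mor_closed)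
  have "Cmp C E Z F w' d = Cmp C E E' F (Cmp C E' Z F w' d') h" by (simp add: dh)
  also have "\<dots> = Cmp C E Z F \<zero>\<^bsub>Hom C Z F\<^esub> d" unfolding w' by (simp add: uv)
  finally have "w' = \<zero>\<^bsub>Hom C Z F\<^esub>" by - (rule cokernel_epi[OF cok, where W = F], simp_all)
  then have "?w = \<zero>\<^bsub>Hom C E' F\<^esub>" using w' by simp
  then show ?thesis by (simp add: Mor_minus_eq_zero)
qed

lemma conf_Ob:
  assumes "\<xi> \<in> Conf C"
  shows "lft \<xi> \<in> Ob C" "mid \<xi> \<in> Ob C" "rgt \<xi> \<in> Ob C"
    "infl \<xi> \<in> Mor C (lft \<xi>) (mid \<xi>)" "defl \<xi> \<in> Mor C (mid \<xi>) (rgt \<xi>)"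
    "Cmp C (lft \<xi>) (mid \<xi>) (rgt \<xi>) (defl \<xi>) (infl \<xi>) = \<zero>\<^bsub>Hom C (lft \<xi>) (rgt \<xi>)\<^esub>"
    "inflation C (lft \<xi>) (mid \<xi>) (infl \<xi>)" "deflation C (mid \<xi>) (rgt \<xi>) (defl \<xi>)"
  using conf_ses[OF assms] conf_kernel[OF assms] assms
  by (auto simp: ses_in_def is_kernel_def inflation_def deflation_def)

lemma ses_morD:
  assumes "ses_mor C \<xi> \<xi>' a b c"
  shows "a \<in> Mor C (lft \<xi>) (lft \<xi>')" "b \<in> Mor C (mid \<xi>) (mid \<xi>')" "c \<in> Mor C (rgt \<xi>) (rgt \<xi>')"
    "Cmp C (lft \<xi>) (mid \<xi>) (mid \<xi>') b (infl \<xi>) = Cmp C (lft \<xi>) (lft \<xi>') (mid \<xi>') (infl \<xi>') a"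
    "Cmp C (mid \<xi>) (mid \<xi>') (rgt \<xi>') (defl \<xi>') b = Cmp C (mid \<xi>) (rgt \<xi>) (rgt \<xi>') c (defl \<xi>)"
  using assms by (auto simp: ses_mor_def)

lemma conf_mor_comp:
  assumes "ses_mor C \<xi> \<xi>' a b c" "ses_mor C \<xi>' \<xi>'' a' b' c'" "\<xi> \<in> Conf C" "\<xi>' \<in> Conf C" "\<xi>'' \<in> Conf C"
  shows "ses_mor C \<xi> \<xi>'' (Cmp C (lft \<xi>) (lft \<xi>') (lft \<xi>'') a' a) (Cmp C (mid \<xi>) (mid \<xi>') (mid \<xi>'') b' b)
    (Cmp C (rgt \<xi>) (rgt \<xi>') (rgt \<xi>'') c' c)"
  by (rule ses_mor_comp[OF assms(1,2) conf_ses[OF assms(3)] conf_ses[OF assms(4)] conf_ses[OF assms(5)]])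

text \<open>An identity on the right end makes the left square a pushout, so the middle component
  \<open>k\<close> descends to \<open>mid \<eta>\<close>. The right square of the new morphism is
  checked on the jointly epic pair \<open>h\<close>, \<open>infl \<eta>\<close>.\<close>

lemma ses_mor_pushout_factor:
  assumes conf: "\<rho> \<in> Conf C" "\<eta> \<in> Conf C" "\<zeta> \<in> Conf C" and rgt: "rgt \<eta> = rgt \<rho>"
    and h: "ses_mor C \<rho> \<eta> a h (Idm C (rgt \<rho>))" and k: "ses_mor C \<rho> \<zeta> (Cmp C (lft \<rho>) (lft \<eta>) (lft \<zeta>) b a) k c"
    and b: "b \<in> Mor C (lft \<eta>) (lft \<zeta>)"
  shows "\<exists>k'. ses_mor C \<eta> \<zeta> b k' c \<and> Cmp C (mid \<rho>) (mid \<eta>) (mid \<zeta>) k' h = k"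
proof -
  note [simp] = cat_simps
  note [simp] = conf_Ob(1-6)[OF conf(1)] conf_Ob(1-4)[OF conf(2)] conf_Ob(5,6)[OF conf(2), unfolded rgt] conf_Ob(1-6)[OF conf(3)]
  note [simp] = b ses_morD(1-3)[OF h, unfolded rgt] ses_morD(1-3)[OF k]
  note hD = ses_morD(4,5)[OF h, unfolded rgt, simplified]
  note kD = ses_morD(4,5)[OF k]
  have "\<exists>k' \<in> Mor C (mid \<eta>) (mid \<zeta>). Cmp C (mid \<rho>) (mid \<eta>) (mid \<zeta>) k' h = k \<and>
      Cmp C (lft \<eta>) (mid \<eta>) (mid \<zeta>) k' (infl \<eta>) = Cmp C (lft \<eta>) (lft \<zeta>) (mid \<zeta>) (infl \<zeta>) b"
  proof (rule pushout_factor[OF conf_Ob(8)[OF conf(1)] conf_kernel[OF conf(1)] conf_kernel[OF conf(2), unfolded rgt]])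
    show "Cmp C (lft \<rho>) (mid \<rho>) (mid \<zeta>) k (infl \<rho>) =
        Cmp C (lft \<rho>) (lft \<eta>) (mid \<zeta>) (Cmp C (lft \<eta>) (lft \<zeta>) (mid \<zeta>) (infl \<zeta>) b) a"
      by (simp add: kD)
  qed (use hD in simp_all)
  then obtain k' where [simp]: "k' \<in> Mor C (mid \<eta>) (mid \<zeta>)" and k': "Cmp C (mid \<rho>) (mid \<eta>) (mid \<zeta>) k' h = k"
      "Cmp C (lft \<eta>) (mid \<eta>) (mid \<zeta>) k' (infl \<eta>) = Cmp C (lft \<eta>) (lft \<zeta>) (mid \<zeta>) (infl \<zeta>) b" by blast
  have "Cmp C (mid \<eta>) (mid \<zeta>) (rgt \<zeta>) (defl \<zeta>) k' = Cmp C (mid \<eta>) (rgt \<rho>) (rgt \<zeta>) c (defl \<eta>)"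
    by (rule pushout_joint_epi[OF conf_cokernel[OF conf(1)] conf_cokernel[OF conf(2), unfolded rgt], where F = "rgt \<zeta>" and h = h])
      (simp_all add: hD k' kD Cmp_reassoc[OF conf_Ob(6)[OF conf(3)]])
  then show ?thesis using k' by (intro exI[of _ k']) (simp add: ses_mor_def rgt)
qed

lemma ses_mor_pullback_factor:
  assumes conf: "\<rho> \<in> Conf C" "\<eta> \<in> Conf C" "\<zeta> \<in> Conf C" and lft: "lft \<eta> = lft \<rho>"
    and h: "ses_mor C \<eta> \<rho> (Idm C (lft \<rho>)) h a" and k: "ses_mor C \<zeta> \<rho> c k (Cmp C (rgt \<zeta>) (rgt \<eta>) (rgt \<rho>) a b)"
    and b: "b \<in> Mor C (rgt \<zeta>) (rgt \<eta>)"
  shows "\<exists>k'. ses_mor C \<zeta> \<eta> c k' b \<and> Cmp C (mid \<zeta>) (mid \<eta>) (mid \<rho>) h k' = k"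
proof -
  interpret op: exact_category R "op_cat C" by (rule op_exact_category)
  show ?thesis
    using op.ses_mor_pushout_factor[of "op_ses \<rho>" "op_ses \<eta>" "op_ses \<zeta>" a h b k c] assms
    by (simp add: op_ses_mor)
qed

text \<open>Factoring the identity of \<open>\<xi>\<close> through \<open>h\<close> produces a left
  inverse of \<open>h\<close>. It is a morphism of the same shape, so it has a left inverse too, and
  that one must be \<open>h\<close>.\<close>

lemma five_lemma:
  assumes conf: "\<xi> \<in> Conf C" "\<eta> \<in> Conf C" and ends: "lft \<eta> = lft \<xi>" "rgt \<eta> = rgt \<xi>"
    and h: "ses_mor C \<xi> \<eta> (Idm C (lft \<xi>)) h (Idm C (rgt \<xi>))"
  shows "is_iso C (mid \<xi>) (mid \<eta>) h" "\<exists>h'. ses_mor C \<eta> \<xi> (Idm C (lft \<xi>)) h' (Idm C (rgt \<xi>))"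
proof -
  note [simp] = cat_simps conf_Ob(1-3)[OF conf(1)] conf_Ob(1-2)[OF conf(2)]
  have inv: "\<exists>k'. ses_mor C \<eta> \<xi> (Idm C (lft \<xi>)) k' (Idm C (rgt \<xi>)) \<and> Cmp C (mid \<xi>) (mid \<eta>) (mid \<xi>) k' h = Idm C (mid \<xi>)"
    if "\<xi> \<in> Conf C" "\<eta> \<in> Conf C" "lft \<eta> = lft \<xi>" "rgt \<eta> = rgt \<xi>"
      "ses_mor C \<xi> \<eta> (Idm C (lft \<xi>)) h (Idm C (rgt \<xi>))" for \<xi> \<eta> h
    using ses_mor_pushout_factor[OF that(1,2,1,4,5), of "Idm C (lft \<xi>)" "Idm C (mid \<xi>)" "Idm C (rgt \<xi>)"]
      ses_mor_Idm[OF conf_ses[OF that(1)]] conf_Ob(1)[OF that(1)] that(3) by simp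
  obtain k where k: "ses_mor C \<eta> \<xi> (Idm C (lft \<xi>)) k (Idm C (rgt \<xi>))" "Cmp C (mid \<xi>) (mid \<eta>) (mid \<xi>) k h = Idm C (mid \<xi>)"
    using inv[OF conf ends h] by blast
  obtain l where l: "ses_mor C \<xi> \<eta> (Idm C (lft \<xi>)) l (Idm C (rgt \<xi>))" "Cmp C (mid \<eta>) (mid \<xi>) (mid \<eta>) l k = Idm C (mid \<eta>)"
    using inv[OF conf(2,1)] ends k(1) by auto
  have [simp]: "h \<in> Mor C (mid \<xi>) (mid \<eta>)" "k \<in> Mor C (mid \<eta>) (mid \<xi>)" "l \<in> Mor C (mid \<xi>) (mid \<eta>)"
    using h k(1) l(1) by (auto simp: ses_mor_def)
  have "Cmp C (mid \<xi>) (mid \<xi>) (mid \<eta>) l (Cmp C (mid \<xi>) (mid \<eta>) (mid \<xi>) k h) = h"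
    by (simp add: Cmp_reassoc[OF l(2)])
  then have "l = h" by (simp add: k(2))
  then show "is_iso C (mid \<xi>) (mid \<eta>) h" using k(2) l(2) unfolding is_iso_def by auto
  show "\<exists>h'. ses_mor C \<eta> \<xi> (Idm C (lft \<xi>)) h' (Idm C (rgt \<xi>))" using k(1) by blast
qed

text \<open>The axiom supplies a deflation \<open>q\<close> from \<open>P\<close> to
  \<open>W\<close> with some kernel \<open>L\<close>. The work lies in identifying \<open>L\<close>
  with \<open>lft \<xi>\<close> over \<open>P\<close> and transporting the conflation along that
  isomorphism.\<close>

lemma pullback_conf_exists:
  assumes conf: "\<xi> \<in> Conf C" and [simp]: "W \<in> Ob C" "f \<in> Mor C W (rgt \<xi>)"
  shows "\<exists>\<eta> \<in> Conf C. lft \<eta> = lft \<xi> \<and> rgt \<eta> = W \<and> (\<exists>h. ses_mor C \<eta> \<xi> (Idm C (lft \<xi>)) h f)"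
proof -
  note [simp] = cat_simps conf_Ob(1-6)[OF conf]
  let ?X = "lft \<xi>" and ?E = "mid \<xi>" and ?Y = "rgt \<xi>" and ?i = "infl \<xi>" and ?d = "defl \<xi>"
  obtain P p q where pb: "is_pullback C P ?E W ?Y p q ?d f" and q: "deflation C P W q"
    using deflation_pullback[OF conf_Ob(8)[OF conf] \<open>W \<in> Ob C\<close> \<open>f \<in> Mor C W (rgt \<xi>)\<close>] by blast
  have [simp]: "P \<in> Ob C" "p \<in> Mor C P ?E" "q \<in> Mor C P W" and dpq: "Cmp C P ?E ?Y ?d p = Cmp C P W ?Y f q"
    using pb by (auto simp: is_pullback_def)
  have uniq: "\<exists>!w. w \<in> Mor C V P \<and> Cmp C V P ?E p w = u \<and> Cmp C V P W q w = v"
    if "V \<in> Ob C" "u \<in> Mor C V ?E" "v \<in> Mor C V W" "Cmp C V ?E ?Y ?d u = Cmp C V W ?Y f v" for V u v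
    using pb that unfolding is_pullback_def by blast
  obtain L j where [simp]: "L \<in> Ob C" "j \<in> Mor C L P" and kerq: "is_kernel C L P W j q"
    and cf: "\<lparr>lft = L, mid = P, rgt = W, infl = j, defl = q\<rparr> \<in> Conf C"
    using deflation_kernel[OF q] by metis
  have qj: "Cmp C L P W q j = \<zero>\<^bsub>Hom C L W\<^esub>" using kerq by (simp add: is_kernel_def)
  \<comment> \<open>\<open>m\<close> is \<open>infl \<xi>\<close> lifted to the pullback with zero
    as its other component; it will be the inflation of the new conflation.\<close>
  obtain m where [simp]: "m \<in> Mor C ?X P" and m: "Cmp C ?X P ?E p m = ?i" "Cmp C ?X P W q m = \<zero>\<^bsub>Hom C ?X W\<^esub>"
    using uniq[of ?X ?i "\<zero>\<^bsub>Hom C ?X W\<^esub>"] by auto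
  have "Cmp C L ?E ?Y ?d (Cmp C L P ?E p j) = \<zero>\<^bsub>Hom C L ?Y\<^esub>" by (simp add: Cmp_reassoc[OF dpq] qj)
  then obtain u where [simp]: "u \<in> Mor C L ?X" and u: "Cmp C L ?X ?E ?i u = Cmp C L P ?E p j"
    using kernel_factor[OF conf_kernel[OF conf] \<open>L \<in> Ob C\<close>, of "Cmp C L P ?E p j"] by (auto simp: Cmp_closed)
  obtain u' where [simp]: "u' \<in> Mor C ?X L" and u': "Cmp C ?X L P j u' = m"
    using kernel_factor[OF kerq _ _ m(2)] by auto
  have "Cmp C ?X ?X ?E ?i (Cmp C ?X L ?X u u') = Cmp C ?X ?X ?E ?i (Idm C ?X)"
    by (simp add: Cmp_reassoc[OF u] u' m)
  then have uu': "Cmp C ?X L ?X u u' = Idm C ?X"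
    by - (rule kernel_mono[OF conf_kernel[OF conf], where W = ?X], simp_all)
  \<comment> \<open>Morphisms into a pullback are determined by their two components; here these are
    \<open>p j\<close> and zero on both sides.\<close>
  have mu: "Cmp C L ?X P m u = j"
  proof -
    have "\<exists>!w. w \<in> Mor C L P \<and> Cmp C L P ?E p w = Cmp C L P ?E p j \<and> Cmp C L P W q w = \<zero>\<^bsub>Hom C L W\<^esub>"
      by (rule uniq) (simp_all add: Cmp_reassoc[OF dpq] qj)
    moreover have "Cmp C L P ?E p (Cmp C L ?X P m u) = Cmp C L P ?E p j" by (simp add: Cmp_reassoc[OF m(1)] u)
    moreover have "Cmp C L P W q (Cmp C L ?X P m u) = \<zero>\<^bsub>Hom C L W\<^esub>" by (simp add: Cmp_reassoc[OF m(2)])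
    moreover have "Cmp C L ?X P m u \<in> Mor C L P" "j \<in> Mor C L P" by simp_all
    ultimately show ?thesis using qj by blast
  qed
  have "Cmp C L L P j (Cmp C L ?X L u' u) = Cmp C L L P j (Idm C L)"
    by (simp add: Cmp_reassoc[OF u'] mu)
  then have u'u: "Cmp C L ?X L u' u = Idm C L"
    by - (rule kernel_mono[OF kerq, where W = L], simp_all)
  let ?\<eta> = "\<lparr>lft = ?X, mid = P, rgt = W, infl = m, defl = q\<rparr>"
  have "?\<eta> \<in> Conf C"
  proof (rule conf_iso[OF cf, of ?\<eta> u "Idm C P" "Idm C W"])
    show "ses_in C ?\<eta>" by (simp add: ses_in_def)
    show "ses_mor C \<lparr>lft = L, mid = P, rgt = W, infl = j, defl = q\<rparr> ?\<eta> u (Idm C P) (Idm C W)"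
      by (simp add: ses_mor_def mu)
    show "is_iso C (lft \<lparr>lft = L, mid = P, rgt = W, infl = j, defl = q\<rparr>) (lft ?\<eta>) u"
      using uu' u'u by (auto simp: is_iso_def)
  qed (auto simp: is_iso_def)
  moreover have "ses_mor C ?\<eta> \<xi> (Idm C ?X) p f" by (simp add: ses_mor_def m dpq)
  ultimately show ?thesis by (intro bexI[of _ ?\<eta>]) auto
qed

lemma pushout_conf_exists:
  assumes conf: "\<xi> \<in> Conf C" and "W \<in> Ob C" "f \<in> Mor C (lft \<xi>) W"
  shows "\<exists>\<eta> \<in> Conf C. rgt \<eta> = rgt \<xi> \<and> lft \<eta> = W \<and> (\<exists>h. ses_mor C \<xi> \<eta> f h (Idm C (rgt \<xi>)))"
proof -
  interpret op: exact_category R "op_cat C" by (rule op_exact_category)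
  show ?thesis
    using op.pullback_conf_exists[of "op_ses \<xi>" W f] assms by (simp add: op_ses_mor)
qed

lemma ses_mor_from_left:
  assumes conf: "\<xi> \<in> Conf C" "\<zeta> \<in> Conf C" and [simp]: "a \<in> Mor C (lft \<xi>) (lft \<zeta>)" "b \<in> Mor C (mid \<xi>) (mid \<zeta>)"
    and ab: "Cmp C (lft \<xi>) (mid \<xi>) (mid \<zeta>) b (infl \<xi>) = Cmp C (lft \<xi>) (lft \<zeta>) (mid \<zeta>) (infl \<zeta>) a"
  shows "\<exists>c. ses_mor C \<xi> \<zeta> a b c"
proof -
  note [simp] = cat_simps conf_Ob(1-6)[OF conf(1)] conf_Ob(1-6)[OF conf(2)]
  let ?f = "Cmp C (mid \<xi>) (mid \<zeta>) (rgt \<zeta>) (defl \<zeta>) b"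
  have "Cmp C (lft \<xi>) (mid \<xi>) (rgt \<zeta>) ?f (infl \<xi>) = \<zero>\<^bsub>Hom C (lft \<xi>) (rgt \<zeta>)\<^esub>"
    by (simp add: ab Cmp_reassoc[OF conf_Ob(6)[OF conf(2)]])
  then obtain c where "c \<in> Mor C (rgt \<xi>) (rgt \<zeta>)" "Cmp C (mid \<xi>) (rgt \<xi>) (rgt \<zeta>) c (defl \<xi>) = ?f"
    using cokernel_factor[OF conf_cokernel[OF conf(1)], of "rgt \<zeta>" ?f] by auto
  then show ?thesis using ab by (auto simp: ses_mor_def)
qed

text \<open>The pushout of the two inflations receives both middle terms, and the diagonal of the
  square is an inflation as a composite of two. The conflation \<open>\<zeta>\<close> is one that
  starts with this diagonal.\<close>

lemma common_target:
  assumes conf: "\<xi> \<in> Conf C" "\<xi>' \<in> Conf C" and lft: "lft \<xi>' = lft \<xi>"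
  obtains \<zeta> h g h' g' where "\<zeta> \<in> Conf C" "lft \<zeta> = lft \<xi>"
    "ses_mor C \<xi> \<zeta> (Idm C (lft \<xi>)) h g" "ses_mor C \<xi>' \<zeta> (Idm C (lft \<xi>)) h' g'"
proof -
  note [simp] = cat_simps conf_Ob(1-6)[OF conf(1)] conf_Ob(2,3,5)[OF conf(2)] conf_Ob(4)[OF conf(2), unfolded lft]
  obtain P p q where po: "is_pushout C P (mid \<xi>) (mid \<xi>') (lft \<xi>) p q (infl \<xi>) (infl \<xi>')" and q: "inflation C (mid \<xi>') P q"
    using inflation_pushout[OF conf_Ob(7)[OF conf(1)], of "mid \<xi>'" "infl \<xi>'"] by auto
  have [simp]: "P \<in> Ob C" "p \<in> Mor C (mid \<xi>) P" "q \<in> Mor C (mid \<xi>') P"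
    and pq: "Cmp C (lft \<xi>) (mid \<xi>) P p (infl \<xi>) = Cmp C (lft \<xi>) (mid \<xi>') P q (infl \<xi>')"
    using po by (auto simp: is_pushout_def)
  have "inflation C (lft \<xi>) P (Cmp C (lft \<xi>) (mid \<xi>') P q (infl \<xi>'))"
    using inflation_Cmp[OF conf_Ob(7)[OF conf(2), unfolded lft] q] .
  then obtain \<zeta> where \<zeta>: "\<zeta> \<in> Conf C" "lft \<zeta> = lft \<xi>" "mid \<zeta> = P" "infl \<zeta> = Cmp C (lft \<xi>) (mid \<xi>') P q (infl \<xi>')"
    by (auto simp: inflation_def)
  have "\<exists>c. ses_mor C \<xi> \<zeta> (Idm C (lft \<xi>)) p c" "\<exists>c. ses_mor C \<xi>' \<zeta> (Idm C (lft \<xi>)) q c"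
    by (rule ses_mor_from_left[OF conf(1) \<zeta>(1)] ses_mor_from_left[OF conf(2) \<zeta>(1)]; simp add: \<zeta>(2-4) lft pq)+
  then show thesis using that \<zeta>(1,2) by blast
qed

section \<open>Split conflations\<close>

definition split :: "('o, 'm) ses \<Rightarrow> bool"
  where "split \<eta> \<longleftrightarrow> (\<exists>s \<in> Mor C (rgt \<eta>) (mid \<eta>). Cmp C (rgt \<eta>) (mid \<eta>) (rgt \<eta>) (defl \<eta>) s = Idm C (rgt \<eta>))"

text \<open>The endomorphism \<open>1 - s d\<close> of the middle term is killed by
  \<open>d\<close>, so it factors through the inflation; the factor is a retraction.\<close>

lemma split_imp_retraction:
  assumes conf: "\<eta> \<in> Conf C" and "split \<eta>"
  shows "\<exists>r \<in> Mor C (mid \<eta>) (lft \<eta>). Cmp C (lft \<eta>) (mid \<eta>) (lft \<eta>) r (infl \<eta>) = Idm C (lft \<eta>)"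
proof -
  note [simp] = cat_simps conf_Ob(1-6)[OF conf]
  obtain s where [simp]: "s \<in> Mor C (rgt \<eta>) (mid \<eta>)" and s: "Cmp C (rgt \<eta>) (mid \<eta>) (rgt \<eta>) (defl \<eta>) s = Idm C (rgt \<eta>)"
    using \<open>split \<eta>\<close> by (auto simp: split_def)
  let ?x = "Idm C (mid \<eta>) \<ominus>\<^bsub>Hom C (mid \<eta>) (mid \<eta>)\<^esub> Cmp C (mid \<eta>) (rgt \<eta>) (mid \<eta>) s (defl \<eta>)"
  have "Cmp C (mid \<eta>) (mid \<eta>) (rgt \<eta>) (defl \<eta>) ?x = \<zero>\<^bsub>Hom C (mid \<eta>) (rgt \<eta>)\<^esub>"
    by (simp add: Cmp_reassoc[OF s])
  then obtain r where [simp]: "r \<in> Mor C (mid \<eta>) (lft \<eta>)" and r: "Cmp C (mid \<eta>) (lft \<eta>) (mid \<eta>) (infl \<eta>) r = ?x"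
    using kernel_factor[OF conf_kernel[OF conf], of "mid \<eta>" ?x] by auto
  have "Cmp C (lft \<eta>) (lft \<eta>) (mid \<eta>) (infl \<eta>) (Cmp C (lft \<eta>) (mid \<eta>) (lft \<eta>) r (infl \<eta>)) =
      Cmp C (lft \<eta>) (lft \<eta>) (mid \<eta>) (infl \<eta>) (Idm C (lft \<eta>))"
    by (simp add: Cmp_reassoc[OF r])
  then have "Cmp C (lft \<eta>) (mid \<eta>) (lft \<eta>) r (infl \<eta>) = Idm C (lft \<eta>)"
    by - (rule kernel_mono[OF conf_kernel[OF conf], where W = "lft \<eta>"], simp_all)
  then show ?thesis by (intro bexI[of _ r]) simp_all
qed

text \<open>Sections of the deflation and retractions of the inflation exist together, so splitting
  is self-dual and the criterion for pushouts follows from the one for pullbacks.\<close>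

lemma op_split_iff:
  assumes conf: "\<eta> \<in> Conf C"
  shows "exact_category.split (op_cat C) (op_ses \<eta>) \<longleftrightarrow> split \<eta>"
proof -
  interpret op: exact_category R "op_cat C" by (rule op_exact_category)
  have "op.split (op_ses \<eta>)" if "split \<eta>"
    using split_imp_retraction[OF conf that] by (simp add: op.split_def)
  moreover have "split \<eta>" if "op.split (op_ses \<eta>)"
    using op.split_imp_retraction[OF _ that] conf by (simp add: split_def)
  ultimately show ?thesis by blast
qed

text \<open>By the universal property a section of the pulled back deflation amounts to a morphism
  into \<open>mid \<zeta>\<close> that lies over \<open>g\<close>.\<close>

lemma split_pullback_iff:
  assumes conf: "\<eta> \<in> Conf C" "\<zeta> \<in> Conf C" and lft: "lft \<eta> = lft \<zeta>"
    and m: "ses_mor C \<eta> \<zeta> (Idm C (lft \<zeta>)) h g"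
  shows "split \<eta> \<longleftrightarrow> (\<exists>k \<in> Mor C (rgt \<eta>) (mid \<zeta>). Cmp C (rgt \<eta>) (mid \<zeta>) (rgt \<zeta>) (defl \<zeta>) k = g)"
proof
  note [simp] = cat_simps conf_Ob(1-6)[OF conf(2)] conf_Ob(2,3,5)[OF conf(1)]
  note mD = ses_morD[OF m]
  note [simp] = mD(2,3)
  {
    assume "split \<eta>"
    then obtain s where [simp]: "s \<in> Mor C (rgt \<eta>) (mid \<eta>)" and s: "Cmp C (rgt \<eta>) (mid \<eta>) (rgt \<eta>) (defl \<eta>) s = Idm C (rgt \<eta>)"
      by (auto simp: split_def)
    show "\<exists>k \<in> Mor C (rgt \<eta>) (mid \<zeta>). Cmp C (rgt \<eta>) (mid \<zeta>) (rgt \<zeta>) (defl \<zeta>) k = g"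
      by (rule bexI[of _ "Cmp C (rgt \<eta>) (mid \<eta>) (mid \<zeta>) h s"]) (simp_all add: Cmp_reassoc[OF mD(5)] s)
  }
  assume "\<exists>k \<in> Mor C (rgt \<eta>) (mid \<zeta>). Cmp C (rgt \<eta>) (mid \<zeta>) (rgt \<zeta>) (defl \<zeta>) k = g"
  then obtain k where [simp]: "k \<in> Mor C (rgt \<eta>) (mid \<zeta>)" and k: "Cmp C (rgt \<eta>) (mid \<zeta>) (rgt \<zeta>) (defl \<zeta>) k = g" by blast
  have "\<exists>k' \<in> Mor C (rgt \<eta>) (mid \<eta>). Cmp C (rgt \<eta>) (mid \<eta>) (mid \<zeta>) h k' = k \<and>
      Cmp C (rgt \<eta>) (mid \<eta>) (rgt \<eta>) (defl \<eta>) k' = Idm C (rgt \<eta>)"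
    by (rule pullback_factor[OF conf_Ob(7)[OF conf(2)] conf_cokernel[OF conf(2)] conf_cokernel[OF conf(1), unfolded lft], where a = g])
      (use mD(4,5) conf_Ob(4)[OF conf(1)] in \<open>simp_all add: lft k\<close>)
  then show "split \<eta>" by (auto simp: split_def)
qed

lemma split_pushout_iff:
  assumes conf: "\<eta> \<in> Conf C" "\<zeta> \<in> Conf C" and rgt: "rgt \<eta> = rgt \<zeta>"
    and m: "ses_mor C \<zeta> \<eta> f h (Idm C (rgt \<zeta>))"
  shows "split \<eta> \<longleftrightarrow> (\<exists>k \<in> Mor C (mid \<zeta>) (lft \<eta>). Cmp C (lft \<zeta>) (mid \<zeta>) (lft \<eta>) k (infl \<zeta>) = f)"
proof -
  interpret op: exact_category R "op_cat C" by (rule op_exact_category)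
  show ?thesis
    using op.split_pullback_iff[of "op_ses \<eta>" "op_ses \<zeta>" h f] assms by (simp add: op_split_iff op_ses_mor)
qed

end

section \<open>Binary direct sums of conflations\<close>

context linear_category
begin

lemma direct_sum_pair:
  assumes "direct_sum C [X, Y] S \<iota> \<pi>"
  shows "X \<in> Ob C" "Y \<in> Ob C" "S \<in> Ob C"
    "\<iota> 0 \<in> Mor C X S" "\<iota> 1 \<in> Mor C Y S" "\<pi> 0 \<in> Mor C S X" "\<pi> 1 \<in> Mor C S Y"
    "Cmp C X S X (\<pi> 0) (\<iota> 0) = Idm C X" "Cmp C Y S Y (\<pi> 1) (\<iota> 1) = Idm C Y"
    "Cmp C Y S X (\<pi> 0) (\<iota> 1) = \<zero>\<^bsub>Hom C Y X\<^esub>" "Cmp C X S Y (\<pi> 1) (\<iota> 0) = \<zero>\<^bsub>Hom C X Y\<^esub>"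
    "Cmp C S X S (\<iota> 0) (\<pi> 0) \<oplus>\<^bsub>Hom C S S\<^esub> Cmp C S Y S (\<iota> 1) (\<pi> 1) = Idm C S"
proof -
  note D = assms[unfolded direct_sum_def]
  show obs: "X \<in> Ob C" "Y \<in> Ob C" "S \<in> Ob C" using D by simp_all
  have all2: "\<And>Q. (\<forall>j<length [X, Y]. Q j) \<longleftrightarrow> Q 0 \<and> Q 1" by (auto simp: less_Suc_eq)
  show mor: "\<iota> 0 \<in> Mor C X S" "\<iota> 1 \<in> Mor C Y S" "\<pi> 0 \<in> Mor C S X" "\<pi> 1 \<in> Mor C S Y"
    using D unfolding all2 by simp_all
  show "Cmp C X S X (\<pi> 0) (\<iota> 0) = Idm C X" "Cmp C Y S Y (\<pi> 1) (\<iota> 1) = Idm C Y"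
    "Cmp C Y S X (\<pi> 0) (\<iota> 1) = \<zero>\<^bsub>Hom C Y X\<^esub>" "Cmp C X S Y (\<pi> 1) (\<iota> 0) = \<zero>\<^bsub>Hom C X Y\<^esub>"
    using D unfolding all2 by simp_all
  interpret H: abelian_group "Hom C S S" by (rule Hom_abelian_group) (rule obs)+
  have "Cmp C S X S (\<iota> 0) (\<pi> 0) \<in> Mor C S S" "Cmp C S Y S (\<iota> 1) (\<pi> 1) \<in> Mor C S S"
    using obs mor by (simp_all add: Cmp_closed)
  then show "Cmp C S X S (\<iota> 0) (\<pi> 0) \<oplus>\<^bsub>Hom C S S\<^esub> Cmp C S Y S (\<iota> 1) (\<pi> 1) = Idm C S"
    using D by (simp add: lessThan_Suc H.a_comm)
qed

lemma direct_sum_pairI: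
  assumes obs: "X \<in> Ob C" "Y \<in> Ob C" "S \<in> Ob C"
    and mor: "\<iota> 0 \<in> Mor C X S" "\<iota> 1 \<in> Mor C Y S" "\<pi> 0 \<in> Mor C S X" "\<pi> 1 \<in> Mor C S Y"
    and eq: "Cmp C X S X (\<pi> 0) (\<iota> 0) = Idm C X" "Cmp C Y S Y (\<pi> 1) (\<iota> 1) = Idm C Y"
    "Cmp C Y S X (\<pi> 0) (\<iota> 1) = \<zero>\<^bsub>Hom C Y X\<^esub>" "Cmp C X S Y (\<pi> 1) (\<iota> 0) = \<zero>\<^bsub>Hom C X Y\<^esub>"
    and sum: "Cmp C S X S (\<iota> 0) (\<pi> 0) \<oplus>\<^bsub>Hom C S S\<^esub> Cmp C S Y S (\<iota> 1) (\<pi> 1) = Idm C S"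
  shows "direct_sum C [X, Y] S \<iota> \<pi>"
proof -
  have all2: "\<And>Q. (\<forall>j<length [X, Y]. Q j) \<longleftrightarrow> Q 0 \<and> Q 1" by (auto simp: less_Suc_eq)
  interpret H: abelian_group "Hom C S S" by (rule Hom_abelian_group) (rule obs)+
  have "Cmp C S X S (\<iota> 0) (\<pi> 0) \<in> Mor C S S" "Cmp C S Y S (\<iota> 1) (\<pi> 1) \<in> Mor C S S"
    using obs mor by (simp_all add: Cmp_closed)
  then have "finsum (Hom C S S) (\<lambda>j. Cmp C S ([X, Y] ! j) S (\<iota> j) (\<pi> j)) {..<length [X, Y]} = Idm C S"
    using sum by (simp add: lessThan_Suc H.a_comm)
  then show ?thesis
    unfolding direct_sum_def all2 using obs mor eq by simp
qed

text \<open>Morphisms out of a direct sum are row matrices, morphisms into it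
  (\<open>ses_sum_from\<close>) are columns. The rows will compare a Baer sum with a common target
  of its summands, the columns with a common source.\<close>

lemma ses_sum_to:
  assumes ses: "ses_in C \<xi>" "ses_in C \<xi>'" "ses_in C \<zeta>"
    and m: "ses_mor C \<xi> \<zeta> a h g" and m': "ses_mor C \<xi>' \<zeta> a' h' g'"
    and A: "direct_sum C [lft \<xi>, lft \<xi>'] A \<iota>A \<pi>A" and B: "direct_sum C [mid \<xi>, mid \<xi>'] B \<iota>B \<pi>B"
    and P: "direct_sum C [rgt \<xi>, rgt \<xi>'] P \<iota>P \<pi>P"
  shows "ses_mor C (ses_sum C \<xi> \<xi>' A \<pi>A B \<iota>B \<pi>B P \<iota>P) \<zeta>
    (Cmp C A (lft \<xi>) (lft \<zeta>) a (\<pi>A 0) \<oplus>\<^bsub>Hom C A (lft \<zeta>)\<^esub> Cmp C A (lft \<xi>') (lft \<zeta>) a' (\<pi>A 1))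
    (Cmp C B (mid \<xi>) (mid \<zeta>) h (\<pi>B 0) \<oplus>\<^bsub>Hom C B (mid \<zeta>)\<^esub> Cmp C B (mid \<xi>') (mid \<zeta>) h' (\<pi>B 1))
    (Cmp C P (rgt \<xi>) (rgt \<zeta>) g (\<pi>P 0) \<oplus>\<^bsub>Hom C P (rgt \<zeta>)\<^esub> Cmp C P (rgt \<xi>') (rgt \<zeta>) g' (\<pi>P 1))"
proof -
  note [simp] = cat_simps
  have [simp]: "infl \<xi> \<in> Mor C (lft \<xi>) (mid \<xi>)" "defl \<xi> \<in> Mor C (mid \<xi>) (rgt \<xi>)"
    "infl \<xi>' \<in> Mor C (lft \<xi>') (mid \<xi>')" "defl \<xi>' \<in> Mor C (mid \<xi>') (rgt \<xi>')"
    "infl \<zeta> \<in> Mor C (lft \<zeta>) (mid \<zeta>)" "defl \<zeta> \<in> Mor C (mid \<zeta>) (rgt \<zeta>)"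
    "lft \<zeta> \<in> Ob C" "mid \<zeta> \<in> Ob C" "rgt \<zeta> \<in> Ob C"
    using ses by (auto simp: ses_in_def)
  note [simp] = direct_sum_pair(1-7)[OF A, unfolded One_nat_def] direct_sum_pair(1-7)[OF B, unfolded One_nat_def] direct_sum_pair(1-7)[OF P, unfolded One_nat_def]
  note eqs = direct_sum_pair(8-11)[OF A, unfolded One_nat_def] direct_sum_pair(8-11)[OF B, unfolded One_nat_def] direct_sum_pair(8-11)[OF P, unfolded One_nat_def]
  have a[simp]: "a \<in> Mor C (lft \<xi>) (lft \<zeta>)" "h \<in> Mor C (mid \<xi>) (mid \<zeta>)" "g \<in> Mor C (rgt \<xi>) (rgt \<zeta>)"
    "a' \<in> Mor C (lft \<xi>') (lft \<zeta>)" "h' \<in> Mor C (mid \<xi>') (mid \<zeta>)" "g' \<in> Mor C (rgt \<xi>') (rgt \<zeta>)"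
    using m m' by (auto simp: ses_mor_def)
  have e: "Cmp C (lft \<xi>) (mid \<xi>) (mid \<zeta>) h (infl \<xi>) = Cmp C (lft \<xi>) (lft \<zeta>) (mid \<zeta>) (infl \<zeta>) a"
    "Cmp C (lft \<xi>') (mid \<xi>') (mid \<zeta>) h' (infl \<xi>') = Cmp C (lft \<xi>') (lft \<zeta>) (mid \<zeta>) (infl \<zeta>) a'"
    "Cmp C (mid \<xi>) (mid \<zeta>) (rgt \<zeta>) (defl \<zeta>) h = Cmp C (mid \<xi>) (rgt \<xi>) (rgt \<zeta>) g (defl \<xi>)"
    "Cmp C (mid \<xi>') (mid \<zeta>) (rgt \<zeta>) (defl \<zeta>) h' = Cmp C (mid \<xi>') (rgt \<xi>') (rgt \<zeta>) g' (defl \<xi>')"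
    using m m' by (auto simp: ses_mor_def)
  show ?thesis
    unfolding ses_mor_def ses_sum_def
    by (simp add: eqs[THEN Cmp_reassoc] e[THEN Cmp_reassoc] e)
qed

lemma ses_sum_from:
  assumes ses: "ses_in C \<xi>" "ses_in C \<xi>'" "ses_in C \<zeta>"
    and m: "ses_mor C \<zeta> \<xi> a h g" and m': "ses_mor C \<zeta> \<xi>' a' h' g'"
    and A: "direct_sum C [lft \<xi>, lft \<xi>'] A \<iota>A \<pi>A" and B: "direct_sum C [mid \<xi>, mid \<xi>'] B \<iota>B \<pi>B"
    and P: "direct_sum C [rgt \<xi>, rgt \<xi>'] P \<iota>P \<pi>P"
  shows "ses_mor C \<zeta> (ses_sum C \<xi> \<xi>' A \<pi>A B \<iota>B \<pi>B P \<iota>P)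
    (Cmp C (lft \<zeta>) (lft \<xi>) A (\<iota>A 0) a \<oplus>\<^bsub>Hom C (lft \<zeta>) A\<^esub> Cmp C (lft \<zeta>) (lft \<xi>') A (\<iota>A 1) a')
    (Cmp C (mid \<zeta>) (mid \<xi>) B (\<iota>B 0) h \<oplus>\<^bsub>Hom C (mid \<zeta>) B\<^esub> Cmp C (mid \<zeta>) (mid \<xi>') B (\<iota>B 1) h')
    (Cmp C (rgt \<zeta>) (rgt \<xi>) P (\<iota>P 0) g \<oplus>\<^bsub>Hom C (rgt \<zeta>) P\<^esub> Cmp C (rgt \<zeta>) (rgt \<xi>') P (\<iota>P 1) g')"
proof -
  note [simp] = cat_simps
  have [simp]: "infl \<xi> \<in> Mor C (lft \<xi>) (mid \<xi>)" "defl \<xi> \<in> Mor C (mid \<xi>) (rgt \<xi>)"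
    "infl \<xi>' \<in> Mor C (lft \<xi>') (mid \<xi>')" "defl \<xi>' \<in> Mor C (mid \<xi>') (rgt \<xi>')"
    "infl \<zeta> \<in> Mor C (lft \<zeta>) (mid \<zeta>)" "defl \<zeta> \<in> Mor C (mid \<zeta>) (rgt \<zeta>)"
    "lft \<zeta> \<in> Ob C" "mid \<zeta> \<in> Ob C" "rgt \<zeta> \<in> Ob C"
    using ses by (auto simp: ses_in_def)
  note [simp] = direct_sum_pair(1-7)[OF A, unfolded One_nat_def] direct_sum_pair(1-7)[OF B, unfolded One_nat_def] direct_sum_pair(1-7)[OF P, unfolded One_nat_def]
  note eqs = direct_sum_pair(8-11)[OF A, unfolded One_nat_def] direct_sum_pair(8-11)[OF B, unfolded One_nat_def] direct_sum_pair(8-11)[OF P, unfolded One_nat_def]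
  have a[simp]: "a \<in> Mor C (lft \<zeta>) (lft \<xi>)" "h \<in> Mor C (mid \<zeta>) (mid \<xi>)" "g \<in> Mor C (rgt \<zeta>) (rgt \<xi>)"
    "a' \<in> Mor C (lft \<zeta>) (lft \<xi>')" "h' \<in> Mor C (mid \<zeta>) (mid \<xi>')" "g' \<in> Mor C (rgt \<zeta>) (rgt \<xi>')"
    using m m' by (auto simp: ses_mor_def)
  have e: "Cmp C (lft \<zeta>) (mid \<zeta>) (mid \<xi>) h (infl \<zeta>) = Cmp C (lft \<zeta>) (lft \<xi>) (mid \<xi>) (infl \<xi>) a"
    "Cmp C (lft \<zeta>) (mid \<zeta>) (mid \<xi>') h' (infl \<zeta>) = Cmp C (lft \<zeta>) (lft \<xi>') (mid \<xi>') (infl \<xi>') a'"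
    "Cmp C (mid \<zeta>) (mid \<xi>) (rgt \<xi>) (defl \<xi>) h = Cmp C (mid \<zeta>) (rgt \<zeta>) (rgt \<xi>) g (defl \<zeta>)"
    "Cmp C (mid \<zeta>) (mid \<xi>') (rgt \<xi>') (defl \<xi>') h' = Cmp C (mid \<zeta>) (rgt \<zeta>) (rgt \<xi>') g' (defl \<zeta>)"
    using m m' by (auto simp: ses_mor_def)
  show ?thesis
    unfolding ses_mor_def ses_sum_def
    by (simp add: eqs[THEN Cmp_reassoc] e[THEN Cmp_reassoc] e)
qed

end

context exact_category
begin

text \<open>The axioms give pushouts and composites of inflations, so the inflation of the sum is
  built in two steps: pushing \<open>infl \<xi>\<close> out along the first injection replaces
  \<open>lft \<xi>\<close> by \<open>mid \<xi>\<close> in \<open>A\<close>, and pushing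
  \<open>infl \<xi>'\<close> out into the result replaces the second summand.\<close>

lemma ses_sum_conf:
  assumes conf: "\<xi> \<in> Conf C" "\<xi>' \<in> Conf C"
    and A: "direct_sum C [lft \<xi>, lft \<xi>'] A \<iota>A \<pi>A" and P: "direct_sum C [rgt \<xi>, rgt \<xi>'] P \<iota>P \<pi>P"
  shows "\<exists>B \<iota>B \<pi>B. direct_sum C [mid \<xi>, mid \<xi>'] B \<iota>B \<pi>B \<and> ses_sum C \<xi> \<xi>' A \<pi>A B \<iota>B \<pi>B P \<iota>P \<in> Conf C"
proof -
  note [simp] = cat_simps conf_Ob(1-6)[OF conf(1)] conf_Ob(1-6)[OF conf(2)]
  note [simp] = direct_sum_pair(1-7)[OF A] direct_sum_pair(1-7)[OF P]
  \<comment> \<open>Keeps the index \<open>1\<close> of the second summand from turning into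
    \<open>Suc 0\<close>, so that the direct sum equations still match.\<close>
  note [simp del] = One_nat_def
  note eA = direct_sum_pair(8-11)[OF A] and eP = direct_sum_pair(8-11)[OF P]
  let ?Y = "lft \<xi>" and ?Y' = "lft \<xi>'" and ?E = "mid \<xi>" and ?E' = "mid \<xi>'" and ?X = "rgt \<xi>" and ?X' = "rgt \<xi>'"
    and ?i = "infl \<xi>" and ?i' = "infl \<xi>'" and ?d = "defl \<xi>" and ?d' = "defl \<xi>'"
  obtain Q e u where po: "is_pushout C Q ?E A ?Y e u ?i (\<iota>A 0)" and u: "inflation C A Q u"
    using inflation_pushout[OF conf_Ob(7)[OF conf(1)], of A "\<iota>A 0"] by auto
  have [simp]: "Q \<in> Ob C" "e \<in> Mor C ?E Q" "u \<in> Mor C A Q" and ei: "Cmp C ?Y ?E Q e ?i = Cmp C ?Y A Q u (\<iota>A 0)"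
    using po by (auto simp: is_pushout_def)
  have uniq: "\<exists>!w. w \<in> Mor C Q W \<and> Cmp C ?E Q W w e = x \<and> Cmp C A Q W w u = y"
    if "W \<in> Ob C" "x \<in> Mor C ?E W" "y \<in> Mor C A W" "Cmp C ?Y ?E W x ?i = Cmp C ?Y A W y (\<iota>A 0)" for W x y
    using po that unfolding is_pushout_def by blast
  obtain B e' w where po': "is_pushout C B ?E' Q ?Y' e' w ?i' (Cmp C ?Y' A Q u (\<iota>A 1))" and w: "inflation C Q B w"
    using inflation_pushout[OF conf_Ob(7)[OF conf(2)], of Q "Cmp C ?Y' A Q u (\<iota>A 1)"] by auto
  have [simp]: "B \<in> Ob C" "e' \<in> Mor C ?E' B" "w \<in> Mor C Q B"
    and ei': "Cmp C ?Y' ?E' B e' ?i' = Cmp C ?Y' Q B w (Cmp C ?Y' A Q u (\<iota>A 1))"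
    using po' by (auto simp: is_pushout_def)
  have uniq': "\<exists>!v. v \<in> Mor C B W \<and> Cmp C ?E' B W v e' = x \<and> Cmp C Q B W v w = y"
    if "W \<in> Ob C" "x \<in> Mor C ?E' W" "y \<in> Mor C Q W"
      "Cmp C ?Y' ?E' W x ?i' = Cmp C ?Y' Q W y (Cmp C ?Y' A Q u (\<iota>A 1))" for W x y
    using po' that unfolding is_pushout_def by blast
  let ?j = "Cmp C A Q B w u"
  have j: "inflation C A B ?j" by (rule inflation_Cmp[OF u w])
  \<comment> \<open>\<open>Q\<close> plays the role of the sum of \<open>?E\<close> and
    \<open>?Y'\<close>. The morphisms \<open>m0\<close> and \<open>m1\<close> are its projection to
    \<open>?E\<close> and its projection to \<open>?Y'\<close> followed by \<open>?i'\<close>;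
    \<open>p0\<close> and \<open>p1\<close> extend them to the projections of
    \<open>B\<close>.\<close>
  obtain m0 where [simp]: "m0 \<in> Mor C Q ?E" and m0: "Cmp C ?E Q ?E m0 e = Idm C ?E" "Cmp C A Q ?E m0 u = Cmp C A ?Y ?E ?i (\<pi>A 0)"
    using uniq[of ?E "Idm C ?E" "Cmp C A ?Y ?E ?i (\<pi>A 0)"] by (auto simp: eA)
  obtain m1 where [simp]: "m1 \<in> Mor C Q ?E'" and m1: "Cmp C ?E Q ?E' m1 e = \<zero>\<^bsub>Hom C ?E ?E'\<^esub>" "Cmp C A Q ?E' m1 u = Cmp C A ?Y' ?E' ?i' (\<pi>A 1)"
    using uniq[of ?E' "\<zero>\<^bsub>Hom C ?E ?E'\<^esub>" "Cmp C A ?Y' ?E' ?i' (\<pi>A 1)"] by (auto simp: eA)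
  obtain p0 where [simp]: "p0 \<in> Mor C B ?E" and p0: "Cmp C ?E' B ?E p0 e' = \<zero>\<^bsub>Hom C ?E' ?E\<^esub>" "Cmp C Q B ?E p0 w = m0"
    using uniq'[of ?E "\<zero>\<^bsub>Hom C ?E' ?E\<^esub>" m0] by (auto simp: Cmp_reassoc[OF m0(2)] eA)
  obtain p1 where [simp]: "p1 \<in> Mor C B ?E'" and p1: "Cmp C ?E' B ?E' p1 e' = Idm C ?E'" "Cmp C Q B ?E' p1 w = m1"
    using uniq'[of ?E' "Idm C ?E'" m1] by (auto simp: Cmp_reassoc[OF m1(2)] eA)
  let ?t = "Cmp C B ?E B (Cmp C ?E Q B w e) p0 \<oplus>\<^bsub>Hom C B B\<^esub> Cmp C B ?E' B e' p1"
  have jA: "Cmp C A ?E B (Cmp C ?E Q B w e) (Cmp C A ?Y ?E ?i (\<pi>A 0)) \<oplus>\<^bsub>Hom C A B\<^esub> Cmp C A ?E' B e' (Cmp C A ?Y' ?E' ?i' (\<pi>A 1)) = ?j"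
  proof -
    have "?j = Cmp C A A B ?j (Cmp C A ?Y A (\<iota>A 0) (\<pi>A 0) \<oplus>\<^bsub>Hom C A A\<^esub> Cmp C A ?Y' A (\<iota>A 1) (\<pi>A 1))"
      by (simp add: direct_sum_pair(12)[OF A])
    then show ?thesis by (simp add: Cmp_reassoc[OF ei] Cmp_reassoc[OF ei'])
  qed
  \<comment> \<open>An endomorphism of \<open>B\<close> is determined on the two legs
    \<open>e'\<close> and \<open>w\<close> of the outer pushout, and along \<open>w\<close> in turn
    on the legs \<open>e\<close> and \<open>u\<close> of the inner one.\<close>
  have "Cmp C Q B B ?t w = w"
  proof -
    have *: "\<exists>!v. v \<in> Mor C Q B \<and> Cmp C ?E Q B v e = Cmp C ?E Q B w e \<and> Cmp C A Q B v u = ?j"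
      by (rule uniq) (simp_all add: ei)
    have "Cmp C Q B B ?t w \<in> Mor C Q B" by simp
    moreover have "Cmp C ?E Q B (Cmp C Q B B ?t w) e = Cmp C ?E Q B w e"
      by (simp add: Cmp_reassoc[OF p0(2)] Cmp_reassoc[OF p1(2)] m0 m1)
    moreover have "Cmp C A Q B (Cmp C Q B B ?t w) u = ?j"
      using jA by (simp add: Cmp_reassoc[OF p0(2)] Cmp_reassoc[OF p1(2)] m0 m1)
    ultimately show ?thesis using * by (metis \<open>w \<in> Mor C Q B\<close>)
  qed
  moreover have "Cmp C ?E' B B ?t e' = e'" by (simp add: p0 p1)
  moreover have "\<exists>!v. v \<in> Mor C B B \<and> Cmp C ?E' B B v e' = e' \<and> Cmp C Q B B v w = w"
    by (rule uniq') (simp_all add: ei')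
  moreover have "?t \<in> Mor C B B" "Idm C B \<in> Mor C B B" "Cmp C ?E' B B (Idm C B) e' = e'" "Cmp C Q B B (Idm C B) w = w" by simp_all
  ultimately have t: "?t = Idm C B" by blast
  define \<iota>B where "\<iota>B j = (if j = (0::nat) then Cmp C ?E Q B w e else e')" for j
  define \<pi>B where "\<pi>B j = (if j = (0::nat) then p0 else p1)" for j
  have \<iota>\<pi>: "\<iota>B 0 = Cmp C ?E Q B w e" "\<iota>B 1 = e'" "\<pi>B 0 = p0" "\<pi>B 1 = p1" by (simp_all add: \<iota>B_def \<pi>B_def)
  have B: "direct_sum C [?E, ?E'] B \<iota>B \<pi>B"
  proof (rule direct_sum_pairI)
    show "Cmp C B ?E B (\<iota>B 0) (\<pi>B 0) \<oplus>\<^bsub>Hom C B B\<^esub> Cmp C B ?E' B (\<iota>B 1) (\<pi>B 1) = Idm C B"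
      using t by (simp only: \<iota>\<pi>)
  qed (simp_all add: \<iota>\<pi> p0 p1 m0 m1 Cmp_reassoc[OF p0(2)] Cmp_reassoc[OF p1(2)])
  let ?\<sigma> = "ses_sum C \<xi> \<xi>' A \<pi>A B \<iota>B \<pi>B P \<iota>P"
  note [simp] = direct_sum_pair(4-7)[OF B]
  note eB = direct_sum_pair(8-11)[OF B]
  have \<sigma>: "lft ?\<sigma> = A" "mid ?\<sigma> = B" "rgt ?\<sigma> = P" "infl ?\<sigma> = ?j"
    using jA by (simp_all only: ses_sum_def ses.simps \<iota>\<pi>)
  let ?D = "defl ?\<sigma>"
  have D: "?D = Cmp C B ?X P (\<iota>P 0) (Cmp C B ?E ?X ?d (\<pi>B 0))
       \<oplus>\<^bsub>Hom C B P\<^esub> Cmp C B ?X' P (\<iota>P 1) (Cmp C B ?E' ?X' ?d' (\<pi>B 1))"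
    by (simp add: ses_sum_def)
  have Dm [simp]: "?D \<in> Mor C B P" unfolding D by simp
  have jB: "?j = Cmp C A ?E B (\<iota>B 0) (Cmp C A ?Y ?E ?i (\<pi>A 0)) \<oplus>\<^bsub>Hom C A B\<^esub> Cmp C A ?E' B (\<iota>B 1) (Cmp C A ?Y' ?E' ?i' (\<pi>A 1))"
    using jA by (simp only: \<iota>\<pi>)
  \<comment> \<open>Some conflation begins with \<open>?j\<close>, but its right end
    \<open>?Z\<close> has no given relation to \<open>P\<close>. The morphisms \<open>c\<close> from
    \<open>?Z\<close> to \<open>P\<close> and \<open>?e\<close> back will turn out to be inverse to
    each other, so that \<open>?\<sigma>\<close> is isomorphic to \<open>\<kappa>\<close>.\<close>
  obtain \<kappa> where \<kappa>: "\<kappa> \<in> Conf C" "lft \<kappa> = A" "mid \<kappa> = B" "infl \<kappa> = ?j" using j by (auto simp: inflation_def)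
  let ?Z = "rgt \<kappa>" and ?q = "defl \<kappa>"
  note k = conf_Ob[OF \<kappa>(1), unfolded \<kappa>(2-4)]
  note [simp] = k(3,5)
  note cok = conf_cokernel[OF \<kappa>(1), unfolded \<kappa>(2-4)]
  note dii = conf_Ob(6)[OF conf(1)] conf_Ob(6)[OF conf(2)]
  have "Cmp C A B P ?D ?j = \<zero>\<^bsub>Hom C A P\<^esub>"
    unfolding D jB by (simp add: eB[THEN Cmp_reassoc] dii[THEN Cmp_reassoc])
  then obtain c where [simp]: "c \<in> Mor C ?Z P" and c: "Cmp C B ?Z P c ?q = ?D"
    using cokernel_factor[OF cok, of P ?D] by auto
  have j0: "Cmp C ?Y A B ?j (\<iota>A 0) = Cmp C ?Y ?E B (\<iota>B 0) ?i" "Cmp C ?Y' A B ?j (\<iota>A 1) = Cmp C ?Y' ?E' B (\<iota>B 1) ?i'"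
    unfolding jB by (simp_all add: eA)
  have "Cmp C ?Y ?E ?Z (Cmp C ?E B ?Z ?q (\<iota>B 0)) ?i = \<zero>\<^bsub>Hom C ?Y ?Z\<^esub>"
    using Cmp_reassoc[OF k(6), of ?Y "\<iota>A 0"] j0(1) k by simp
  then obtain x where [simp]: "x \<in> Mor C ?X ?Z" and x: "Cmp C ?E ?X ?Z x ?d = Cmp C ?E B ?Z ?q (\<iota>B 0)"
    by (rule cokernel_factor[OF conf_cokernel[OF conf(1)], rotated 2]) simp_all
  have "Cmp C ?Y' ?E' ?Z (Cmp C ?E' B ?Z ?q (\<iota>B 1)) ?i' = \<zero>\<^bsub>Hom C ?Y' ?Z\<^esub>"
    using Cmp_reassoc[OF k(6), of ?Y' "\<iota>A 1"] j0(2) k by simp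
  then obtain y where [simp]: "y \<in> Mor C ?X' ?Z" and y: "Cmp C ?E' ?X' ?Z y ?d' = Cmp C ?E' B ?Z ?q (\<iota>B 1)"
    by (rule cokernel_factor[OF conf_cokernel[OF conf(2)], rotated 2]) simp_all
  note xy = x y
  let ?e = "Cmp C P ?X ?Z x (\<pi>P 0) \<oplus>\<^bsub>Hom C P ?Z\<^esub> Cmp C P ?X' ?Z y (\<pi>P 1)"
  have "Cmp C B P ?Z ?e ?D = Cmp C B B ?Z ?q (Cmp C B ?E B (\<iota>B 0) (\<pi>B 0) \<oplus>\<^bsub>Hom C B B\<^esub> Cmp C B ?E' B (\<iota>B 1) (\<pi>B 1))"
    unfolding D by (simp add: eP[THEN Cmp_reassoc] xy[THEN Cmp_reassoc])
  then have eD: "Cmp C B P ?Z ?e ?D = ?q" by (simp add: direct_sum_pair(12)[OF B])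
  have "Cmp C B ?Z ?Z (Cmp C ?Z P ?Z ?e c) ?q = Cmp C B ?Z ?Z (Idm C ?Z) ?q"
    using eD by (simp add: c)
  then have ec: "Cmp C ?Z P ?Z ?e c = Idm C ?Z"
    by - (rule cokernel_epi[OF cok, where W = ?Z], use k in simp_all)
  have "Cmp C ?E ?X P (Cmp C ?X ?Z P c x) ?d = Cmp C ?E ?X P (\<iota>P 0) ?d"
    "Cmp C ?E' ?X' P (Cmp C ?X' ?Z P c y) ?d' = Cmp C ?E' ?X' P (\<iota>P 1) ?d'"
    by (simp_all add: xy Cmp_reassoc[OF c] D eB)
  then have "Cmp C ?X ?Z P c x = \<iota>P 0" "Cmp C ?X' ?Z P c y = \<iota>P 1"
    by - (rule cokernel_epi[OF conf_cokernel[OF conf(1)], where W = P], simp_all,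
      rule cokernel_epi[OF conf_cokernel[OF conf(2)], where W = P], simp_all)
  then have ce: "Cmp C P ?Z P c ?e = Idm C P"
    using direct_sum_pair(12)[OF P] by (simp flip: Cmp_assoc)
  have "?\<sigma> \<in> Conf C"
  proof (rule conf_iso[OF \<kappa>(1), of ?\<sigma> "Idm C A" "Idm C B" c])
    show "ses_in C ?\<sigma>" using k by (simp add: ses_in_def \<sigma>)
    show "ses_mor C \<kappa> ?\<sigma> (Idm C A) (Idm C B) c" using k by (simp add: ses_mor_def \<sigma> \<kappa> c)
    show "is_iso C (rgt \<kappa>) (rgt ?\<sigma>) c" using ec ce by (auto simp: is_iso_def \<sigma> intro!: bexI[of _ ?e])
  qed (auto simp: is_iso_def \<sigma> \<kappa>)
  then show ?thesis using B by blast
qed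

end

section \<open>Pullbacks and pushouts of extensions\<close>

context exact_category
begin

text \<open>
  \<open>exts X Y\<close> consists of the conflations that represent elements of \<open>Ext(X, Y)\<close>; \<open>pullto \<eta> \<zeta> g\<close> says
  that \<open>\<eta>\<close> represents \<open>g\<^sup>*\<zeta>\<close>, and \<open>pushto \<zeta> \<eta> f\<close> that \<open>\<eta>\<close> represents \<open>f\<^sub>*\<zeta>\<close>.
\<close>

definition exts :: "'o \<Rightarrow> 'o \<Rightarrow> ('o, 'm) ses set"
  where "exts X Y = {\<xi> \<in> Conf C. lft \<xi> = Y \<and> rgt \<xi> = X}"

definition pullto :: "('o, 'm) ses \<Rightarrow> ('o, 'm) ses \<Rightarrow> 'm \<Rightarrow> bool"
  where "pullto \<eta> \<zeta> g \<longleftrightarrow> (\<exists>h. ses_mor C \<eta> \<zeta> (Idm C (lft \<zeta>)) h g)"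

definition pushto :: "('o, 'm) ses \<Rightarrow> ('o, 'm) ses \<Rightarrow> 'm \<Rightarrow> bool"
  where "pushto \<zeta> \<eta> f \<longleftrightarrow> (\<exists>h. ses_mor C \<zeta> \<eta> f h (Idm C (rgt \<zeta>)))"

lemma extsD:
  assumes "\<xi> \<in> exts X Y"
  shows "\<xi> \<in> Conf C" "lft \<xi> = Y" "rgt \<xi> = X" "X \<in> Ob C" "Y \<in> Ob C"
  using assms conf_Ob(1,3)[of \<xi>] by (auto simp: exts_def)

lemma pullto_closed: "\<lbrakk>\<eta> \<in> exts W Y; \<zeta> \<in> exts Z Y; pullto \<eta> \<zeta> g\<rbrakk> \<Longrightarrow> g \<in> Mor C W Z"
  by (auto simp: pullto_def ses_mor_def exts_def)

lemma pushto_closed: "\<lbrakk>\<zeta> \<in> exts X Y; \<eta> \<in> exts X Y'; pushto \<zeta> \<eta> f\<rbrakk> \<Longrightarrow> f \<in> Mor C Y Y'"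
  by (auto simp: pushto_def ses_mor_def exts_def)

lemma pullto_refl: "\<xi> \<in> exts X Y \<Longrightarrow> pullto \<xi> \<xi> (Idm C X)"
  using ses_mor_Idm[OF conf_ses[of \<xi>]] by (auto simp: exts_def pullto_def)

lemma pullto_trans:
  assumes e: "\<eta> \<in> exts W Y" "\<zeta> \<in> exts X Y" "\<xi> \<in> exts Z Y" and "pullto \<eta> \<zeta> g" "pullto \<zeta> \<xi> g'"
  shows "pullto \<eta> \<xi> (Cmp C W X Z g' g)"
proof -
  obtain h h' where h: "ses_mor C \<eta> \<zeta> (Idm C Y) h g" "ses_mor C \<zeta> \<xi> (Idm C Y) h' g'"
    using assms extsD by (auto simp: pullto_def)
  show ?thesis
    using conf_mor_comp[OF h extsD(1)[OF e(1)] extsD(1)[OF e(2)] extsD(1)[OF e(3)]] extsD(2-)[OF e(1)] extsD(2-)[OF e(2)] extsD(2-)[OF e(3)]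
    by (auto simp: pullto_def cat_simps)
qed

lemma pushto_trans:
  assumes e: "\<zeta> \<in> exts X Y" "\<eta> \<in> exts X Y'" "\<theta> \<in> exts X Z" and "pushto \<zeta> \<eta> f" "pushto \<eta> \<theta> f'"
  shows "pushto \<zeta> \<theta> (Cmp C Y Y' Z f' f)"
proof -
  obtain h h' where h: "ses_mor C \<zeta> \<eta> f h (Idm C X)" "ses_mor C \<eta> \<theta> f' h' (Idm C X)"
    using assms extsD by (auto simp: pushto_def)
  show ?thesis
    using conf_mor_comp[OF h extsD(1)[OF e(1)] extsD(1)[OF e(2)] extsD(1)[OF e(3)]] extsD(2-)[OF e(1)] extsD(2-)[OF e(2)] extsD(2-)[OF e(3)]
    by (auto simp: pushto_def cat_simps)
qed

text \<open>Cartesian lifting: because \<open>\<eta>\<close> is a pullback of \<open>\<xi>\<close>,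
  a morphism to \<open>\<xi>\<close> whose right end factors through \<open>g'\<close> passes
  through \<open>\<eta>\<close>.\<close>

lemma ses_mor_factor_pull:
  assumes e: "\<zeta> \<in> exts W Y'" "\<eta> \<in> exts X Y" "\<xi> \<in> exts Z Y" and p: "pullto \<eta> \<xi> g'"
    and m: "ses_mor C \<zeta> \<xi> f k (Cmp C W X Z g' g)" and g: "g \<in> Mor C W X"
  shows "\<exists>h. ses_mor C \<zeta> \<eta> f h g"
proof -
  obtain h where "ses_mor C \<eta> \<xi> (Idm C Y) h g'" using p extsD(2)[OF e(3)] by (auto simp: pullto_def)
  then show ?thesis
    using ses_mor_pullback_factor[OF extsD(1)[OF e(3)] extsD(1)[OF e(2)] extsD(1)[OF e(1)], of h g' f k g]
      extsD(2,3)[OF e(1)] extsD(2,3)[OF e(2)] extsD(2,3)[OF e(3)] m g by auto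
qed

lemma ses_mor_factor_push:
  assumes e: "\<rho> \<in> exts X Y" "\<eta> \<in> exts X Y'" "\<zeta> \<in> exts Z W" and p: "pushto \<rho> \<eta> f"
    and m: "ses_mor C \<rho> \<zeta> (Cmp C Y Y' W f' f) k g" and f': "f' \<in> Mor C Y' W"
  shows "\<exists>h. ses_mor C \<eta> \<zeta> f' h g"
proof -
  obtain h where "ses_mor C \<rho> \<eta> f h (Idm C X)" using p extsD(3)[OF e(1)] by (auto simp: pushto_def)
  then show ?thesis
    using ses_mor_pushout_factor[OF extsD(1)[OF e(1)] extsD(1)[OF e(2)] extsD(1)[OF e(3)], of f h f' k g]
      extsD(2,3)[OF e(1)] extsD(2,3)[OF e(2)] extsD(2,3)[OF e(3)] m f' by auto
qed

lemma pullto_factor: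
  assumes e: "\<zeta> \<in> exts W Y" "\<eta> \<in> exts X Y" "\<xi> \<in> exts Z Y" and "pullto \<eta> \<xi> g'"
    and "pullto \<zeta> \<xi> (Cmp C W X Z g' g)" "g \<in> Mor C W X"
  shows "pullto \<zeta> \<eta> g"
proof -
  obtain k where "ses_mor C \<zeta> \<xi> (Idm C Y) k (Cmp C W X Z g' g)" using assms extsD(2)[OF e(3)] by (auto simp: pullto_def)
  then show ?thesis using ses_mor_factor_pull[OF e assms(4) _ assms(6)] extsD(2)[OF e(2)] unfolding pullto_def by blast
qed

lemma pushto_factor:
  assumes e: "\<rho> \<in> exts X Y" "\<eta> \<in> exts X Y'" "\<zeta> \<in> exts X Z" and "pushto \<rho> \<eta> f"
    and "pushto \<rho> \<zeta> (Cmp C Y Y' Z f' f)" "f' \<in> Mor C Y' Z"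
  shows "pushto \<eta> \<zeta> f'"
proof -
  obtain k where "ses_mor C \<rho> \<zeta> (Cmp C Y Y' Z f' f) k (Idm C X)" using assms extsD(3)[OF e(1)] by (auto simp: pushto_def)
  then show ?thesis using ses_mor_factor_push[OF e assms(4) _ assms(6)] extsD(3)[OF e(2)] unfolding pushto_def by blast
qed

text \<open>A morphism of conflations with ends \<open>f\<close> and \<open>g\<close> factors
  through a pushout along \<open>f\<close>. What remains has an identity on the left, so it is a
  pullback: \<open>f\<^sub>*\<eta> = g\<^sup>*\<zeta>\<close>.\<close>

lemma ses_mor_push_pull:
  assumes e: "\<eta> \<in> exts X Y" "\<eta>' \<in> exts X Y'" "\<zeta> \<in> exts Z Y'"
    and m: "ses_mor C \<eta> \<zeta> f h g" and p: "pushto \<eta> \<eta>' f"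
  shows "pullto \<eta>' \<zeta> g"
proof -
  have f: "f \<in> Mor C Y Y'" using m extsD(2)[OF e(1)] extsD(2)[OF e(3)] by (auto simp: ses_mor_def)
  have "ses_mor C \<eta> \<zeta> (Cmp C Y Y' Y' (Idm C Y') f) h g" using m f extsD(5)[OF e(1)] extsD(5)[OF e(2)] by (simp add: cat_simps)
  then show ?thesis
    using ses_mor_factor_push[OF e p] extsD(2,5)[OF e(3)] by (auto simp: pullto_def cat_simps)
qed

text \<open>Pulling back and pushing out commute: the composite from \<open>\<eta>\<close> over
  \<open>\<zeta>\<close> to \<open>\<zeta>'\<close> has ends \<open>f\<close> and \<open>g\<close>,
  and \<open>ses_mor_push_pull\<close> applies to it.\<close>

lemma push_pull:
  assumes e: "\<eta> \<in> exts X Y" "\<eta>' \<in> exts X Y'" "\<zeta> \<in> exts Z Y" "\<zeta>' \<in> exts Z Y'"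
    and p: "pullto \<eta> \<zeta> g" "pushto \<zeta> \<zeta>' f" "pushto \<eta> \<eta>' f"
  shows "pullto \<eta>' \<zeta>' g"
proof -
  obtain h h' where h: "ses_mor C \<eta> \<zeta> (Idm C Y) h g" "ses_mor C \<zeta> \<zeta>' f h' (Idm C Z)"
    using p extsD(2,3)[OF e(3)] by (auto simp: pullto_def pushto_def)
  have "g \<in> Mor C X Z" "f \<in> Mor C Y Y'" using pullto_closed[OF e(1,3) p(1)] pushto_closed[OF e(3,4) p(2)] by auto
  then obtain k where "ses_mor C \<eta> \<zeta>' f k g"
    using conf_mor_comp[OF h extsD(1)[OF e(1)] extsD(1)[OF e(3)] extsD(1)[OF e(4)]]
      extsD(2-)[OF e(1)] extsD(2-)[OF e(3)] extsD(2-)[OF e(4)] by (auto simp: cat_simps)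
  then show ?thesis using ses_mor_push_pull[OF e(1,2,4) _ p(3)] by blast
qed

lemma pullto_exists:
  assumes "\<zeta> \<in> exts Z Y" "X \<in> Ob C" "g \<in> Mor C X Z"
  obtains \<eta> where "\<eta> \<in> exts X Y" "pullto \<eta> \<zeta> g"
  using pullback_conf_exists[of \<zeta> X g] assms extsD[OF assms(1)] by (auto simp: exts_def pullto_def)

lemma pushto_exists:
  assumes "\<zeta> \<in> exts X Y" "Z \<in> Ob C" "f \<in> Mor C Y Z"
  obtains \<eta> where "\<eta> \<in> exts X Z" "pushto \<zeta> \<eta> f"
  using pushout_conf_exists[of \<zeta> Z f] assms extsD[OF assms(1)] by (auto simp: exts_def pushto_def)

lemma split_pullto_iff:
  assumes e: "\<eta> \<in> exts X Y" "\<zeta> \<in> exts Z Y" and p: "pullto \<eta> \<zeta> g"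
  shows "split \<eta> \<longleftrightarrow> g \<in> contra_im C \<zeta> X"
proof -
  obtain h where "ses_mor C \<eta> \<zeta> (Idm C (lft \<zeta>)) h g" using p by (auto simp: pullto_def)
  then show ?thesis
    using split_pullback_iff[OF extsD(1)[OF e(1)] extsD(1)[OF e(2)]] extsD(2,3)[OF e(1)] extsD(2,3)[OF e(2)]
    by (auto simp: contra_im_def)
qed

lemma split_pushto_iff:
  assumes e: "\<eta> \<in> exts X Y" "\<zeta> \<in> exts X Z" and p: "pushto \<zeta> \<eta> f"
  shows "split \<eta> \<longleftrightarrow> f \<in> cov_im C \<zeta> Y"
proof -
  obtain h where "ses_mor C \<zeta> \<eta> f h (Idm C (rgt \<zeta>))" using p by (auto simp: pushto_def)
  then show ?thesis
    using split_pushout_iff[OF extsD(1)[OF e(1)] extsD(1)[OF e(2)]] extsD(2,3)[OF e(1)] extsD(2,3)[OF e(2)]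
    by (auto simp: cov_im_def)
qed

section \<open>Extension classes\<close>

text \<open>By the five lemma the isomorphism that \<open>ext_class\<close> demands in the middle is
  automatic, so equivalence of extensions becomes \<open>pullto\<close> along an identity.\<close>

lemma mem_ext_class:
  assumes "\<xi> \<in> exts X Y"
  shows "\<eta> \<in> ext_class C \<xi> \<longleftrightarrow> \<eta> \<in> exts X Y \<and> pullto \<xi> \<eta> (Idm C X)"
  using five_lemma(1)[of \<xi> \<eta>] extsD[OF assms]
  by (auto simp: ext_class_def exts_def pullto_def) blast

lemma pullto_Idm_sym:
  assumes "\<xi> \<in> exts X Y" "\<eta> \<in> exts X Y" "pullto \<xi> \<eta> (Idm C X)"
  shows "pullto \<eta> \<xi> (Idm C X)"
  using five_lemma(2)[of \<xi> \<eta>] assms extsD[OF assms(1)] extsD[OF assms(2)]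
  by (auto simp: pullto_def)

lemma ext_class_eq_iff:
  assumes "\<xi> \<in> exts X Y" "\<eta> \<in> exts X Y"
  shows "ext_class C \<xi> = ext_class C \<eta> \<longleftrightarrow> pullto \<xi> \<eta> (Idm C X)"
proof
  assume "ext_class C \<xi> = ext_class C \<eta>"
  then show "pullto \<xi> \<eta> (Idm C X)" using mem_ext_class assms pullto_refl by blast
next
  have *: "ext_class C \<eta> \<subseteq> ext_class C \<xi>" if "\<xi> \<in> exts X Y" "\<eta> \<in> exts X Y" "pullto \<xi> \<eta> (Idm C X)" for \<xi> \<eta>
  proof
    fix \<theta> assume "\<theta> \<in> ext_class C \<eta>"
    then have t: "\<theta> \<in> exts X Y" "pullto \<eta> \<theta> (Idm C X)" by (simp_all add: mem_ext_class[OF that(2)])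
    from pullto_trans[OF that(1,2) t(1) that(3) t(2)] show "\<theta> \<in> ext_class C \<xi>"
      using t(1) extsD(4)[OF that(1)] by (simp add: mem_ext_class[OF that(1)] cat_simps)
  qed
  assume "pullto \<xi> \<eta> (Idm C X)"
  then show "ext_class C \<xi> = ext_class C \<eta>" using * pullto_Idm_sym assms by blast
qed

lemma pullto_Idm_iff_pushto:
  assumes "\<xi> \<in> exts X Y" "\<eta> \<in> exts X Y"
  shows "pullto \<xi> \<eta> (Idm C X) \<longleftrightarrow> pushto \<xi> \<eta> (Idm C Y)"
  using extsD[OF assms(1)] extsD[OF assms(2)] by (simp add: pullto_def pushto_def)

lemma pullto_unique:
  assumes e: "\<eta> \<in> exts X Y" "\<eta>' \<in> exts X Y" "\<zeta> \<in> exts Z Y" and p: "pullto \<eta> \<zeta> g" "pullto \<eta>' \<zeta> g"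
  shows "ext_class C \<eta> = ext_class C \<eta>'"
  using pullto_factor[OF e p(2), of "Idm C X"] p(1) pullto_closed[OF e(1,3) p(1)] extsD(4)[OF e(1)] extsD(4)[OF e(3)]
  by (simp add: ext_class_eq_iff[OF e(1,2)] cat_simps)

lemma pushto_unique:
  assumes e: "\<eta> \<in> exts X Y" "\<eta>' \<in> exts X Y" "\<zeta> \<in> exts X Z" and p: "pushto \<zeta> \<eta> f" "pushto \<zeta> \<eta>' f"
  shows "ext_class C \<eta> = ext_class C \<eta>'"
  using pushto_factor[OF e(3,1,2) p(1), of "Idm C Y"] p(2) pushto_closed[OF e(3,1) p(1)] extsD(5)[OF e(1)] extsD(5)[OF e(3)]
  by (simp add: ext_class_eq_iff[OF e(1,2)] cat_simps pullto_Idm_iff_pushto[OF e(1,2)])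

text \<open>Reduces the set-valued operation to a single representative. The set is a full class
  because pullbacks are unique up to equivalence and absorb equivalences on either side.\<close>

lemma Ext_pull_eq:
  assumes e: "\<eta> \<in> exts X Z" "\<zeta> \<in> exts Y Z" and p: "pullto \<eta> \<zeta> g"
  shows "Ext_pull C Z X Y g (ext_class C \<zeta>) = ext_class C \<eta>"
proof (intro equalityI subsetI)
  note g = pullto_closed[OF e p] extsD(4)[OF e(1)] extsD(4)[OF e(2)]
  fix \<theta>
  {
    assume "\<theta> \<in> Ext_pull C Z X Y g (ext_class C \<zeta>)"
    then obtain \<xi> h where t: "\<theta> \<in> exts X Z" and x: "\<xi> \<in> ext_class C \<zeta>" and h: "ses_mor C \<theta> \<xi> (Idm C Z) h g"
      by (auto simp: Ext_pull_def exts_def)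
    have x': "\<xi> \<in> exts Y Z" "pullto \<xi> \<zeta> (Idm C Y)"
      using x pullto_Idm_sym[OF e(2)] by (auto simp: mem_ext_class[OF e(2)])
    have "pullto \<theta> \<xi> g" using h extsD(2)[OF x'(1)] by (auto simp: pullto_def)
    from pullto_trans[OF t x'(1) e(2) this x'(2)] have "pullto \<theta> \<zeta> g" using g by (simp add: cat_simps)
    then have "ext_class C \<eta> = ext_class C \<theta>" using pullto_unique[OF e(1) t e(2) p] by blast
    then show "\<theta> \<in> ext_class C \<eta>" by (simp add: mem_ext_class[OF e(1)] t ext_class_eq_iff[OF e(1) t])
  }
  assume "\<theta> \<in> ext_class C \<eta>"
  then have t: "\<theta> \<in> exts X Z" "pullto \<theta> \<eta> (Idm C X)" using pullto_Idm_sym[OF e(1)] by (auto simp: mem_ext_class[OF e(1)])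
  from pullto_trans[OF t(1) e t(2) p] have "pullto \<theta> \<zeta> g" using g by (simp add: cat_simps)
  moreover have "\<zeta> \<in> ext_class C \<zeta>" using e(2) pullto_refl by (simp add: mem_ext_class[OF e(2)])
  ultimately show "\<theta> \<in> Ext_pull C Z X Y g (ext_class C \<zeta>)"
    using t(1) extsD(2)[OF e(2)] by (auto simp: Ext_pull_def pullto_def exts_def)
qed

lemma Ext_push_eq:
  assumes e: "\<eta> \<in> exts X Y'" "\<zeta> \<in> exts X Y" and p: "pushto \<zeta> \<eta> f"
  shows "Ext_push C X Y Y' f (ext_class C \<zeta>) = ext_class C \<eta>"
proof (intro equalityI subsetI)
  note f = pushto_closed[OF e(2,1) p] extsD(5)[OF e(1)] extsD(5)[OF e(2)]
  fix \<theta>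
  {
    assume "\<theta> \<in> Ext_push C X Y Y' f (ext_class C \<zeta>)"
    then obtain \<xi> h where t: "\<theta> \<in> exts X Y'" and x: "\<xi> \<in> ext_class C \<zeta>" and h: "ses_mor C \<xi> \<theta> f h (Idm C X)"
      by (auto simp: Ext_push_def exts_def)
    have x': "\<xi> \<in> exts X Y" "pushto \<zeta> \<xi> (Idm C Y)"
      using x pullto_Idm_iff_pushto[OF e(2)] by (auto simp: mem_ext_class[OF e(2)])
    have "pushto \<xi> \<theta> f" using h extsD(3)[OF x'(1)] by (auto simp: pushto_def)
    from pushto_trans[OF e(2) x'(1) t x'(2) this] have "pushto \<zeta> \<theta> f" using f by (simp add: cat_simps)
    then have "ext_class C \<eta> = ext_class C \<theta>" using pushto_unique[OF e(1) t e(2) p] by blast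
    then show "\<theta> \<in> ext_class C \<eta>" by (simp add: mem_ext_class[OF e(1)] t ext_class_eq_iff[OF e(1) t])
  }
  assume "\<theta> \<in> ext_class C \<eta>"
  then have t: "\<theta> \<in> exts X Y'" "pushto \<eta> \<theta> (Idm C Y')"
    using pullto_Idm_iff_pushto[OF e(1)] by (auto simp: mem_ext_class[OF e(1)])
  from pushto_trans[OF e(2,1) t(1) p t(2)] have "pushto \<zeta> \<theta> f" using f by (simp add: cat_simps)
  moreover have "\<zeta> \<in> ext_class C \<zeta>" using e(2) pullto_refl by (simp add: mem_ext_class[OF e(2)])
  ultimately show "\<theta> \<in> Ext_push C X Y Y' f (ext_class C \<zeta>)"
    using t(1) extsD(3)[OF e(2)] by (auto simp: Ext_push_def pushto_def exts_def)
qed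

lemma Ext_carrier: "c \<in> carrier (Ext C X Y) \<longleftrightarrow> (\<exists>\<xi> \<in> exts X Y. c = ext_class C \<xi>)"
  by (auto simp: Ext_def exts_def)

lemma ext_class_in_Ext: "\<xi> \<in> exts X Y \<Longrightarrow> ext_class C \<xi> \<in> carrier (Ext C X Y)"
  by (auto simp: Ext_carrier)

text \<open>As the zero of \<open>Ext\<close> is the set of all split conflations, this set has to
  be one class: a section can be moved along an equivalence, and two split conflations are
  equivalent through \<open>i r + s d\<close>, where \<open>i\<close> and \<open>s\<close> belong to
  the target, the retraction \<open>r\<close> and \<open>d\<close> to the source.\<close>

lemma ext_class_eq_zero_iff:
  assumes e: "\<xi> \<in> exts X Y"
  shows "ext_class C \<xi> = \<zero>\<^bsub>Ext C X Y\<^esub> \<longleftrightarrow> split \<xi>"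
proof -
  have zero: "\<eta> \<in> \<zero>\<^bsub>Ext C X Y\<^esub> \<longleftrightarrow> \<eta> \<in> exts X Y \<and> split \<eta>" for \<eta>
    by (auto simp: Ext_def exts_def split_def)
  have pres: "split \<eta>" if "split \<theta>" "\<theta> \<in> exts X Y" "\<eta> \<in> exts X Y" "pullto \<theta> \<eta> (Idm C X)" for \<theta> \<eta>
  proof -
    note \<theta> = extsD[OF that(2)] and \<eta> = extsD[OF that(3)] and p = that(4) and sp = that(1)
    note [simp] = cat_simps conf_Ob(2)[OF \<theta>(1)] conf_Ob(5)[OF \<theta>(1), unfolded \<theta>(3)] conf_Ob(2)[OF \<eta>(1)] conf_Ob(5)[OF \<eta>(1), unfolded \<eta>(3)] \<theta>(4)
    obtain h where h: "ses_mor C \<theta> \<eta> (Idm C Y) h (Idm C X)" using p \<eta> by (auto simp: pullto_def)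
    obtain s where [simp]: "s \<in> Mor C X (mid \<theta>)" and s: "Cmp C X (mid \<theta>) X (defl \<theta>) s = Idm C X"
      using sp \<theta> by (auto simp: split_def)
    note hD = ses_morD(2,5)[OF h, unfolded \<theta>(3) \<eta>(3)]
    have [simp]: "h \<in> Mor C (mid \<theta>) (mid \<eta>)" by (rule hD)
    show ?thesis unfolding split_def \<eta>(3)
      by (rule bexI[of _ "Cmp C X (mid \<theta>) (mid \<eta>) h s"]) (simp_all add: Cmp_reassoc[OF hD(2)] s)
  qed
  have iso: "pullto \<xi> \<eta> (Idm C X)" if "split \<xi>" "\<eta> \<in> exts X Y" "split \<eta>" for \<eta>
  proof -
    note \<xi> = extsD[OF e] and \<eta> = extsD[OF that(2)] and sp = that(1,3)
    note [simp] = cat_simps conf_Ob(2)[OF \<xi>(1)] conf_Ob(4-6)[OF \<xi>(1), unfolded \<xi>(2,3)]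
      conf_Ob(2)[OF \<eta>(1)] conf_Ob(4-6)[OF \<eta>(1), unfolded \<eta>(2,3)] \<xi>(4,5)
    obtain r where [simp]: "r \<in> Mor C (mid \<xi>) Y" and r: "Cmp C Y (mid \<xi>) Y r (infl \<xi>) = Idm C Y"
      using split_imp_retraction[OF \<xi>(1) sp(1)] \<xi> by auto
    obtain s where [simp]: "s \<in> Mor C X (mid \<eta>)" and s: "Cmp C X (mid \<eta>) X (defl \<eta>) s = Idm C X"
      using sp(2) \<eta> by (auto simp: split_def)
    let ?h = "Cmp C (mid \<xi>) Y (mid \<eta>) (infl \<eta>) r \<oplus>\<^bsub>Hom C (mid \<xi>) (mid \<eta>)\<^esub> Cmp C (mid \<xi>) X (mid \<eta>) s (defl \<xi>)"
    have "ses_mor C \<xi> \<eta> (Idm C Y) ?h (Idm C X)"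
      unfolding ses_mor_def \<xi>(2,3) \<eta>(2,3)
      by (simp add: r Cmp_reassoc[OF s] Cmp_reassoc[OF conf_Ob(6)[OF \<eta>(1), unfolded \<eta>(2,3)]])
    then show ?thesis using \<eta>(2) by (auto simp: pullto_def)
  qed
  show ?thesis
  proof
    assume "ext_class C \<xi> = \<zero>\<^bsub>Ext C X Y\<^esub>"
    moreover have "\<xi> \<in> ext_class C \<xi>" using e pullto_refl by (simp add: mem_ext_class[OF e])
    ultimately show "split \<xi>" using zero by blast
  next
    assume "split \<xi>"
    then show "ext_class C \<xi> = \<zero>\<^bsub>Ext C X Y\<^esub>"
      using zero mem_ext_class[OF e] iso pres[OF _ e] by blast
  qed
qed

section \<open>The Baer sum\<close>

text \<open>\<open>Baer_sum\<close> admits arbitrary direct sums, and the sum sequence is recorded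
  here merely as a sequence. The conflation \<open>\<sigma>\<close> isomorphic to it stands in for
  it, and the comparison is kept in both directions: one serves targets, the other sources.\<close>

lemma Baer_sumE:
  assumes e: "\<xi> \<in> exts X Y" "\<xi>' \<in> exts X Y" and "\<eta> \<in> Baer_sum C X Y (ext_class C \<xi>) (ext_class C \<xi>')"
  obtains \<xi>1 \<xi>2 A \<iota>A \<pi>A B \<iota>B \<pi>B P \<iota>P \<pi>P \<rho> \<sigma> h h' where
    "\<xi>1 \<in> exts X Y" "pullto \<xi> \<xi>1 (Idm C X)" "\<xi>2 \<in> exts X Y" "pullto \<xi>' \<xi>2 (Idm C X)"
    "direct_sum C [Y, Y] A \<iota>A \<pi>A" "direct_sum C [mid \<xi>1, mid \<xi>2] B \<iota>B \<pi>B" "direct_sum C [X, X] P \<iota>P \<pi>P"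
    "\<eta> \<in> exts X Y" "\<rho> \<in> exts X A" "\<sigma> \<in> exts P A"
    "pushto \<rho> \<eta> (\<pi>A 0 \<oplus>\<^bsub>Hom C A Y\<^esub> \<pi>A 1)" "pullto \<rho> \<sigma> (\<iota>P 0 \<oplus>\<^bsub>Hom C X P\<^esub> \<iota>P 1)"
    "ses_in C (ses_sum C \<xi>1 \<xi>2 A \<pi>A B \<iota>B \<pi>B P \<iota>P)"
    "ses_mor C (ses_sum C \<xi>1 \<xi>2 A \<pi>A B \<iota>B \<pi>B P \<iota>P) \<sigma> (Idm C A) h (Idm C P)"
    "ses_mor C \<sigma> (ses_sum C \<xi>1 \<xi>2 A \<pi>A B \<iota>B \<pi>B P \<iota>P) (Idm C A) h' (Idm C P)"
proof -
  obtain \<xi>1 \<xi>2 A \<iota>A \<pi>A B \<iota>B \<pi>B P \<iota>P \<pi>P where x: "\<xi>1 \<in> ext_class C \<xi>" "\<xi>2 \<in> ext_class C \<xi>'"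
    and A: "direct_sum C [Y, Y] A \<iota>A \<pi>A" and B: "direct_sum C [mid \<xi>1, mid \<xi>2] B \<iota>B \<pi>B" and P: "direct_sum C [X, X] P \<iota>P \<pi>P"
    and \<eta>: "\<eta> \<in> Ext_push C X A Y (\<pi>A 0 \<oplus>\<^bsub>Hom C A Y\<^esub> \<pi>A 1)
          (Ext_pull C A X P (\<iota>P 0 \<oplus>\<^bsub>Hom C X P\<^esub> \<iota>P 1) (ext_class C (ses_sum C \<xi>1 \<xi>2 A \<pi>A B \<iota>B \<pi>B P \<iota>P)))"
    using assms(3) unfolding Baer_sum_def by blast
  let ?S = "ses_sum C \<xi>1 \<xi>2 A \<pi>A B \<iota>B \<pi>B P \<iota>P"
  have S: "lft ?S = A" "mid ?S = B" "rgt ?S = P" by (simp_all add: ses_sum_def)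
  have x': "\<xi>1 \<in> exts X Y" "pullto \<xi> \<xi>1 (Idm C X)" "\<xi>2 \<in> exts X Y" "pullto \<xi>' \<xi>2 (Idm C X)"
    using x by (simp_all add: mem_ext_class[OF e(1)] mem_ext_class[OF e(2)])
  note x1 = extsD[OF x'(1)] and x2 = extsD[OF x'(3)]
  obtain \<rho> h1 where \<eta>': "\<eta> \<in> exts X Y" and \<rho>: "\<rho> \<in> Ext_pull C A X P (\<iota>P 0 \<oplus>\<^bsub>Hom C X P\<^esub> \<iota>P 1) (ext_class C ?S)"
    and h1: "ses_mor C \<rho> \<eta> (\<pi>A 0 \<oplus>\<^bsub>Hom C A Y\<^esub> \<pi>A 1) h1 (Idm C X)"
    using \<eta> by (auto simp: Ext_push_def exts_def)
  obtain \<sigma> h2 where \<rho>': "\<rho> \<in> exts X A" and \<sigma>: "\<sigma> \<in> ext_class C ?S" and h2: "ses_mor C \<rho> \<sigma> (Idm C A) h2 (\<iota>P 0 \<oplus>\<^bsub>Hom C X P\<^esub> \<iota>P 1)"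
    using \<rho> by (auto simp: Ext_pull_def exts_def)
  obtain h where \<sigma>': "\<sigma> \<in> exts P A" and iso: "is_iso C B (mid \<sigma>) h" and h: "ses_mor C ?S \<sigma> (Idm C A) h (Idm C P)"
    using \<sigma> by (auto simp: ext_class_def exts_def S)
  note sD = extsD[OF \<sigma>']
  note [simp del] = One_nat_def
  have Sin: "ses_in C ?S"
    using direct_sum_pair(1-7)[OF A] direct_sum_pair(1-7)[OF B] direct_sum_pair(1-7)[OF P]
      conf_Ob(4,5)[OF x1(1)] conf_Ob(4,5)[OF x2(1)] x1 x2
    by (simp add: ses_in_def ses_sum_def cat_simps)
  obtain h' where h': "h' \<in> Mor C (mid \<sigma>) B" "Cmp C B (mid \<sigma>) B h' h = Idm C B" "Cmp C (mid \<sigma>) B (mid \<sigma>) h h' = Idm C (mid \<sigma>)"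
    using is_iso_inverse[OF iso] by blast
  have "ses_mor C \<sigma> ?S (Idm C A) h' (Idm C P)"
    by (rule ses_mor_inverse[OF h Sin conf_ses[OF sD(1)]]) (use sD h' in \<open>simp_all add: S cat_simps\<close>)
  with that[OF x' A B P \<eta>' \<rho>' \<sigma>' _ _ Sin h] show thesis
    using h1 h2 sD extsD(2,3)[OF \<rho>'] by (auto simp: pushto_def pullto_def)
qed

text \<open>The row with entries \<open>g\<close> and \<open>g'\<close> maps the direct sum to
  \<open>\<zeta>\<close>, with the codiagonal on the left; restricted along the diagonal its right
  end becomes \<open>g + g'\<close>. The pushout along the codiagonal turns the left end into an
  identity.\<close>

lemma Baer_sum_pullto:
  assumes e: "\<xi> \<in> exts X Y" "\<xi>' \<in> exts X Y" "\<zeta> \<in> exts Z Y" and \<eta>: "\<eta> \<in> Baer_sum C X Y (ext_class C \<xi>) (ext_class C \<xi>')"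
    and p: "pullto \<xi> \<zeta> g" "pullto \<xi>' \<zeta> g'"
  shows "\<eta> \<in> exts X Y \<and> pullto \<eta> \<zeta> (g \<oplus>\<^bsub>Hom C X Z\<^esub> g')"
proof -
  obtain \<xi>1 \<xi>2 A \<iota>A \<pi>A B \<iota>B \<pi>B P \<iota>P \<pi>P \<rho> \<sigma> h h' where
    x: "\<xi>1 \<in> exts X Y" "pullto \<xi> \<xi>1 (Idm C X)" "\<xi>2 \<in> exts X Y" "pullto \<xi>' \<xi>2 (Idm C X)"
    and A: "direct_sum C [Y, Y] A \<iota>A \<pi>A" and B: "direct_sum C [mid \<xi>1, mid \<xi>2] B \<iota>B \<pi>B" and P: "direct_sum C [X, X] P \<iota>P \<pi>P"
    and \<eta>: "\<eta> \<in> exts X Y" and \<rho>: "\<rho> \<in> exts X A" and \<sigma>: "\<sigma> \<in> exts P A"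
    and pu: "pushto \<rho> \<eta> (\<pi>A 0 \<oplus>\<^bsub>Hom C A Y\<^esub> \<pi>A 1)" "pullto \<rho> \<sigma> (\<iota>P 0 \<oplus>\<^bsub>Hom C X P\<^esub> \<iota>P 1)"
    and S: "ses_in C (ses_sum C \<xi>1 \<xi>2 A \<pi>A B \<iota>B \<pi>B P \<iota>P)"
    "ses_mor C (ses_sum C \<xi>1 \<xi>2 A \<pi>A B \<iota>B \<pi>B P \<iota>P) \<sigma> (Idm C A) h (Idm C P)"
    "ses_mor C \<sigma> (ses_sum C \<xi>1 \<xi>2 A \<pi>A B \<iota>B \<pi>B P \<iota>P) (Idm C A) h' (Idm C P)"
    by (rule Baer_sumE[OF e(1,2) \<eta>])
  let ?S = "ses_sum C \<xi>1 \<xi>2 A \<pi>A B \<iota>B \<pi>B P \<iota>P"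
  have Ssel: "lft ?S = A" "mid ?S = B" "rgt ?S = P" by (simp_all add: ses_sum_def)
  note x1 = extsD[OF x(1)] and x2 = extsD[OF x(3)] and zD = extsD[OF e(3)] and sD = extsD[OF \<sigma>] and rD = extsD[OF \<rho>]
  note [simp del] = One_nat_def
  note [simp] = cat_simps direct_sum_pair(1-7)[OF A] direct_sum_pair(1-7)[OF P] x1(4,5) zD(4)
  have g: "g \<in> Mor C X Z" "g' \<in> Mor C X Z" using pullto_closed[OF e(1,3) p(1)] pullto_closed[OF e(2,3) p(2)] by auto
  note [simp] = g
  have "pullto \<xi>1 \<zeta> (Cmp C X X Z g (Idm C X))" "pullto \<xi>2 \<zeta> (Cmp C X X Z g' (Idm C X))"
    using pullto_trans[OF x(1) e(1) e(3) pullto_Idm_sym[OF e(1) x(1,2)] p(1)]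
      pullto_trans[OF x(3) e(2) e(3) pullto_Idm_sym[OF e(2) x(3,4)] p(2)] by auto
  then obtain k k' where k: "ses_mor C \<xi>1 \<zeta> (Idm C Y) k g" "ses_mor C \<xi>2 \<zeta> (Idm C Y) k' g'"
    using zD by (auto simp: pullto_def)
  note m1 = ses_sum_to[OF conf_ses[OF x1(1)] conf_ses[OF x2(1)] conf_ses[OF zD(1)] k, unfolded x1(2,3) x2(2,3) zD(2,3), OF A B P]
  note m2 = ses_mor_comp[OF S(3) m1 conf_ses[OF sD(1)] S(1) conf_ses[OF zD(1)]]
  obtain l where l: "ses_mor C \<rho> \<sigma> (Idm C A) l (\<iota>P 0 \<oplus>\<^bsub>Hom C X P\<^esub> \<iota>P 1)" using pu(2) sD by (auto simp: pullto_def)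
  note m3 = ses_mor_comp[OF l m2 conf_ses[OF rD(1)] conf_ses[OF sD(1)] conf_ses[OF zD(1)]]
  have "\<exists>n. ses_mor C \<rho> \<zeta> (\<pi>A 0 \<oplus>\<^bsub>Hom C A Y\<^esub> \<pi>A 1) n (g \<oplus>\<^bsub>Hom C X Z\<^esub> g')"
    using m3 by (auto simp: Ssel sD rD zD direct_sum_pair(8-11)[OF P])
  then show ?thesis using ses_mor_push_pull[OF \<rho> \<eta> e(3) _ pu(1)] \<eta> by blast
qed

text \<open>The column with entries \<open>f\<close> and \<open>f'\<close> maps
  \<open>\<zeta>\<close> to the direct sum, with the diagonal on the right, and hence lifts to the
  pullback \<open>\<rho>\<close> along the diagonal. Composing with the codiagonal adds up the
  entries.\<close>

lemma Baer_sum_pushto: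
  assumes e: "\<xi> \<in> exts X Y" "\<xi>' \<in> exts X Y" "\<zeta> \<in> exts X Z" and \<eta>: "\<eta> \<in> Baer_sum C X Y (ext_class C \<xi>) (ext_class C \<xi>')"
    and p: "pushto \<zeta> \<xi> f" "pushto \<zeta> \<xi>' f'"
  shows "pushto \<zeta> \<eta> (f \<oplus>\<^bsub>Hom C Z Y\<^esub> f')"
proof -
  obtain \<xi>1 \<xi>2 A \<iota>A \<pi>A B \<iota>B \<pi>B P \<iota>P \<pi>P \<rho> \<sigma> h h' where
    x: "\<xi>1 \<in> exts X Y" "pullto \<xi> \<xi>1 (Idm C X)" "\<xi>2 \<in> exts X Y" "pullto \<xi>' \<xi>2 (Idm C X)"
    and A: "direct_sum C [Y, Y] A \<iota>A \<pi>A" and B: "direct_sum C [mid \<xi>1, mid \<xi>2] B \<iota>B \<pi>B" and P: "direct_sum C [X, X] P \<iota>P \<pi>P"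
    and \<eta>: "\<eta> \<in> exts X Y" and \<rho>: "\<rho> \<in> exts X A" and \<sigma>: "\<sigma> \<in> exts P A"
    and pu: "pushto \<rho> \<eta> (\<pi>A 0 \<oplus>\<^bsub>Hom C A Y\<^esub> \<pi>A 1)" "pullto \<rho> \<sigma> (\<iota>P 0 \<oplus>\<^bsub>Hom C X P\<^esub> \<iota>P 1)"
    and S: "ses_in C (ses_sum C \<xi>1 \<xi>2 A \<pi>A B \<iota>B \<pi>B P \<iota>P)"
    "ses_mor C (ses_sum C \<xi>1 \<xi>2 A \<pi>A B \<iota>B \<pi>B P \<iota>P) \<sigma> (Idm C A) h (Idm C P)"
    "ses_mor C \<sigma> (ses_sum C \<xi>1 \<xi>2 A \<pi>A B \<iota>B \<pi>B P \<iota>P) (Idm C A) h' (Idm C P)"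
    by (rule Baer_sumE[OF e(1,2) \<eta>])
  let ?S = "ses_sum C \<xi>1 \<xi>2 A \<pi>A B \<iota>B \<pi>B P \<iota>P"
  have Ssel: "lft ?S = A" "mid ?S = B" "rgt ?S = P" by (simp_all add: ses_sum_def)
  note x1 = extsD[OF x(1)] and x2 = extsD[OF x(3)] and zD = extsD[OF e(3)] and sD = extsD[OF \<sigma>] and rD = extsD[OF \<rho>] and hD = extsD[OF \<eta>]
  note [simp del] = One_nat_def
  note [simp] = cat_simps direct_sum_pair(1-7)[OF A] direct_sum_pair(1-7)[OF P] x1(4,5) zD(5)
  have f: "f \<in> Mor C Z Y" "f' \<in> Mor C Z Y" using pushto_closed[OF e(3,1) p(1)] pushto_closed[OF e(3,2) p(2)] by auto
  note [simp] = f
  have px: "pushto \<xi> \<xi>1 (Idm C Y)" "pushto \<xi>' \<xi>2 (Idm C Y)"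
    using x pullto_Idm_iff_pushto[OF e(1) x(1)] pullto_Idm_iff_pushto[OF e(2) x(3)] by simp_all
  have "pushto \<zeta> \<xi>1 f" "pushto \<zeta> \<xi>2 f'"
    using pushto_trans[OF e(3) e(1) x(1) p(1) px(1)] pushto_trans[OF e(3) e(2) x(3) p(2) px(2)] by simp_all
  then obtain k k' where k: "ses_mor C \<zeta> \<xi>1 f k (Idm C X)" "ses_mor C \<zeta> \<xi>2 f' k' (Idm C X)"
    using zD by (auto simp: pushto_def)
  note m1 = ses_sum_from[OF conf_ses[OF x1(1)] conf_ses[OF x2(1)] conf_ses[OF zD(1)] k, unfolded x1(2,3) x2(2,3) zD(2,3), OF A B P]
  note m2 = ses_mor_comp[OF m1 S(2) conf_ses[OF zD(1)] S(1) conf_ses[OF sD(1)]]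
  let ?a = "Cmp C Z Y A (\<iota>A 0) f \<oplus>\<^bsub>Hom C Z A\<^esub> Cmp C Z Y A (\<iota>A 1) f'"
  have "\<exists>n. ses_mor C \<zeta> \<sigma> ?a n (Cmp C X X P (\<iota>P 0 \<oplus>\<^bsub>Hom C X P\<^esub> \<iota>P 1) (Idm C X))"
    using m2 by (auto simp: Ssel sD zD)
  then obtain n where "ses_mor C \<zeta> \<rho> ?a n (Idm C X)"
    using ses_mor_factor_pull[OF e(3) \<rho> \<sigma> pu(2)] by (metis Idm_closed x1(4))
  then have "pushto \<zeta> \<rho> ?a" using zD(3) by (auto simp: pushto_def)
  from pushto_trans[OF e(3) \<rho> \<eta> this pu(1)] show ?thesis
    by (simp add: direct_sum_pair(8-11)[OF A] direct_sum_pair(8-11)[OF A, THEN Cmp_reassoc])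
qed

text \<open>\<open>Baer_sum\<close> is a set comprehension that could be empty a priori;
  \<open>ses_sum_conf\<close> provides a conflation from which a member can be built.\<close>

lemma Baer_sum_nonempty:
  assumes e: "\<xi> \<in> exts X Y" "\<xi>' \<in> exts X Y"
  obtains \<eta> where "\<eta> \<in> Baer_sum C X Y (ext_class C \<xi>) (ext_class C \<xi>')"
proof -
  note [simp del] = One_nat_def
  note x = extsD[OF e(1)] and x' = extsD[OF e(2)]
  obtain A \<iota>A \<pi>A where A: "direct_sum C [Y, Y] A \<iota>A \<pi>A" using direct_sums[of "[Y, Y]"] x by auto
  obtain P \<iota>P \<pi>P where P: "direct_sum C [X, X] P \<iota>P \<pi>P" using direct_sums[of "[X, X]"] x by auto
  obtain B \<iota>B \<pi>B where B: "direct_sum C [mid \<xi>, mid \<xi>'] B \<iota>B \<pi>B" and S: "ses_sum C \<xi> \<xi>' A \<pi>A B \<iota>B \<pi>B P \<iota>P \<in> Conf C"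
    using ses_sum_conf[OF x(1) x'(1), unfolded x x', OF A P] by blast
  let ?S = "ses_sum C \<xi> \<xi>' A \<pi>A B \<iota>B \<pi>B P \<iota>P"
  have S: "?S \<in> exts P A" using S by (simp add: exts_def ses_sum_def)
  note [simp] = cat_simps direct_sum_pair(1-7)[OF A] direct_sum_pair(1-7)[OF P]
  obtain \<rho> where \<rho>: "\<rho> \<in> exts X A" "pullto \<rho> ?S (\<iota>P 0 \<oplus>\<^bsub>Hom C X P\<^esub> \<iota>P 1)"
    by (rule pullto_exists[OF S, of X "\<iota>P 0 \<oplus>\<^bsub>Hom C X P\<^esub> \<iota>P 1"]) simp_all
  obtain \<eta> where \<eta>: "\<eta> \<in> exts X Y" "pushto \<rho> \<eta> (\<pi>A 0 \<oplus>\<^bsub>Hom C A Y\<^esub> \<pi>A 1)"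
    by (rule pushto_exists[OF \<rho>(1), of Y "\<pi>A 0 \<oplus>\<^bsub>Hom C A Y\<^esub> \<pi>A 1"]) simp_all
  have self: "\<theta> \<in> ext_class C \<theta>" if "\<theta> \<in> exts V W" for \<theta> V W using that pullto_refl by (simp add: mem_ext_class[OF that])
  have "\<eta> \<in> Ext_push C X A Y (\<pi>A 0 \<oplus>\<^bsub>Hom C A Y\<^esub> \<pi>A 1) (Ext_pull C A X P (\<iota>P 0 \<oplus>\<^bsub>Hom C X P\<^esub> \<iota>P 1) (ext_class C ?S))"
    unfolding Ext_pull_eq[OF \<rho>(1) S \<rho>(2)] Ext_push_eq[OF \<eta>(1) \<rho>(1) \<eta>(2)] by (rule self[OF \<eta>(1)])
  then show thesis
    using that[of \<eta>] self[OF e(1)] self[OF e(2)] A B P unfolding Baer_sum_def by blast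
qed

lemma Baer_sum_closed:
  assumes "\<eta> \<in> Baer_sum C X Y c c'" "\<eta> \<in> exts X Y" "\<eta>' \<in> exts X Y" "pullto \<eta> \<eta>' (Idm C X)"
  shows "\<eta>' \<in> Baer_sum C X Y c c'"
proof -
  have m: "pushto \<eta> \<eta>' (Idm C Y)" using assms pullto_Idm_iff_pushto by blast
  have *: "\<eta>' \<in> Ext_push C X A Y f (Ext_pull C A X P g d)" if *: "\<eta> \<in> Ext_push C X A Y f (Ext_pull C A X P g d)" for A P f g d
  proof -
    obtain \<rho> h where \<rho>: "\<rho> \<in> Ext_pull C A X P g d" and h: "ses_mor C \<rho> \<eta> f h (Idm C X)" using * by (auto simp: Ext_push_def)
    have r: "\<rho> \<in> exts X A" using \<rho> by (auto simp: Ext_pull_def exts_def)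
    have p: "pushto \<rho> \<eta> f" using h extsD(3)[OF r] by (auto simp: pushto_def)
    from pushto_trans[OF r assms(2,3) p m] have "pushto \<rho> \<eta>' f"
      using pushto_closed[OF r assms(2) p] extsD(5)[OF r] extsD(5)[OF assms(2)] by (simp add: cat_simps)
    then show ?thesis using \<rho> assms(3) extsD(3)[OF r] unfolding Ext_push_def pushto_def exts_def by auto
  qed
  show ?thesis using assms(1) * unfolding Baer_sum_def by blast
qed

text \<open>Every member of the Baer sum represents the pullback along \<open>g + g'\<close>, a
  member exists, and the set is closed under equivalence; so it is exactly one class.\<close>

lemma Ext_add_pullto:
  assumes e: "\<xi> \<in> exts X Y" "\<xi>' \<in> exts X Y" "\<zeta> \<in> exts Z Y" "\<eta> \<in> exts X Y"
    and p: "pullto \<xi> \<zeta> g" "pullto \<xi>' \<zeta> g'" "pullto \<eta> \<zeta> (g \<oplus>\<^bsub>Hom C X Z\<^esub> g')"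
  shows "ext_class C \<xi> \<oplus>\<^bsub>Ext C X Y\<^esub> ext_class C \<xi>' = ext_class C \<eta>"
proof -
  let ?B = "Baer_sum C X Y (ext_class C \<xi>) (ext_class C \<xi>')"
  have B: "\<theta> \<in> exts X Y \<and> ext_class C \<theta> = ext_class C \<eta>" if "\<theta> \<in> ?B" for \<theta>
    using Baer_sum_pullto[OF e(1-3) that p(1,2)] pullto_unique[OF _ e(4,3) _ p(3)] by blast
  obtain \<eta>0 where \<eta>0: "\<eta>0 \<in> ?B" by (rule Baer_sum_nonempty[OF e(1,2)])
  have "?B = ext_class C \<eta>"
  proof (intro equalityI subsetI)
    fix \<theta> assume "\<theta> \<in> ?B"
    from B[OF this] have "\<theta> \<in> exts X Y" "ext_class C \<eta> = ext_class C \<theta>" by auto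
    then show "\<theta> \<in> ext_class C \<eta>" using mem_ext_class[OF e(4)] ext_class_eq_iff[OF e(4)] by blast
  next
    fix \<theta> assume "\<theta> \<in> ext_class C \<eta>"
    then have t: "\<theta> \<in> exts X Y" "ext_class C \<eta> = ext_class C \<theta>" using mem_ext_class[OF e(4)] ext_class_eq_iff[OF e(4)] by blast+
    have h: "\<eta>0 \<in> exts X Y" "ext_class C \<eta>0 = ext_class C \<theta>" using B[OF \<eta>0] t by auto
    then have "pullto \<eta>0 \<theta> (Idm C X)" using ext_class_eq_iff[OF h(1) t(1)] by blast
    then show "\<theta> \<in> ?B" using Baer_sum_closed[OF \<eta>0 h(1) t(1)] by blast
  qed
  then show ?thesis by (simp add: Ext_def)
qed

lemma Ext_common:
  assumes "\<xi> \<in> exts X Y" "\<xi>' \<in> exts X' Y"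
  obtains \<zeta> Z g g' where "\<zeta> \<in> exts Z Y" "pullto \<xi> \<zeta> g" "pullto \<xi>' \<zeta> g'" "g \<in> Mor C X Z" "g' \<in> Mor C X' Z" "Z \<in> Ob C"
proof -
  note x = extsD[OF assms(1)] and x' = extsD[OF assms(2)]
  obtain \<zeta> h g h' g' where *: "\<zeta> \<in> Conf C" "lft \<zeta> = Y" "ses_mor C \<xi> \<zeta> (Idm C Y) h g" "ses_mor C \<xi>' \<zeta> (Idm C Y) h' g'"
    using common_target[OF x(1) x'(1)] x(2) x'(2) by metis
  have z: "\<zeta> \<in> exts (rgt \<zeta>) Y" and p: "pullto \<xi> \<zeta> g" "pullto \<xi>' \<zeta> g'" using * by (auto simp: exts_def pullto_def)
  then show thesis using that pullto_closed assms extsD(4) by metis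
qed

text \<open>A common target of \<open>\<xi>\<close> and \<open>\<xi>'\<close> already computes the
  sum. One member \<open>\<eta>0\<close> of the Baer sum is at once that pullback and the pushout
  along \<open>f + f'\<close>, which ties the two descriptions together.\<close>

lemma Ext_add_pushto:
  assumes e: "\<xi> \<in> exts X Y" "\<xi>' \<in> exts X Y" "\<zeta> \<in> exts X Z" "\<eta> \<in> exts X Y"
    and p: "pushto \<zeta> \<xi> f" "pushto \<zeta> \<xi>' f'" "pushto \<zeta> \<eta> (f \<oplus>\<^bsub>Hom C Z Y\<^esub> f')"
  shows "ext_class C \<xi> \<oplus>\<^bsub>Ext C X Y\<^esub> ext_class C \<xi>' = ext_class C \<eta>"
proof -
  obtain \<theta> W g g' where t: "\<theta> \<in> exts W Y" "pullto \<xi> \<theta> g" "pullto \<xi>' \<theta> g'" "g \<in> Mor C X W" "g' \<in> Mor C X W" "W \<in> Ob C"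
    by (rule Ext_common[OF e(1,2)])
  obtain \<eta>0 where \<eta>0: "\<eta>0 \<in> Baer_sum C X Y (ext_class C \<xi>) (ext_class C \<xi>')" by (rule Baer_sum_nonempty[OF e(1,2)])
  have *: "\<eta>0 \<in> exts X Y" "pullto \<eta>0 \<theta> (g \<oplus>\<^bsub>Hom C X W\<^esub> g')" using Baer_sum_pullto[OF e(1,2) t(1) \<eta>0 t(2,3)] by auto
  have "ext_class C \<eta>0 = ext_class C \<eta>"
    using pushto_unique[OF *(1) e(4,3) Baer_sum_pushto[OF e(1-3) \<eta>0 p(1,2)] p(3)] .
  then show ?thesis using Ext_add_pullto[OF e(1,2) t(1) *(1) t(2,3) *(2)] by simp
qed

section \<open>Connecting maps and the module structure on extensions\<close>

text \<open>The connecting map of the long exact sequence for \<open>Hom(X, -)\<close>;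
  \<open>coconn\<close> is the one for \<open>Hom(-, W)\<close>.\<close>

definition conn :: "('o, 'm) ses \<Rightarrow> 'o \<Rightarrow> 'm \<Rightarrow> ('o, 'm) ses set"
  where "conn \<zeta> X g = Ext_pull C (lft \<zeta>) X (rgt \<zeta>) g (ext_class C \<zeta>)"

definition coconn :: "('o, 'm) ses \<Rightarrow> 'o \<Rightarrow> 'm \<Rightarrow> ('o, 'm) ses set"
  where "coconn \<zeta> W f = Ext_push C (rgt \<zeta>) (lft \<zeta>) W f (ext_class C \<zeta>)"

lemma conn_eq: "\<lbrakk>\<zeta> \<in> exts Z Y; \<eta> \<in> exts X Y; pullto \<eta> \<zeta> g\<rbrakk> \<Longrightarrow> conn \<zeta> X g = ext_class C \<eta>"
  using Ext_pull_eq[of \<eta> X Y \<zeta> Z g] extsD[of \<zeta> Z Y] by (simp add: conn_def)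

lemma coconn_eq: "\<lbrakk>\<zeta> \<in> exts X Y; \<eta> \<in> exts X W; pushto \<zeta> \<eta> f\<rbrakk> \<Longrightarrow> coconn \<zeta> W f = ext_class C \<eta>"
  using Ext_push_eq[of \<eta> X W \<zeta> Y f] extsD[of \<zeta> X Y] by (simp add: coconn_def)

lemma conn_closed:
  assumes "\<zeta> \<in> exts Z Y" "X \<in> Ob C" "g \<in> Mor C X Z"
  shows "conn \<zeta> X g \<in> carrier (Ext C X Y)"
  using pullto_exists[OF assms] conn_eq[OF assms(1)] ext_class_in_Ext by metis

lemma coconn_closed:
  assumes "\<zeta> \<in> exts X Y" "W \<in> Ob C" "f \<in> Mor C Y W"
  shows "coconn \<zeta> W f \<in> carrier (Ext C X W)"
  using pushto_exists[OF assms] coconn_eq[OF assms(1)] ext_class_in_Ext by metis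

lemma conn_add:
  assumes z: "\<zeta> \<in> exts Z Y" and X: "X \<in> Ob C" and g: "g \<in> Mor C X Z" "g' \<in> Mor C X Z"
  shows "conn \<zeta> X (g \<oplus>\<^bsub>Hom C X Z\<^esub> g') = conn \<zeta> X g \<oplus>\<^bsub>Ext C X Y\<^esub> conn \<zeta> X g'"
proof -
  have "g \<oplus>\<^bsub>Hom C X Z\<^esub> g' \<in> Mor C X Z" using X g extsD(4)[OF z] by (simp add: cat_simps)
  then obtain \<eta> where \<eta>: "\<eta> \<in> exts X Y" "pullto \<eta> \<zeta> (g \<oplus>\<^bsub>Hom C X Z\<^esub> g')" using pullto_exists[OF z X] by blast
  obtain \<xi> where \<xi>: "\<xi> \<in> exts X Y" "pullto \<xi> \<zeta> g" using pullto_exists[OF z X g(1)] by blast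
  obtain \<xi>' where \<xi>': "\<xi>' \<in> exts X Y" "pullto \<xi>' \<zeta> g'" using pullto_exists[OF z X g(2)] by blast
  show ?thesis
    unfolding conn_eq[OF z \<eta>] conn_eq[OF z \<xi>] conn_eq[OF z \<xi>']
    by (rule Ext_add_pullto[OF \<xi>(1) \<xi>'(1) z \<eta>(1) \<xi>(2) \<xi>'(2) \<eta>(2), symmetric])
qed

lemma coconn_add:
  assumes z: "\<zeta> \<in> exts X Y" and W: "W \<in> Ob C" and f: "f \<in> Mor C Y W" "f' \<in> Mor C Y W"
  shows "coconn \<zeta> W (f \<oplus>\<^bsub>Hom C Y W\<^esub> f') = coconn \<zeta> W f \<oplus>\<^bsub>Ext C X W\<^esub> coconn \<zeta> W f'"
proof -
  have "f \<oplus>\<^bsub>Hom C Y W\<^esub> f' \<in> Mor C Y W" using W f extsD(5)[OF z] by (simp add: cat_simps)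
  then obtain \<eta> where \<eta>: "\<eta> \<in> exts X W" "pushto \<zeta> \<eta> (f \<oplus>\<^bsub>Hom C Y W\<^esub> f')" using pushto_exists[OF z W] by blast
  obtain \<xi> where \<xi>: "\<xi> \<in> exts X W" "pushto \<zeta> \<xi> f" using pushto_exists[OF z W f(1)] by blast
  obtain \<xi>' where \<xi>': "\<xi>' \<in> exts X W" "pushto \<zeta> \<xi>' f'" using pushto_exists[OF z W f(2)] by blast
  show ?thesis
    unfolding coconn_eq[OF z \<eta>] coconn_eq[OF z \<xi>] coconn_eq[OF z \<xi>']
    by (rule Ext_add_pushto[OF \<xi>(1) \<xi>'(1) z \<eta>(1) \<xi>(2) \<xi>'(2) \<eta>(2), symmetric])
qed

text \<open>This is exactness of the long sequence at \<open>Hom\<close>: the pullback splits just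
  when \<open>g\<close> lifts through the deflation.\<close>

lemma conn_eq_zero_iff:
  assumes z: "\<zeta> \<in> exts Z Y" and X: "X \<in> Ob C" and g: "g \<in> Mor C X Z"
  shows "conn \<zeta> X g = \<zero>\<^bsub>Ext C X Y\<^esub> \<longleftrightarrow> g \<in> contra_im C \<zeta> X"
proof -
  obtain \<eta> where \<eta>: "\<eta> \<in> exts X Y" "pullto \<eta> \<zeta> g" using pullto_exists[OF assms] by blast
  show ?thesis using conn_eq[OF z \<eta>] ext_class_eq_zero_iff[OF \<eta>(1)] split_pullto_iff[OF \<eta>(1) z \<eta>(2)] by simp
qed

lemma coconn_eq_zero_iff:
  assumes z: "\<zeta> \<in> exts X Y" and W: "W \<in> Ob C" and f: "f \<in> Mor C Y W"
  shows "coconn \<zeta> W f = \<zero>\<^bsub>Ext C X W\<^esub> \<longleftrightarrow> f \<in> cov_im C \<zeta> W"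
proof -
  obtain \<eta> where \<eta>: "\<eta> \<in> exts X W" "pushto \<zeta> \<eta> f" using pushto_exists[OF assms] by blast
  show ?thesis using coconn_eq[OF z \<eta>] ext_class_eq_zero_iff[OF \<eta>(1)] split_pushto_iff[OF \<eta>(1) z \<eta>(2)] by simp
qed

lemma Ext_push_conn:
  assumes z: "\<zeta> \<in> exts Z Y" "\<zeta>' \<in> exts Z Y'" "pushto \<zeta> \<zeta>' f" and X: "X \<in> Ob C" and g: "g \<in> Mor C X Z"
  shows "Ext_push C X Y Y' f (conn \<zeta> X g) = conn \<zeta>' X g"
proof -
  obtain \<eta> where \<eta>: "\<eta> \<in> exts X Y" "pullto \<eta> \<zeta> g" using pullto_exists[OF z(1) X g] by blast
  obtain \<eta>' where \<eta>': "\<eta>' \<in> exts X Y'" "pushto \<eta> \<eta>' f"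
    using pushto_exists[OF \<eta>(1) extsD(5)[OF z(2)] pushto_closed[OF z]] by blast
  have "pullto \<eta>' \<zeta>' g" by (rule push_pull[OF \<eta>(1) \<eta>'(1) z(1,2) \<eta>(2) z(3) \<eta>'(2)])
  then show ?thesis using conn_eq[OF z(1) \<eta>] conn_eq[OF z(2) \<eta>'(1)] Ext_push_eq[OF \<eta>'(1) \<eta>(1) \<eta>'(2)] by simp
qed

lemma Ext_pull_conn:
  assumes z: "\<zeta> \<in> exts Z Y" and X: "X \<in> Ob C" "X' \<in> Ob C" and g: "g \<in> Mor C X Z" "f \<in> Mor C X' X"
  shows "Ext_pull C Y X' X f (conn \<zeta> X g) = conn \<zeta> X' (Cmp C X' X Z g f)"
proof -
  obtain \<eta> where \<eta>: "\<eta> \<in> exts X Y" "pullto \<eta> \<zeta> g" using pullto_exists[OF z X(1) g(1)] by blast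
  obtain \<eta>' where \<eta>': "\<eta>' \<in> exts X' Y" "pullto \<eta>' \<eta> f" using pullto_exists[OF \<eta>(1) X(2) g(2)] by blast
  show ?thesis
    using conn_eq[OF z \<eta>] conn_eq[OF z \<eta>'(1) pullto_trans[OF \<eta>'(1) \<eta>(1) z \<eta>'(2) \<eta>(2)]] Ext_pull_eq[OF \<eta>'(1) \<eta>(1) \<eta>'(2)] by simp
qed

lemma Ext_push_coconn:
  assumes z: "\<zeta> \<in> exts X Y" and W: "W \<in> Ob C" "W' \<in> Ob C" and f: "f \<in> Mor C Y W" "f' \<in> Mor C W W'"
  shows "Ext_push C X W W' f' (coconn \<zeta> W f) = coconn \<zeta> W' (Cmp C Y W W' f' f)"
proof -
  obtain \<eta> where \<eta>: "\<eta> \<in> exts X W" "pushto \<zeta> \<eta> f" using pushto_exists[OF z W(1) f(1)] by blast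
  obtain \<eta>' where \<eta>': "\<eta>' \<in> exts X W'" "pushto \<eta> \<eta>' f'" using pushto_exists[OF \<eta>(1) W(2) f(2)] by blast
  show ?thesis
    using coconn_eq[OF z \<eta>] coconn_eq[OF z \<eta>'(1) pushto_trans[OF z \<eta>(1) \<eta>'(1) \<eta>(2) \<eta>'(2)]] Ext_push_eq[OF \<eta>'(1) \<eta>(1) \<eta>'(2)] by simp
qed

lemma Ext_smult: "a \<odot>\<^bsub>Ext C X Y\<^esub> c = Ext_push C X Y Y (a \<odot>\<^bsub>Hom C Y Y\<^esub> Idm C Y) c"
  by (simp add: Ext_def)

text \<open>Multiplication by \<open>a\<close> on all three terms is an endomorphism of \<open>\<zeta>\<close>.\<close>

lemma conn_smult:
  assumes z: "\<zeta> \<in> exts Z Y" and X: "X \<in> Ob C" and g: "g \<in> Mor C X Z" and a: "a \<in> carrier R"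
  shows "conn \<zeta> X (a \<odot>\<^bsub>Hom C X Z\<^esub> g) = a \<odot>\<^bsub>Ext C X Y\<^esub> conn \<zeta> X g"
proof -
  note zD = extsD[OF z]
  note [simp] = cat_simps conf_Ob(2)[OF zD(1)] conf_Ob(4,5)[OF zD(1), unfolded zD(2,3)] zD(4,5) X g a
  let ?a = "\<lambda>V. a \<odot>\<^bsub>Hom C V V\<^esub> Idm C V"
  obtain \<eta> where \<eta>: "\<eta> \<in> exts X Y" "pullto \<eta> \<zeta> g" using pullto_exists[OF z X g] by blast
  obtain \<eta>' where \<eta>': "\<eta>' \<in> exts X Y" "pushto \<eta> \<eta>' (?a Y)" by (rule pushto_exists[OF \<eta>(1), of Y "?a Y"]) simp_all
  note eD = extsD[OF \<eta>(1)]
  have m: "ses_mor C \<zeta> \<zeta> (?a Y) (?a (mid \<zeta>)) (?a Z)"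
    unfolding ses_mor_def zD(2,3) by simp
  obtain h where h: "ses_mor C \<eta> \<zeta> (Idm C Y) h g" using \<eta>(2) zD by (auto simp: pullto_def)
  have "\<exists>k. ses_mor C \<eta> \<zeta> (?a Y) k (a \<odot>\<^bsub>Hom C X Z\<^esub> g)"
    using conf_mor_comp[OF h m eD(1) zD(1) zD(1)] unfolding eD(2,3) zD(2,3) by auto
  then have "pullto \<eta>' \<zeta> (a \<odot>\<^bsub>Hom C X Z\<^esub> g)" using ses_mor_push_pull[OF \<eta>(1) \<eta>'(1) z _ \<eta>'(2)] by blast
  then show ?thesis
    unfolding Ext_smult conn_eq[OF z \<eta>] Ext_push_eq[OF \<eta>'(1) \<eta>(1) \<eta>'(2)] by (rule conn_eq[OF z \<eta>'(1)])
qed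

text \<open>Direct on this side, because scalars act on \<open>Ext\<close> by pushout along
  multiples of the identity of the second argument.\<close>

lemma coconn_smult:
  assumes z: "\<zeta> \<in> exts X Y" and W: "W \<in> Ob C" and f: "f \<in> Mor C Y W" and a: "a \<in> carrier R"
  shows "coconn \<zeta> W (a \<odot>\<^bsub>Hom C Y W\<^esub> f) = a \<odot>\<^bsub>Ext C X W\<^esub> coconn \<zeta> W f"
  using Ext_push_coconn[OF z W W f, of "a \<odot>\<^bsub>Hom C W W\<^esub> Idm C W"] W f a extsD(5)[OF z]
  by (simp add: Ext_smult cat_simps)

lemma exts_nonempty:
  assumes "Y \<in> Ob C"
  obtains \<zeta> Z where "\<zeta> \<in> exts Z Y" "Z \<in> Ob C"
proof -
  obtain \<zeta> where "\<zeta> \<in> Conf C" "lft \<zeta> = Y" using inflation_Idm[OF assms] by (auto simp: inflation_def)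
  then show thesis using that[of \<zeta> "rgt \<zeta>"] conf_Ob(3)[of \<zeta>] by (auto simp: exts_def)
qed

text \<open>Associativity needs three classes in the image of a single connecting map, which two
  applications of \<open>Ext_common\<close> provide; laws about fewer classes use it with repeated
  arguments.\<close>

lemma Ext_represent:
  assumes "c \<in> carrier (Ext C X Y)" "c' \<in> carrier (Ext C X Y)" "c'' \<in> carrier (Ext C X Y)" "X \<in> Ob C"
  obtains \<zeta> Z g g' g'' where "\<zeta> \<in> exts Z Y" "Z \<in> Ob C" "g \<in> Mor C X Z" "g' \<in> Mor C X Z" "g'' \<in> Mor C X Z"
    "c = conn \<zeta> X g" "c' = conn \<zeta> X g'" "c'' = conn \<zeta> X g''"
proof -
  obtain \<xi> \<xi>' \<xi>'' where x: "\<xi> \<in> exts X Y" "\<xi>' \<in> exts X Y" "\<xi>'' \<in> exts X Y"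
    "c = ext_class C \<xi>" "c' = ext_class C \<xi>'" "c'' = ext_class C \<xi>''"
    using assms by (auto simp: Ext_carrier)
  obtain \<theta> W u u' where t: "\<theta> \<in> exts W Y" "pullto \<xi> \<theta> u" "pullto \<xi>' \<theta> u'" "u \<in> Mor C X W" "u' \<in> Mor C X W" "W \<in> Ob C"
    by (rule Ext_common[OF x(1,2)])
  obtain \<zeta> Z v v'' where z: "\<zeta> \<in> exts Z Y" "pullto \<theta> \<zeta> v" "pullto \<xi>'' \<zeta> v''" "v \<in> Mor C W Z" "v'' \<in> Mor C X Z" "Z \<in> Ob C"
    by (rule Ext_common[OF t(1) x(3)])
  have p: "pullto \<xi> \<zeta> (Cmp C X W Z v u)" "pullto \<xi>' \<zeta> (Cmp C X W Z v u')"
    using pullto_trans[OF x(1) t(1) z(1) t(2) z(2)] pullto_trans[OF x(2) t(1) z(1) t(3) z(2)] by auto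
  show thesis
    using that[OF z(1,6) _ _ z(5), of "Cmp C X W Z v u" "Cmp C X W Z v u'"] conn_eq[OF z(1) x(1) p(1)] conn_eq[OF z(1) x(2) p(2)]
      conn_eq[OF z(1) x(3) z(3)] x(4-6) assms(4) z t by (simp add: cat_simps)
qed

lemma conn_zero:
  assumes "\<zeta> \<in> exts Z Y" "X \<in> Ob C"
  shows "conn \<zeta> X \<zero>\<^bsub>Hom C X Z\<^esub> = \<zero>\<^bsub>Ext C X Y\<^esub>"
proof -
  note z = extsD[OF assms(1)]
  have "Cmp C X (mid \<zeta>) Z (defl \<zeta>) \<zero>\<^bsub>Hom C X (mid \<zeta>)\<^esub> \<in> contra_im C \<zeta> X"
    unfolding contra_im_def z(3) using conf_Ob(2)[OF z(1)] assms(2) by (intro imageI) (simp add: cat_simps)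
  then have "\<zero>\<^bsub>Hom C X Z\<^esub> \<in> contra_im C \<zeta> X"
    using conf_Ob(2,5)[OF z(1)] z assms(2) by (simp add: cat_simps)
  then show ?thesis using conn_eq_zero_iff[OF assms] z(4) assms(2) by (simp add: cat_simps)
qed

lemma Ext_module:
  assumes X: "X \<in> Ob C" and Y: "Y \<in> Ob C"
  shows "module R (Ext C X Y)"
proof (rule moduleI)
  let ?M = "Ext C X Y"
  note [simp] = cat_simps X Y
  have z0: "\<zero>\<^bsub>?M\<^esub> \<in> carrier ?M"
  proof -
    \<comment> \<open>Any conflation starting in \<open>Y\<close> will do: its connecting map sends
      the zero morphism to the zero of \<open>Ext\<close>.\<close>
    obtain \<zeta> Z where z: "\<zeta> \<in> exts Z Y" "Z \<in> Ob C" by (rule exts_nonempty[OF Y])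
    show ?thesis using conn_closed[OF z(1) X, of "\<zero>\<^bsub>Hom C X Z\<^esub>"] conn_zero[OF z(1) X] z by simp
  qed
  show "cring R" ..
  show "abelian_group ?M"
  proof (rule abelian_groupI)
    fix c c' c'' assume c: "c \<in> carrier ?M" "c' \<in> carrier ?M" "c'' \<in> carrier ?M"
    obtain \<zeta> Z g g' g'' where z: "\<zeta> \<in> exts Z Y" and [simp]: "Z \<in> Ob C" "g \<in> Mor C X Z" "g' \<in> Mor C X Z" "g'' \<in> Mor C X Z"
      and e: "c = conn \<zeta> X g" "c' = conn \<zeta> X g'" "c'' = conn \<zeta> X g''"
      by (rule Ext_represent[OF c X])
    interpret H: abelian_group "Hom C X Z" by (rule Hom_abelian_group) simp_all
    show "c \<oplus>\<^bsub>?M\<^esub> c' \<oplus>\<^bsub>?M\<^esub> c'' = c \<oplus>\<^bsub>?M\<^esub> (c' \<oplus>\<^bsub>?M\<^esub> c'')"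
      unfolding e by (simp flip: conn_add[OF z X] add: H.a_assoc)
  next
    fix c c' assume c: "c \<in> carrier ?M" "c' \<in> carrier ?M"
    obtain \<zeta> Z g g' g'' where z: "\<zeta> \<in> exts Z Y" and [simp]: "Z \<in> Ob C" "g \<in> Mor C X Z" "g' \<in> Mor C X Z" "g'' \<in> Mor C X Z"
      and e: "c = conn \<zeta> X g" "c' = conn \<zeta> X g'" "c' = conn \<zeta> X g''"
      by (rule Ext_represent[OF c c(2) X])
    interpret H: abelian_group "Hom C X Z" by (rule Hom_abelian_group) simp_all
    show "c \<oplus>\<^bsub>?M\<^esub> c' \<in> carrier ?M"
      unfolding e(1,2) using conn_closed[OF z X] by (simp flip: conn_add[OF z X])
    show "c \<oplus>\<^bsub>?M\<^esub> c' = c' \<oplus>\<^bsub>?M\<^esub> c"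
      unfolding e(1,2) by (simp flip: conn_add[OF z X] add: H.a_comm)
  next
    show "\<zero>\<^bsub>?M\<^esub> \<in> carrier ?M" by (rule z0)
  next
    fix c assume c: "c \<in> carrier ?M"
    obtain \<zeta> Z g g' g'' where z: "\<zeta> \<in> exts Z Y" and [simp]: "Z \<in> Ob C" "g \<in> Mor C X Z" "g' \<in> Mor C X Z" "g'' \<in> Mor C X Z"
      and e: "c = conn \<zeta> X g" "c = conn \<zeta> X g'" "c = conn \<zeta> X g''"
      by (rule Ext_represent[OF c c c X])
    interpret H: abelian_group "Hom C X Z" by (rule Hom_abelian_group) simp_all
    show "\<zero>\<^bsub>?M\<^esub> \<oplus>\<^bsub>?M\<^esub> c = c"
      unfolding e(1) conn_zero[OF z X, symmetric] by (simp flip: conn_add[OF z X])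
    show "\<exists>y\<in>carrier ?M. y \<oplus>\<^bsub>?M\<^esub> c = \<zero>\<^bsub>?M\<^esub>"
      unfolding e(1) conn_zero[OF z X, symmetric] using conn_closed[OF z X, of "\<ominus>\<^bsub>Hom C X Z\<^esub> g"]
      by (intro bexI[of _ "conn \<zeta> X (\<ominus>\<^bsub>Hom C X Z\<^esub> g)"]) (simp_all flip: conn_add[OF z X] add: H.l_neg)
  qed
next
  let ?M = "Ext C X Y"
  note [simp] = cat_simps X Y
  {
    fix a c assume a: "a \<in> carrier R" and c: "c \<in> carrier ?M"
    obtain \<zeta> Z g g' g'' where z: "\<zeta> \<in> exts Z Y" and [simp]: "Z \<in> Ob C" "g \<in> Mor C X Z" "g' \<in> Mor C X Z" "g'' \<in> Mor C X Z"
      and e: "c = conn \<zeta> X g" "c = conn \<zeta> X g'" "c = conn \<zeta> X g''"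
      by (rule Ext_represent[OF c c c X])
    show "a \<odot>\<^bsub>?M\<^esub> c \<in> carrier ?M"
      unfolding e(1) using conn_closed[OF z X] a by (simp flip: conn_smult[OF z X])
  }
  {
    fix a b c assume a: "a \<in> carrier R" "b \<in> carrier R" and c: "c \<in> carrier ?M"
    obtain \<zeta> Z g g' g'' where z: "\<zeta> \<in> exts Z Y" and [simp]: "Z \<in> Ob C" "g \<in> Mor C X Z" "g' \<in> Mor C X Z" "g'' \<in> Mor C X Z"
      and e: "c = conn \<zeta> X g" "c = conn \<zeta> X g'" "c = conn \<zeta> X g''"
      by (rule Ext_represent[OF c c c X])
    interpret H: module R "Hom C X Z" by (rule Hom_module) simp_all
    show "(a \<oplus> b) \<odot>\<^bsub>?M\<^esub> c = a \<odot>\<^bsub>?M\<^esub> c \<oplus>\<^bsub>?M\<^esub> b \<odot>\<^bsub>?M\<^esub> c"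
      unfolding e(1) using a by (simp flip: conn_smult[OF z X] conn_add[OF z X] add: H.smult_l_distr)
    show "(a \<otimes> b) \<odot>\<^bsub>?M\<^esub> c = a \<odot>\<^bsub>?M\<^esub> (b \<odot>\<^bsub>?M\<^esub> c)"
      unfolding e(1) using a by (simp flip: conn_smult[OF z X] add: H.smult_assoc1)
  }
  {
    fix a c c' assume a: "a \<in> carrier R" and c: "c \<in> carrier ?M" "c' \<in> carrier ?M"
    obtain \<zeta> Z g g' g'' where z: "\<zeta> \<in> exts Z Y" and [simp]: "Z \<in> Ob C" "g \<in> Mor C X Z" "g' \<in> Mor C X Z" "g'' \<in> Mor C X Z"
      and e: "c = conn \<zeta> X g" "c' = conn \<zeta> X g'" "c' = conn \<zeta> X g''"
      by (rule Ext_represent[OF c c(2) X])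
    interpret H: module R "Hom C X Z" by (rule Hom_module) simp_all
    show "a \<odot>\<^bsub>?M\<^esub> (c \<oplus>\<^bsub>?M\<^esub> c') = a \<odot>\<^bsub>?M\<^esub> c \<oplus>\<^bsub>?M\<^esub> a \<odot>\<^bsub>?M\<^esub> c'"
      unfolding e(1,2) using a by (simp flip: conn_smult[OF z X] conn_add[OF z X] add: H.smult_r_distr)
  }
  fix c assume c: "c \<in> carrier ?M"
  obtain \<zeta> Z g g' g'' where z: "\<zeta> \<in> exts Z Y" and [simp]: "Z \<in> Ob C" "g \<in> Mor C X Z" "g' \<in> Mor C X Z" "g'' \<in> Mor C X Z"
    and e: "c = conn \<zeta> X g" "c = conn \<zeta> X g'" "c = conn \<zeta> X g''"
    by (rule Ext_represent[OF c c c X])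
  interpret H: module R "Hom C X Z" by (rule Hom_module) simp_all
  show "\<one> \<odot>\<^bsub>?M\<^esub> c = c"
    unfolding e(1) by (simp flip: conn_smult[OF z X])
qed

lemma conn_hom:
  assumes "\<zeta> \<in> exts Z Y" "X \<in> Ob C"
  shows "conn \<zeta> X \<in> mod_hom R (Hom C X Z) (Ext C X Y)"
  using assms by (intro mod_homI) (simp_all add: conn_closed conn_add conn_smult)

lemma coconn_hom:
  assumes "\<zeta> \<in> exts X Y" "W \<in> Ob C"
  shows "coconn \<zeta> W \<in> mod_hom R (Hom C Y W) (Ext C X W)"
  using assms by (intro mod_homI) (simp_all add: coconn_closed coconn_add coconn_smult)

section \<open>Linearity of \<open>Ext\<close> in both variables\<close>

lemma Ext_push_hom:
  assumes X: "X \<in> Ob C" and Y: "Y \<in> Ob C" "Y' \<in> Ob C" and f: "f \<in> Mor C Y Y'"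
  shows "Ext_push C X Y Y' f \<in> mod_hom R (Ext C X Y) (Ext C X Y')"
proof (rule mod_homI)
  let ?p = "Ext_push C X Y Y' f"
  note [simp] = cat_simps X Y f
  \<comment> \<open>Pushing out changes \<open>\<zeta>\<close> into \<open>\<zeta>'\<close> but
    leaves the morphism into \<open>Z\<close> untouched, so sums and multiples before and after come
    from the same sums and multiples in \<open>Hom C X Z\<close>.\<close>
  have rep: "\<exists>\<zeta>' Z g g'. \<zeta>' \<in> exts Z Y' \<and> g \<in> Mor C X Z \<and> g' \<in> Mor C X Z \<and> Z \<in> Ob C \<and> ?p c = conn \<zeta>' X g \<and> ?p c' = conn \<zeta>' X g' \<and>
      ?p (c \<oplus>\<^bsub>Ext C X Y\<^esub> c') = conn \<zeta>' X (g \<oplus>\<^bsub>Hom C X Z\<^esub> g') \<and>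
      (\<forall>a\<in>carrier R. ?p (a \<odot>\<^bsub>Ext C X Y\<^esub> c) = conn \<zeta>' X (a \<odot>\<^bsub>Hom C X Z\<^esub> g))"
    if c: "c \<in> carrier (Ext C X Y)" "c' \<in> carrier (Ext C X Y)" for c c'
  proof -
    obtain \<zeta> Z g g' g'' where z: "\<zeta> \<in> exts Z Y" and [simp]: "Z \<in> Ob C" "g \<in> Mor C X Z" "g' \<in> Mor C X Z" "g'' \<in> Mor C X Z"
      and e: "c = conn \<zeta> X g" "c' = conn \<zeta> X g'" "c' = conn \<zeta> X g''"
      by (rule Ext_represent[OF c c(2) X])
    obtain \<zeta>' where z': "\<zeta>' \<in> exts Z Y'" "pushto \<zeta> \<zeta>' f" by (rule pushto_exists[OF z Y(2) f])
    note pc = Ext_push_conn[OF z z' X]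
    show ?thesis
      unfolding e(1,2) using z' by (intro exI[of _ \<zeta>'] exI[of _ Z] exI[of _ g] exI[of _ g'])
        (auto simp: pc simp flip: conn_add[OF z X] conn_smult[OF z X])
  qed
  fix c assume c: "c \<in> carrier (Ext C X Y)"
  show "?p c \<in> carrier (Ext C X Y')" using rep[OF c c] conn_closed X by auto
  show "?p (c \<oplus>\<^bsub>Ext C X Y\<^esub> c') = ?p c \<oplus>\<^bsub>Ext C X Y'\<^esub> ?p c'" if c': "c' \<in> carrier (Ext C X Y)" for c'
    using rep[OF c c'] conn_add[OF _ X] by auto
  show "?p (a \<odot>\<^bsub>Ext C X Y\<^esub> c) = a \<odot>\<^bsub>Ext C X Y'\<^esub> ?p c" if a: "a \<in> carrier R" for a
    using rep[OF c c] conn_smult[OF _ X _ a] a by auto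
qed

lemma Ext_pull_hom:
  assumes X: "X \<in> Ob C" "X' \<in> Ob C" and Y: "Y \<in> Ob C" and f: "f \<in> Mor C X' X"
  shows "Ext_pull C Y X' X f \<in> mod_hom R (Ext C X Y) (Ext C X' Y)"
proof (rule mod_homI)
  let ?p = "Ext_pull C Y X' X f"
  note [simp] = cat_simps X Y f
  have rep: "\<exists>\<zeta> Z g g'. \<zeta> \<in> exts Z Y \<and> g \<in> Mor C X' Z \<and> g' \<in> Mor C X' Z \<and> Z \<in> Ob C \<and> ?p c = conn \<zeta> X' g \<and> ?p c' = conn \<zeta> X' g' \<and>
      ?p (c \<oplus>\<^bsub>Ext C X Y\<^esub> c') = conn \<zeta> X' (g \<oplus>\<^bsub>Hom C X' Z\<^esub> g') \<and>
      (\<forall>a\<in>carrier R. ?p (a \<odot>\<^bsub>Ext C X Y\<^esub> c) = conn \<zeta> X' (a \<odot>\<^bsub>Hom C X' Z\<^esub> g))"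
    if c: "c \<in> carrier (Ext C X Y)" "c' \<in> carrier (Ext C X Y)" for c c'
  proof -
    obtain \<zeta> Z g g' g'' where z: "\<zeta> \<in> exts Z Y" and [simp]: "Z \<in> Ob C" "g \<in> Mor C X Z" "g' \<in> Mor C X Z" "g'' \<in> Mor C X Z"
      and e: "c = conn \<zeta> X g" "c' = conn \<zeta> X g'" "c' = conn \<zeta> X g''"
      by (rule Ext_represent[OF c c(2) X(1)])
    note pc = Ext_pull_conn[OF z X _ f]
    show ?thesis
      unfolding e(1,2) using z by (intro exI[of _ \<zeta>] exI[of _ Z] exI[of _ "Cmp C X' X Z g f"] exI[of _ "Cmp C X' X Z g' f"])
        (auto simp: pc simp flip: conn_add[OF z X(1)] conn_smult[OF z X(1)])
  qed
  fix c assume c: "c \<in> carrier (Ext C X Y)"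
  show "?p c \<in> carrier (Ext C X' Y)" using rep[OF c c] conn_closed X by auto
  show "?p (c \<oplus>\<^bsub>Ext C X Y\<^esub> c') = ?p c \<oplus>\<^bsub>Ext C X' Y\<^esub> ?p c'" if c': "c' \<in> carrier (Ext C X Y)" for c'
    using rep[OF c c'] conn_add[OF _ X(2)] by auto
  show "?p (a \<odot>\<^bsub>Ext C X Y\<^esub> c) = a \<odot>\<^bsub>Ext C X' Y\<^esub> ?p c" if a: "a \<in> carrier R" for a
    using rep[OF c c] conn_smult[OF _ X(2) _ a] a by auto
qed

section \<open>Exactness at \<open>Ext\<close> and naturality of the connecting maps\<close>

lemma ses_mor_from_right:
  assumes conf: "\<xi> \<in> Conf C" "\<zeta> \<in> Conf C" and "c \<in> Mor C (rgt \<xi>) (rgt \<zeta>)" "b \<in> Mor C (mid \<xi>) (mid \<zeta>)"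
    and bc: "Cmp C (mid \<xi>) (mid \<zeta>) (rgt \<zeta>) (defl \<zeta>) b = Cmp C (mid \<xi>) (rgt \<xi>) (rgt \<zeta>) c (defl \<xi>)"
  shows "\<exists>a. ses_mor C \<xi> \<zeta> a b c"
proof -
  interpret op: exact_category R "op_cat C" by (rule op_exact_category)
  show ?thesis using op.ses_mor_from_left[of "op_ses \<zeta>" "op_ses \<xi>" c b] assms by (simp add: op_ses_mor)
qed

text \<open>Exactness at \<open>Ext(K, X)\<close>: the pushout of \<open>\<eta>\<close> along the
  inflation splits just when the inflation extends over \<open>mid \<eta>\<close>. Such an extension
  is the middle component of a morphism that exhibits \<open>\<eta>\<close> as some
  \<open>g\<^sup>*\<xi>\<close>.\<close>

lemma Ext_push_infl_eq_zero_iff: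
  assumes x: "\<xi> \<in> exts Y X" and K: "K \<in> Ob C" and m: "m \<in> carrier (Ext C K X)"
  shows "Ext_push C K X (mid \<xi>) (infl \<xi>) m = \<zero>\<^bsub>Ext C K (mid \<xi>)\<^esub> \<longleftrightarrow> m \<in> conn \<xi> K ` Mor C K Y"
proof -
  note xD = extsD[OF x]
  note i = conf_Ob(4)[OF xD(1), unfolded xD(2)] and E = conf_Ob(2)[OF xD(1)]
  obtain \<eta> where \<eta>: "\<eta> \<in> exts K X" "m = ext_class C \<eta>" using m by (auto simp: Ext_carrier)
  note eD = extsD[OF \<eta>(1)]
  obtain \<eta>' where \<eta>': "\<eta>' \<in> exts K (mid \<xi>)" "pushto \<eta> \<eta>' (infl \<xi>)" by (rule pushto_exists[OF \<eta>(1) E i])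
  have "Ext_push C K X (mid \<xi>) (infl \<xi>) m = \<zero>\<^bsub>Ext C K (mid \<xi>)\<^esub> \<longleftrightarrow> infl \<xi> \<in> cov_im C \<eta> (mid \<xi>)"
    unfolding \<eta>(2) Ext_push_eq[OF \<eta>'(1) \<eta>(1) \<eta>'(2)]
    using ext_class_eq_zero_iff[OF \<eta>'(1)] split_pushto_iff[OF \<eta>'(1) \<eta>(1) \<eta>'(2)] by simp
  also have "\<dots> \<longleftrightarrow> m \<in> conn \<xi> K ` Mor C K Y"
  proof
    assume "infl \<xi> \<in> cov_im C \<eta> (mid \<xi>)"
    then obtain k where k: "k \<in> Mor C (mid \<eta>) (mid \<xi>)" "Cmp C X (mid \<eta>) (mid \<xi>) k (infl \<eta>) = infl \<xi>"
      using eD by (auto simp: cov_im_def)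
    have "\<exists>g. ses_mor C \<eta> \<xi> (Idm C X) k g"
      by (rule ses_mor_from_left[OF eD(1) xD(1)]) (use k i E xD eD in \<open>simp_all add: cat_simps\<close>)
    then obtain g where g: "pullto \<eta> \<xi> g" using xD by (auto simp: pullto_def)
    show "m \<in> conn \<xi> K ` Mor C K Y"
      using conn_eq[OF x \<eta>(1) g] pullto_closed[OF \<eta>(1) x g] \<eta>(2) by blast
  next
    assume "m \<in> conn \<xi> K ` Mor C K Y"
    then obtain g where g: "g \<in> Mor C K Y" "m = conn \<xi> K g" by blast
    obtain \<theta> where \<theta>: "\<theta> \<in> exts K X" "pullto \<theta> \<xi> g" by (rule pullto_exists[OF x K g(1)])
    have "pullto \<eta> \<theta> (Idm C K)" using ext_class_eq_iff[OF \<eta>(1) \<theta>(1)] conn_eq[OF x \<theta>] g(2) \<eta>(2) by simp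
    from pullto_trans[OF \<eta>(1) \<theta>(1) x this \<theta>(2)] obtain h g' where "ses_mor C \<eta> \<xi> (Idm C X) h g'"
      using xD by (auto simp: pullto_def)
    from ses_morD(2,4)[OF this] show "infl \<xi> \<in> cov_im C \<eta> (mid \<xi>)"
      using i E xD eD by (auto simp: cov_im_def cat_simps image_iff intro!: bexI[of _ h])
  qed
  finally show ?thesis .
qed

text \<open>Dually, a lift of the deflation to \<open>mid \<eta>\<close> is the middle component of
  a morphism that exhibits \<open>\<eta>\<close> as some \<open>f\<^sub>*\<xi>\<close>.\<close>

lemma Ext_pull_defl_eq_zero_iff:
  assumes x: "\<xi> \<in> exts Y X" and K: "K \<in> Ob C" and m: "m \<in> carrier (Ext C Y K)"
  shows "Ext_pull C K (mid \<xi>) Y (defl \<xi>) m = \<zero>\<^bsub>Ext C (mid \<xi>) K\<^esub> \<longleftrightarrow> m \<in> coconn \<xi> K ` Mor C X K"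
proof -
  note xD = extsD[OF x]
  note d = conf_Ob(5)[OF xD(1), unfolded xD(3)] and E = conf_Ob(2)[OF xD(1)]
  obtain \<eta> where \<eta>: "\<eta> \<in> exts Y K" "m = ext_class C \<eta>" using m by (auto simp: Ext_carrier)
  note eD = extsD[OF \<eta>(1)]
  obtain \<eta>' where \<eta>': "\<eta>' \<in> exts (mid \<xi>) K" "pullto \<eta>' \<eta> (defl \<xi>)" by (rule pullto_exists[OF \<eta>(1) E d])
  have "Ext_pull C K (mid \<xi>) Y (defl \<xi>) m = \<zero>\<^bsub>Ext C (mid \<xi>) K\<^esub> \<longleftrightarrow> defl \<xi> \<in> contra_im C \<eta> (mid \<xi>)"
    unfolding \<eta>(2) Ext_pull_eq[OF \<eta>'(1) \<eta>(1) \<eta>'(2)]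
    using ext_class_eq_zero_iff[OF \<eta>'(1)] split_pullto_iff[OF \<eta>'(1) \<eta>(1) \<eta>'(2)] by simp
  also have "\<dots> \<longleftrightarrow> m \<in> coconn \<xi> K ` Mor C X K"
  proof
    assume "defl \<xi> \<in> contra_im C \<eta> (mid \<xi>)"
    then obtain k where k: "k \<in> Mor C (mid \<xi>) (mid \<eta>)" "Cmp C (mid \<xi>) (mid \<eta>) Y (defl \<eta>) k = defl \<xi>"
      using eD by (auto simp: contra_im_def)
    have "\<exists>f. ses_mor C \<xi> \<eta> f k (Idm C Y)"
      by (rule ses_mor_from_right[OF xD(1) eD(1)]) (use k d E xD eD in \<open>simp_all add: cat_simps\<close>)
    then obtain f where f: "pushto \<xi> \<eta> f" using xD by (auto simp: pushto_def)
    show "m \<in> coconn \<xi> K ` Mor C X K"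
      using coconn_eq[OF x \<eta>(1) f] pushto_closed[OF x \<eta>(1) f] \<eta>(2) by blast
  next
    assume "m \<in> coconn \<xi> K ` Mor C X K"
    then obtain f where f: "f \<in> Mor C X K" "m = coconn \<xi> K f" by blast
    obtain \<theta> where \<theta>: "\<theta> \<in> exts Y K" "pushto \<xi> \<theta> f" by (rule pushto_exists[OF x K f(1)])
    have "pullto \<theta> \<eta> (Idm C Y)" using ext_class_eq_iff[OF \<theta>(1) \<eta>(1)] coconn_eq[OF x \<theta>] f(2) \<eta>(2) by simp
    then have "pushto \<theta> \<eta> (Idm C K)" using pullto_Idm_iff_pushto[OF \<theta>(1) \<eta>(1)] by simp
    from pushto_trans[OF x \<theta>(1) \<eta>(1) \<theta>(2) this] obtain h f' where "ses_mor C \<xi> \<eta> f' h (Idm C Y)"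
      using xD by (auto simp: pushto_def)
    from ses_morD(2,5)[OF this] show "defl \<xi> \<in> contra_im C \<eta> (mid \<xi>)"
      using d E xD eD by (auto simp: contra_im_def cat_simps image_iff intro!: bexI[of _ h])
  qed
  finally show ?thesis .
qed

lemma Ext_push_ext_class: "\<xi> \<in> exts X Y \<Longrightarrow> Ext_push C X Y W f (ext_class C \<xi>) = coconn \<xi> W f"
  using extsD[of \<xi> X Y] by (simp add: coconn_def)

lemma Ext_pull_ext_class: "\<xi> \<in> exts X Y \<Longrightarrow> Ext_pull C Y W X g (ext_class C \<xi>) = conn \<xi> W g"
  using extsD[of \<xi> X Y] by (simp add: conn_def)

text \<open>The composite of \<open>\<eta>\<close> to \<open>\<xi>\<close> with the given morphism
  has ends \<open>a\<close> and \<open>c g\<close>, so pushing \<open>\<eta>\<close> out along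
  \<open>a\<close> gives the pullback of \<open>\<xi>'\<close> along \<open>c g\<close>. Naturality
  in the conflation comes from here.\<close>

lemma Ext_push_conn_mor:
  assumes x: "\<xi> \<in> exts Y X" "\<xi>' \<in> exts Y' X'" and m: "ses_mor C \<xi> \<xi>' a b c" and K: "K \<in> Ob C" and g: "g \<in> Mor C K Y"
  shows "Ext_push C K X X' a (conn \<xi> K g) = conn \<xi>' K (Cmp C K Y Y' c g)"
proof -
  note D = extsD[OF x(1)] and D' = extsD[OF x(2)]
  note [simp] = cat_simps K g D(4,5) D'(4,5)
  have [simp]: "a \<in> Mor C X X'" "c \<in> Mor C Y Y'" using ses_morD(1,3)[OF m] D D' by simp_all
  obtain \<eta> where \<eta>: "\<eta> \<in> exts K X" "pullto \<eta> \<xi> g" by (rule pullto_exists[OF x(1) K g])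
  obtain \<eta>' where \<eta>': "\<eta>' \<in> exts K X'" "pushto \<eta> \<eta>' a" by (rule pushto_exists[OF \<eta>(1) D'(5), of a]) simp_all
  note E = extsD[OF \<eta>(1)]
  obtain h where h: "ses_mor C \<eta> \<xi> (Idm C X) h g" using \<eta>(2) D by (auto simp: pullto_def)
  have "\<exists>k. ses_mor C \<eta> \<xi>' a k (Cmp C K Y Y' c g)"
    using conf_mor_comp[OF h m E(1) D(1) D'(1)] unfolding E(2,3) D(2,3) D'(2,3) by auto
  then have "pullto \<eta>' \<xi>' (Cmp C K Y Y' c g)" using ses_mor_push_pull[OF \<eta>(1) \<eta>'(1) x(2) _ \<eta>'(2)] by blast
  then show ?thesis
    unfolding conn_eq[OF x(1) \<eta>] Ext_push_eq[OF \<eta>'(1) \<eta>(1) \<eta>'(2)] by (rule conn_eq[OF x(2) \<eta>'(1), symmetric])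
qed

lemma Ext_pull_coconn_mor:
  assumes x: "\<xi> \<in> exts Y X" "\<xi>' \<in> exts Y' X'" and m: "ses_mor C \<xi> \<xi>' a b c" and K: "K \<in> Ob C" and f: "f \<in> Mor C X' K"
  shows "Ext_pull C K Y Y' c (coconn \<xi>' K f) = coconn \<xi> K (Cmp C X X' K f a)"
proof -
  note D = extsD[OF x(1)] and D' = extsD[OF x(2)]
  note [simp] = cat_simps K f D(4,5) D'(4,5)
  have [simp]: "a \<in> Mor C X X'" "c \<in> Mor C Y Y'" using ses_morD(1,3)[OF m] D D' by simp_all
  obtain \<eta> where \<eta>: "\<eta> \<in> exts Y' K" "pushto \<xi>' \<eta> f" by (rule pushto_exists[OF x(2) K f])
  obtain \<eta>' where \<eta>': "\<eta>' \<in> exts Y K" "pullto \<eta>' \<eta> c" by (rule pullto_exists[OF \<eta>(1) D(4), of c]) simp_all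
  note E = extsD[OF \<eta>(1)]
  obtain h where h: "ses_mor C \<xi>' \<eta> f h (Idm C Y')" using \<eta>(2) D' by (auto simp: pushto_def)
  have "\<exists>k. ses_mor C \<xi> \<eta> (Cmp C X X' K f a) k (Cmp C Y Y Y' c (Idm C Y))"
    using conf_mor_comp[OF m h D(1) D'(1) E(1)] unfolding E(2,3) D(2,3) D'(2,3) by auto
  then obtain k where "ses_mor C \<xi> \<eta>' (Cmp C X X' K f a) k (Idm C Y)"
    using ses_mor_factor_pull[OF x(1) \<eta>'(1) \<eta>(1) \<eta>'(2)] Idm_closed[OF D(4)] by blast
  then have "pushto \<xi> \<eta>' (Cmp C X X' K f a)" using D(3) by (auto simp: pushto_def)
  then show ?thesis
    unfolding coconn_eq[OF x(2) \<eta>] Ext_pull_eq[OF \<eta>'(1) \<eta>(1) \<eta>'(2)] by (rule coconn_eq[OF x(1) \<eta>'(1), symmetric])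
qed

section \<open>Trivial morphisms and stable categories\<close>

lemma ball_Ext_left:
  "(\<forall>Z\<in>Ob C. \<forall>c \<in> carrier (Ext C Z X). Q Z c) \<longleftrightarrow> (\<forall>Z. \<forall>\<xi> \<in> exts Z X. Q Z (ext_class C \<xi>))"
proof (intro iffI allI ballI)
  fix Z \<xi> assume "\<forall>Z\<in>Ob C. \<forall>c \<in> carrier (Ext C Z X). Q Z c" and x: "\<xi> \<in> exts Z X"
  then show "Q Z (ext_class C \<xi>)" using extsD(4)[OF x] ext_class_in_Ext[OF x] by blast
qed (auto simp: Ext_carrier)

lemma ball_Ext_right:
  "(\<forall>Z\<in>Ob C. \<forall>c \<in> carrier (Ext C X Z). Q Z c) \<longleftrightarrow> (\<forall>Z. \<forall>\<xi> \<in> exts X Z. Q Z (ext_class C \<xi>))"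
proof (intro iffI allI ballI)
  fix Z \<xi> assume "\<forall>Z\<in>Ob C. \<forall>c \<in> carrier (Ext C X Z). Q Z c" and x: "\<xi> \<in> exts X Z"
  then show "Q Z (ext_class C \<xi>)" using extsD(5)[OF x] ext_class_in_Ext[OF x] by blast
qed (auto simp: Ext_carrier)

text \<open>A pushout along \<open>t\<close> splits exactly when \<open>t\<close> extends along the
  inflation. Triviality thus becomes extendability along every inflation out of \<open>X\<close>,
  the form that both the ideal property and the comparison with \<open>cov_im\<close> use.\<close>

lemma inj_trivial_iff:
  assumes "X \<in> Ob C" "Y \<in> Ob C"
  shows "t \<in> inj_trivial C X Y \<longleftrightarrow> t \<in> Mor C X Y \<and> (\<forall>Z. \<forall>\<xi> \<in> exts Z X. t \<in> cov_im C \<xi> Y)"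
proof -
  have "Ext_push C Z X Y t (ext_class C \<xi>) = \<zero>\<^bsub>Ext C Z Y\<^esub> \<longleftrightarrow> t \<in> cov_im C \<xi> Y" if "\<xi> \<in> exts Z X" "t \<in> Mor C X Y" for Z \<xi>
    using coconn_eq_zero_iff[OF that(1) assms(2) that(2)] by (simp add: Ext_push_ext_class[OF that(1)])
  then show ?thesis by (auto simp: inj_trivial_def ball_Ext_left)
qed

lemma proj_trivial_iff:
  assumes "X \<in> Ob C" "Y \<in> Ob C"
  shows "t \<in> proj_trivial C X Y \<longleftrightarrow> t \<in> Mor C X Y \<and> (\<forall>Z. \<forall>\<xi> \<in> exts Y Z. t \<in> contra_im C \<xi> X)"
proof -
  have "Ext_pull C Z X Y t (ext_class C \<xi>) = \<zero>\<^bsub>Ext C X Z\<^esub> \<longleftrightarrow> t \<in> contra_im C \<xi> X" if "\<xi> \<in> exts Y Z" "t \<in> Mor C X Y" for Z \<xi>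
    using conn_eq_zero_iff[OF that(1) assms(1) that(2)] by (simp add: Ext_pull_ext_class[OF that(1)])
  then show ?thesis by (auto simp: proj_trivial_def ball_Ext_right)
qed

lemma cov_im_hom:
  assumes "\<xi> \<in> exts Z X" "Y \<in> Ob C"
  shows "(\<lambda>g. Cmp C X (mid \<xi>) Y g (infl \<xi>)) \<in> mod_hom R (Hom C (mid \<xi>) Y) (Hom C X Y)"
    "cov_im C \<xi> Y = (\<lambda>g. Cmp C X (mid \<xi>) Y g (infl \<xi>)) ` carrier (Hom C (mid \<xi>) Y)"
    "submodule (cov_im C \<xi> Y) R (Hom C X Y)"
proof -
  note D = extsD[OF assms(1)]
  show h: "(\<lambda>g. Cmp C X (mid \<xi>) Y g (infl \<xi>)) \<in> mod_hom R (Hom C (mid \<xi>) Y) (Hom C X Y)"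
    using Cmp_linear_left conf_Ob(1,2,4)[OF D(1)] D assms(2) by simp
  show e: "cov_im C \<xi> Y = (\<lambda>g. Cmp C X (mid \<xi>) Y g (infl \<xi>)) ` carrier (Hom C (mid \<xi>) Y)"
    using D by (simp add: cov_im_def)
  show "submodule (cov_im C \<xi> Y) R (Hom C X Y)"
    unfolding e by (rule mod_hom_image_submodule[OF _ _ h]) (use Hom_module D conf_Ob(2)[OF D(1)] assms(2) in auto)
qed

lemma contra_im_hom:
  assumes "\<xi> \<in> exts Y Z" "X \<in> Ob C"
  shows "(\<lambda>g. Cmp C X (mid \<xi>) Y (defl \<xi>) g) \<in> mod_hom R (Hom C X (mid \<xi>)) (Hom C X Y)"
    "contra_im C \<xi> X = (\<lambda>g. Cmp C X (mid \<xi>) Y (defl \<xi>) g) ` carrier (Hom C X (mid \<xi>))"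
    "submodule (contra_im C \<xi> X) R (Hom C X Y)"
proof -
  note D = extsD[OF assms(1)]
  show h: "(\<lambda>g. Cmp C X (mid \<xi>) Y (defl \<xi>) g) \<in> mod_hom R (Hom C X (mid \<xi>)) (Hom C X Y)"
    using Cmp_linear_right conf_Ob(2,3,5)[OF D(1)] D assms(2) by simp
  show e: "contra_im C \<xi> X = (\<lambda>g. Cmp C X (mid \<xi>) Y (defl \<xi>) g) ` carrier (Hom C X (mid \<xi>))"
    using D by (simp add: contra_im_def)
  show "submodule (contra_im C \<xi> X) R (Hom C X Y)"
    unfolding e by (rule mod_hom_image_submodule[OF _ _ h]) (use Hom_module D conf_Ob(2)[OF D(1)] assms(2) in auto)
qed

text \<open>Extensions can be composed with any \<open>g\<close> afterwards. For precomposition with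
  \<open>f\<close>, the inflation is first pushed out along \<open>f\<close>, and \<open>t\<close>
  is extended over the pushed out inflation.\<close>

lemma inj_trivial_ideal: "hom_ideal (inj_trivial C)"
  unfolding hom_ideal_def
proof (intro conjI ballI)
  fix X Y assume X: "X \<in> Ob C" and Y: "Y \<in> Ob C"
  \<comment> \<open>The index \<open>p\<close> packs the right end together with the conflation,
    since \<open>submodule_Inter\<close> takes a single index.\<close>
  have "submodule {x \<in> Mor C X Y. \<forall>p. snd p \<in> exts (fst p) X \<longrightarrow> x \<in> cov_im C (snd p) Y} R (Hom C X Y)"
    by (rule submodule_Inter[OF Hom_module[OF X Y]]) (rule cov_im_hom(3)[OF _ Y])
  moreover have "{x \<in> Mor C X Y. \<forall>p. snd p \<in> exts (fst p) X \<longrightarrow> x \<in> cov_im C (snd p) Y} = inj_trivial C X Y"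
    by (auto simp: inj_trivial_iff[OF X Y])
  ultimately show "submodule (inj_trivial C X Y) R (Hom C X Y)" by simp
next
  fix X Y Z f t assume ob: "X \<in> Ob C" "Y \<in> Ob C" "Z \<in> Ob C" and f: "f \<in> Mor C X Y" and t: "t \<in> inj_trivial C Y Z"
  note [simp] = cat_simps ob f
  have tm [simp]: "t \<in> Mor C Y Z" and ti: "\<And>W \<xi>. \<xi> \<in> exts W Y \<Longrightarrow> t \<in> cov_im C \<xi> Z" using t by (auto simp: inj_trivial_iff[OF ob(2,3)])
  have "Cmp C X Y Z t f \<in> cov_im C \<xi> Z" if x: "\<xi> \<in> exts W X" for \<xi> W
  proof -
    note D = extsD[OF x]
    obtain \<eta> where \<eta>: "\<eta> \<in> exts W Y" "pushto \<xi> \<eta> f" by (rule pushto_exists[OF x ob(2) f])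
    note E = extsD[OF \<eta>(1)]
    obtain h where h: "ses_mor C \<xi> \<eta> f h (Idm C W)" using \<eta>(2) D by (auto simp: pushto_def)
    note hD = ses_morD(2,4)[OF h, unfolded D(2) E(2)]
    obtain k where k: "k \<in> Mor C (mid \<eta>) Z" "t = Cmp C Y (mid \<eta>) Z k (infl \<eta>)"
      using ti[OF \<eta>(1)] E by (auto simp: cov_im_def)
    note [simp] = conf_Ob(2)[OF D(1)] conf_Ob(2)[OF E(1)] conf_Ob(4)[OF D(1), unfolded D(2)] conf_Ob(4)[OF E(1), unfolded E(2)] k(1) hD(1)
    have "Cmp C X Y Z t f = Cmp C X (mid \<xi>) Z (Cmp C (mid \<xi>) (mid \<eta>) Z k h) (infl \<xi>)"
      unfolding k(2) by (simp add: hD(2))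
    then show ?thesis unfolding cov_im_def D(2) by (intro image_eqI[of _ _ "Cmp C (mid \<xi>) (mid \<eta>) Z k h"]) simp_all
  qed
  then show "Cmp C X Y Z t f \<in> inj_trivial C X Z" by (simp add: inj_trivial_iff)
next
  fix X Y Z t g assume ob: "X \<in> Ob C" "Y \<in> Ob C" "Z \<in> Ob C" and t: "t \<in> inj_trivial C X Y" and g: "g \<in> Mor C Y Z"
  note [simp] = cat_simps ob g
  have tm [simp]: "t \<in> Mor C X Y" and ti: "\<And>W \<xi>. \<xi> \<in> exts W X \<Longrightarrow> t \<in> cov_im C \<xi> Y" using t by (auto simp: inj_trivial_iff[OF ob(1,2)])
  have "Cmp C X Y Z g t \<in> cov_im C \<xi> Z" if x: "\<xi> \<in> exts W X" for \<xi> W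
  proof -
    note D = extsD[OF x]
    obtain k where k: "k \<in> Mor C (mid \<xi>) Y" "t = Cmp C X (mid \<xi>) Y k (infl \<xi>)"
      using ti[OF x] D by (auto simp: cov_im_def)
    note [simp] = conf_Ob(2)[OF D(1)] conf_Ob(4)[OF D(1), unfolded D(2)] k(1)
    have "Cmp C X Y Z g t = Cmp C X (mid \<xi>) Z (Cmp C (mid \<xi>) Y Z g k) (infl \<xi>)" unfolding k(2) by simp
    then show ?thesis unfolding cov_im_def D(2) by (intro image_eqI[of _ _ "Cmp C (mid \<xi>) Y Z g k"]) simp_all
  qed
  then show "Cmp C X Y Z g t \<in> inj_trivial C X Z" by (simp add: inj_trivial_iff)
qed

lemma proj_trivial_ideal: "hom_ideal (proj_trivial C)"
  unfolding hom_ideal_def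
proof (intro conjI ballI)
  fix X Y assume X: "X \<in> Ob C" and Y: "Y \<in> Ob C"
  have "submodule {x \<in> Mor C X Y. \<forall>p. snd p \<in> exts Y (fst p) \<longrightarrow> x \<in> contra_im C (snd p) X} R (Hom C X Y)"
    by (rule submodule_Inter[OF Hom_module[OF X Y]]) (rule contra_im_hom(3)[OF _ X])
  moreover have "{x \<in> Mor C X Y. \<forall>p. snd p \<in> exts Y (fst p) \<longrightarrow> x \<in> contra_im C (snd p) X} = proj_trivial C X Y"
    by (auto simp: proj_trivial_iff[OF X Y])
  ultimately show "submodule (proj_trivial C X Y) R (Hom C X Y)" by simp
next
  fix X Y Z f t assume ob: "X \<in> Ob C" "Y \<in> Ob C" "Z \<in> Ob C" and f: "f \<in> Mor C X Y" and t: "t \<in> proj_trivial C Y Z"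
  note [simp] = cat_simps ob f
  have tm [simp]: "t \<in> Mor C Y Z" and ti: "\<And>W \<xi>. \<xi> \<in> exts Z W \<Longrightarrow> t \<in> contra_im C \<xi> Y" using t by (auto simp: proj_trivial_iff[OF ob(2,3)])
  have "Cmp C X Y Z t f \<in> contra_im C \<xi> X" if x: "\<xi> \<in> exts Z W" for \<xi> W
  proof -
    note D = extsD[OF x]
    obtain k where k: "k \<in> Mor C Y (mid \<xi>)" "t = Cmp C Y (mid \<xi>) Z (defl \<xi>) k"
      using ti[OF x] D by (auto simp: contra_im_def)
    note [simp] = conf_Ob(2)[OF D(1)] conf_Ob(5)[OF D(1), unfolded D(3)] k(1)
    have "Cmp C X Y Z t f = Cmp C X (mid \<xi>) Z (defl \<xi>) (Cmp C X Y (mid \<xi>) k f)" unfolding k(2) by simp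
    then show ?thesis unfolding contra_im_def D(3) by (intro image_eqI[of _ _ "Cmp C X Y (mid \<xi>) k f"]) simp_all
  qed
  then show "Cmp C X Y Z t f \<in> proj_trivial C X Z" by (simp add: proj_trivial_iff)
next
  fix X Y Z t g assume ob: "X \<in> Ob C" "Y \<in> Ob C" "Z \<in> Ob C" and t: "t \<in> proj_trivial C X Y" and g: "g \<in> Mor C Y Z"
  note [simp] = cat_simps ob g
  have tm [simp]: "t \<in> Mor C X Y" and ti: "\<And>W \<xi>. \<xi> \<in> exts Y W \<Longrightarrow> t \<in> contra_im C \<xi> X" using t by (auto simp: proj_trivial_iff[OF ob(1,2)])
  have "Cmp C X Y Z g t \<in> contra_im C \<xi> X" if x: "\<xi> \<in> exts Z W" for \<xi> W
  proof -
    note D = extsD[OF x]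
    obtain \<eta> where \<eta>: "\<eta> \<in> exts Y W" "pullto \<eta> \<xi> g" by (rule pullto_exists[OF x ob(2) g])
    note E = extsD[OF \<eta>(1)]
    obtain h where h: "ses_mor C \<eta> \<xi> (Idm C W) h g" using \<eta>(2) D by (auto simp: pullto_def)
    note hD = ses_morD(2,5)[OF h, unfolded D(3) E(3)]
    obtain k where k: "k \<in> Mor C X (mid \<eta>)" "t = Cmp C X (mid \<eta>) Y (defl \<eta>) k"
      using ti[OF \<eta>(1)] E by (auto simp: contra_im_def)
    note [simp] = conf_Ob(2)[OF D(1)] conf_Ob(2)[OF E(1)] conf_Ob(5)[OF D(1), unfolded D(3)] conf_Ob(5)[OF E(1), unfolded E(3)] k(1) hD(1)
    have "Cmp C X Y Z g t = Cmp C X (mid \<xi>) Z (defl \<xi>) (Cmp C X (mid \<eta>) (mid \<xi>) h k)"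
      unfolding k(2) by (simp add: Cmp_reassoc[OF hD(2)])
    then show ?thesis unfolding contra_im_def D(3) by (intro image_eqI[of _ _ "Cmp C X (mid \<eta>) (mid \<xi>) h k"]) simp_all
  qed
  then show "Cmp C X Y Z g t \<in> proj_trivial C X Z" by (simp add: proj_trivial_iff)
qed

text \<open>Makes the representative picked by \<open>induced\<close> harmless: two representatives
  differ by a trivial morphism, whose \<open>coconn\<close> vanishes, and \<open>coconn\<close> is
  additive.\<close>

lemma Ext_push_coset:
  assumes ob: "X \<in> Ob C" "Y \<in> Ob C" "Z \<in> Ob C" and f: "f \<in> Mor C X Y" "f' \<in> Mor C X Y"
    and eq: "inj_trivial C X Y +>\<^bsub>Hom C X Y\<^esub> f = inj_trivial C X Y +>\<^bsub>Hom C X Y\<^esub> f'" and c: "c \<in> carrier (Ext C Z X)"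
  shows "Ext_push C Z X Y f c = Ext_push C Z X Y f' c"
proof -
  interpret H: module R "Hom C X Y" by (rule Hom_module[OF ob(1,2)])
  interpret E: module R "Ext C Z Y" by (rule Ext_module[OF ob(3,2)])
  obtain \<xi> where x: "\<xi> \<in> exts Z X" "c = ext_class C \<xi>" using c by (auto simp: Ext_carrier)
  have t: "f \<ominus>\<^bsub>Hom C X Y\<^esub> f' \<in> inj_trivial C X Y"
    using rcos_eq_iff[OF Hom_module[OF ob(1,2)] hom_ideal_submodule[OF inj_trivial_ideal ob(1,2)] f] eq by simp
  then have "coconn \<xi> Y (f \<ominus>\<^bsub>Hom C X Y\<^esub> f') = \<zero>\<^bsub>Ext C Z Y\<^esub>"
    using coconn_eq_zero_iff[OF x(1) ob(2)] x(1) by (simp add: inj_trivial_iff[OF ob(1,2)])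
  then have "coconn \<xi> Y f \<ominus>\<^bsub>Ext C Z Y\<^esub> coconn \<xi> Y f' = \<zero>\<^bsub>Ext C Z Y\<^esub>"
    using mod_hom_minus[OF Hom_module[OF ob(1,2)] Ext_module[OF ob(3,2)] coconn_hom[OF x(1) ob(2)] f] by simp
  then show ?thesis
    using coconn_closed[OF x(1) ob(2) f(1)] coconn_closed[OF x(1) ob(2) f(2)]
    by (simp add: E.M.minus_eq_zero_iff x(2) Ext_push_ext_class[OF x(1)])
qed

lemma Ext_pull_coset:
  assumes ob: "X \<in> Ob C" "Y \<in> Ob C" "Z \<in> Ob C" and f: "f \<in> Mor C X Y" "f' \<in> Mor C X Y"
    and eq: "proj_trivial C X Y +>\<^bsub>Hom C X Y\<^esub> f = proj_trivial C X Y +>\<^bsub>Hom C X Y\<^esub> f'" and c: "c \<in> carrier (Ext C Y Z)"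
  shows "Ext_pull C Z X Y f c = Ext_pull C Z X Y f' c"
proof -
  interpret H: module R "Hom C X Y" by (rule Hom_module[OF ob(1,2)])
  interpret E: module R "Ext C X Z" by (rule Ext_module[OF ob(1,3)])
  obtain \<xi> where x: "\<xi> \<in> exts Y Z" "c = ext_class C \<xi>" using c by (auto simp: Ext_carrier)
  have t: "f \<ominus>\<^bsub>Hom C X Y\<^esub> f' \<in> proj_trivial C X Y"
    using rcos_eq_iff[OF Hom_module[OF ob(1,2)] hom_ideal_submodule[OF proj_trivial_ideal ob(1,2)] f] eq by simp
  then have "conn \<xi> X (f \<ominus>\<^bsub>Hom C X Y\<^esub> f') = \<zero>\<^bsub>Ext C X Z\<^esub>"
    using conn_eq_zero_iff[OF x(1) ob(1)] x(1) by (simp add: proj_trivial_iff[OF ob(1,2)])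
  then have "conn \<xi> X f \<ominus>\<^bsub>Ext C X Z\<^esub> conn \<xi> X f' = \<zero>\<^bsub>Ext C X Z\<^esub>"
    using mod_hom_minus[OF Hom_module[OF ob(1,2)] Ext_module[OF ob(1,3)] conn_hom[OF x(1) ob(1)] f] by simp
  then show ?thesis
    using conn_closed[OF x(1) ob(1) f(1)] conn_closed[OF x(1) ob(1) f(2)]
    by (simp add: E.M.minus_eq_zero_iff x(2) Ext_pull_ext_class[OF x(1)])
qed

end

section \<open>The duality of defects\<close>

lemma upper_stable_simps:
  "Ob (upper_stable C) = Ob C" "Hom (upper_stable C) X Y = quot_mod (Hom C X Y) (inj_trivial C X Y)"
  by (simp_all add: upper_stable_def quot_cat_def)

lemma lower_stable_simps:
  "Ob (lower_stable C) = Ob C" "Hom (lower_stable C) X Y = quot_mod (Hom C X Y) (proj_trivial C X Y)"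
  by (simp_all add: lower_stable_def quot_cat_def)

context exact_category
begin

abbreviation upper_class :: "'o \<Rightarrow> 'o \<Rightarrow> 'm \<Rightarrow> 'm set"
  where "upper_class X Y f \<equiv> inj_trivial C X Y +>\<^bsub>Hom C X Y\<^esub> f"

abbreviation lower_class :: "'o \<Rightarrow> 'o \<Rightarrow> 'm \<Rightarrow> 'm set"
  where "lower_class X Y f \<equiv> proj_trivial C X Y +>\<^bsub>Hom C X Y\<^esub> f"

lemma upper_class:
  assumes ob: "X \<in> Ob C" "Y \<in> Ob C"
  shows "f \<in> Mor C X Y \<Longrightarrow> upper_class X Y f \<in> Mor (upper_stable C) X Y"
    and "g \<in> Mor (upper_stable C) X Y \<Longrightarrow> (SOME f. f \<in> g) \<in> Mor C X Y \<and> upper_class X Y (SOME f. f \<in> g) = g"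
proof -
  note Q = quot_carrier[OF Hom_module[OF ob] hom_ideal_submodule[OF inj_trivial_ideal ob]]
  show "f \<in> Mor C X Y \<Longrightarrow> upper_class X Y f \<in> Mor (upper_stable C) X Y"
    by (auto simp: upper_stable_simps Q)
  show "g \<in> Mor (upper_stable C) X Y \<Longrightarrow> (SOME f. f \<in> g) \<in> Mor C X Y \<and> upper_class X Y (SOME f. f \<in> g) = g"
    using some_rcos[OF Hom_module[OF ob] hom_ideal_submodule[OF inj_trivial_ideal ob]] by (auto simp: upper_stable_simps Q)
qed

lemma lower_class:
  assumes ob: "X \<in> Ob C" "Y \<in> Ob C"
  shows "f \<in> Mor C X Y \<Longrightarrow> lower_class X Y f \<in> Mor (lower_stable C) X Y"
    and "g \<in> Mor (lower_stable C) X Y \<Longrightarrow> (SOME f. f \<in> g) \<in> Mor C X Y \<and> lower_class X Y (SOME f. f \<in> g) = g"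
proof -
  note Q = quot_carrier[OF Hom_module[OF ob] hom_ideal_submodule[OF proj_trivial_ideal ob]]
  show "f \<in> Mor C X Y \<Longrightarrow> lower_class X Y f \<in> Mor (lower_stable C) X Y"
    by (auto simp: lower_stable_simps Q)
  show "g \<in> Mor (lower_stable C) X Y \<Longrightarrow> (SOME f. f \<in> g) \<in> Mor C X Y \<and> lower_class X Y (SOME f. f \<in> g) = g"
    using some_rcos[OF Hom_module[OF ob] hom_ideal_submodule[OF proj_trivial_ideal ob]] by (auto simp: lower_stable_simps Q)
qed

text \<open>Translates \<open>\<phi>\<close> from the stable category to plain morphisms; in the
  naturality law the given \<open>f\<close> takes the place of the representative that
  \<open>induced\<close> chooses.\<close>

lemma upper_natiso:
  assumes nat: "contra_natiso R (upper_stable C) (hom_contra (upper_stable C) T) (induced (dual_cov R J (ext_cov C K))) \<phi>"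
    and J: "module R J" and T: "T \<in> Ob C" and K: "K \<in> Ob C" and X: "X \<in> Ob C"
  shows "(\<lambda>f. \<phi> X (upper_class X T f)) \<in> mod_hom R (Hom C X T) (dual R J (Ext C K X))"
    and "(\<lambda>f. \<phi> X (upper_class X T f)) ` Mor C X T = carrier (dual R J (Ext C K X))"
    and "\<lbrakk>f \<in> Mor C X T; \<And>m. m \<in> carrier (Ext C K X) \<Longrightarrow> \<phi> X (upper_class X T f) m = \<zero>\<^bsub>J\<^esub>\<rbrakk> \<Longrightarrow> f \<in> inj_trivial C X T"
    and "\<lbrakk>X' \<in> Ob C; f \<in> Mor C X X'; h \<in> Mor C X' T; m \<in> carrier (Ext C K X)\<rbrakk> \<Longrightarrow>
      \<phi> X (upper_class X T (Cmp C X X' T h f)) m = \<phi> X' (upper_class X' T h) (Ext_push C K X X' f m)"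
proof -
  have "\<phi> X \<in> mod_iso R (quot_mod (Hom C X T) (inj_trivial C X T)) (dual R J (Ext C K X))"
    using nat X by (simp add: contra_natiso_def hom_contra_def induced_def dual_cov_def ext_cov_def upper_stable_simps)
  from mod_iso_quot_lift[OF Hom_module[OF X T] hom_ideal_submodule[OF inj_trivial_ideal X T] J Ext_module[OF K X] this]
  show "(\<lambda>f. \<phi> X (upper_class X T f)) \<in> mod_hom R (Hom C X T) (dual R J (Ext C K X))"
    "(\<lambda>f. \<phi> X (upper_class X T f)) ` Mor C X T = carrier (dual R J (Ext C K X))"
    "\<lbrakk>f \<in> Mor C X T; \<And>m. m \<in> carrier (Ext C K X) \<Longrightarrow> \<phi> X (upper_class X T f) m = \<zero>\<^bsub>J\<^esub>\<rbrakk> \<Longrightarrow> f \<in> inj_trivial C X T"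
    by blast+
  assume X': "X' \<in> Ob C" and f: "f \<in> Mor C X X'" and h: "h \<in> Mor C X' T" and m: "m \<in> carrier (Ext C K X)"
  \<comment> \<open>The representative at which \<open>induced\<close> evaluates. It may differ from
    \<open>f\<close>, but \<open>Ext_push_coset\<close> shows that both act alike.\<close>
  define f' where "f' = (SOME g. g \<in> upper_class X X' f)"
  have f': "f' \<in> Mor C X X'" "upper_class X X' f' = upper_class X X' f"
    unfolding f'_def using upper_class(2)[OF X X' upper_class(1)[OF X X' f]] by auto
  have "\<phi> X (Cmp (upper_stable C) X X' T (upper_class X' T h) (upper_class X X' f)) =
      dual_map (Ext C K X) (Ext_push C K X X' f') (\<phi> X' (upper_class X' T h))"
    using nat X X' upper_class(1)[OF X X' f] upper_class(1)[OF X' T h]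
    by (simp add: contra_natiso_def hom_contra_def induced_def dual_cov_def ext_cov_def upper_stable_simps f'_def)
  moreover have "Cmp (upper_stable C) X X' T (upper_class X' T h) (upper_class X X' f) = upper_class X T (Cmp C X X' T h f)"
    unfolding upper_stable_def by (rule quot_Cmp[OF inj_trivial_ideal X X' T f h])
  ultimately show "\<phi> X (upper_class X T (Cmp C X X' T h f)) m = \<phi> X' (upper_class X' T h) (Ext_push C K X X' f m)"
    using m Ext_push_coset[OF X X' K f'(1) f f'(2) m] by (simp add: dual_map_def)
qed

lemma lower_natiso:
  assumes nat: "cov_natiso R (lower_stable C) (hom_cov (lower_stable C) T) (induced (dual_contra R J (ext_contra C K))) \<psi>"
    and J: "module R J" and T: "T \<in> Ob C" and K: "K \<in> Ob C" and Y: "Y \<in> Ob C"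
  shows "(\<lambda>g. \<psi> Y (lower_class T Y g)) \<in> mod_hom R (Hom C T Y) (dual R J (Ext C Y K))"
    and "(\<lambda>g. \<psi> Y (lower_class T Y g)) ` Mor C T Y = carrier (dual R J (Ext C Y K))"
    and "\<lbrakk>g \<in> Mor C T Y; \<And>m. m \<in> carrier (Ext C Y K) \<Longrightarrow> \<psi> Y (lower_class T Y g) m = \<zero>\<^bsub>J\<^esub>\<rbrakk> \<Longrightarrow> g \<in> proj_trivial C T Y"
    and "\<lbrakk>X \<in> Ob C; f \<in> Mor C X Y; h \<in> Mor C T X; m \<in> carrier (Ext C Y K)\<rbrakk> \<Longrightarrow>
      \<psi> Y (lower_class T Y (Cmp C T X Y f h)) m = \<psi> X (lower_class T X h) (Ext_pull C K X Y f m)"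
proof -
  have "\<psi> Y \<in> mod_iso R (quot_mod (Hom C T Y) (proj_trivial C T Y)) (dual R J (Ext C Y K))"
    using nat Y by (simp add: cov_natiso_def hom_cov_def induced_def dual_contra_def ext_contra_def lower_stable_simps)
  from mod_iso_quot_lift[OF Hom_module[OF T Y] hom_ideal_submodule[OF proj_trivial_ideal T Y] J Ext_module[OF Y K] this]
  show "(\<lambda>g. \<psi> Y (lower_class T Y g)) \<in> mod_hom R (Hom C T Y) (dual R J (Ext C Y K))"
    "(\<lambda>g. \<psi> Y (lower_class T Y g)) ` Mor C T Y = carrier (dual R J (Ext C Y K))"
    "\<lbrakk>g \<in> Mor C T Y; \<And>m. m \<in> carrier (Ext C Y K) \<Longrightarrow> \<psi> Y (lower_class T Y g) m = \<zero>\<^bsub>J\<^esub>\<rbrakk> \<Longrightarrow> g \<in> proj_trivial C T Y"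
    by blast+
  assume X: "X \<in> Ob C" and f: "f \<in> Mor C X Y" and h: "h \<in> Mor C T X" and m: "m \<in> carrier (Ext C Y K)"
  define f' where "f' = (SOME g. g \<in> lower_class X Y f)"
  have f': "f' \<in> Mor C X Y" "lower_class X Y f' = lower_class X Y f"
    unfolding f'_def using lower_class(2)[OF X Y lower_class(1)[OF X Y f]] by auto
  have "\<psi> Y (Cmp (lower_stable C) T X Y (lower_class X Y f) (lower_class T X h)) =
      dual_map (Ext C Y K) (Ext_pull C K X Y f') (\<psi> X (lower_class T X h))"
    using nat X Y lower_class(1)[OF X Y f] lower_class(1)[OF T X h]
    by (simp add: cov_natiso_def hom_cov_def induced_def dual_contra_def ext_contra_def lower_stable_simps f'_def)
  moreover have "Cmp (lower_stable C) T X Y (lower_class X Y f) (lower_class T X h) = lower_class T Y (Cmp C T X Y f h)"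
    unfolding lower_stable_def by (rule quot_Cmp[OF proj_trivial_ideal T X Y h f])
  ultimately show "\<psi> Y (lower_class T Y (Cmp C T X Y f h)) m = \<psi> X (lower_class T X h) (Ext_pull C K X Y f m)"
    using m Ext_pull_coset[OF X Y K f'(1) f f'(2) m] by (simp add: dual_map_def)
qed

text \<open>\<open>T\<close> stands for \<open>\<tau>K\<close> and \<open>\<phi>\<close> for the
  family belonging to \<open>K\<close>. Keeping them as parameters allows two objects with their own
  data to be compared later.\<close>

definition cov_pairing :: "('o \<Rightarrow> 'm set \<Rightarrow> ('o, 'm) ses set \<Rightarrow> 'j) \<Rightarrow> 'o \<Rightarrow> ('o, 'm) ses \<Rightarrow> 'o \<Rightarrow> 'm set \<Rightarrow> 'm set \<Rightarrow> 'j"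
  where "cov_pairing \<phi> T \<xi> K = coset_pairing (MOb (contra_defect C \<xi>) K) (\<lambda>f. \<phi> (lft \<xi>) (upper_class (lft \<xi>) T f)) (conn \<xi> K)"

definition contra_pairing :: "('o \<Rightarrow> 'm set \<Rightarrow> ('o, 'm) ses set \<Rightarrow> 'j) \<Rightarrow> 'o \<Rightarrow> ('o, 'm) ses \<Rightarrow> 'o \<Rightarrow> 'm set \<Rightarrow> 'm set \<Rightarrow> 'j"
  where "contra_pairing \<psi> T \<xi> K = coset_pairing (MOb (cov_defect C \<xi>) K) (\<lambda>g. \<psi> (rgt \<xi>) (lower_class T (rgt \<xi>) g)) (coconn \<xi> K)"

text \<open>An instance of the abstract duality: \<open>A\<close> and \<open>B\<close> are the
  morphisms from \<open>X\<close> and \<open>mid \<xi>\<close> to \<open>T\<close>, \<open>G\<close>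
  and \<open>H\<close> those from \<open>K\<close> to \<open>Y\<close> and \<open>mid \<xi>\<close>,
  while \<open>M\<close> and \<open>M'\<close> are the extensions of \<open>K\<close> by
  \<open>X\<close> and \<open>mid \<xi>\<close>. Exactness is \<open>conn_eq_zero_iff\<close> and
  \<open>Ext_push_infl_eq_zero_iff\<close>.\<close>

lemma cov_pairing:
  assumes nat: "contra_natiso R (upper_stable C) (hom_contra (upper_stable C) T) (induced (dual_cov R J (ext_cov C K))) \<phi>"
    and J: "injective_module R J" and T: "T \<in> Ob C" and K: "K \<in> Ob C" and x: "\<xi> \<in> exts Y X"
  shows "cov_pairing \<phi> T \<xi> K \<in> mod_iso R (MOb (cov_defect C \<xi>) T) (dual R J (MOb (contra_defect C \<xi>) K))"
    and "\<lbrakk>f \<in> Mor C X T; g \<in> Mor C K Y\<rbrakk> \<Longrightarrow>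
      cov_pairing \<phi> T \<xi> K (cov_im C \<xi> T +>\<^bsub>Hom C X T\<^esub> f) (contra_im C \<xi> K +>\<^bsub>Hom C K Y\<^esub> g) =
      \<phi> X (upper_class X T f) (conn \<xi> K g)"
proof -
  note D = extsD[OF x]
  have E: "mid \<xi> \<in> Ob C" and i: "infl \<xi> \<in> Mor C X (mid \<xi>)" using conf_Ob(2,4)[OF D(1)] D by simp_all
  note mJ = injective_module_module[OF J]
  note N = upper_natiso[OF nat mJ T K]
  note hyps = J Hom_module[OF D(5) T] Hom_module[OF E T] Hom_module[OF K D(4)] Hom_module[OF K E]
    Ext_module[OF K D(5)] Ext_module[OF K E] cov_im_hom(1)[OF x T] contra_im_hom(1)[OF x K] conn_hom[OF x K]
    Ext_push_hom[OF K D(5) E i]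
  have k1: "conn \<xi> K g = \<zero>\<^bsub>Ext C K X\<^esub> \<longleftrightarrow> g \<in> (\<lambda>g. Cmp C K (mid \<xi>) Y (defl \<xi>) g) ` carrier (Hom C K (mid \<xi>))"
    if "g \<in> Mor C K Y" for g
    using conn_eq_zero_iff[OF x K that] contra_im_hom(2)[OF x K] by simp
  have k2: "f \<in> (\<lambda>g. Cmp C X (mid \<xi>) T g (infl \<xi>)) ` carrier (Hom C (mid \<xi>) T)"
    if "f \<in> Mor C X T" "\<And>m. m \<in> carrier (Ext C K X) \<Longrightarrow> \<phi> X (upper_class X T f) m = \<zero>\<^bsub>J\<^esub>" for f
  proof -
    have "f \<in> inj_trivial C X T" by (rule N(3)[OF D(5) that])
    then have "f \<in> cov_im C \<xi> T" using x by (simp add: inj_trivial_iff[OF D(5) T])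
    then show ?thesis by (simp only: cov_im_hom(2)[OF x T])
  qed
  note k3 = N(4)[OF D(5) E i]
  note k = k1 Ext_push_infl_eq_zero_iff[OF x K] N(1,2)[OF D(5)] k2 N(2)[OF E] k3
  have eq: "cov_pairing \<phi> T \<xi> K =
      coset_pairing (quot_mod (Hom C K Y) ((\<lambda>g. Cmp C K (mid \<xi>) Y (defl \<xi>) g) ` carrier (Hom C K (mid \<xi>))))
        (\<lambda>f. \<phi> X (upper_class X T f)) (conn \<xi> K)"
    unfolding cov_pairing_def contra_defect_def mfun.simps D contra_im_hom(2)[OF x K] ..
  have M: "MOb (cov_defect C \<xi>) T = quot_mod (Hom C X T) ((\<lambda>g. Cmp C X (mid \<xi>) T g (infl \<xi>)) ` carrier (Hom C (mid \<xi>) T))"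
    "MOb (contra_defect C \<xi>) K = quot_mod (Hom C K Y) ((\<lambda>g. Cmp C K (mid \<xi>) Y (defl \<xi>) g) ` carrier (Hom C K (mid \<xi>)))"
    unfolding cov_defect_def contra_defect_def mfun.simps D contra_im_hom(2)[OF x K] cov_im_hom(2)[OF x T] by (rule refl)+
  show "cov_pairing \<phi> T \<xi> K \<in> mod_iso R (MOb (cov_defect C \<xi>) T) (dual R J (MOb (contra_defect C \<xi>) K))"
    unfolding eq M by (rule coset_pairing_iso[OF hyps, where \<Psi> = "\<lambda>h. \<phi> (mid \<xi>) (upper_class (mid \<xi>) T h)"]) (fact k)+
  assume f: "f \<in> Mor C X T" and g: "g \<in> Mor C K Y"
  show "cov_pairing \<phi> T \<xi> K (cov_im C \<xi> T +>\<^bsub>Hom C X T\<^esub> f) (contra_im C \<xi> K +>\<^bsub>Hom C K Y\<^esub> g) =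
      \<phi> X (upper_class X T f) (conn \<xi> K g)"
    unfolding eq cov_im_hom(2)[OF x T] contra_im_hom(2)[OF x K]
    by (rule coset_pairing_apply[OF hyps, where \<Psi> = "\<lambda>h. \<phi> (mid \<xi>) (upper_class (mid \<xi>) T h)"]) (fact k f g)+
qed

lemma contra_pairing:
  assumes nat: "cov_natiso R (lower_stable C) (hom_cov (lower_stable C) T) (induced (dual_contra R J (ext_contra C K))) \<psi>"
    and J: "injective_module R J" and T: "T \<in> Ob C" and K: "K \<in> Ob C" and x: "\<xi> \<in> exts Y X"
  shows "contra_pairing \<psi> T \<xi> K \<in> mod_iso R (MOb (contra_defect C \<xi>) T) (dual R J (MOb (cov_defect C \<xi>) K))"
    and "\<lbrakk>g \<in> Mor C T Y; f \<in> Mor C X K\<rbrakk> \<Longrightarrow>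
      contra_pairing \<psi> T \<xi> K (contra_im C \<xi> T +>\<^bsub>Hom C T Y\<^esub> g) (cov_im C \<xi> K +>\<^bsub>Hom C X K\<^esub> f) =
      \<psi> Y (lower_class T Y g) (coconn \<xi> K f)"
proof -
  note D = extsD[OF x]
  have E: "mid \<xi> \<in> Ob C" and d: "defl \<xi> \<in> Mor C (mid \<xi>) Y" using conf_Ob(2,5)[OF D(1)] D by simp_all
  note mJ = injective_module_module[OF J]
  note N = lower_natiso[OF nat mJ T K]
  note hyps = J Hom_module[OF T D(4)] Hom_module[OF T E] Hom_module[OF D(5) K] Hom_module[OF E K]
    Ext_module[OF D(4) K] Ext_module[OF E K] contra_im_hom(1)[OF x T] cov_im_hom(1)[OF x K] coconn_hom[OF x K]
    Ext_pull_hom[OF D(4) E K d]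
  have k1: "coconn \<xi> K f = \<zero>\<^bsub>Ext C Y K\<^esub> \<longleftrightarrow> f \<in> (\<lambda>g. Cmp C X (mid \<xi>) K g (infl \<xi>)) ` carrier (Hom C (mid \<xi>) K)"
    if "f \<in> Mor C X K" for f
    using coconn_eq_zero_iff[OF x K that] cov_im_hom(2)[OF x K] by simp
  have k2: "g \<in> (\<lambda>g. Cmp C T (mid \<xi>) Y (defl \<xi>) g) ` carrier (Hom C T (mid \<xi>))"
    if "g \<in> Mor C T Y" "\<And>m. m \<in> carrier (Ext C Y K) \<Longrightarrow> \<psi> Y (lower_class T Y g) m = \<zero>\<^bsub>J\<^esub>" for g
  proof -
    have "g \<in> proj_trivial C T Y" by (rule N(3)[OF D(4) that])
    then have "g \<in> contra_im C \<xi> T" using x by (simp add: proj_trivial_iff[OF T D(4)])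
    then show ?thesis by (simp only: contra_im_hom(2)[OF x T])
  qed
  note k3 = N(4)[OF D(4) E d]
  note k = k1 Ext_pull_defl_eq_zero_iff[OF x K] N(1,2)[OF D(4)] k2 N(2)[OF E] k3
  have eq: "contra_pairing \<psi> T \<xi> K =
      coset_pairing (quot_mod (Hom C X K) ((\<lambda>g. Cmp C X (mid \<xi>) K g (infl \<xi>)) ` carrier (Hom C (mid \<xi>) K)))
        (\<lambda>g. \<psi> Y (lower_class T Y g)) (coconn \<xi> K)"
    unfolding contra_pairing_def cov_defect_def mfun.simps D cov_im_hom(2)[OF x K] ..
  have M: "MOb (contra_defect C \<xi>) T = quot_mod (Hom C T Y) ((\<lambda>g. Cmp C T (mid \<xi>) Y (defl \<xi>) g) ` carrier (Hom C T (mid \<xi>)))"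
    "MOb (cov_defect C \<xi>) K = quot_mod (Hom C X K) ((\<lambda>g. Cmp C X (mid \<xi>) K g (infl \<xi>)) ` carrier (Hom C (mid \<xi>) K))"
    unfolding cov_defect_def contra_defect_def mfun.simps D contra_im_hom(2)[OF x T] cov_im_hom(2)[OF x K] by (rule refl)+
  show "contra_pairing \<psi> T \<xi> K \<in> mod_iso R (MOb (contra_defect C \<xi>) T) (dual R J (MOb (cov_defect C \<xi>) K))"
    unfolding eq M by (rule coset_pairing_iso[OF hyps, where \<Psi> = "\<lambda>h. \<psi> (mid \<xi>) (lower_class T (mid \<xi>) h)"]) (fact k)+
  assume g: "g \<in> Mor C T Y" and f: "f \<in> Mor C X K"
  show "contra_pairing \<psi> T \<xi> K (contra_im C \<xi> T +>\<^bsub>Hom C T Y\<^esub> g) (cov_im C \<xi> K +>\<^bsub>Hom C X K\<^esub> f) =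
      \<psi> Y (lower_class T Y g) (coconn \<xi> K f)"
    unfolding eq contra_im_hom(2)[OF x T] cov_im_hom(2)[OF x K]
    by (rule coset_pairing_apply[OF hyps, where \<Psi> = "\<lambda>h. \<psi> (mid \<xi>) (lower_class T (mid \<xi>) h)"]) (fact k f g)+
qed

section \<open>Functoriality of the defects and naturality of the pairings\<close>

lemma cov_defect_map_rcos:
  assumes x: "\<xi> \<in> exts Y X" "\<xi>' \<in> exts Y' X'" and m: "ses_mor C \<xi> \<xi>' a b c" and Z: "Z \<in> Ob C" and f: "f \<in> Mor C X' Z"
  shows "cov_defect_map C \<xi> \<xi>' a Z (cov_im C \<xi>' Z +>\<^bsub>Hom C X' Z\<^esub> f) = cov_im C \<xi> Z +>\<^bsub>Hom C X Z\<^esub> Cmp C X X' Z f a"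
proof -
  note D = extsD[OF x(1)] and D' = extsD[OF x(2)]
  note mD = ses_morD[OF m, unfolded D(2,3) D'(2,3)]
  note [simp] = cat_simps mD(1-3) D(4,5) D'(4,5) Z conf_Ob(2)[OF D(1)] conf_Ob(2)[OF D'(1)]
    conf_Ob(4)[OF D(1), unfolded D(2)] conf_Ob(4)[OF D'(1), unfolded D'(2)]
  show ?thesis
    unfolding cov_defect_map_def D(2) D'(2)
  proof (rule quot_map_rcos[OF Hom_module cov_im_hom(3)[OF x(1) Z] Hom_module cov_im_hom(3)[OF x(2) Z] Cmp_linear_left _ f])
    fix s assume "s \<in> cov_im C \<xi>' Z"
    then obtain k where k: "k \<in> Mor C (mid \<xi>') Z" "s = Cmp C X' (mid \<xi>') Z k (infl \<xi>')" using D' by (auto simp: cov_im_def)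
    note [simp] = k(1)
    have "Cmp C X X' Z s a = Cmp C X (mid \<xi>) Z (Cmp C (mid \<xi>) (mid \<xi>') Z k b) (infl \<xi>)"
      unfolding k(2) by (simp add: mD(4))
    then show "Cmp C X X' Z s a \<in> cov_im C \<xi> Z"
      unfolding cov_im_def D(2) by (intro image_eqI[of _ _ "Cmp C (mid \<xi>) (mid \<xi>') Z k b"]) simp_all
  qed simp_all
qed

lemma contra_defect_map_rcos:
  assumes x: "\<xi> \<in> exts Y X" "\<xi>' \<in> exts Y' X'" and m: "ses_mor C \<xi> \<xi>' a b c" and Z: "Z \<in> Ob C" and g: "g \<in> Mor C Z Y"
  shows "contra_defect_map C \<xi> \<xi>' c Z (contra_im C \<xi> Z +>\<^bsub>Hom C Z Y\<^esub> g) = contra_im C \<xi>' Z +>\<^bsub>Hom C Z Y'\<^esub> Cmp C Z Y Y' c g"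
proof -
  note D = extsD[OF x(1)] and D' = extsD[OF x(2)]
  note mD = ses_morD[OF m, unfolded D(2,3) D'(2,3)]
  note [simp] = cat_simps mD(1-3) D(4,5) D'(4,5) Z conf_Ob(2)[OF D(1)] conf_Ob(2)[OF D'(1)]
    conf_Ob(5)[OF D(1), unfolded D(3)] conf_Ob(5)[OF D'(1), unfolded D'(3)]
  show ?thesis
    unfolding contra_defect_map_def D(3) D'(3)
  proof (rule quot_map_rcos[OF Hom_module contra_im_hom(3)[OF x(2) Z] Hom_module contra_im_hom(3)[OF x(1) Z] Cmp_linear_right _ g])
    fix s assume "s \<in> contra_im C \<xi> Z"
    then obtain k where k: "k \<in> Mor C Z (mid \<xi>)" "s = Cmp C Z (mid \<xi>) Y (defl \<xi>) k" using D by (auto simp: contra_im_def)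
    note [simp] = k(1)
    have "Cmp C Z Y Y' c s = Cmp C Z (mid \<xi>') Y' (defl \<xi>') (Cmp C Z (mid \<xi>) (mid \<xi>') b k)"
      unfolding k(2) by (simp add: Cmp_reassoc[OF mD(5)])
    then show "Cmp C Z Y Y' c s \<in> contra_im C \<xi>' Z"
      unfolding contra_im_def D'(3) by (intro image_eqI[of _ _ "Cmp C Z (mid \<xi>) (mid \<xi>') b k"]) simp_all
  qed simp_all
qed

lemma cov_defect_rcos:
  assumes x: "\<xi> \<in> exts Y X" and Z: "Z \<in> Ob C" "Z' \<in> Ob C" and t: "t \<in> Mor C Z Z'" and f: "f \<in> Mor C X Z"
  shows "MMor (cov_defect C \<xi>) Z Z' t (cov_im C \<xi> Z +>\<^bsub>Hom C X Z\<^esub> f) = cov_im C \<xi> Z' +>\<^bsub>Hom C X Z'\<^esub> Cmp C X Z Z' t f"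
proof -
  note D = extsD[OF x]
  note [simp] = cat_simps D(4,5) Z t conf_Ob(2)[OF D(1)] conf_Ob(4)[OF D(1), unfolded D(2)]
  show ?thesis
    unfolding cov_defect_def mfun.simps D(2)
  proof (rule quot_map_rcos[OF Hom_module cov_im_hom(3)[OF x Z(2)] Hom_module cov_im_hom(3)[OF x Z(1)] Cmp_linear_right _ f])
    fix s assume "s \<in> cov_im C \<xi> Z"
    then obtain k where k: "k \<in> Mor C (mid \<xi>) Z" "s = Cmp C X (mid \<xi>) Z k (infl \<xi>)" using D by (auto simp: cov_im_def)
    note [simp] = k(1)
    have "Cmp C X Z Z' t s = Cmp C X (mid \<xi>) Z' (Cmp C (mid \<xi>) Z Z' t k) (infl \<xi>)" unfolding k(2) by simp
    then show "Cmp C X Z Z' t s \<in> cov_im C \<xi> Z'"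
      unfolding cov_im_def D(2) by (intro image_eqI[of _ _ "Cmp C (mid \<xi>) Z Z' t k"]) simp_all
  qed simp_all
qed

lemma contra_defect_rcos:
  assumes x: "\<xi> \<in> exts Y X" and Z: "Z \<in> Ob C" "Z' \<in> Ob C" and t: "t \<in> Mor C Z Z'" and g: "g \<in> Mor C Z' Y"
  shows "MMor (contra_defect C \<xi>) Z Z' t (contra_im C \<xi> Z' +>\<^bsub>Hom C Z' Y\<^esub> g) = contra_im C \<xi> Z +>\<^bsub>Hom C Z Y\<^esub> Cmp C Z Z' Y g t"
proof -
  note D = extsD[OF x]
  note [simp] = cat_simps D(4,5) Z t conf_Ob(2)[OF D(1)] conf_Ob(5)[OF D(1), unfolded D(3)]
  show ?thesis
    unfolding contra_defect_def mfun.simps D(3)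
  proof (rule quot_map_rcos[OF Hom_module contra_im_hom(3)[OF x Z(1)] Hom_module contra_im_hom(3)[OF x Z(2)] Cmp_linear_left _ g])
    fix s assume "s \<in> contra_im C \<xi> Z'"
    then obtain k where k: "k \<in> Mor C Z' (mid \<xi>)" "s = Cmp C Z' (mid \<xi>) Y (defl \<xi>) k" using D by (auto simp: contra_im_def)
    note [simp] = k(1)
    have "Cmp C Z Z' Y s t = Cmp C Z (mid \<xi>) Y (defl \<xi>) (Cmp C Z Z' (mid \<xi>) k t)" unfolding k(2) by simp
    then show "Cmp C Z Z' Y s t \<in> contra_im C \<xi> Z"
      unfolding contra_im_def D(3) by (intro image_eqI[of _ _ "Cmp C Z Z' (mid \<xi>) k t"]) simp_all
  qed simp_all
qed

lemma cov_defect_carrier: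
  assumes x: "\<xi> \<in> exts Y X" and Z: "Z \<in> Ob C"
  shows "G \<in> carrier (MOb (cov_defect C \<xi>) Z) \<longleftrightarrow> (\<exists>f \<in> Mor C X Z. G = cov_im C \<xi> Z +>\<^bsub>Hom C X Z\<^esub> f)"
  using quot_carrier[OF Hom_module[OF extsD(5)[OF x] Z] cov_im_hom(3)[OF x Z]] extsD(2)[OF x]
  by (auto simp: cov_defect_def)

lemma contra_defect_carrier:
  assumes x: "\<xi> \<in> exts Y X" and Z: "Z \<in> Ob C"
  shows "G \<in> carrier (MOb (contra_defect C \<xi>) Z) \<longleftrightarrow> (\<exists>g \<in> Mor C Z Y. G = contra_im C \<xi> Z +>\<^bsub>Hom C Z Y\<^esub> g)"
  using quot_carrier[OF Hom_module[OF Z extsD(4)[OF x]] contra_im_hom(3)[OF x Z]] extsD(3)[OF x]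
  by (auto simp: contra_defect_def)

text \<open>Equality of two functionals can then be tested on the classes in the carrier.\<close>

lemma cov_pairing_extensional: "cov_pairing \<phi> T \<xi> K x \<in> extensional (carrier (MOb (contra_defect C \<xi>) K))"
  by (simp add: cov_pairing_def coset_pairing_def)

lemma contra_pairing_extensional: "contra_pairing \<psi> T \<xi> K x \<in> extensional (carrier (MOb (cov_defect C \<xi>) K))"
  by (simp add: contra_pairing_def coset_pairing_def)

text \<open>At classes of \<open>f\<close> and \<open>g\<close> both sides evaluate
  \<open>\<phi>\<close> at \<open>f\<close> on one extension: naturality of \<open>\<phi>\<close> in
  its object moves \<open>a\<close> to the pushout \<open>a\<^sub>*(g\<^sup>*\<xi>)\<close>, and
  this is \<open>(c g)\<^sup>*\<xi>'\<close>.\<close>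

lemma cov_pairing_natural:
  assumes nat: "contra_natiso R (upper_stable C) (hom_contra (upper_stable C) T) (induced (dual_cov R J (ext_cov C K))) \<phi>"
    and J: "injective_module R J" and T: "T \<in> Ob C" and K: "K \<in> Ob C" and x: "\<xi> \<in> exts Y X" "\<xi>' \<in> exts Y' X'"
    and m: "ses_mor C \<xi> \<xi>' a b c" and G: "G \<in> carrier (MOb (cov_defect C \<xi>') T)"
  shows "cov_pairing \<phi> T \<xi> K (cov_defect_map C \<xi> \<xi>' a T G) =
    dual_map (MOb (contra_defect C \<xi>) K) (contra_defect_map C \<xi> \<xi>' c K) (cov_pairing \<phi> T \<xi>' K G)"
proof (rule extensionalityI[of _ "carrier (MOb (contra_defect C \<xi>) K)"])
  note D = extsD[OF x(1)] and D' = extsD[OF x(2)]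
  note mJ = injective_module_module[OF J]
  obtain f where f: "f \<in> Mor C X' T" "G = cov_im C \<xi>' T +>\<^bsub>Hom C X' T\<^esub> f" using G by (auto simp: cov_defect_carrier[OF x(2) T])
  have a: "a \<in> Mor C X X'" and c: "c \<in> Mor C Y Y'" using ses_morD[OF m] D D' by simp_all
  fix H assume H: "H \<in> carrier (MOb (contra_defect C \<xi>) K)"
  then obtain g where g: "g \<in> Mor C K Y" "H = contra_im C \<xi> K +>\<^bsub>Hom C K Y\<^esub> g" by (auto simp: contra_defect_carrier[OF x(1) K])
  have "cov_pairing \<phi> T \<xi> K (cov_defect_map C \<xi> \<xi>' a T G) H = \<phi> X (upper_class X T (Cmp C X X' T f a)) (conn \<xi> K g)"
    unfolding f(2) g(2) cov_defect_map_rcos[OF x m T f(1)]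
    by (rule cov_pairing(2)[OF nat J T K x(1) Cmp_closed[OF D(5) D'(5) T a f(1)] g(1)])
  also have "\<dots> = \<phi> X' (upper_class X' T f) (Ext_push C K X X' a (conn \<xi> K g))"
    by (rule upper_natiso(4)[OF nat mJ T K D(5) D'(5) a f(1) conn_closed[OF x(1) K g(1)]])
  also have "\<dots> = \<phi> X' (upper_class X' T f) (conn \<xi>' K (Cmp C K Y Y' c g))"
    by (simp only: Ext_push_conn_mor[OF x m K g(1)])
  also have "\<dots> = cov_pairing \<phi> T \<xi>' K G (contra_defect_map C \<xi> \<xi>' c K H)"
    unfolding f(2) g(2) contra_defect_map_rcos[OF x m K g(1)]
    by (rule cov_pairing(2)[OF nat J T K x(2) f(1) Cmp_closed[OF K D(4) D'(4) g(1) c], symmetric])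
  finally show "cov_pairing \<phi> T \<xi> K (cov_defect_map C \<xi> \<xi>' a T G) H =
    dual_map (MOb (contra_defect C \<xi>) K) (contra_defect_map C \<xi> \<xi>' c K) (cov_pairing \<phi> T \<xi>' K G) H"
    using H by (simp add: dual_map_def)
qed (simp_all add: cov_pairing_extensional dual_map_def)

lemma contra_pairing_natural:
  assumes nat: "cov_natiso R (lower_stable C) (hom_cov (lower_stable C) T) (induced (dual_contra R J (ext_contra C K))) \<psi>"
    and J: "injective_module R J" and T: "T \<in> Ob C" and K: "K \<in> Ob C" and x: "\<xi> \<in> exts Y X" "\<xi>' \<in> exts Y' X'"
    and m: "ses_mor C \<xi> \<xi>' a b c" and G: "G \<in> carrier (MOb (contra_defect C \<xi>) T)"
  shows "contra_pairing \<psi> T \<xi>' K (contra_defect_map C \<xi> \<xi>' c T G) =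
    dual_map (MOb (cov_defect C \<xi>') K) (cov_defect_map C \<xi> \<xi>' a K) (contra_pairing \<psi> T \<xi> K G)"
proof (rule extensionalityI[of _ "carrier (MOb (cov_defect C \<xi>') K)"])
  note D = extsD[OF x(1)] and D' = extsD[OF x(2)]
  note mJ = injective_module_module[OF J]
  obtain g where g: "g \<in> Mor C T Y" "G = contra_im C \<xi> T +>\<^bsub>Hom C T Y\<^esub> g" using G by (auto simp: contra_defect_carrier[OF x(1) T])
  have a: "a \<in> Mor C X X'" and c: "c \<in> Mor C Y Y'" using ses_morD[OF m] D D' by simp_all
  fix H assume H: "H \<in> carrier (MOb (cov_defect C \<xi>') K)"
  then obtain f where f: "f \<in> Mor C X' K" "H = cov_im C \<xi>' K +>\<^bsub>Hom C X' K\<^esub> f" by (auto simp: cov_defect_carrier[OF x(2) K])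
  have "contra_pairing \<psi> T \<xi>' K (contra_defect_map C \<xi> \<xi>' c T G) H = \<psi> Y' (lower_class T Y' (Cmp C T Y Y' c g)) (coconn \<xi>' K f)"
    unfolding f(2) g(2) contra_defect_map_rcos[OF x m T g(1)]
    by (rule contra_pairing(2)[OF nat J T K x(2) Cmp_closed[OF T D(4) D'(4) g(1) c] f(1)])
  also have "\<dots> = \<psi> Y (lower_class T Y g) (Ext_pull C K Y Y' c (coconn \<xi>' K f))"
    by (rule lower_natiso(4)[OF nat mJ T K D'(4) D(4) c g(1) coconn_closed[OF x(2) K f(1)]])
  also have "\<dots> = \<psi> Y (lower_class T Y g) (coconn \<xi> K (Cmp C X X' K f a))"
    by (simp only: Ext_pull_coconn_mor[OF x m K f(1)])
  also have "\<dots> = contra_pairing \<psi> T \<xi> K G (cov_defect_map C \<xi> \<xi>' a K H)"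
    unfolding f(2) g(2) cov_defect_map_rcos[OF x m K f(1)]
    by (rule contra_pairing(2)[OF nat J T K x(1) g(1) Cmp_closed[OF D(5) D'(5) K a f(1)], symmetric])
  finally show "contra_pairing \<psi> T \<xi>' K (contra_defect_map C \<xi> \<xi>' c T G) H =
    dual_map (MOb (cov_defect C \<xi>') K) (cov_defect_map C \<xi> \<xi>' a K) (contra_pairing \<psi> T \<xi> K G) H"
    using H by (simp add: dual_map_def)
qed (simp_all add: contra_pairing_extensional dual_map_def)

text \<open>The hypothesis \<open>eq\<close> trades \<open>t\<close> for a pullback along
  \<open>g\<close>, and iterated pullbacks compose: pulling \<open>u\<^sup>*\<xi>\<close> back along
  \<open>g\<close> gives the pullback of \<open>\<xi>\<close> along \<open>u g\<close>.\<close>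

lemma cov_pairing_natural_object:
  assumes nat: "contra_natiso R (upper_stable C) (hom_contra (upper_stable C) T) (induced (dual_cov R J (ext_cov C K))) \<phi>"
      "contra_natiso R (upper_stable C) (hom_contra (upper_stable C) T') (induced (dual_cov R J (ext_cov C K'))) \<phi>'"
    and J: "injective_module R J" and ob: "T \<in> Ob C" "T' \<in> Ob C" "K \<in> Ob C" "K' \<in> Ob C" and x: "\<xi> \<in> exts Y X"
    and g: "g \<in> Mor (lower_stable C) K K'" and t: "t \<in> Mor (upper_stable C) T T'"
    and eq: "\<And>h. h \<in> Mor (upper_stable C) X T \<Longrightarrow>
      \<phi>' X (Cmp (upper_stable C) X T T' t h) = MMor (induced (dual_contra R J (ext_contra C X))) K K' g (\<phi> X h)"
    and G: "G \<in> carrier (MOb (cov_defect C \<xi>) T)"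
  shows "cov_pairing \<phi>' T' \<xi> K' (MMor (induced (cov_defect C \<xi>)) T T' t G) =
    MMor (dual_contra R J (induced (contra_defect C \<xi>))) K K' g (cov_pairing \<phi> T \<xi> K G)"
proof (rule extensionalityI[of _ "carrier (MOb (contra_defect C \<xi>) K')"])
  note D = extsD[OF x]
  \<comment> \<open>The very choices made by \<open>induced\<close>, so that unfolding it leaves
    exactly these representatives.\<close>
  define g0 where "g0 = (SOME f. f \<in> g)"
  define t0 where "t0 = (SOME f. f \<in> t)"
  have g0: "g0 \<in> Mor C K K'" using lower_class(2)[OF ob(3,4) g] by (simp add: g0_def)
  have t0: "t0 \<in> Mor C T T'" "upper_class T T' t0 = t" using upper_class(2)[OF ob(1,2) t] by (simp_all add: t0_def)
  obtain f where f: "f \<in> Mor C X T" "G = cov_im C \<xi> T +>\<^bsub>Hom C X T\<^esub> f" using G by (auto simp: cov_defect_carrier[OF x ob(1)])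
  fix H assume H: "H \<in> carrier (MOb (contra_defect C \<xi>) K')"
  then obtain u where u: "u \<in> Mor C K' Y" "H = contra_im C \<xi> K' +>\<^bsub>Hom C K' Y\<^esub> u" by (auto simp: contra_defect_carrier[OF x ob(4)])
  have tf: "Cmp (upper_stable C) X T T' t (upper_class X T f) = upper_class X T' (Cmp C X T T' t0 f)"
    unfolding t0(2)[symmetric] upper_stable_def by (rule quot_Cmp[OF inj_trivial_ideal D(5) ob(1,2) f(1) t0(1)])
  have ind: "MMor (induced (cov_defect C \<xi>)) T T' t G = cov_im C \<xi> T' +>\<^bsub>Hom C X T'\<^esub> Cmp C X T T' t0 f"
    unfolding f(2) cov_defect_rcos[OF x ob(1,2) t0(1) f(1), symmetric] by (simp add: induced_def t0_def)
  have "cov_pairing \<phi>' T' \<xi> K' (MMor (induced (cov_defect C \<xi>)) T T' t G) H = \<phi>' X (upper_class X T' (Cmp C X T T' t0 f)) (conn \<xi> K' u)"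
    unfolding ind u(2) by (rule cov_pairing(2)[OF nat(2) J ob(2,4) x Cmp_closed[OF D(5) ob(1,2) f(1) t0(1)] u(1)])
  also have "\<dots> = \<phi> X (upper_class X T f) (Ext_pull C X K K' g0 (conn \<xi> K' u))"
    unfolding tf[symmetric] eq[OF upper_class(1)[OF D(5) ob(1) f(1)]]
    using conn_closed[OF x ob(4) u(1)] by (simp add: induced_def dual_contra_def ext_contra_def dual_map_def g0_def)
  also have "\<dots> = \<phi> X (upper_class X T f) (conn \<xi> K (Cmp C K K' Y u g0))"
    by (simp only: Ext_pull_conn[OF x ob(4,3) u(1) g0])
  also have "\<dots> = cov_pairing \<phi> T \<xi> K G (MMor (contra_defect C \<xi>) K K' g0 H)"
    unfolding f(2) u(2) contra_defect_rcos[OF x ob(3,4) g0 u(1)]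
    by (rule cov_pairing(2)[OF nat(1) J ob(1,3) x f(1) Cmp_closed[OF ob(3,4) D(4) g0 u(1)], symmetric])
  finally show "cov_pairing \<phi>' T' \<xi> K' (MMor (induced (cov_defect C \<xi>)) T T' t G) H =
    MMor (dual_contra R J (induced (contra_defect C \<xi>))) K K' g (cov_pairing \<phi> T \<xi> K G) H"
    using H by (simp add: induced_def dual_contra_def dual_map_def g0_def)
qed (simp_all add: cov_pairing_extensional induced_def dual_contra_def dual_map_def)

text \<open>Here \<open>eq\<close> trades \<open>t\<close> for a pushout along \<open>g\<close>, and
  iterated pushouts compose; as \<open>\<xi>\<^sup>*\<close> is contravariant, the argument
  \<open>G\<close> lives over the target \<open>T'\<close>.\<close>

lemma contra_pairing_natural_object:
  assumes nat: "cov_natiso R (lower_stable C) (hom_cov (lower_stable C) T) (induced (dual_contra R J (ext_contra C K))) \<psi>"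
      "cov_natiso R (lower_stable C) (hom_cov (lower_stable C) T') (induced (dual_contra R J (ext_contra C K'))) \<psi>'"
    and J: "injective_module R J" and ob: "T \<in> Ob C" "T' \<in> Ob C" "K \<in> Ob C" "K' \<in> Ob C" and x: "\<xi> \<in> exts Y X"
    and g: "g \<in> Mor (upper_stable C) K K'" and t: "t \<in> Mor (lower_stable C) T T'"
    and eq: "\<And>h. h \<in> Mor (lower_stable C) T' Y \<Longrightarrow>
      \<psi> Y (Cmp (lower_stable C) T T' Y h t) = MMor (induced (dual_cov R J (ext_cov C Y))) K K' g (\<psi>' Y h)"
    and G: "G \<in> carrier (MOb (contra_defect C \<xi>) T')"
  shows "contra_pairing \<psi> T \<xi> K (MMor (induced (contra_defect C \<xi>)) T T' t G) =
    MMor (dual_cov R J (induced (cov_defect C \<xi>))) K K' g (contra_pairing \<psi>' T' \<xi> K' G)"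
proof (rule extensionalityI[of _ "carrier (MOb (cov_defect C \<xi>) K)"])
  note D = extsD[OF x]
  define g0 where "g0 = (SOME f. f \<in> g)"
  define t0 where "t0 = (SOME f. f \<in> t)"
  have g0: "g0 \<in> Mor C K K'" using upper_class(2)[OF ob(3,4) g] by (simp add: g0_def)
  have t0: "t0 \<in> Mor C T T'" "lower_class T T' t0 = t" using lower_class(2)[OF ob(1,2) t] by (simp_all add: t0_def)
  obtain u where u: "u \<in> Mor C T' Y" "G = contra_im C \<xi> T' +>\<^bsub>Hom C T' Y\<^esub> u" using G by (auto simp: contra_defect_carrier[OF x ob(2)])
  fix H assume H: "H \<in> carrier (MOb (cov_defect C \<xi>) K)"
  then obtain f where f: "f \<in> Mor C X K" "H = cov_im C \<xi> K +>\<^bsub>Hom C X K\<^esub> f" by (auto simp: cov_defect_carrier[OF x ob(3)])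
  have ut: "Cmp (lower_stable C) T T' Y (lower_class T' Y u) t = lower_class T Y (Cmp C T T' Y u t0)"
    unfolding t0(2)[symmetric] lower_stable_def by (rule quot_Cmp[OF proj_trivial_ideal ob(1,2) D(4) t0(1) u(1)])
  have ind: "MMor (induced (contra_defect C \<xi>)) T T' t G = contra_im C \<xi> T +>\<^bsub>Hom C T Y\<^esub> Cmp C T T' Y u t0"
    unfolding u(2) contra_defect_rcos[OF x ob(1,2) t0(1) u(1), symmetric] by (simp add: induced_def t0_def)
  have "contra_pairing \<psi> T \<xi> K (MMor (induced (contra_defect C \<xi>)) T T' t G) H = \<psi> Y (lower_class T Y (Cmp C T T' Y u t0)) (coconn \<xi> K f)"
    unfolding ind f(2) by (rule contra_pairing(2)[OF nat(1) J ob(1,3) x Cmp_closed[OF ob(1,2) D(4) t0(1) u(1)] f(1)])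
  also have "\<dots> = \<psi>' Y (lower_class T' Y u) (Ext_push C Y K K' g0 (coconn \<xi> K f))"
    unfolding ut[symmetric] eq[OF lower_class(1)[OF ob(2) D(4) u(1)]]
    using coconn_closed[OF x ob(3) f(1)] by (simp add: induced_def dual_cov_def ext_cov_def dual_map_def g0_def)
  also have "\<dots> = \<psi>' Y (lower_class T' Y u) (coconn \<xi> K' (Cmp C X K K' g0 f))"
    by (simp only: Ext_push_coconn[OF x ob(3,4) f(1) g0])
  also have "\<dots> = contra_pairing \<psi>' T' \<xi> K' G (MMor (cov_defect C \<xi>) K K' g0 H)"
    unfolding f(2) u(2) cov_defect_rcos[OF x ob(3,4) g0 f(1)]
    by (rule contra_pairing(2)[OF nat(2) J ob(2,4) x u(1) Cmp_closed[OF D(5) ob(3,4) f(1) g0], symmetric])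
  finally show "contra_pairing \<psi> T \<xi> K (MMor (induced (contra_defect C \<xi>)) T T' t G) H =
    MMor (dual_cov R J (induced (cov_defect C \<xi>))) K K' g (contra_pairing \<psi>' T' \<xi> K' G) H"
    using H by (simp add: induced_def dual_cov_def dual_map_def g0_def)
qed (simp_all add: contra_pairing_extensional induced_def dual_cov_def dual_map_def)

end

theorem proposition2p5:
  fixes R :: "'k ring"
    and J :: "('k, 'j) module"
    and C :: "('o, 'm, 'k) excat"
    and \<phi> \<psi> :: "'o \<Rightarrow> 'o \<Rightarrow> 'm set \<Rightarrow> ('o, 'm) ses set \<Rightarrow> 'j"
    and \<tau> \<tau>' :: "('o, 'm set, 'o, 'm set) cfun"
  assumes "cring R" and "artinian_ring R"
    and "minimal_injective_cogenerator R J"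
    and "exact_category R C" and "hom_finite R C" and "krull_schmidt C"
    and "AR_duality R J C \<phi> \<psi> \<tau> \<tau>'"
  shows
    "(\<exists>\<theta> :: ('o, 'm) ses \<Rightarrow> 'o \<Rightarrow> 'm set \<Rightarrow> 'm set \<Rightarrow> 'j.
        (\<forall>\<xi> \<in> Conf C. \<forall>K \<in> Cr R J C.
           \<theta> \<xi> K \<in> mod_iso R (MOb (cov_defect C \<xi>) (FOb \<tau> K)) (dual R J (MOb (contra_defect C \<xi>) K))) \<and>
        (\<forall>\<xi> \<in> Conf C. \<forall>\<xi>' \<in> Conf C. \<forall>a b c. ses_mor C \<xi> \<xi>' a b c \<longrightarrow>
           (\<forall>K \<in> Cr R J C. \<forall>x \<in> carrier (MOb (cov_defect C \<xi>') (FOb \<tau> K)).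
              \<theta> \<xi> K (cov_defect_map C \<xi> \<xi>' a (FOb \<tau> K) x) =
              dual_map (MOb (contra_defect C \<xi>) K) (contra_defect_map C \<xi> \<xi>' c K) (\<theta> \<xi>' K x))) \<and>
        (\<forall>\<xi> \<in> Conf C. \<forall>K \<in> Cr R J C. \<forall>K' \<in> Cr R J C. \<forall>g \<in> Mor (lower_Cr R J C) K K'.
           \<forall>x \<in> carrier (MOb (cov_defect C \<xi>) (FOb \<tau> K)).
              \<theta> \<xi> K' (MMor (induced (cov_defect C \<xi>)) (FOb \<tau> K) (FOb \<tau> K') (FMor \<tau> K K' g) x) =
              MMor (dual_contra R J (induced (contra_defect C \<xi>))) K K' g (\<theta> \<xi> K x)))
     \<and>
     (\<exists>\<theta> :: ('o, 'm) ses \<Rightarrow> 'o \<Rightarrow> 'm set \<Rightarrow> 'm set \<Rightarrow> 'j.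
        (\<forall>\<xi> \<in> Conf C. \<forall>K \<in> Cl R J C.
           \<theta> \<xi> K \<in> mod_iso R (MOb (contra_defect C \<xi>) (FOb \<tau>' K)) (dual R J (MOb (cov_defect C \<xi>) K))) \<and>
        (\<forall>\<xi> \<in> Conf C. \<forall>\<xi>' \<in> Conf C. \<forall>a b c. ses_mor C \<xi> \<xi>' a b c \<longrightarrow>
           (\<forall>K \<in> Cl R J C. \<forall>x \<in> carrier (MOb (contra_defect C \<xi>) (FOb \<tau>' K)).
              \<theta> \<xi>' K (contra_defect_map C \<xi> \<xi>' c (FOb \<tau>' K) x) =
              dual_map (MOb (cov_defect C \<xi>') K) (cov_defect_map C \<xi> \<xi>' a K) (\<theta> \<xi> K x))) \<and>
        (\<forall>\<xi> \<in> Conf C. \<forall>K \<in> Cl R J C. \<forall>K' \<in> Cl R J C. \<forall>g \<in> Mor (upper_Cl R J C) K K'.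
           \<forall>x \<in> carrier (MOb (contra_defect C \<xi>) (FOb \<tau>' K')).
              \<theta> \<xi> K (MMor (induced (contra_defect C \<xi>)) (FOb \<tau>' K) (FOb \<tau>' K') (FMor \<tau>' K K' g) x) =
              MMor (dual_cov R J (induced (cov_defect C \<xi>))) K K' g (\<theta> \<xi> K' x)))"
  (is "?P1 \<and> ?P2")
proof -
  interpret exact_category R C by (rule assms(4))
  have J: "injective_module R J" using assms(3) by (simp add: minimal_injective_cogenerator_def)
  have F: "is_cfun (lower_Cr R J C) (upper_Cl R J C) \<tau>" "is_cfun (upper_Cl R J C) (lower_Cr R J C) \<tau>'"
    using AR_duality.equivalence[OF assms(7)] by (simp_all add: quasi_inverse_def)
  have Cr: "K \<in> Ob C" if "K \<in> Cr R J C" for K using that by (simp add: Cr_def)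
  have Cl: "K \<in> Ob C" if "K \<in> Cl R J C" for K using that by (simp add: Cl_def)
  have \<tau>: "FOb \<tau> K \<in> Ob C" if "K \<in> Cr R J C" for K
    using F(1) that by (auto simp: is_cfun_def full_subcat_def intro: Cl)
  have \<tau>': "FOb \<tau>' K \<in> Ob C" if "K \<in> Cl R J C" for K
    using F(2) that by (auto simp: is_cfun_def full_subcat_def intro: Cr)
  have \<tau>m: "FMor \<tau> K K' g \<in> Mor (upper_stable C) (FOb \<tau> K) (FOb \<tau> K')"
    if "K \<in> Cr R J C" "K' \<in> Cr R J C" "g \<in> Mor (lower_stable C) K K'" for K K' g
    using F(1) that by (auto simp: is_cfun_def full_subcat_def)
  have \<tau>'m: "FMor \<tau>' K K' g \<in> Mor (lower_stable C) (FOb \<tau>' K) (FOb \<tau>' K')"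
    if "K \<in> Cl R J C" "K' \<in> Cl R J C" "g \<in> Mor (upper_stable C) K K'" for K K' g
    using F(2) that by (auto simp: is_cfun_def full_subcat_def)
  note nat\<phi> = AR_duality.\<phi>_natiso[OF assms(7)] and nat\<psi> = AR_duality.\<psi>_natiso[OF assms(7)]
  have x: "\<xi> \<in> exts (rgt \<xi>) (lft \<xi>)" if "\<xi> \<in> Conf C" for \<xi> using that by (simp add: exts_def)
  let ?\<theta> = "\<lambda>\<xi> K. cov_pairing (\<phi> K) (FOb \<tau> K) \<xi> K"
  have "?\<theta> \<xi> K \<in> mod_iso R (MOb (cov_defect C \<xi>) (FOb \<tau> K)) (dual R J (MOb (contra_defect C \<xi>) K))"
    if "\<xi> \<in> Conf C" "K \<in> Cr R J C" for \<xi> K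
    by (rule cov_pairing(1)[OF nat\<phi>[OF that(2)] J \<tau>[OF that(2)] Cr[OF that(2)] x[OF that(1)]])
  moreover have "?\<theta> \<xi> K (cov_defect_map C \<xi> \<xi>' a (FOb \<tau> K) G) =
      dual_map (MOb (contra_defect C \<xi>) K) (contra_defect_map C \<xi> \<xi>' c K) (?\<theta> \<xi>' K G)"
    if "\<xi> \<in> Conf C" "\<xi>' \<in> Conf C" "ses_mor C \<xi> \<xi>' a b c" "K \<in> Cr R J C" "G \<in> carrier (MOb (cov_defect C \<xi>') (FOb \<tau> K))"
    for \<xi> \<xi>' a b c K G
    by (rule cov_pairing_natural[OF nat\<phi>[OF that(4)] J \<tau>[OF that(4)] Cr[OF that(4)] x[OF that(1)] x[OF that(2)] that(3,5)])
  moreover have "?\<theta> \<xi> K' (MMor (induced (cov_defect C \<xi>)) (FOb \<tau> K) (FOb \<tau> K') (FMor \<tau> K K' g) G) =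
      MMor (dual_contra R J (induced (contra_defect C \<xi>))) K K' g (?\<theta> \<xi> K G)"
    if "\<xi> \<in> Conf C" "K \<in> Cr R J C" "K' \<in> Cr R J C" "g \<in> Mor (lower_Cr R J C) K K'" "G \<in> carrier (MOb (cov_defect C \<xi>) (FOb \<tau> K))"
    for \<xi> K K' g G
  proof -
    \<comment> \<open>The square relating \<open>g\<close> to its image under \<open>\<tau>\<close>
      is naturality of \<open>\<phi>\<close> in \<open>K\<close>, taken at the object
      \<open>lft \<xi>\<close>.\<close>
    have g: "g \<in> Mor (lower_stable C) K K'" using that(4) by (simp add: full_subcat_def)
    show ?thesis
      by (rule cov_pairing_natural_object[OF nat\<phi>[OF that(2)] nat\<phi>[OF that(3)] J \<tau>[OF that(2)] \<tau>[OF that(3)]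
            Cr[OF that(2)] Cr[OF that(3)] x[OF that(1)] g \<tau>m[OF that(2,3) g]
            AR_duality.\<phi>_natural[OF assms(7) conf_Ob(1)[OF that(1)] that(2,3) g] that(5)])
  qed
  ultimately have 1: ?P1 by (intro exI[of _ ?\<theta>]) blast
  let ?\<theta>' = "\<lambda>\<xi> K. contra_pairing (\<psi> K) (FOb \<tau>' K) \<xi> K"
  have "?\<theta>' \<xi> K \<in> mod_iso R (MOb (contra_defect C \<xi>) (FOb \<tau>' K)) (dual R J (MOb (cov_defect C \<xi>) K))"
    if "\<xi> \<in> Conf C" "K \<in> Cl R J C" for \<xi> K
    by (rule contra_pairing(1)[OF nat\<psi>[OF that(2)] J \<tau>'[OF that(2)] Cl[OF that(2)] x[OF that(1)]])
  moreover have "?\<theta>' \<xi>' K (contra_defect_map C \<xi> \<xi>' c (FOb \<tau>' K) G) =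
      dual_map (MOb (cov_defect C \<xi>') K) (cov_defect_map C \<xi> \<xi>' a K) (?\<theta>' \<xi> K G)"
    if "\<xi> \<in> Conf C" "\<xi>' \<in> Conf C" "ses_mor C \<xi> \<xi>' a b c" "K \<in> Cl R J C" "G \<in> carrier (MOb (contra_defect C \<xi>) (FOb \<tau>' K))"
    for \<xi> \<xi>' a b c K G
    by (rule contra_pairing_natural[OF nat\<psi>[OF that(4)] J \<tau>'[OF that(4)] Cl[OF that(4)] x[OF that(1)] x[OF that(2)] that(3,5)])
  moreover have "?\<theta>' \<xi> K (MMor (induced (contra_defect C \<xi>)) (FOb \<tau>' K) (FOb \<tau>' K') (FMor \<tau>' K K' g) G) =
      MMor (dual_cov R J (induced (cov_defect C \<xi>))) K K' g (?\<theta>' \<xi> K' G)"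
    if "\<xi> \<in> Conf C" "K \<in> Cl R J C" "K' \<in> Cl R J C" "g \<in> Mor (upper_Cl R J C) K K'" "G \<in> carrier (MOb (contra_defect C \<xi>) (FOb \<tau>' K'))"
    for \<xi> K K' g G
  proof -
    \<comment> \<open>This time naturality of \<open>\<psi>\<close> in \<open>K\<close> is taken at
      the object \<open>rgt \<xi>\<close>.\<close>
    have g: "g \<in> Mor (upper_stable C) K K'" using that(4) by (simp add: full_subcat_def)
    show ?thesis
      by (rule contra_pairing_natural_object[OF nat\<psi>[OF that(2)] nat\<psi>[OF that(3)] J \<tau>'[OF that(2)] \<tau>'[OF that(3)]
            Cl[OF that(2)] Cl[OF that(3)] x[OF that(1)] g \<tau>'m[OF that(2,3) g]
            AR_duality.\<psi>_natural[OF assms(7) conf_Ob(3)[OF that(1)] that(2,3) g] that(5)])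
  qed
  ultimately have 2: ?P2 by (intro exI[of _ ?\<theta>']) blast
  from 1 2 show ?thesis ..
qed

end
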